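(* Let $\chi_1$ and $\chi_2$ be nontrivial primitive Dirichlet characters modulo $q_1$ and $q_2$ with $\chi_1\chi_2(-1)=1$, and let $c$ be a positive integer with $q_1q_2\mid c$. For every $\varepsilon>0$, \[\sum_{\substack{a\bmod c\\(a,c)=1}}\lvert S_{\chi_1,\chi_2}(a,c)\rvert^2\gg_\varepsilon q_1c^{2-\varepsilon},\] where the implied constant depends only on $\varepsilon$.
   Context: Dirichlet characters are extended by $0$ to integers not coprime to their modulus. $B_1(x)=0$ if $x\in\mathbb{Z}$ and $B_1(x)=x-\lfloor x\rfloor-\tfrac12$ otherwise. For integers $a$ and $c\ge1$ with $q_1q_2\mid c$, \[S_{\chi_1,\chi_2}(a,c)=\sum_{j\bmod c}\sum_{n\bmod q_1}\overline{\chi_2}(j)\overline{\chi_1}(n)B_1\!\Big(\frac{j}{c}\Big)B_1\!\Big(\frac{n}{q_1}+\frac{aj}{c}\Big).\] *)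

theory Defs
  imports Complex_Main "HOL-Number_Theory.Cong"
begin

text \<open>
  A Dirichlet character modulo \<open>q\<close>, as a \<open>q\<close>-periodic function on all integers that is
  extended by 0. The normalisation \<open>\<chi> 1 = 1\<close> is not listed since it follows from
  \<open>\<chi> 1 = \<chi> 1 * \<chi> 1\<close> and \<open>\<chi> 1 \<noteq> 0\<close>.
\<close>

definition dirichlet_char :: "nat \<Rightarrow> (int \<Rightarrow> complex) \<Rightarrow> bool" where
  "dirichlet_char q \<chi> \<longleftrightarrow>
     q > 0 \<and>
     (\<forall>m n. \<chi> (m * n) = \<chi> m * \<chi> n) \<and>
     (\<forall>n. \<chi> (n + int q) = \<chi> n) \<and>
     (\<forall>n. \<chi> n = 0 \<longleftrightarrow> \<not> coprime n (int q))"

definition trivial_char :: "nat \<Rightarrow> int \<Rightarrow> complex" where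
  "trivial_char q n = (if coprime n (int q) then 1 else 0)"

text \<open>
  Induced moduli and primitivity as in Apostol, Introduction to Analytic Number Theory, Chapter 8:
  \<open>d\<close> is an induced modulus iff \<open>\<chi>\<close> is trivial on the kernel of the reduction of units
  modulo \<open>q\<close> to units modulo \<open>d\<close>, so that \<open>\<chi>\<close> comes from a character modulo \<open>d\<close>.
\<close>

definition induced_modulus :: "nat \<Rightarrow> (int \<Rightarrow> complex) \<Rightarrow> nat \<Rightarrow> bool" where
  "induced_modulus q \<chi> d \<longleftrightarrow>
     d dvd q \<and> (\<forall>a. coprime a (int q) \<and> [a = 1] (mod int d) \<longrightarrow> \<chi> a = 1)"

definition primitive_char :: "nat \<Rightarrow> (int \<Rightarrow> complex) \<Rightarrow> bool" where
  "primitive_char q \<chi> \<longleftrightarrow> dirichlet_char q \<chi> \<and> (\<forall>d<q. \<not> induced_modulus q \<chi> d)"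

definition B1 :: "real \<Rightarrow> real" where
  "B1 x = (if x \<in> \<int> then 0 else x - of_int \<lfloor>x\<rfloor> - 1 / 2)"

text \<open>
  The Dedekind sum attached to the characters \<open>\<chi>\<^sub>1\<close> modulo \<open>q\<^sub>1\<close> and \<open>\<chi>\<^sub>2\<close> modulo \<open>q\<^sub>2\<close>.
  It is meaningful for \<open>q\<^sub>1 * q\<^sub>2\<close> dividing \<open>c\<close>; the summand is then periodic in \<open>j\<close> modulo
  \<open>c\<close> and in \<open>n\<close> modulo \<open>q\<^sub>1\<close>. The modulus \<open>q\<^sub>2\<close> does not occur in the formula.
\<close>

definition dedekind_sum ::
  "nat \<Rightarrow> (int \<Rightarrow> complex) \<Rightarrow> (int \<Rightarrow> complex) \<Rightarrow> int \<Rightarrow> nat \<Rightarrow> complex" where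
  "dedekind_sum q\<^sub>1 \<chi>\<^sub>1 \<chi>\<^sub>2 a c =
     (\<Sum>j\<in>{0..<int c}. \<Sum>n\<in>{0..<int q\<^sub>1}.
        cnj (\<chi>\<^sub>2 j) * cnj (\<chi>\<^sub>1 n) *
        of_real (B1 (of_int j / of_nat c)) *
        of_real (B1 (of_int n / of_nat q\<^sub>1 + of_int (a * j) / of_nat c)))"

end

theory Submission
  imports Defs "HOL-Number_Theory.Number_Theory" "HOL-Analysis.Analysis" "HOL-Real_Asymp.Real_Asymp"
begin

text \<open>
  Finite Fourier analysis turns the Dedekind sum \<open>S(a)\<close> into a constant times the double cotangent
  sum of \<open>\<chi>1(m) cot(\<pi>m/c) cot(\<pi>k/c) \<chi>2((am + k)/N)\<close>, \<open>N = c/q2\<close>. Correlating it with the test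
  function \<open>\<chi>2((a - b)/N)\<close>, \<open>b\<close> being 1 or 2, the terms with \<open>bm + k = 0\<close> modulo \<open>c\<close> contribute a
  multiple of the sum of \<open>\<chi>1(m) \<chi>2(m) cot(\<pi>m/c) cot(\<pi>bm/c)\<close>, which is of order \<open>c\<^sup>2\<close> because of
  \<open>m = \<plusminus>1\<close>; by Moebius inversion and the primitivity of \<open>\<chi>2\<close> the other terms are small. The
  Cauchy-Schwarz inequality then gives the bound for large \<open>c\<close>. There remain finitely many tuples
  \<open>(q1, q2, \<chi>1, \<chi>2, c)\<close>, for which \<open>S(a)\<close> must not vanish for all units \<open>a\<close>: twisting with a suitable
  character \<open>\<psi>\<close> such that \<open>\<chi>1\<psi>\<close> and \<open>\<chi>2\<psi>\<close> are odd, the sum of \<open>\<psi>(a) S(a)\<close> factors into two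
  cotangent sums of odd characters, and these are non-zero since \<open>L(1)\<close> is.
\<close>

text \<open>The sizes: with N = c / q2 the squared constant in the double cotangent formula is q1 /
  (16 q2 c^2), the squared norm of the test function is at least q2 / 3^w, w the number of primes of
  q2, and its correlation with the cotangent sum is of order c^2 times that norm. Cauchy-Schwarz
  thus returns q1 c^2 / 3^w up to a constant, and 3^w is absorbed by c^\<epsilon>. For bounded c
  positivity suffices, but it is the harder half. The twist separates m from k only if \<psi>, and
  at some primes also \<psi> \<open>\<eta>2\<close>, has full level. At 2 no character has full
  level if c is twice an odd number; the twist is then taken modulo c / 2. If p divides q2 but not
  N, the two demands contradict each other at p = 2, and at p = 3 unless 9 divides q2: locally the
  relevant group has only one nontrivial character, so the product of two of them is trivial. Such
  primes are collected in qE and sieved out by Moebius inversion; each leaves an Euler factor, which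
  \<psi> must keep from vanishing. All demands on \<psi> are inequalities between single character
  values, and one \<psi> is found for all of them at once.\<close>

section \<open>Periodic functions on the integers and sums over residues\<close>

lemma periodic_add_mult:
  fixes f :: "int \<Rightarrow> 'a" and n k x :: int
  assumes "\<And>x. f (x + n) = f x"
  shows "f (x + n * k) = f x"
proof -
  have *: "f (x + n * int j) = f x" for j x
  proof (induction j)
    case (Suc j)
    have "f (x + n * int (Suc j)) = f ((x + n * int j) + n)" by (simp add: algebra_simps)
    then show ?case using assms Suc by simp
  qed simp
  show ?thesis
  proof (cases "k \<ge> 0")
    case True
    then show ?thesis using *[of x "nat k"] by simp
  next
    case False
    then show ?thesis using *[of "x + n * k" "nat (-k)"] by (simp add: algebra_simps)
  qed
qed

lemma periodic_cong:
  fixes f :: "int \<Rightarrow> 'a" and n x y :: int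
  assumes "\<And>x. f (x + n) = f x" "[x = y] (mod n)"
  shows "f x = f y"
proof -
  obtain k where "y = x + n * k" using assms(2) by (metis cong_iff_lin)
  then show ?thesis using periodic_add_mult[of f n x k] assms(1) by simp
qed

lemma periodic_mod:
  fixes f :: "int \<Rightarrow> 'a" and n x :: int
  assumes "\<And>x. f (x + n) = f x"
  shows "f (x mod n) = f x"
  using periodic_cong[where f = f and n = n and x = "x mod n" and y = x] assms by (simp add: unique_euclidean_semiring_class.cong_def)

lemma sum_periodic_affine:
  fixes f :: "int \<Rightarrow> 'a::comm_monoid_add" and n u t :: int
  assumes n: "n > 0" and per: "\<And>x. f (x + n) = f x" and u: "coprime u n"
  shows "(\<Sum>x\<in>{0..<n}. f (u * x + t)) = (\<Sum>x\<in>{0..<n}. f x)"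
proof -
  let ?g = "\<lambda>x. (u * x + t) mod n"
  have inj: "inj_on ?g {0..<n}"
  proof (rule inj_onI)
    fix x y assume xy: "x \<in> {0..<n}" "y \<in> {0..<n}" "?g x = ?g y"
    then have "[u * x + t = u * y + t] (mod n)" unfolding unique_euclidean_semiring_class.cong_def by blast
    then have "[u * x = u * y] (mod n)" by (simp add: cong_add_rcancel)
    then have "[x = y] (mod n)" using u cong_mult_lcancel by blast
    then show "x = y" using xy by (simp add: unique_euclidean_semiring_class.cong_def)
  qed
  have "?g ` {0..<n} \<subseteq> {0..<n}" using n by auto
  then have "bij_betw ?g {0..<n} {0..<n}"
    using inj endo_inj_surj[of "{0..<n}" ?g] by (simp add: bij_betw_def)
  from sum.reindex_bij_betw[OF this, of f]
  show ?thesis using periodic_mod[of f n, OF per] by simp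
qed

lemma sum_periodic_shift:
  fixes f :: "int \<Rightarrow> 'a::comm_monoid_add" and n t :: int
  assumes "n > 0" "\<And>x. f (x + n) = f x"
  shows "(\<Sum>x\<in>{0..<n}. f (x + t)) = (\<Sum>x\<in>{0..<n}. f x)"
  using sum_periodic_affine[of n f 1 t] assms by simp

lemma sum_periodic_scale:
  fixes f :: "int \<Rightarrow> 'a::comm_monoid_add" and n u :: int
  assumes "n > 0" "\<And>x. f (x + n) = f x" "coprime u n"
  shows "(\<Sum>x\<in>{0..<n}. f (u * x)) = (\<Sum>x\<in>{0..<n}. f x)"
  using sum_periodic_affine[of n f u 0] assms by simp

lemma sum_split_residues:
  fixes f :: "int \<Rightarrow> 'a::comm_monoid_add" and n m :: int
  assumes n: "n > 0" and m: "m > 0"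
  shows "(\<Sum>x\<in>{0..<n*m}. f x) = (\<Sum>x\<in>{0..<n}. \<Sum>i\<in>{0..<m}. f (x + n * i))"
proof -
  have "bij_betw (\<lambda>(x,i). x + n * i) ({0..<n} \<times> {0..<m}) {0..<n*m}"
  proof (rule bij_betw_byWitness[where f' = "\<lambda>y. (y mod n, y div n)"])
    show "(\<lambda>(x, i). x + n * i) ` ({0..<n} \<times> {0..<m}) \<subseteq> {0..<n * m}"
    proof -
      have "x + n * i < n * m" if h: "0 \<le> x" "x < n" "0 \<le> i" "i < m" for x i
      proof -
        have "x + n * i < n * (i + 1)" using h by (simp add: algebra_simps)
        also have "\<dots> \<le> n * m" using h n by (intro mult_left_mono) auto
        finally show ?thesis .
      qed
      then show ?thesis using n by auto
    qed
    show "(\<lambda>y. (y mod n, y div n)) ` {0..<n * m} \<subseteq> {0..<n} \<times> {0..<m}"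
    proof -
      have "y div n < m" if "y < n * m" for y
      proof (rule ccontr)
        assume "\<not> y div n < m"
        then have "n * m \<le> n * (y div n)" using n by simp
        also have "\<dots> \<le> y" using n by (metis mult.commute pos_mod_sign add_increasing2 div_mult_mod_eq order_refl)
        finally show False using that by simp
      qed
      then show ?thesis using n m by (auto simp: pos_imp_zdiv_nonneg_iff)
    qed
  qed (use n in auto)
  then have "(\<Sum>x\<in>{0..<n*m}. f x) = (\<Sum>p\<in>{0..<n}\<times>{0..<m}. f ((\<lambda>(x,i). x + n * i) p))"
    by (rule sum.reindex_bij_betw[symmetric])
  then show ?thesis by (simp add: sum.cartesian_product case_prod_beta')
qed

lemma sum_multiples:
  fixes f :: "int \<Rightarrow> 'a::comm_monoid_add" and n m :: int
  assumes n: "n > 0" and m: "m > 0"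
  shows "(\<Sum>x\<in>{0..<n*m}. if m dvd x then f x else 0) = (\<Sum>y\<in>{0..<n}. f (m * y))"
proof -
  have "(\<Sum>x\<in>{0..<n*m}. if m dvd x then f x else 0) = (\<Sum>x\<in>{x\<in>{0..<n*m}. m dvd x}. f x)"
    by (rule sum.inter_filter[symmetric]) simp
  also have "\<dots> = (\<Sum>y\<in>{0..<n}. f (m * y))"
    by (rule sum.reindex_bij_witness[where i = "\<lambda>y. m * y" and j = "\<lambda>x. x div m"])
      (use n m in \<open>auto simp: div_less_iff_less_mult mult.commute pos_imp_zdiv_nonneg_iff\<close>)
  finally show ?thesis .
qed

lemma sum_periodic_blocks:
  fixes f :: "int \<Rightarrow> 'a::comm_semiring_1" and n m :: int
  assumes n: "n > 0" and m: "m > 0" and per: "\<And>x. f (x + n) = f x"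
  shows "(\<Sum>x\<in>{0..<n*m}. f x) = of_nat (nat m) * (\<Sum>x\<in>{0..<n}. f x)"
  unfolding sum_split_residues[OF n m] using periodic_add_mult[of f n, OF per]
  by (simp add: sum_distrib_left)

section \<open>Dirichlet characters\<close>

lemma dc_pos: "dirichlet_char q \<eta> \<Longrightarrow> q > 0"
  and dc_mult: "dirichlet_char q \<eta> \<Longrightarrow> \<eta> (m * n) = \<eta> m * \<eta> n"
  and dc_periodic: "dirichlet_char q \<eta> \<Longrightarrow> \<eta> (n + int q) = \<eta> n"
  and dc_eq_0_iff: "dirichlet_char q \<eta> \<Longrightarrow> \<eta> n = 0 \<longleftrightarrow> \<not> coprime n (int q)"
  by (auto simp: dirichlet_char_def)

lemma dc_cong: "dirichlet_char q \<eta> \<Longrightarrow> [m = n] (mod int q) \<Longrightarrow> \<eta> m = \<eta> n"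
  using periodic_cong[of \<eta> "int q"] dc_periodic by blast

lemma dc_one [simp]: "dirichlet_char q \<eta> \<Longrightarrow> \<eta> 1 = 1"
  using dc_mult[of q \<eta> 1 1] dc_eq_0_iff[of q \<eta> 1] by simp

lemma dc_power: "dirichlet_char q \<eta> \<Longrightarrow> \<eta> (m ^ k) = \<eta> m ^ k"
  by (induction k) (simp_all add: dc_mult)

lemma dc_prod: "dirichlet_char q \<eta> \<Longrightarrow> \<eta> (\<Prod>i\<in>I. g i) = (\<Prod>i\<in>I. \<eta> (g i))"
  by (induction I rule: infinite_finite_induct) (simp_all add: dc_mult)

lemma dc_root_of_unity:
  assumes "dirichlet_char q \<eta>" "coprime n (int q)"
  shows "\<eta> n ^ totient q = 1"
proof -
  have q: "q > 0" using dc_pos assms by auto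
  define k where "k = nat (n mod int q)"
  have kn: "int k = n mod int q" using q by (simp add: k_def)
  have "coprime (int k) (int q)" using assms(2) q by (simp add: kn coprime_mod_left_iff)
  then have "coprime k q" by simp
  then have "[k ^ totient q = 1] (mod q)" using euler_theorem by auto
  then have "[int k ^ totient q = 1] (mod int q)"
    using cong_int_iff[of "k ^ totient q" 1 q] by simp
  moreover have "[n = int k] (mod int q)" by (simp add: kn unique_euclidean_semiring_class.cong_def)
  ultimately have "[n ^ totient q = 1] (mod int q)"
    by (meson cong_pow cong_trans)
  then show ?thesis using dc_cong[OF assms(1)] dc_power[OF assms(1)] dc_one[OF assms(1)] by metis
qed

lemma dc_norm: 
  assumes "dirichlet_char q \<eta>" "coprime n (int q)" shows "cmod (\<eta> n) = 1"
proof -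
  have "cmod (\<eta> n) ^ totient q = 1" using dc_root_of_unity[OF assms] by (metis norm_one norm_power)
  moreover have "totient q > 0" using dc_pos[OF assms(1)] by simp
  ultimately show ?thesis using power_eq_imp_eq_base[of "cmod (\<eta> n)" "totient q" 1] by simp
qed

lemma dc_norm_le: "dirichlet_char q \<eta> \<Longrightarrow> cmod (\<eta> n) \<le> 1"
  using dc_norm[of q \<eta> n] dc_eq_0_iff[of q \<eta> n] by (cases "coprime n (int q)") auto

lemma dc_mult_cnj:
  assumes "dirichlet_char q \<eta>" 
  shows "\<eta> n * cnj (\<eta> n) = (if coprime n (int q) then 1 else 0)"
  using dc_norm[OF assms, of n] dc_eq_0_iff[OF assms, of n] complex_norm_square[of "\<eta> n"] by auto

lemma dc_neg_one_cases:
  assumes "dirichlet_char q \<eta>" shows "\<eta> (-1) = 1 \<or> \<eta> (-1) = -1"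
  using dc_mult[OF assms, of "-1" "-1"] dc_one[OF assms] square_eq_1_iff by (metis mult_minus_left mult_1 minus_minus)

lemma dc_uminus:
  assumes "dirichlet_char q \<eta>" shows "\<eta> (-n) = \<eta> (-1) * \<eta> n"
  using dc_mult[OF assms, of "-1" n] by simp

lemma dc_cnj: "dirichlet_char q \<eta> \<Longrightarrow> dirichlet_char q (\<lambda>n. cnj (\<eta> n))"
  unfolding dirichlet_char_def by simp

text \<open>The pointwise product serves directly as a character modulo n, without passing to
  induced characters. By the last hypothesis every prime of n divides a or b, so the product
  vanishes exactly off the units of n.\<close>

lemma dc_mult_char:
  assumes "dirichlet_char a \<eta>" "dirichlet_char b \<psi>" "a dvd n" "b dvd n" "n > 0"
    and "\<And>x. coprime x (int a) \<Longrightarrow> coprime x (int b) \<Longrightarrow> coprime x (int n)"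
  shows "dirichlet_char n (\<lambda>x. \<eta> x * \<psi> x)"
  unfolding dirichlet_char_def
proof (intro conjI allI)
  show "n > 0" by fact
next
  fix x y show "\<eta> (x * y) * \<psi> (x * y) = \<eta> x * \<psi> x * (\<eta> y * \<psi> y)"
    using assms by (simp add: dc_mult)
next
  fix x
  have "[x + int n = x] (mod int a)" "[x + int n = x] (mod int b)"
    using assms(3,4) by (auto simp: cong_iff_dvd_diff)
  then show "\<eta> (x + int n) * \<psi> (x + int n) = \<eta> x * \<psi> x"
    using dc_cong[OF assms(1)] dc_cong[OF assms(2)] by metis
next
  fix x
  have "coprime x (int n) \<Longrightarrow> coprime x (int a) \<and> coprime x (int b)"
    using assms(3,4) by (meson coprime_divisors dvd_refl of_nat_dvd_iff)
  then show "(\<eta> x * \<psi> x = 0) = (\<not> coprime x (int n))"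
    using assms(6)[of x] dc_eq_0_iff[OF assms(1), of x] dc_eq_0_iff[OF assms(2), of x] by auto
qed

lemma dc_sum_eq_0:
  assumes "dirichlet_char q \<eta>" "coprime u (int q)" "\<eta> u \<noteq> 1"
  shows "(\<Sum>x\<in>{0..<int q}. \<eta> x) = 0"
proof -
  have "(\<Sum>x\<in>{0..<int q}. \<eta> x) = (\<Sum>x\<in>{0..<int q}. \<eta> (u * x))"
    using sum_periodic_scale[of "int q" \<eta> u] dc_pos[OF assms(1)] dc_periodic[OF assms(1)] assms(2) by simp
  also have "\<dots> = \<eta> u * (\<Sum>x\<in>{0..<int q}. \<eta> x)" by (simp add: dc_mult[OF assms(1)] sum_distrib_left)
  finally have "(1 - \<eta> u) * (\<Sum>x\<in>{0..<int q}. \<eta> x) = 0" by (simp add: algebra_simps)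
  then show ?thesis using assms(3) by simp
qed

lemma primitive_dc: "primitive_char q \<eta> \<Longrightarrow> dirichlet_char q \<eta>"
  by (simp add: primitive_char_def)

lemma primitive_witness:
  assumes "primitive_char q \<eta>" "d dvd q" "d < q"
  obtains a where "coprime a (int q)" "[a = 1] (mod int d)" "\<eta> a \<noteq> 1"
  using assms unfolding primitive_char_def induced_modulus_def by blast

text \<open>If q does not divide B, then g = gcd(B, q) is a proper divisor of q, and primitivity
  gives a unit a = 1 modulo g with \<open>\<eta> a\<close> different from 1. Multiplication by a
  permutes the progression: a (A + B x) = A + B (a x) + (a - 1) A, and the last term is a multiple
  of g, hence of B modulo q. So the sum equals \<open>\<eta> a\<close> times itself. A need not be
  prime to q.\<close>

lemma primitive_sum_progression:
  assumes prim: "primitive_char q \<eta>"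
  shows "(\<Sum>x\<in>{0..<int q}. \<eta> (A + B * x)) = (if int q dvd B then of_nat q * \<eta> A else 0)"
proof -
  note dc = primitive_dc[OF prim]
  have q: "q > 0" using dc_pos[OF dc] .
  show ?thesis
  proof (cases "int q dvd B")
    case True
    then have "\<eta> (A + B * x) = \<eta> A" for x by (intro dc_cong[OF dc]) (simp add: cong_iff_dvd_diff)
    then show ?thesis using True by simp
  next
    case False
    define g where "g = nat (gcd B (int q))"
    have g: "int g = gcd B (int q)" by (simp add: g_def)
    have gq: "g dvd q" using g by (metis gcd_dvd2 int_dvd_int_iff)
    moreover have "g \<noteq> q" using False g gcd_dvd1[of B "int q"] by metis
    ultimately have "g < q" using dvd_imp_le[OF gq q] by linarith
    then obtain a where a: "coprime a (int q)" "[a = 1] (mod int g)" "\<eta> a \<noteq> 1"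
      using primitive_witness[OF prim gq] by blast
    obtain w where w: "a - 1 = int g * w" using a(2) cong_iff_dvd_diff[of a 1 "int g"] by (meson dvdE)
    obtain r s where "r * B + s * int q = gcd B (int q)" using bezout_int[of B "int q"] by blast
    then have rs: "int g = B * r + int q * s" using g by (simp add: mult.commute)
    have eq: "[a * (A + B * x) = A + B * (a * x + r * w * A)] (mod int q)" for x
    proof -
      have "a * (A + B * x) - (A + B * (a * x + r * w * A)) = (a - 1) * A - B * r * w * A"
        by (simp add: algebra_simps)
      also have "\<dots> = int q * (s * w * A)" unfolding w rs by (simp add: algebra_simps)
      finally show ?thesis by (simp add: cong_iff_dvd_diff)
    qed
    have "\<eta> a * (\<Sum>x\<in>{0..<int q}. \<eta> (A + B * x)) = (\<Sum>x\<in>{0..<int q}. \<eta> (a * (A + B * x)))"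
      by (simp add: sum_distrib_left dc_mult[OF dc])
    also have "\<dots> = (\<Sum>x\<in>{0..<int q}. (\<lambda>y. \<eta> (A + B * y)) (a * x + r * w * A))"
      using dc_cong[OF dc eq] by simp
    also have "\<dots> = (\<Sum>x\<in>{0..<int q}. \<eta> (A + B * x))"
    proof (rule sum_periodic_affine)
      show "\<eta> (A + B * (x + int q)) = \<eta> (A + B * x)" for x
        by (rule dc_cong[OF dc]) (simp add: cong_iff_dvd_diff algebra_simps)
    qed (use q a in auto)
    finally have "(\<eta> a - 1) * (\<Sum>x\<in>{0..<int q}. \<eta> (A + B * x)) = 0" by (simp add: algebra_simps)
    then show ?thesis using a(3) False by simp
  qed
qed

section \<open>Finite Fourier analysis\<close>

definition ee :: "nat \<Rightarrow> int \<Rightarrow> complex" where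
  "ee n x = cis (2 * pi * of_int x / of_nat n)"

lemma ee_add: "ee n (x + y) = ee n x * ee n y"
  by (simp add: ee_def cis_mult ring_distribs add_divide_distrib)

lemma ee_0 [simp]: "ee n 0 = 1" by (simp add: ee_def)

lemma cnj_ee: "cnj (ee n x) = ee n (-x)"
  by (simp add: ee_def cis_cnj)

lemma ee_power: "ee n x ^ k = ee n (x * int k)"
  unfolding ee_def Complex.DeMoivre by (rule arg_cong[of _ _ cis]) simp

lemma ee_mult_self: "n > 0 \<Longrightarrow> ee n (int n * k) = 1"
  using cis_multiple_2pi[of "of_int k"] by (simp add: ee_def mult_ac)

lemma ee_periodic: "n > 0 \<Longrightarrow> ee n (x + int n) = ee n x"
  using ee_mult_self[of n 1] by (simp add: ee_add)

lemma ee_cong: "n > 0 \<Longrightarrow> [x = y] (mod int n) \<Longrightarrow> ee n x = ee n y"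
  using periodic_cong[of "ee n" "int n" x y] ee_periodic by blast

lemma ee_eq_1_iff: 
  assumes "n > 0" shows "ee n x = 1 \<longleftrightarrow> int n dvd x"
proof
  assume "ee n x = 1"
  then have "cos (2 * pi * of_int x / of_nat n) = 1" by (simp add: ee_def complex_eq_iff)
  then obtain k where "2 * pi * of_int x / of_nat n = real_of_int k * 2 * pi"
    using cos_one_2pi_int by blast
  then have "real_of_int x = of_int k * of_nat n" using assms by (simp add: field_simps)
  then have "x = k * int n" by (metis of_int_eq_iff of_int_mult of_int_of_nat_eq)
  then show "int n dvd x" by simp
next
  assume "int n dvd x"
  then show "ee n x = 1" using ee_mult_self[OF assms] by auto
qed

lemma ee_scale: "d > 0 \<Longrightarrow> ee (n * d) (int d * x) = ee n x"
  by (simp add: ee_def mult_ac)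

lemma sum_int_eq_sum_nat: "(\<Sum>x\<in>{0..<int n}. f x) = (\<Sum>k<n. f (int k))"
  by (rule sum.reindex_bij_witness[where i = int and j = nat]) auto

lemma sum_ee:
  assumes n: "n > 0"
  shows "(\<Sum>x\<in>{0..<int n}. ee n (k * x)) = (if int n dvd k then of_nat n else 0)"
proof (cases "int n dvd k")
  case True
  then have "ee n (k * x) = 1" for x using ee_eq_1_iff[OF n] by simp
  then show ?thesis using True by simp
next
  case False
  have "ee n k \<noteq> 1" using False ee_eq_1_iff[OF n] by simp
  moreover have "(\<Sum>x\<in>{0..<int n}. ee n (k * x)) = (\<Sum>j<n. ee n k ^ j)"
    by (simp add: sum_int_eq_sum_nat ee_power)
  moreover have "ee n k ^ n = 1" using ee_mult_self[OF n, of k] by (simp add: ee_power mult.commute)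
  ultimately show ?thesis using False geometric_sum[of "ee n k" n] by simp
qed

lemma fourier_inversion:
  assumes n: "n > 0" and per: "\<And>x. f (x + int n) = f x"
  shows "f h = (\<Sum>m\<in>{0..<int n}. (\<Sum>x\<in>{0..<int n}. f x * ee n (- (m * x))) * ee n (m * h)) / of_nat n"
proof -
  have "(\<Sum>m\<in>{0..<int n}. (\<Sum>x\<in>{0..<int n}. f x * ee n (- (m * x))) * ee n (m * h))
      = (\<Sum>x\<in>{0..<int n}. f x * (\<Sum>m\<in>{0..<int n}. ee n ((h - x) * m)))"
    unfolding sum_distrib_right sum_distrib_left
    by (subst sum.swap) (simp add: ee_add[symmetric] mult.assoc algebra_simps)
  also have "\<dots> = (\<Sum>x\<in>{0..<int n}. if x = h mod int n then of_nat n * f h else 0)"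
  proof (rule sum.cong[OF refl])
    fix x assume x: "x \<in> {0..<int n}"
    have "int n dvd h - x \<longleftrightarrow> x = h mod int n"
      using x cong_iff_dvd_diff[of h x "int n"] by (auto simp: unique_euclidean_semiring_class.cong_def)
    then show "f x * (\<Sum>m\<in>{0..<int n}. ee n ((h - x) * m)) = (if x = h mod int n then of_nat n * f h else 0)"
      using sum_ee[OF n, of "h - x"] periodic_mod[of f "int n" h, OF per] by simp
  qed
  also have "\<dots> = of_nat n * f h" using n by simp
  finally show ?thesis using n by simp
qed

definition gauss :: "nat \<Rightarrow> (int \<Rightarrow> complex) \<Rightarrow> complex" where
  "gauss q \<eta> = (\<Sum>x\<in>{0..<int q}. \<eta> x * ee q x)"

text \<open>For a unit k this is a substitution. Otherwise there is a unit a = 1 modulo q / gcd(k,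
  q) with \<open>\<eta> a\<close> different from 1; replacing x by a x does not change the
  exponential, since a k = k modulo q, but multiplies the sum by \<open>\<eta> a\<close>.\<close>

lemma gauss_primitive:
  assumes prim: "primitive_char q \<eta>"
  shows "(\<Sum>x\<in>{0..<int q}. \<eta> x * ee q (k * x)) = cnj (\<eta> k) * gauss q \<eta>"
proof -
  note dc = primitive_dc[OF prim]
  have q: "q > 0" using dc_pos[OF dc] .
  have per: "\<eta> (x + int q) * ee q (k * (x + int q)) = \<eta> x * ee q (k * x)" for x k
    using dc_periodic[OF dc] ee_mult_self[OF q, of k] by (simp add: ring_distribs ee_add mult.commute)
  show ?thesis
  proof (cases "coprime k (int q)")
    case True
    have "cnj (\<eta> k) * gauss q \<eta> = cnj (\<eta> k) * (\<Sum>x\<in>{0..<int q}. \<eta> (k * x) * ee q (1 * (k * x)))"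
      unfolding gauss_def 
      using sum_periodic_scale[of "int q" "\<lambda>x. \<eta> x * ee q (1 * x)" k] q per[of _ 1] True by simp
    also have "\<dots> = (\<eta> k * cnj (\<eta> k)) * (\<Sum>x\<in>{0..<int q}. \<eta> x * ee q (k * x))"
      by (simp add: dc_mult[OF dc] sum_distrib_left mult_ac)
    finally show ?thesis using dc_mult_cnj[OF dc, of k] True by simp
  next
    case False
    define g where "g = nat (int q div gcd k (int q))"
    have gg: "int g * gcd k (int q) = int q" using q by (simp add: g_def pos_imp_zdiv_nonneg_iff)
    have "gcd k (int q) > 1" using False q
      by (metis coprime_iff_gcd_eq_1 gcd_pos_int int_one_le_iff_zero_less less_le of_nat_0_less_iff less_irrefl)
    then have "g < q" using gg q by (smt (verit) mult_le_cancel_left1 mult_less_cancel_left_pos nat_int of_nat_0_less_iff of_nat_less_iff zero_less_mult_iff)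
    moreover have "g dvd q" using gg by (metis dvd_triv_left int_dvd_int_iff)
    ultimately obtain a where a: "coprime a (int q)" "[a = 1] (mod int g)" "\<eta> a \<noteq> 1"
      using primitive_witness[OF prim] by blast
    have "int q dvd k * (a - 1)"
    proof -
      have "int g dvd a - 1" using a(2) by (simp add: cong_iff_dvd_diff)
      then have "int g * gcd k (int q) dvd (a - 1) * k" by (intro mult_dvd_mono) auto
      then show ?thesis using gg by (simp add: mult.commute)
    qed
    then have ka: "[k * (a * x) = k * x] (mod int q)" for x
      by (metis (no_types, lifting) cong_iff_dvd_diff cong_scalar_right mult.assoc right_diff_distrib' mult.right_neutral)
    have "(\<Sum>x\<in>{0..<int q}. \<eta> x * ee q (k * x)) = (\<Sum>x\<in>{0..<int q}. \<eta> (a * x) * ee q (k * (a * x)))"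
      using sum_periodic_scale[of "int q" "\<lambda>x. \<eta> x * ee q (k * x)" a] q per a(1) by simp
    also have "\<dots> = \<eta> a * (\<Sum>x\<in>{0..<int q}. \<eta> x * ee q (k * x))"
      using ee_cong[OF q ka] by (simp add: dc_mult[OF dc] sum_distrib_left mult.assoc)
    finally have "(1 - \<eta> a) * (\<Sum>x\<in>{0..<int q}. \<eta> x * ee q (k * x)) = 0" by (simp add: algebra_simps)
    then have "(\<Sum>x\<in>{0..<int q}. \<eta> x * ee q (k * x)) = 0" using a(3) by simp
    then show ?thesis using dc_eq_0_iff[OF dc, of k] False by simp
  qed
qed

lemma gauss_norm:
  assumes prim: "primitive_char q \<eta>"
  shows "(cmod (gauss q \<eta>))\<^sup>2 = real q"
proof -
  note dc = primitive_dc[OF prim]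
  have q: "q > 0" using dc_pos[OF dc] .
  have "gauss q \<eta> * cnj (gauss q \<eta>) = (\<Sum>k\<in>{0..<int q}. cnj (\<eta> k) * gauss q \<eta> * ee q (- k))"
    by (simp add: gauss_def[of q \<eta>] cnj_ee sum_distrib_left mult_ac)
  also have "\<dots> = (\<Sum>k\<in>{0..<int q}. \<Sum>x\<in>{0..<int q}. \<eta> x * ee q ((x - 1) * k))"
    unfolding gauss_primitive[OF prim, symmetric]
    unfolding sum_distrib_right
  proof (intro sum.cong refl)
    fix k x
    have "ee q ((x - 1) * k) = ee q (k * x) * ee q (- k)" unfolding ee_add[symmetric] by (simp add: algebra_simps)
    then show "\<eta> x * ee q (k * x) * ee q (- k) = \<eta> x * ee q ((x - 1) * k)" by simp
  qed
  also have "\<dots> = (\<Sum>x\<in>{0..<int q}. \<eta> x * (\<Sum>k\<in>{0..<int q}. ee q ((x - 1) * k)))"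
    by (subst sum.swap) (simp add: sum_distrib_left)
  also have "\<dots> = (\<Sum>x\<in>{0..<int q}. if x = 1 mod int q then of_nat q else 0)"
  proof (rule sum.cong[OF refl])
    fix x assume x: "x \<in> {0..<int q}"
    have "int q dvd x - 1 \<longleftrightarrow> x = 1 mod int q"
      using x cong_iff_dvd_diff[of x 1 "int q"] by (auto simp: unique_euclidean_semiring_class.cong_def)
    moreover have "\<eta> (1 mod int q) = 1" using periodic_mod[of \<eta> "int q" 1] dc_periodic[OF dc] dc by simp
    ultimately show "\<eta> x * (\<Sum>k\<in>{0..<int q}. ee q ((x - 1) * k)) = (if x = 1 mod int q then of_nat q else 0)"
      using sum_ee[OF q, of "x - 1"] by simp
  qed
  also have "\<dots> = of_nat q" using q by simp
  finally have "complex_of_real ((cmod (gauss q \<eta>))\<^sup>2) = of_real (real q)"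
    by (simp only: complex_norm_square of_real_of_nat_eq)
  then show ?thesis by (simp only: of_real_eq_iff)
qed

text \<open>At multiples of c the division by \<open>sin\<close> = 0 yields the default value 0.
  This is the right value: it matches the vanishing of the Fourier coefficient of \<open>B1\<close>
  at frequency 0, so no sum over residues has to leave out a term.\<close>

definition ct :: "nat \<Rightarrow> int \<Rightarrow> real" where
  "ct c m = cot (pi * of_int m / of_nat c)"

lemma cot_add_pi: "cot (x + pi) = cot (x::real)" by (simp add: cot_def)

lemma ct_periodic: "c > 0 \<Longrightarrow> ct c (m + int c) = ct c m"
  using cot_add_pi[of "pi * of_int m / of_nat c"] by (simp add: ct_def ring_distribs add_divide_distrib)

lemma ct_cong: "c > 0 \<Longrightarrow> [x = y] (mod int c) \<Longrightarrow> ct c x = ct c y"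
  using periodic_cong[of "ct c" "int c" x y] ct_periodic by blast

lemma ct_uminus: "ct c (- m) = - ct c m"
  by (simp add: ct_def cot_minus)

lemma ct_0 [simp]: "ct c 0 = 0" by (simp add: ct_def)

lemma ct_scale: "d > 0 \<Longrightarrow> ct (c * d) (int d * x) = ct c x"
  by (simp add: ct_def)

lemma B1_int_div:
  assumes "c > 0"
  shows "B1 (of_int h / of_nat c) = (if int c dvd h then 0 else of_int (h mod int c) / of_nat c - 1/2)"
proof -
  have int: "of_int h / of_nat c \<in> (\<int>::real set) \<longleftrightarrow> int c dvd h"
  proof
    assume "of_int h / of_nat c \<in> (\<int>::real set)"
    then obtain k where "of_int h / of_nat c = real_of_int k" by (auto elim: Ints_cases)
    then have "real_of_int h = of_int (k * int c)" using assms by (simp add: field_simps)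
    then have "h = k * int c" by (simp only: of_int_eq_iff)
    then show "int c dvd h" by simp
  next
    assume "int c dvd h"
    then obtain k where "h = int c * k" by auto
    then show "of_int h / of_nat c \<in> (\<int>::real set)" using assms by simp
  qed
  have fl: "\<lfloor>of_int h / of_nat c :: real\<rfloor> = h div int c"
    by (metis floor_divide_of_int_eq of_int_of_nat_eq)
  have "real_of_int h = of_int (h mod int c) + of_nat c * of_int (h div int c)"
    by (metis mod_mult_div_eq of_int_add of_int_mult of_int_of_nat_eq)
  then have "of_int h / of_nat c - of_int (h div int c) = (of_int (h mod int c) / of_nat c :: real)"
    using assms by (simp add: field_simps)
  then show ?thesis unfolding B1_def int fl by simp
qed

lemma B1_periodic: "c > 0 \<Longrightarrow> B1 (of_int (h + int c) / of_nat c) = B1 (of_int h / of_nat c)"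
  by (simp only: B1_int_div mod_add_self2) simp

lemma sum_nat_times_power:
  fixes z :: complex
  shows "(z - 1)\<^sup>2 * (\<Sum>j<n. of_nat j * z ^ j) = (of_nat n - 1) * z ^ (n + 1) - of_nat n * z ^ n + z"
  by (induction n) (simp_all add: algebra_simps power2_eq_square)

text \<open>For c not dividing m put z = e(-m/c). As z^c = 1, the sum of j z^j collapses to c / (z -
  1), and the value 0 instead of -1/2 of \<open>B1\<close> at the integers adds 1/2. The total (z +
  1) / (2 (z - 1)) is the cotangent, seen by extracting a square root w of z from numerator and
  denominator.\<close>

lemma B1_transform:
  assumes c: "c > 0"
  shows "(\<Sum>h\<in>{0..<int c}. of_real (B1 (of_int h / of_nat c)) * ee c (- (m * h))) = \<i> / 2 * of_real (ct c m)"
proof (cases "int c dvd m")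
  case True
  have b: "B1 (of_int h / of_nat c) = (if h = 0 then 0 else of_int h / of_nat c - 1/2)" if "h \<in> {0..<int c}" for h
    using that by (auto simp: B1_int_div[OF c] dest: zdvd_imp_le)
  have "(\<Sum>h\<in>{0..<int c}. of_real (B1 (of_int h / of_nat c)) * ee c (- (m * h)))
     = complex_of_real (\<Sum>h\<in>{0..<int c}. B1 (of_int h / of_nat c))"
    unfolding of_real_sum
  proof (rule sum.cong[OF refl])
    fix h
    have "ee c (- (m * h)) = 1" using True ee_eq_1_iff[OF c] by simp
    then show "of_real (B1 (of_int h / of_nat c)) * ee c (- (m * h)) = complex_of_real (B1 (of_int h / of_nat c))" by simp
  qed
  also have "(\<Sum>h\<in>{0..<int c}. B1 (of_int h / of_nat c)) = (\<Sum>h\<in>{0..<int c}. if h = 0 then 0 else of_int h / of_nat c - 1/2)"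
    by (rule sum.cong[OF refl b])
  also have "\<dots> = (\<Sum>j<c. if j = 0 then 0 else real j / real c - 1/2)"
    by (simp add: sum_int_eq_sum_nat if_distrib cong: if_cong)
  also have "\<dots> = (\<Sum>j<c. (real j / real c - 1/2) + (if j = 0 then 1/2 else 0))"
    by (rule sum.cong) auto
  also have "\<dots> = (\<Sum>j<c. real j) / real c - real c / 2 + 1/2"
    using c by (simp add: sum.distrib sum_subtractf sum_divide_distrib)
  also have "(\<Sum>j<c. real j) = real c * (real c - 1) / 2"
    by (induction c) (simp_all add: field_simps)
  also have "real c * (real c - 1) / 2 / real c - real c / 2 + 1/2 = 0" using c by (simp add: field_simps)
  finally have 1: "(\<Sum>h\<in>{0..<int c}. of_real (B1 (of_int h / of_nat c)) * ee c (- (m * h))) = 0" by simp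
  have "ct c m = ct c 0" using True by (intro ct_cong[OF c]) (simp add: cong_0_iff)
  then show ?thesis using 1 by simp
next
  case False
  define z where "z = ee c (- m)"
  have z1: "z \<noteq> 1" using False ee_eq_1_iff[OF c, of "-m"] by (simp add: z_def)
  have zc: "z ^ c = 1" using ee_mult_self[OF c, of "-m"] by (simp add: z_def ee_power mult.commute)
  have S: "(\<Sum>j<c. of_nat j * z ^ j) = of_nat c / (z - 1)"
  proof -
    have "(z - 1)\<^sup>2 * (\<Sum>j<c. of_nat j * z ^ j) = of_nat c * (z - 1)"
      unfolding sum_nat_times_power using zc by (simp add: algebra_simps)
    then have "(z - 1) * ((z - 1) * (\<Sum>j<c. of_nat j * z ^ j)) = (z - 1) * of_nat c"
      by (simp only: power2_eq_square mult_ac)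
    then have "(z - 1) * (\<Sum>j<c. of_nat j * z ^ j) = of_nat c" using z1 by simp
    then show ?thesis using z1 by (simp add: eq_divide_eq mult.commute)
  qed
  have b: "of_real (B1 (of_int (int j) / of_nat c)) = of_nat j / of_nat c - 1/2 + (if j = 0 then 1/2 else (0::complex))" if "j < c" for j
    using B1_int_div[OF c, of "int j"] that by (auto dest: zdvd_imp_le)
  have "(\<Sum>h\<in>{0..<int c}. of_real (B1 (of_int h / of_nat c)) * ee c (- (m * h)))
     = (\<Sum>j<c. (of_nat j / of_nat c - 1/2 + (if j = 0 then 1/2 else 0)) * z ^ j)"
    unfolding sum_int_eq_sum_nat
    by (rule sum.cong[OF refl]) (use b in \<open>simp add: z_def ee_power\<close>)
  also have "\<dots> = (\<Sum>j<c. of_nat j * z ^ j) / of_nat c - (\<Sum>j<c. z ^ j) / 2 + (\<Sum>j<c. if j = 0 then 1/2 else 0)"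
    unfolding sum_divide_distrib sum_subtractf[symmetric] sum.distrib[symmetric]
    by (rule sum.cong[OF refl]) (simp add: algebra_simps)
  also have "\<dots> = 1 / (z - 1) + 1 / 2"
    using S geometric_sum[OF z1, of c] zc c by simp
  also have "\<dots> = (z + 1) / (2 * (z - 1))" using z1 by (simp add: field_simps)
  also have "\<dots> = \<i> / 2 * of_real (ct c m)"
  proof -
    define t where "t = pi * of_int m / real c"
    define w where "w = cis (- t)"
    have zw: "z = w * w" by (simp add: z_def w_def ee_def t_def cis_mult mult_ac)
    have w0: "w * cis t = 1" by (simp add: w_def cis_mult)
    have p: "z + 1 = w * (2 * of_real (cos t))"
    proof -
      have "z + 1 = w * (w + cis t)" using w0 by (simp add: zw algebra_simps)
      also have "w + cis t = 2 * of_real (cos t)" by (simp add: w_def complex_eq_iff)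
      finally show ?thesis .
    qed
    have q: "z - 1 = w * (- 2 * \<i> * of_real (sin t))"
    proof -
      have "z - 1 = w * (w - cis t)" using w0 by (simp add: zw algebra_simps)
      also have "w - cis t = - 2 * \<i> * of_real (sin t)" by (simp add: w_def complex_eq_iff)
      finally show ?thesis .
    qed
    have wn: "w \<noteq> 0" using w0 by auto
    have sn: "sin t \<noteq> 0" using q z1 by auto
    have "ct c m = cos t / sin t" by (simp add: ct_def t_def cot_def)
    then have "sin t * ct c m = cos t" using sn by simp
    then have "complex_of_real (sin t) * of_real (ct c m) = of_real (cos t)" by (metis of_real_mult)
    then show ?thesis unfolding p q using wn sn by (simp add: field_simps)
  qed
  finally show ?thesis .
qed

lemma B1_fourier:
  assumes c: "c > 0"
  shows "complex_of_real (B1 (of_int h / of_nat c)) = \<i> / (2 * of_nat c) * (\<Sum>m\<in>{0..<int c}. of_real (ct c m) * ee c (m * h))"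
  using fourier_inversion[OF c, of "\<lambda>h. of_real (B1 (of_int h / of_nat c))" h] B1_periodic[OF c]
  unfolding B1_transform[OF c] by (simp add: sum_distrib_left mult_ac sum_divide_distrib)

section \<open>Partial summation\<close>

lemma abel_identity:
  fixes a :: "nat \<Rightarrow> complex" and g :: "nat \<Rightarrow> real"
  shows "(\<Sum>k<M. a k * of_real (g k))
     = (\<Sum>k<M. a k) * of_real (g M) + (\<Sum>k<M. (\<Sum>j<Suc k. a j) * of_real (g k - g (Suc k)))"
  by (induction M) (simp_all add: algebra_simps)

lemma abel_bound:
  fixes a :: "nat \<Rightarrow> complex" and g :: "nat \<Rightarrow> real"
  assumes "\<And>n. n \<le> M \<Longrightarrow> cmod (\<Sum>k<n. a k) \<le> K"
  shows "cmod (\<Sum>k<M. a k * of_real (g k)) \<le> K * (\<bar>g M\<bar> + (\<Sum>k<M. \<bar>g k - g (Suc k)\<bar>))"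
proof -
  have "cmod (\<Sum>k<M. a k * of_real (g k)) \<le> cmod (\<Sum>k<M. a k) * \<bar>g M\<bar>
      + (\<Sum>k<M. cmod (\<Sum>j<Suc k. a j) * \<bar>g k - g (Suc k)\<bar>)"
    by (subst abel_identity, rule order_trans[OF norm_triangle_ineq add_mono])
      (auto simp: norm_mult intro!: sum_norm_le simp del: of_real_diff sum.lessThan_Suc)
  also have "\<dots> \<le> K * \<bar>g M\<bar> + (\<Sum>k<M. K * \<bar>g k - g (Suc k)\<bar>)"
    by (intro add_mono mult_right_mono sum_mono assms) auto
  finally show ?thesis by (simp add: sum_distrib_left ring_distribs)
qed

lemma abel_bound_decreasing:
  fixes a :: "nat \<Rightarrow> complex" and g :: "nat \<Rightarrow> real"
  assumes K: "\<And>n. n \<le> M \<Longrightarrow> cmod (\<Sum>k<n. a k) \<le> K"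
    and dec: "\<And>k. k < M \<Longrightarrow> g (Suc k) \<le> g k" and nn: "g M \<ge> 0"
  shows "cmod (\<Sum>k<M. a k * of_real (g k)) \<le> K * g 0"
proof -
  have "(\<Sum>k<M. \<bar>g k - g (Suc k)\<bar>) = (\<Sum>k<M. g k - g (Suc k))"
    by (rule sum.cong) (use dec in auto)
  also have "\<dots> = g 0 - g M" by (rule sum_lessThan_telescope')
  finally show ?thesis using abel_bound[of M a K g] K nn by simp
qed

lemma periodic_partial_sums:
  fixes f :: "int \<Rightarrow> complex"
  assumes c: "c > 0" and per: "\<And>x. f (x + int c) = f x" and z: "(\<Sum>x\<in>{0..<int c}. f x) = 0"
    and b: "\<And>x. cmod (f x) \<le> 1"
  shows "cmod (\<Sum>k<M. f (int k)) \<le> real c"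
proof (induction M rule: less_induct)
  case (less M)
  show ?case
  proof (cases "M < c")
    case True
    have "cmod (\<Sum>k<M. f (int k)) \<le> (\<Sum>k<M. 1)" by (intro sum_norm_le b)
    then show ?thesis using True by simp
  next
    case False
    then have cM: "c \<le> M" "c > 0" using c by auto
    have "(\<Sum>k<M. f (int k)) = (\<Sum>k<c. f (int k)) + (\<Sum>k<M-c. f (int k))"
    proof -
      have "(\<Sum>k<M. f (int k)) = (\<Sum>k<c. f (int k)) + (\<Sum>k=c..<M. f (int k))"
        using cM sum.atLeastLessThan_concat[of 0 c M "\<lambda>k. f (int k)"] by (simp add: atLeast0LessThan)
      also have "(\<Sum>k=c..<M. f (int k)) = (\<Sum>k<M-c. f (int k + int c))"
        by (rule sum.reindex_bij_witness[where i = "\<lambda>k. k + c" and j = "\<lambda>k. k - c"]) auto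
      finally show ?thesis using per by simp
    qed
    then show ?thesis using z less[of "M - c"] cM by (simp add: sum_int_eq_sum_nat)
  qed
qed

section \<open>Cotangent sums of odd characters and the series of L(1)\<close>

text \<open>Proved on the Fourier side: summing over i annihilates every frequency h not divisible
  by M, and at h = M h' the function \<open>B1\<close> of level c M is \<open>B1\<close> of level
  c.\<close>

lemma ct_distribution:
  assumes c: "c > 0" and M: "M > 0"
  shows "(\<Sum>i\<in>{0..<int M}. ct (c * M) (m + int c * i)) = real M * ct c m"
proof -
  have cM: "c * M > 0" using c M by simp
  have "\<i> / 2 * of_real (\<Sum>i\<in>{0..<int M}. ct (c * M) (m + int c * i))
    = (\<Sum>i\<in>{0..<int M}. \<Sum>h\<in>{0..<int (c * M)}. of_real (B1 (of_int h / of_nat (c * M))) * ee (c * M) (- ((m + int c * i) * h)))"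
    unfolding of_real_sum sum_distrib_left B1_transform[OF cM] ..
  also have "\<dots> = (\<Sum>h\<in>{0..<int c * int M}. of_real (B1 (of_int h / of_nat (c * M))) * ee (c * M) (- (m * h)) * (\<Sum>i\<in>{0..<int M}. ee M (-h * i)))"
  proof -
    have "ee (c * M) (- ((m + int c * i) * h)) = ee (c * M) (- (m * h)) * ee M (- h * i)" for h i
    proof -
      have "ee (c * M) (- ((m + int c * i) * h)) = ee (c * M) (- (m * h) + int c * (- h * i))"
        by (rule arg_cong[of _ _ "ee (c * M)"]) (simp add: algebra_simps)
      then show ?thesis using ee_scale[OF c, of M "- h * i"] by (simp only: ee_add mult.commute[of c M])
    qed
    then show ?thesis by (subst sum.swap) (simp add: sum_distrib_left mult.assoc)
  qed
  also have "\<dots> = (\<Sum>h\<in>{0..<int c * int M}. if int M dvd h then of_nat M * (of_real (B1 (of_int h / of_nat (c * M))) * ee (c * M) (- (m * h))) else 0)"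
    by (rule sum.cong[OF refl], subst sum_ee[OF M]) simp
  also have "\<dots> = (\<Sum>h\<in>{0..<int c}. of_nat M * (of_real (B1 (of_int h / of_nat c)) * ee c (- (m * h))))"
  proof (subst sum_multiples)
    have "B1 (of_int (int M * h) / of_nat (c * M)) = B1 (of_int h / of_nat c)" for h using M by simp
    moreover have "ee (c * M) (- (m * (int M * h))) = ee c (- (m * h))" for h
      using ee_scale[OF M, of c "- (m * h)"] by (simp add: mult_ac)
    ultimately show "(\<Sum>h\<in>{0..<int c}. of_nat M * (of_real (B1 (of_int (int M * h) / of_nat (c * M))) * ee (c * M) (- (m * (int M * h)))))
        = (\<Sum>h\<in>{0..<int c}. of_nat M * (of_real (B1 (of_int h / of_nat c)) * ee c (- (m * h))))" by simp
  qed (use c M in auto)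
  also have "\<dots> = of_nat M * (\<i> / 2 * of_real (ct c m))"
    unfolding sum_distrib_left[symmetric] B1_transform[OF c] ..
  finally have "complex_of_real (\<Sum>i\<in>{0..<int M}. ct (c * M) (m + int c * i)) = of_real (real M * ct c m)"
    by simp
  then show ?thesis unfolding of_real_eq_iff .
qed

lemma sum_ct_level:
  fixes f :: "int \<Rightarrow> complex"
  assumes c: "c > 0" and M: "M > 0" and per: "\<And>x. f (x + int c) = f x"
  shows "(\<Sum>m\<in>{0..<int (c * M)}. f m * of_real (ct (c * M) m)) = of_nat M * (\<Sum>m\<in>{0..<int c}. f m * of_real (ct c m))"
proof -
  have "(\<Sum>m\<in>{0..<int c * int M}. f m * of_real (ct (c * M) m))
      = (\<Sum>m\<in>{0..<int c}. f m * of_real (\<Sum>i\<in>{0..<int M}. ct (c * M) (m + int c * i)))"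
    using c M periodic_add_mult[of f "int c", OF per]
    by (subst sum_split_residues) (simp_all add: sum_distrib_left)
  then show ?thesis unfolding ct_distribution[OF c M] by (simp add: sum_distrib_left mult_ac)
qed

lemma inverse_minus_cot_mono:
  assumes "0 < x" "x \<le> y" "y \<le> pi / 2"
  shows "1 / x - cot x \<le> 1 / y - cot (y::real)"
proof (rule DERIV_nonneg_imp_nondecreasing[OF assms(2)])
  fix t assume t: "x \<le> t" "t \<le> y"
  have s: "sin t > 0" using t assms pi_half_less_two pi_gt_zero by (intro sin_gt_zero) linarith+
  have t0: "t > 0" using t assms by simp
  have "((\<lambda>t. 1 / t - cot t) has_real_derivative (inverse ((sin t)\<^sup>2) - 1 / t\<^sup>2)) (at t)"
  proof -
    have "((\<lambda>t. 1 / t) has_real_derivative (- (1 / t\<^sup>2))) (at t)"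
      using t0 by (auto intro!: derivative_eq_intros simp: power2_eq_square)
    moreover have "(cot has_real_derivative (- inverse ((sin t)\<^sup>2))) (at t)" using DERIV_cot[of t] s by simp
    ultimately have "((\<lambda>t. 1 / t - cot t) has_real_derivative (- (1 / t\<^sup>2) - - inverse ((sin t)\<^sup>2))) (at t)"
      by (rule DERIV_diff)
    then show ?thesis by simp
  qed
  moreover have "inverse ((sin t)\<^sup>2) - 1 / t\<^sup>2 \<ge> 0"
  proof -
    have "sin t \<le> t" using t0 sin_x_le_x by simp
    then have "(sin t)\<^sup>2 \<le> t\<^sup>2" using s by (intro power_mono) auto
    then show ?thesis using s t0 by (simp add: field_simps)
  qed
  ultimately show "\<exists>d. ((\<lambda>t. 1 / t - cot t) has_real_derivative d) (at t) \<and> 0 \<le> d" by blast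
qed

lemma cot_le_inverse:
  assumes "0 < x" "x < pi / 2"
  shows "cot x \<le> 1 / (x::real)"
proof -
  have c: "cos x > 0" and s: "sin x > 0" using assms cos_gt_zero[of x] sin_gt_zero[of x] by auto
  have "x * cos x - sin x \<le> 0 * cos 0 - sin (0::real)"
  proof (rule DERIV_nonpos_imp_nonincreasing[of 0 x "\<lambda>x. x * cos x - sin x"])
    fix t assume t: "0 \<le> t" "t \<le> x"
    have "((\<lambda>x. x * cos x - sin x) has_real_derivative (- t * sin t)) (at t)"
      by (auto intro!: derivative_eq_intros)
    moreover have "- t * sin t \<le> 0" using t assms sin_ge_zero[of t] by simp
    ultimately show "\<exists>d. ((\<lambda>x. x * cos x - sin x) has_real_derivative d) (at t) \<and> d \<le> 0" by blast
  qed (use assms in auto)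
  then show ?thesis using c s assms by (simp add: cot_def field_simps)
qed

text \<open>The reflection of m to 2 y - m changes the sign of both factors. The level is even so
  that the fixed point m = y has cotangent 0, and only arguments below \<pi>/2 remain, where 1/x -
  cot x is monotone.\<close>

lemma odd_sum_ct_half:
  fixes f :: "int \<Rightarrow> complex"
  assumes y: "y > 0" and per: "\<And>x. f (x + int (2 * y)) = f x" and odd: "\<And>x. f (-x) = - f x"
  shows "(\<Sum>m\<in>{0..<int (2 * y)}. f m * of_real (ct (2 * y) m)) = 2 * (\<Sum>m\<in>{1..<int y}. f m * of_real (ct (2 * y) m))"
proof -
  let ?g = "\<lambda>m. f m * complex_of_real (ct (2 * y) m)"
  have mid: "ct (2 * y) (int y) = 0" using y by (simp add: ct_def cot_def)
  have split: "{0..<int (2 * y)} = {0} \<union> {1..<int y} \<union> {int y} \<union> {int y + 1..<int (2*y)}" using y by auto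
  have "(\<Sum>m\<in>{0..<int (2 * y)}. ?g m) = (\<Sum>m\<in>{1..<int y}. ?g m) + (\<Sum>m\<in>{int y + 1..<int (2 * y)}. ?g m)"
    unfolding split using y mid by (subst sum.union_disjoint, auto)+
  also have "(\<Sum>m\<in>{int y + 1..<int (2 * y)}. ?g m) = (\<Sum>m\<in>{1..<int y}. ?g m)"
  proof (rule sum.reindex_bij_witness[where i = "\<lambda>m. int (2 * y) - m" and j = "\<lambda>m. int (2 * y) - m"])
    fix a assume "a \<in> {int y + 1..<int (2 * y)}"
    have "f (int (2 * y) - a) = - f a" using per[of "-a"] odd[of a] by (simp add: algebra_simps)
    moreover have "ct (2 * y) (int (2 * y) - a) = - ct (2 * y) a" 
      using ct_periodic[of "2 * y" "-a"] y by (simp add: ct_uminus algebra_simps)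
    ultimately show "?g (int (2 * y) - a) = ?g a" by simp
  qed auto
  finally show ?thesis by simp
qed

text \<open>If the cotangent sum of an odd periodic function vanishes, so does its series at 1: the
  sum at level \<open>2 c M\<close> is a multiple of the one at level \<open>c\<close>, and \<open>1/x - cot x\<close> is monotone.\<close>

lemma cot_sum_zero_imp_series_small:
  fixes f :: "int \<Rightarrow> complex"
  assumes c: "c > 0" and per: "\<And>x. f (x + int c) = f x" and odd: "\<And>x. f (-x) = - f x"
    and b: "\<And>x. cmod (f x) \<le> 1" and z: "(\<Sum>m\<in>{0..<int c}. f m * of_real (ct c m)) = 0"
  shows "cmod (\<Sum>k<x. f (int k + 1) / of_nat (k + 1)) \<le> 2 * real c / real (x + 1)"
proof -
  have sum0: "(\<Sum>m\<in>{0..<int c}. f m) = 0"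
  proof -
    have "(\<Sum>m\<in>{0..<int c}. f m) = (\<Sum>m\<in>{0..<int c}. f ((-1) * m))"
      using sum_periodic_scale[of "int c" f "-1"] c per by simp
    also have "\<dots> = - (\<Sum>m\<in>{0..<int c}. f m)" using odd by (simp add: sum_negf)
    finally show ?thesis by (simp add: equal_neg_zero)
  qed
  have f0: "f 0 = 0" using odd[of 0] by (simp add: equal_neg_zero)
  have part: "cmod (\<Sum>k<n. f (int k + 1)) \<le> real c" for n
  proof -
    have "(\<Sum>k<n. f (int k + 1)) = (\<Sum>k<Suc n. f (int k))"
      using f0 by (subst sum.lessThan_Suc_shift) (simp add: add.commute)
    then show ?thesis using periodic_partial_sums[OF c per sum0 b, of "Suc n"] by simp
  qed
  define S where "S = (\<lambda>x. \<Sum>k<x. f (int k + 1) / of_nat (k + 1))"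
  have far: "cmod (S (c * M - 1)) \<le> 2 / real M" if M: "M > 0" for M
  proof -
    define y where "y = c * M"
    have y: "y > 0" using c M by (simp add: y_def)
    have pery: "f (x + int (2 * y)) = f x" for x
      using periodic_add_mult[of f "int c" x "2 * int M", OF per] by (simp add: y_def mult_ac)
    have "(\<Sum>m\<in>{0..<int (2 * y)}. f m * of_real (ct (2 * y) m)) = 0"
      using sum_ct_level[of c "2 * M" f, OF c _ per] M z by (simp add: y_def mult_ac)
    then have "(\<Sum>m\<in>{1..<int y}. f m * of_real (ct (2 * y) m)) = 0"
      using odd_sum_ct_half[OF y pery odd] by simp
    moreover have "(\<Sum>m\<in>{1..<int y}. f m * of_real (ct (2 * y) m)) = (\<Sum>k<y-1. f (int k + 1) * of_real (ct (2 * y) (int k + 1)))"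
      by (rule sum.reindex_bij_witness[where i = "\<lambda>k. int k + 1" and j = "\<lambda>m. nat (m - 1)"]) auto
    ultimately have ct0: "(\<Sum>k<y-1. f (int k + 1) * of_real (ct (2 * y) (int k + 1))) = 0" by simp
    \<comment> \<open>Up to the factor 2 y / \<pi>, the sum of f against \<open>d\<close> is the
      partial sum of the series minus the vanishing cotangent sum. Since \<open>d\<close> increases
      from a non-negative value to 2 / \<pi> at k = y - 1, where the cotangent is 0, its variation
      is bounded uniformly in M.\<close>
    define d where "d = (\<lambda>k. 2 * real y / (pi * real (k + 1)) - ct (2 * y) (int k + 1))"
    define X where "X = (\<lambda>k. pi * real (k + 1) / real (2 * y))"
    have dX: "d k = 1 / X k - cot (X k)" for k by (simp add: d_def X_def ct_def algebra_simps)
    have Xpos: "X k > 0" for k using y by (simp add: X_def)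
    have Xm: "X k \<le> X (Suc k)" for k using y by (simp add: X_def field_simps)
    have Xh: "X k \<le> pi / 2" if "k \<le> y - 1" for k
    proof -
      have "real (k + 1) \<le> real y" using that y by linarith
      then have "pi * real (k + 1) \<le> pi * real y" using pi_gt_zero by (intro mult_left_mono) auto
      then show ?thesis using y by (simp add: X_def field_simps)
    qed
    have dm: "d k \<le> d (Suc k)" if "k < y - 1" for k
      unfolding dX using Xpos Xm Xh[of "Suc k"] that by (intro inverse_minus_cot_mono) auto
    have d0: "d 0 \<ge> 0"
    proof (cases "y = 1")
      case True
      then show ?thesis by (simp add: d_def ct_def cot_def)
    next
      case False
      then have "X 0 < pi / 2" using y by (simp add: X_def field_simps)
      then show ?thesis unfolding dX using cot_le_inverse[OF Xpos[of 0]] by simp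
    qed
    have dl: "d (y - 1) = 2 / pi"
      using y by (simp add: d_def ct_def cot_def of_nat_diff)
    have tel: "(\<Sum>k<y-1. \<bar>d k - d (Suc k)\<bar>) = d (y - 1) - d 0"
    proof -
      have "(\<Sum>k<y-1. \<bar>d k - d (Suc k)\<bar>) = (\<Sum>k<y-1. d (Suc k) - d k)"
        by (rule sum.cong) (use dm in auto)
      then show ?thesis using sum_lessThan_telescope[of d "y - 1"] by simp
    qed
    have "cmod (\<Sum>k<y-1. f (int k + 1) * of_real (d k)) \<le> real c * (\<bar>d (y-1)\<bar> + (\<Sum>k<y-1. \<bar>d k - d (Suc k)\<bar>))"
      by (rule abel_bound) (rule part)
    also have "\<dots> \<le> real c * (4 / pi)" unfolding tel using dl d0 by (intro mult_left_mono) auto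
    finally have *: "cmod (\<Sum>k<y-1. f (int k + 1) * of_real (d k)) \<le> real c * (4 / pi)" .
    have "(\<Sum>k<y-1. f (int k + 1) * of_real (d k)) = of_real (2 * real y / pi) * S (y - 1)"
    proof -
      have "(\<Sum>k<y-1. f (int k + 1) * of_real (d k)) = (\<Sum>k<y-1. f (int k + 1) * of_real (2 * real y / (pi * real (k + 1)))) 
          - (\<Sum>k<y-1. f (int k + 1) * of_real (ct (2 * y) (int k + 1)))"
        unfolding d_def by (simp only: of_real_diff right_diff_distrib sum_subtractf)
      then show ?thesis unfolding ct0 S_def sum_distrib_left
        by (simp add: field_simps)
    qed
    then have "(2 * real y / pi) * cmod (S (y - 1)) \<le> real c * (4 / pi)" 
      using * by (simp add: norm_mult norm_divide)
    then have "2 * real y * cmod (S (y - 1)) \<le> real c * 4" using pi_gt_zero by (simp add: field_simps)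
    then have "real c * (2 * (real M * cmod (S (y - 1)))) \<le> real c * 4" by (simp add: y_def algebra_simps)
    then have "real M * cmod (S (y - 1)) \<le> 2" using c by simp
    then show ?thesis using M by (simp add: y_def field_simps)
  qed
  \<comment> \<open>A general x differs from some far point c M - 1 by a stretch of the series,
    which partial summation bounds by 2 c / (x + 1) however long it is. Letting M grow leaves only
    this term.\<close>
  have near: "cmod (S z - S x) \<le> 2 * real c / real (x + 1)" if "x \<le> z" for z
  proof -
    have "S z - S x = (\<Sum>k=x..<z. f (int k + 1) / of_nat (k + 1))"
      unfolding S_def using sum.atLeastLessThan_concat[of 0 x z "\<lambda>k. f (int k + 1) / of_nat (k + 1)"] that
      by (simp add: atLeast0LessThan algebra_simps)
    also have "\<dots> = (\<Sum>k<z-x. f (int (k + x) + 1) / of_nat (k + x + 1))"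
      by (rule sum.reindex_bij_witness[where i = "\<lambda>k. k + x" and j = "\<lambda>k. k - x"]) auto
    also have "\<dots> = (\<Sum>k<z-x. f (int (k + x) + 1) * of_real (1 / real (k + x + 1)))"
      by (simp add: divide_inverse)
    finally have e: "S z - S x = (\<Sum>k<z-x. f (int (k + x) + 1) * of_real (1 / real (k + x + 1)))" .
    have "cmod (\<Sum>k<z-x. f (int (k + x) + 1) * of_real (1 / real (k + x + 1))) \<le> (2 * real c) * (1 / real (0 + x + 1))"
    proof (rule abel_bound_decreasing)
      fix n
      have "(\<Sum>k<n. f (int (k + x) + 1)) = (\<Sum>k=x..<n+x. f (int k + 1))"
        by (rule sum.reindex_bij_witness[where j = "\<lambda>k. k + x" and i = "\<lambda>k. k - x"]) auto
      also have "\<dots> = (\<Sum>k<n+x. f (int k + 1)) - (\<Sum>k<x. f (int k + 1))"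
        using sum.atLeastLessThan_concat[of 0 x "n+x" "\<lambda>k. f (int k + 1)"] by (simp add: atLeast0LessThan algebra_simps)
      finally show "cmod (\<Sum>k<n. f (int (k + x) + 1)) \<le> 2 * real c"
        using part[of "n+x"] part[of x] norm_triangle_ineq4[of "\<Sum>k<n+x. f (int k + 1)" "\<Sum>k<x. f (int k + 1)"] by simp
    qed (auto simp: field_simps)
    then show ?thesis unfolding e by simp
  qed
  have "cmod (S x) \<le> 2 * real c / real (x + 1) + 2 / real (Suc n + x)" for n
  proof -
    define M where "M = Suc n + x"
    have "x \<le> c * M - 1" using c by (cases c) (auto simp: M_def)
    then have "cmod (S x) \<le> cmod (S (c * M - 1)) + 2 * real c / real (x + 1)"
      using near[of "c * M - 1"] norm_triangle_sub[of "S x" "S (c * M - 1)"] by (simp add: norm_minus_commute)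
    then show ?thesis using far[of M] by (simp add: M_def)
  qed
  moreover have "(\<lambda>n. 2 * real c / real (x + 1) + 2 / real (Suc n + x)) \<longlonglongrightarrow> 2 * real c / real (x + 1) + 0"
    by (intro tendsto_intros) real_asymp
  ultimately have "cmod (S x) \<le> 2 * real c / real (x + 1)"
    by (intro LIMSEQ_le_const[of _ "2 * real c / real (x + 1)"]) auto
  then show ?thesis by (simp only: S_def)
qed

section \<open>Non-vanishing of L(1) for real characters\<close>

lemma sum_divisors_coprime:
  fixes g :: "nat \<Rightarrow> real"
  assumes mult: "\<And>m n. g (m * n) = g m * g n" and cop: "coprime a b" and "a > 0" "b > 0"
  shows "(\<Sum>d | d dvd a * b. g d) = (\<Sum>d | d dvd a. g d) * (\<Sum>d | d dvd b. g d)"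
proof -
  have gx: "gcd (x * y) a = x" and gy: "gcd (x * y) b = y" if "x dvd a" "y dvd b" for x y
  proof -
    have "coprime y a" using cop that(2) by (meson coprime_commute coprime_divisors dvd_refl)
    then have "gcd (x * y) a = gcd x a" by (simp add: gcd_mult_left_right_cancel coprime_commute)
    then show "gcd (x * y) a = x" using that by (simp add: gcd_proj1_iff)
    have "coprime x b" using cop that(1) by (meson coprime_divisors dvd_refl)
    then have "gcd (x * y) b = gcd y b" by (simp add: gcd_mult_left_left_cancel coprime_commute)
    then show "gcd (x * y) b = y" using that by (simp add: gcd_proj1_iff)
  qed
  have "(\<Sum>d | d dvd a * b. g d) = (\<Sum>p\<in>{d. d dvd a} \<times> {d. d dvd b}. g (fst p * snd p))"
  proof (rule sum.reindex_bij_witness[where i = "\<lambda>p. fst p * snd p" and j = "\<lambda>d. (gcd d a, gcd d b)"])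
    fix d assume "d \<in> {d. d dvd a * b}"
    then obtain x y where d: "d = x * y" "x dvd a" "y dvd b" using division_decomp[of d a b] by auto
    then show "fst (gcd d a, gcd d b) * snd (gcd d a, gcd d b) = d"
      and "g (fst (gcd d a, gcd d b) * snd (gcd d a, gcd d b)) = g d"
      using gx gy by simp_all
  next
    fix p assume "p \<in> {d. d dvd a} \<times> {d. d dvd b}"
    then show "(gcd (fst p * snd p) a, gcd (fst p * snd p) b) = p" "fst p * snd p \<in> {d. d dvd a * b}"
      using gx gy by (auto simp: mult_dvd_mono)
  qed auto
  also have "\<dots> = (\<Sum>d | d dvd a. g d) * (\<Sum>d | d dvd b. g d)"
    by (simp add: sum.cartesian_product mult sum_product case_prod_beta')
  finally show ?thesis .
qed

lemma sum_divisors_prime_power: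
  fixes g :: "nat \<Rightarrow> real"
  assumes "\<And>m n. g (m * n) = g m * g n" "g 1 = 1" "prime p"
  shows "(\<Sum>d | d dvd p ^ k. g d) = (\<Sum>i\<le>k. g p ^ i)"
proof -
  have pw: "g (p ^ i) = g p ^ i" for i using assms by (induction i) auto
  have "{d. d dvd p ^ k} = (\<lambda>i. p ^ i) ` {..k}" 
    using divides_primepow_nat[OF assms(3)] by auto
  moreover have "inj_on (\<lambda>i. p ^ i) {..k}"
    using prime_gt_1_nat[OF assms(3)] by (auto simp: inj_on_def)
  ultimately show ?thesis by (simp add: sum.reindex pw)
qed

text \<open>The divisor sum is multiplicative, so prime powers decide: for \<open>g p\<close> in
  {-1, 0, 1} the sum of the powers up to exponent k is non-negative, and at least 1 for even k.
  These sums are the coefficients of the Lambert series below; the squares make it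
  unbounded.\<close>

lemma sum_divisors_real_char:
  fixes g :: "nat \<Rightarrow> real"
  assumes mult: "\<And>m n. g (m * n) = g m * g n" and one: "g 1 = 1" and val: "\<And>n. g n \<in> {-1, 0, 1}"
    and "n > 0"
  shows "(\<Sum>d | d dvd n. g d) \<ge> 0 \<and> ((\<exists>m. n = m\<^sup>2) \<longrightarrow> (\<Sum>d | d dvd n. g d) \<ge> 1)"
  using \<open>n > 0\<close>
proof (induction n rule: less_induct)
  case (less n)
  show ?case
  proof (cases "n = 1")
    case True
    then show ?thesis using one by simp
  next
    case False
    then obtain p where p: "prime p" "p dvd n" using prime_factor_nat by auto
    define k where "k = multiplicity p n"
    define m where "m = n div p ^ k"
    have n: "n = p ^ k * m" using less.prems by (simp add: m_def k_def multiplicity_dvd)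
    have np: "\<not> p dvd m" unfolding m_def k_def using less.prems p
      by (intro multiplicity_decompose) auto
    have cop: "coprime (p ^ k) m" using np p by (simp add: prime_imp_coprime)
    have m0: "m > 0" using n less.prems by (cases m) auto
    have k0: "k > 0" using p less.prems by (simp add: k_def prime_multiplicity_gt_zero_iff)
    have "p ^ k > 1" using one_less_power[OF prime_gt_1_nat[OF p(1)] k0] .
    then have "m < n" using n m0 by simp
    note IH = less.IH[OF this m0]
    have eq: "(\<Sum>d | d dvd n. g d) = (\<Sum>i\<le>k. g p ^ i) * (\<Sum>d | d dvd m. g d)"
      unfolding n using sum_divisors_coprime[OF mult cop] m0 sum_divisors_prime_power[OF mult one p(1)] p
      by (simp add: prime_gt_0_nat)
    have alt: "(\<Sum>i\<le>j. (-1::real) ^ i) = (if even j then 1 else 0)" for j by (induction j) auto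
    have geo: "(\<Sum>i\<le>k. g p ^ i) \<ge> 0 \<and> (even k \<longrightarrow> (\<Sum>i\<le>k. g p ^ i) \<ge> 1)"
    proof -
      consider "g p = -1" | "g p = 0" | "g p = 1" using val[of p] by auto
      then show ?thesis
      proof cases
        case 2
        then have "(\<Sum>i\<le>k. g p ^ i) = 1" by (simp add: power_0_left)
        then show ?thesis by simp
      qed (auto simp: alt)
    qed
    show ?thesis
    proof (intro conjI impI)
      show "(\<Sum>d | d dvd n. g d) \<ge> 0" unfolding eq using geo IH by simp
      assume "\<exists>x. n = x\<^sup>2"
      then obtain x where x: "n = x\<^sup>2" by auto
      then have x0: "x > 0" using less.prems by (cases x) auto
      have "k = 2 * multiplicity p x"
        unfolding k_def x using p x0 by (simp add: prime_elem_multiplicity_power_distrib)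
      then have ev: "even k" by simp
      have "m = (x div p ^ (k div 2))\<^sup>2"
      proof -
        obtain y where y: "x = p ^ multiplicity p x * y" using multiplicity_dvd[of p x] by (auto elim: dvdE)
        have "p ^ k * m = p ^ k * y\<^sup>2"
          using n x y \<open>k = 2 * multiplicity p x\<close> 
          by (metis power_mult power_mult_distrib mult.commute)
        then have "m = y\<^sup>2" using p by (simp add: prime_gt_0_nat)
        moreover have "y = x div p ^ (k div 2)"
          using y \<open>k = 2 * multiplicity p x\<close> p by (metis nonzero_mult_div_cancel_left nonzero_mult_div_cancel_left not_prime_0 power_not_zero zero_neq_numeral)
        ultimately show ?thesis by simp
      qed
      then have "(\<Sum>d | d dvd m. g d) \<ge> 1" using IH by blast
      moreover have "(\<Sum>i\<le>k. g p ^ i) \<ge> 1" using geo ev by blast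
      ultimately have "1 * 1 \<le> (\<Sum>i\<le>k. g p ^ i) * (\<Sum>d | d dvd m. g d)" by (intro mult_mono) auto
      then show "(\<Sum>d | d dvd n. g d) \<ge> 1" unfolding eq by simp
    qed
  qed
qed

lemma geometric_sum_lower:
  fixes x :: real
  assumes "0 < x" "x < 1"
  shows "(\<Sum>i<n. x ^ i) * (\<Sum>i<Suc n. x ^ i) \<ge> real n * real (Suc n) * x ^ n"
proof -
  text \<open>Pairing \<open>x^i\<close> with \<open>x^(n-1-i)\<close> (AM-GM).\<close>
  have half: "(\<Sum>i<m. x ^ i)\<^sup>2 \<ge> (real m)\<^sup>2 * x ^ (m - 1)" for m
  proof -
    have "(\<Sum>i<m. x ^ i) = (\<Sum>i<m. x ^ (m - Suc i))"
      by (rule sum.nat_diff_reindex[symmetric])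
    then have "2 * (\<Sum>i<m. x ^ i) = (\<Sum>i<m. x ^ i + x ^ (m - Suc i))"
      by (simp add: sum.distrib)
    also have "\<dots> \<ge> (\<Sum>i<m. 2 * sqrt (x ^ (m - 1)))"
    proof (rule sum_mono)
      fix i assume "i \<in> {..<m}"
      then have "i + (m - Suc i) = m - 1" by auto
      then have "x ^ i * x ^ (m - Suc i) = x ^ (m - 1)" by (simp add: power_add[symmetric])
      then show "2 * sqrt (x ^ (m - 1)) \<le> x ^ i + x ^ (m - Suc i)"
        using arith_geo_mean_sqrt[of "x ^ i" "x ^ (m - Suc i)"] assms by simp
    qed
    finally have "(\<Sum>i<m. x ^ i) \<ge> real m * sqrt (x ^ (m - 1))" by simp
    then have "(\<Sum>i<m. x ^ i)\<^sup>2 \<ge> (real m * sqrt (x ^ (m - 1)))\<^sup>2" using assms by (intro power_mono) auto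
    then show ?thesis using assms by (simp add: power_mult_distrib)
  qed
  let ?A = "\<Sum>i<n. x ^ i" and ?B = "\<Sum>i<Suc n. x ^ i"
  have "(real n * real (Suc n) * x ^ n)\<^sup>2 \<le> ((real n)\<^sup>2 * x ^ (n - 1)) * ((real (Suc n))\<^sup>2 * x ^ (Suc n - 1))"
  proof (cases n)
    case (Suc m)
    have "(x ^ n)\<^sup>2 \<le> x ^ (n - 1) * x ^ n"
      unfolding power2_eq_square using assms by (intro mult_right_mono) (auto simp: power_decreasing)
    then have "((real n)\<^sup>2 * (real (Suc n))\<^sup>2) * (x ^ n)\<^sup>2 \<le> ((real n)\<^sup>2 * (real (Suc n))\<^sup>2) * (x ^ (n - 1) * x ^ n)"
      by (intro mult_left_mono) auto
    then show ?thesis by (simp add: power_mult_distrib mult_ac)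
  qed simp
  also have "\<dots> \<le> ?A\<^sup>2 * ?B\<^sup>2" using assms by (intro mult_mono half) auto
  finally have "(real n * real (Suc n) * x ^ n)\<^sup>2 \<le> (?A * ?B)\<^sup>2" by (simp add: power_mult_distrib)
  then show ?thesis using assms by (elim power2_le_imp_le) (auto intro!: mult_nonneg_nonneg sum_nonneg simp del: sum.lessThan_Suc)
qed

text \<open>Gelfond's and Monsky's argument: the Lambert series \<open>\<Sum> g n x^n/(1-x^n)\<close> is unbounded as
  \<open>x\<close> tends to 1, but would be bounded if the series of \<open>g n / n\<close> had sum 0.\<close>

lemma real_char_series_not_zero:
  fixes g :: "nat \<Rightarrow> real"
  assumes mult: "\<And>m n. g (m * n) = g m * g n" and one: "g 1 = 1" and val: "\<And>n. g n \<in> {-1, 0, 1}"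
    and K: "\<And>n. \<bar>\<Sum>k<n. g (k + 1)\<bar> \<le> K"
    and S: "(\<lambda>n. \<Sum>k<n. g (k + 1) / real (k + 1)) \<longlonglongrightarrow> 0"
  shows False
proof -
  define r where "r = (\<lambda>n. \<Sum>d | d dvd n. g d)"
  have r0: "r n \<ge> 0" and r1: "(\<exists>m. n = m\<^sup>2) \<Longrightarrow> r n \<ge> 1" if "n > 0" for n
    using sum_divisors_real_char[OF mult one val that] unfolding r_def by auto
  have K0: "K \<ge> 0" using K[of 0] by simp
  have g1: "\<bar>g n\<bar> \<le> 1" for n using val[of n] by auto
  have main: "(\<Sum>j=1..J. x ^ j\<^sup>2) \<le> K" if x: "0 < x" "x < 1" for x :: real and J :: nat
  proof -
    define F where "F = (\<lambda>M. \<Sum>n=1..M. g n * (x ^ n / (1 - x ^ n)))"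
    have xn: "x ^ n < 1" if "n > 0" for n using x that by (simp add: power_less_one_iff)
    have xl: "1 - x \<le> 1 - x ^ n" if "n > 0" for n
      using x that power_decreasing[of 1 n x] by simp
    \<comment> \<open>Replaces x^n / (1 - x^n) by its approximation 1 / (n (1 - x)), whose sum
      against g is the series at 1 over 1 - x. The difference \<open>b\<close> is decreasing and
      non-negative with \<open>b 1 = 1\<close>, so partial summation bounds its contribution by K
      for every x.\<close>
    define b where "b = (\<lambda>n. 1 / (real n * (1 - x)) - x ^ n / (1 - x ^ n))"
    have geo: "1 - x ^ n = (1 - x) * (\<Sum>i<n. x ^ i)" for n
      using x one_diff_power_eq[of x n] by simp
    have bdiff: "b (Suc n) \<le> b n" if n: "n > 0" for n
    proof -
      let ?A = "\<Sum>i<n. x ^ i" and ?B = "\<Sum>i<Suc n. x ^ i"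
      have A: "?A > 0" using n x by (intro sum_pos) auto
      have B: "?B > 0" using x by (intro sum_pos) auto
      have BA: "?B = ?A + x ^ n" by simp
      have B1: "?B = 1 + x * ?A" by (subst sum.lessThan_Suc_shift) (simp add: sum_distrib_left)
      have "(1 - x) * (b n - b (Suc n)) = (1 / real n - 1 / real (Suc n)) - (x ^ n / ?A - x ^ Suc n / ?B)"
      proof -
        have "P * (1 / (y * P) - w / (P * z)) = 1 / y - w / z" if "P \<noteq> 0" for P y z w :: real
          using that by (simp add: right_diff_distrib)
        then have c1: "(1 - x) * (1 / (y * (1 - x)) - w / ((1 - x) * z)) = 1 / y - w / z" for y z w
          using x by simp
        have "(1 - x) * (b n - b (Suc n)) = (1 - x) * b n - (1 - x) * b (Suc n)" by (rule right_diff_distrib)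
        then show ?thesis unfolding b_def geo c1 by simp
      qed
      also have "1 / real n - 1 / real (Suc n) = 1 / (real n * real (Suc n))" using n by (simp add: field_simps)
      also have "x ^ n / ?A - x ^ Suc n / ?B = x ^ n * (?B - x * ?A) / (?A * ?B)" using A B by (simp add: field_simps del: sum.lessThan_Suc)
      also have "?B - x * ?A = 1" using B1 by simp
      finally have e: "(1 - x) * (b n - b (Suc n)) = 1 / (real n * real (Suc n)) - x ^ n / (?A * ?B)" by simp
      have "x ^ n / (?A * ?B) \<le> 1 / (real n * real (Suc n))"
        using geometric_sum_lower[OF x, of n] A B n by (simp add: field_simps del: sum.lessThan_Suc of_nat_Suc)
      then have "(1 - x) * (b n - b (Suc n)) \<ge> 0" using e by simp
      then show ?thesis using x by (simp add: zero_le_mult_iff)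
    qed
    have bnn: "b n \<ge> 0" if n: "n > 0" for n
    proof -
      have "real n * x ^ n \<le> (\<Sum>i<n. x ^ i)"
        using sum_mono[of "{..<n}" "\<lambda>_. x ^ n" "\<lambda>i. x ^ i"] x by (auto simp: power_decreasing)
      then have "real n * x ^ n * (1 - x) \<le> (\<Sum>i<n. x ^ i) * (1 - x)" using x by (intro mult_right_mono) auto
      then have "x ^ n * (real n * (1 - x)) \<le> 1 - x ^ n" by (simp add: geo mult_ac)
      moreover have "real n * (1 - x) > 0" using n x by simp
      ultimately have "x ^ n \<le> 1 / (real n * (1 - x)) * (1 - x ^ n)" by (simp add: pos_le_divide_eq)
      then have "x ^ n / (1 - x ^ n) \<le> 1 / (real n * (1 - x))" using xn[OF n] by (subst pos_divide_le_eq) auto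
      then show ?thesis by (simp add: b_def)
    qed
    have b1: "b 1 = 1" using x by (simp add: b_def field_simps)
    have shift: "(\<Sum>n=1..M. h n) = (\<Sum>k<M. h (k + 1))" for h :: "nat \<Rightarrow> real" and M
      by (rule sum.reindex_bij_witness[where i = "\<lambda>k. k + 1" and j = "\<lambda>n. n - 1"]) auto
    have upper: "F M \<le> \<bar>\<Sum>k<M. g (k + 1) / real (k + 1)\<bar> / (1 - x) + K" for M
    proof -
      have "F M = (\<Sum>k<M. g (k + 1) / real (k + 1)) / (1 - x) - (\<Sum>k<M. g (k + 1) * b (k + 1))"
        unfolding F_def shift b_def sum_divide_distrib sum_subtractf[symmetric]
        by (rule sum.cong) (auto simp: algebra_simps)
      moreover have "\<bar>\<Sum>k<M. g (k + 1) * b (k + 1)\<bar> \<le> K"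
      proof -
        have "cmod (\<Sum>k<M. complex_of_real (g (k + 1)) * of_real (b (k + 1))) \<le> K * b (0 + 1)"
        proof (rule abel_bound_decreasing)
          fix n show "cmod (\<Sum>k<n. complex_of_real (g (k + 1))) \<le> K"
            using K[of n] by (metis norm_of_real of_real_sum real_norm_def)
        qed (use bdiff bnn in auto)
        moreover have "(\<Sum>k<M. complex_of_real (g (k + 1)) * of_real (b (k + 1))) = of_real (\<Sum>k<M. g (k + 1) * b (k + 1))" by simp
        ultimately show ?thesis using b1 by (simp del: of_real_sum)
      qed
      ultimately show ?thesis
        using x abs_ge_self[of "(\<Sum>k<M. g (k + 1) / real (k + 1)) / (1 - x)"] by (simp add: abs_divide)
    qed
    \<comment> \<open>Cutting the n-th geometric series at exponents n k not above M and collecting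
      equal products n k gives exactly the coefficients \<open>r m\<close>. Each remainder starts at
      an exponent above M, so M of them amount to at most M x^(M+1) / (1 - x), which tends to
      0.\<close>
    have lower: "F M \<ge> (\<Sum>j=1..J. x ^ j\<^sup>2) - real M * x ^ (M + 1) / (1 - x)" if MJ: "M \<ge> J\<^sup>2" for M
    proof -
      have gs: "x ^ n / (1 - x ^ n) = (\<Sum>k=1..M div n. x ^ (n * k)) + x ^ (n * (M div n + 1)) / (1 - x ^ n)" if n: "n > 0" for n
      proof -
        have "(1 - z) * (\<Sum>k=1..j. z ^ k) = z - z ^ (j + 1)" for z :: real and j
        proof (induction j)
          case (Suc j)
          have "(1 - z) * (\<Sum>k=1..Suc j. z ^ k) = (1 - z) * (\<Sum>k=1..j. z ^ k) + (1 - z) * z ^ Suc j"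
            by (simp add: distrib_left)
          also have "(1 - z) * (\<Sum>k=1..j. z ^ k) = z - z ^ (j + 1)" by (rule Suc)
          also have "z - z ^ (j + 1) + (1 - z) * z ^ Suc j = z - z ^ (Suc j + 1)" by (simp add: algebra_simps)
          finally show ?case .
        qed simp
        from this[of "x ^ n"] have "(1 - x ^ n) * (\<Sum>k=1..j. x ^ (n * k)) = x ^ n - x ^ (n * (j + 1))" for j
          by (simp only: power_mult)
        then have e: "(1 - x ^ n) * (\<Sum>k=1..M div n. x ^ (n * k)) = x ^ n - x ^ (n * (M div n + 1))" .
        have "A + B / P = (P * A + B) / P" if "P \<noteq> 0" for A B P :: real
          using that by (simp add: add_divide_distrib)
        from this[of "1 - x ^ n" "\<Sum>k=1..M div n. x ^ (n * k)" "x ^ (n * (M div n + 1))"] show ?thesis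
          unfolding e using xn[OF n] by simp
      qed
      have "F M = (\<Sum>n=1..M. \<Sum>k=1..M div n. g n * x ^ (n * k)) + (\<Sum>n=1..M. g n * (x ^ (n * (M div n + 1)) / (1 - x ^ n)))"
        unfolding F_def sum.distrib[symmetric]
        by (rule sum.cong[OF refl]) (simp add: gs ring_distribs sum_distrib_left)
      moreover have "(\<Sum>n=1..M. \<Sum>k=1..M div n. g n * x ^ (n * k)) = (\<Sum>m=1..M. r m * x ^ m)"
      proof -
        have "(\<Sum>n=1..M. \<Sum>k=1..M div n. g n * x ^ (n * k)) = (\<Sum>(n,k)\<in>(SIGMA n:{1..M}. {1..M div n}). g n * x ^ (n * k))"
          by (simp add: sum.Sigma)
        also have "\<dots> = (\<Sum>(m,d)\<in>(SIGMA m:{1..M}. {d. d dvd m}). g d * x ^ m)"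
        proof (rule sum.reindex_bij_witness[where i = "\<lambda>(m,d). (d, m div d)" and j = "\<lambda>(n,k). (n * k, n)"])
          fix a assume "a \<in> (SIGMA n:{1..M}. {1..M div n})"
          then obtain n k where a: "a = (n, k)" "1 \<le> n" "n \<le> M" "1 \<le> k" "k \<le> M div n" by auto
          have "n * k \<le> M" using a by (metis dual_order.trans mult_le_mono2 times_div_less_eq_dividend)
          then show "(case a of (n, k) \<Rightarrow> (n * k, n)) \<in> (SIGMA m:{1..M}. {d. d dvd m})" using a by simp
          show "(case (case a of (n, k) \<Rightarrow> (n * k, n)) of (m, d) \<Rightarrow> (d, m div d)) = a" using a by simp
        next
          fix a assume "a \<in> (SIGMA m:{1..M}. {d. d dvd m})"
          then obtain m d where a: "a = (m, d)" "1 \<le> m" "m \<le> M" "d dvd m" by auto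
          have "d \<ge> 1" "d \<le> m" "m div d \<ge> 1" "m div d \<le> M div d"
            using a by (auto simp: Suc_le_eq dvd_pos_nat dvd_imp_le div_greater_zero_iff intro: div_le_mono)
          then show "(case a of (m, d) \<Rightarrow> (d, m div d)) \<in> (SIGMA n:{1..M}. {1..M div n})" using a by auto
          show "(case (case a of (m, d) \<Rightarrow> (d, m div d)) of (n, k) \<Rightarrow> (n * k, n)) = a" using a by simp
        qed auto
        also have "\<dots> = (\<Sum>m=1..M. r m * x ^ m)"
          by (subst sum.Sigma[symmetric]) (auto simp: r_def sum_distrib_right)
        finally show ?thesis .
      qed
      moreover have "(\<Sum>m=1..M. r m * x ^ m) \<ge> (\<Sum>j=1..J. x ^ j\<^sup>2)"
      proof -
        have "(\<Sum>j=1..J. x ^ j\<^sup>2) = (\<Sum>m\<in>(\<lambda>j. j\<^sup>2) ` {1..J}. x ^ m)"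
          by (subst sum.reindex) (auto simp: inj_on_def)
        also have "\<dots> \<le> (\<Sum>m\<in>(\<lambda>j. j\<^sup>2) ` {1..J}. r m * x ^ m)"
        proof (rule sum_mono)
          fix m assume "m \<in> (\<lambda>j. j\<^sup>2) ` {1..J}"
          then have "r m \<ge> 1" using r1[of m] by auto
          then show "x ^ m \<le> r m * x ^ m" using x by simp
        qed
        also have "\<dots> \<le> (\<Sum>m=1..M. r m * x ^ m)"
        proof (rule sum_mono2)
          show "(\<lambda>j. j\<^sup>2) ` {1..J} \<subseteq> {1..M}"
          proof
            fix m assume "m \<in> (\<lambda>j. j\<^sup>2) ` {1..J}"
            then obtain j where "m = j\<^sup>2" "1 \<le> j" "j \<le> J" by auto
            moreover have "j\<^sup>2 \<le> J\<^sup>2" using \<open>j \<le> J\<close> by (intro power_mono) auto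
            then have "j\<^sup>2 \<le> M" using MJ by (rule order_trans)
            ultimately show "m \<in> {1..M}" by simp
          qed
        qed (use r0 x in auto)
        finally show ?thesis .
      qed
      moreover have "\<bar>\<Sum>n=1..M. g n * (x ^ (n * (M div n + 1)) / (1 - x ^ n))\<bar> \<le> (\<Sum>n=1..M. x ^ (M + 1) / (1 - x))"
      proof (rule order_trans[OF sum_abs sum_mono])
        fix n assume n: "n \<in> {1..M}"
        have "n * (M div n + 1) \<ge> M + 1" using n
          by (metis Suc_eq_plus1 Suc_leI add.commute atLeastAtMost_iff dividend_less_times_div mult.commute mult_Suc_right not_less_eq_eq not_one_le_zero zero_less_iff_neq_zero less_le_not_le linorder_not_less)
        then have "x ^ (n * (M div n + 1)) \<le> x ^ (M + 1)" using x by (intro power_decreasing) auto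
        then have "x ^ (n * (M div n + 1)) / (1 - x ^ n) \<le> x ^ (M + 1) / (1 - x)"
          using x xl[of n] n by (intro frac_le) auto
        moreover have "\<bar>g n * (x ^ (n * (M div n + 1)) / (1 - x ^ n))\<bar> \<le> 1 * (x ^ (n * (M div n + 1)) / (1 - x ^ n))"
          unfolding abs_mult using x xn[of n] n g1[of n] by (intro mult_mono) auto
        ultimately show "\<bar>g n * (x ^ (n * (M div n + 1)) / (1 - x ^ n))\<bar> \<le> x ^ (M + 1) / (1 - x)" by simp
      qed
      ultimately show ?thesis by simp
    qed
    have "(\<Sum>j=1..J. x ^ j\<^sup>2) \<le> real M * x ^ (M + 1) / (1 - x) + \<bar>\<Sum>k<M. g (k + 1) / real (k + 1)\<bar> / (1 - x) + K" if "M \<ge> J\<^sup>2" for M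
      using upper[of M] lower[OF that] by simp
    moreover have "(\<lambda>M. real M * x ^ (M + 1) / (1 - x) + \<bar>\<Sum>k<M. g (k + 1) / real (k + 1)\<bar> / (1 - x) + K) \<longlonglongrightarrow> 0 / (1 - x) + \<bar>0\<bar> / (1 - x) + K"
    proof (intro tendsto_intros S)
      have "(\<lambda>M. real M * x ^ M) \<longlonglongrightarrow> 0" using x powser_times_n_limit_0[of x] by simp
      from tendsto_mult_left[OF this, of x] show "(\<lambda>M. real M * x ^ (M + 1)) \<longlonglongrightarrow> 0"
        by (simp add: mult_ac)
    qed (use x in auto)
    ultimately show ?thesis
      by (intro LIMSEQ_le_const[of _ K]) auto
  qed
  \<comment> \<open>As x tends to 1 the sum of x^(j^2) over j up to J tends to J, yet it stays below
    K.\<close>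
  obtain J :: nat where J: "real J > K + 1" using reals_Archimedean2 by blast
  have "((\<lambda>x. \<Sum>j=1..J. x ^ j\<^sup>2) \<longlongrightarrow> (\<Sum>j=1..J. (1::real) ^ j\<^sup>2)) (at_left 1)"
    by (intro tendsto_intros)
  moreover have "eventually (\<lambda>x::real. (\<Sum>j=1..J. x ^ j\<^sup>2) \<le> K) (at_left 1)"
    using eventually_at_left_real[of 0 1] by (rule eventually_mono) (use main in auto)
  ultimately have "(\<Sum>j=1..J. (1::real) ^ j\<^sup>2) \<le> K"
    by (rule tendsto_upperbound) auto
  then show False using J by simp
qed

section \<open>Non-vanishing of L(1) for complex characters\<close>

text \<open>Sieving by one more prime p removes the multiples of p, whose sum is \<open>f p\<close>
  times the current sum by complete multiplicativity; the current sieved set is stable under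
  multiplication by p.\<close>

lemma euler_product_finite:
  fixes f :: "nat \<Rightarrow> complex"
  assumes mult: "\<And>m n. f (m * n) = f m * f n" and sm: "(\<lambda>n. norm (f n)) summable_on UNIV"
    and P: "finite P" "\<And>p. p \<in> P \<Longrightarrow> prime p"
  shows "infsum f {n. \<forall>p\<in>P. \<not> p dvd n} = (\<Prod>p\<in>P. 1 - f p) * infsum f UNIV"
  using P
proof (induction P rule: finite_induct)
  case (insert p P)
  define A where "A = {n. \<forall>q\<in>P. \<not> q dvd n}"
  have summ: "f summable_on X" for X
    by (rule summable_on_subset_banach[OF Infinite_Sum.abs_summable_summable[OF sm] subset_UNIV])
  have p: "prime p" using insert.prems by simp
  have img: "{n \<in> A. p dvd n} = (\<lambda>n. p * n) ` A"
  proof -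
    have "q dvd p * n \<longleftrightarrow> q dvd n" if "q \<in> P" for q n
    proof -
      have "prime q" "q \<noteq> p" using that insert by auto
      then have "\<not> q dvd p" using primes_dvd_imp_eq[of q p] p by auto
      then show ?thesis using \<open>prime q\<close> by (simp add: prime_dvd_mult_iff)
    qed
    then have pA: "p * n \<in> A \<longleftrightarrow> n \<in> A" for n unfolding A_def by blast
    show ?thesis
    proof (intro equalityI subsetI)
      fix n assume n: "n \<in> {n \<in> A. p dvd n}"
      then obtain k where "n = p * k" by (auto elim: dvdE)
      then show "n \<in> (\<lambda>n. p * n) ` A" using n pA by auto
    qed (use pA in auto)
  qed
  have inj: "inj_on (\<lambda>n. p * n) A" using p by (auto simp: inj_on_def)
  have "{n. \<forall>q\<in>insert p P. \<not> q dvd n} = A - {n \<in> A. p dvd n}" by (auto simp: A_def)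
  then have "infsum f {n. \<forall>q\<in>insert p P. \<not> q dvd n} = infsum f A - infsum f {n \<in> A. p dvd n}"
    using infsum_Diff[of f A "{n \<in> A. p dvd n}"] summ by auto
  also have "infsum f {n \<in> A. p dvd n} = (\<Sum>\<^sub>\<infinity>n\<in>A. f (p * n))"
    unfolding img using infsum_reindex[OF inj, of f] by (simp add: o_def)
  also have "\<dots> = f p * infsum f A" by (simp add: mult infsum_cmult_right')
  also have "infsum f A = (\<Prod>p\<in>P. 1 - f p) * infsum f UNIV" unfolding A_def using insert by simp
  finally show ?case using insert.hyps by (simp add: algebra_simps)
qed simp

text \<open>This form of the Euler product involves neither an infinite product nor a quotient. The
  sieved set consists of 1 and numbers above M, apart possibly from 0, so the sieved sum differs
  from \<open>f 1\<close> by at most a tail of an absolutely convergent series.\<close>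

lemma euler_product_limit:
  fixes f :: "nat \<Rightarrow> complex"
  assumes mult: "\<And>m n. f (m * n) = f m * f n" and sm: "summable (\<lambda>n. norm (f n))" and f0: "f 0 = 0" and f1: "f 1 = 1"
  shows "(\<lambda>M. (\<Prod>p | prime p \<and> p \<le> M. 1 - f p) * infsum f UNIV) \<longlonglongrightarrow> 1"
proof -
  have abs: "(\<lambda>n. norm (f n)) summable_on UNIV" using sm summable_on_UNIV_nonneg_real_iff[of "\<lambda>n. norm (f n)"] by simp
  define A where "A = (\<lambda>M. {n. \<forall>p\<in>{p. prime p \<and> p \<le> (M::nat)}. \<not> p dvd n})"
  have eq: "(\<Prod>p | prime p \<and> p \<le> M. 1 - f p) * infsum f UNIV = infsum f (A M)" for M
    unfolding A_def by (rule euler_product_finite[symmetric]) (use mult abs in auto)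
  have summ: "f summable_on X" for X
    by (rule summable_on_subset_banach[OF Infinite_Sum.abs_summable_summable[OF abs] subset_UNIV])
  have asumm: "(\<lambda>n. norm (f n)) summable_on X" for X
    by (rule summable_on_subset_banach[OF abs subset_UNIV])
  have bound: "cmod (infsum f (A M) - 1) \<le> (\<Sum>n. norm (f n)) - (\<Sum>n<Suc M. norm (f n))" for M
  proof -
    have 1: "1 \<in> A M" by (auto simp: A_def not_prime_1 dest!: prime_gt_1_nat)
    have "infsum f (A M) = infsum f (A M - {1}) + f 1"
      using infsum_Diff[of f "A M" "{1}"] summ 1 by simp
    then have "infsum f (A M) - 1 = infsum f (A M - {1})" using f1 by simp
    also have "\<dots> = infsum f (A M - {0, 1})"
    proof (rule infsum_cong_neutral)
      fix x assume "x \<in> A M - {1} - (A M - {0, 1})"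
      then show "f x = 0" using f0 by auto
    qed auto
    finally have "cmod (infsum f (A M) - 1) \<le> infsum (\<lambda>n. norm (f n)) (A M - {0, 1})"
      using norm_infsum_bound[OF asumm] by simp
    also have "\<dots> \<le> infsum (\<lambda>n. norm (f n)) (UNIV - {..<Suc M})"
    proof (rule infsum_mono2)
      show "A M - {0, 1} \<subseteq> UNIV - {..<Suc M}"
      proof
        fix n assume n: "n \<in> A M - {0, 1}"
        then obtain p where p: "prime p" "p dvd n" using prime_factor_nat[of n] by auto
        then have "p > M" using n by (auto simp: A_def)
        then show "n \<in> UNIV - {..<Suc M}" using p n dvd_imp_le[of p n] by auto
      qed
    qed (use asumm in auto)
    also have "\<dots> = infsum (\<lambda>n. norm (f n)) UNIV - (\<Sum>n<Suc M. norm (f n))"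
      using infsum_Diff[of "\<lambda>n. norm (f n)" UNIV "{..<Suc M}"] asumm by simp
    also have "infsum (\<lambda>n. norm (f n)) UNIV = (\<Sum>n. norm (f n))"
      using has_sum_imp_sums[OF has_sum_infsum[OF abs]] by (simp add: sums_iff)
    finally show ?thesis .
  qed
  have "(\<lambda>M. (\<Sum>n. norm (f n)) - (\<Sum>n<Suc M. norm (f n))) \<longlonglongrightarrow> (\<Sum>n. norm (f n)) - (\<Sum>n. norm (f n))"
    by (intro tendsto_diff tendsto_const LIMSEQ_Suc[OF summable_LIMSEQ[OF sm]])
  then have "(\<lambda>M. infsum f (A M) - 1) \<longlonglongrightarrow> 0"
    by (intro Lim_null_comparison[OF always_eventually[OF allI[OF bound]]]) simp
  then show ?thesis unfolding eq by (simp add: LIM_zero_iff)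
qed

text \<open>The inequality \<open>3 + 4 cos t + cos (2 t) \<ge> 0\<close> applied to the logarithms of the Euler factors.\<close>

lemma euler_factor_norm_ge:
  fixes y :: real and z :: complex
  assumes y: "0 \<le> y" "y < 1" and z: "cmod z = 1"
  shows "cmod (1 - of_real y) ^ 3 * cmod (1 - z * of_real y) ^ 4 * cmod (1 - z\<^sup>2 * of_real y) \<le> 1"
proof -
  have L: "(\<lambda>n. - (Re (w ^ n) / real n)) sums ln (cmod (1 - w))" if "cmod w < 1" for w
  proof -
    have "(\<lambda>n. (-1) ^ Suc n / of_nat n * (-w) ^ n) sums Ln (1 + (-w))"
      using Ln_series[of "-w"] that by simp
    then have "(\<lambda>n. Re ((-1) ^ Suc n / of_nat n * (-w) ^ n)) sums Re (Ln (1 - w))"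
      using sums_Re by fastforce
    moreover have "Re ((-1) ^ Suc n / of_nat n * (-w) ^ n) = - (Re (w ^ n) / real n)" for n
    proof -
      have "(-1) ^ n * (-w) ^ n = w ^ n" by (metis mult_minus1 minus_minus power_mult_distrib mult_minus_left mult_1)
      then have "(-1) ^ Suc n / of_nat n * (-w) ^ n = - (w ^ n / of_nat n)" by (simp add: field_simps)
      then show ?thesis by (simp only:) simp
    qed
    moreover have "Re (Ln (1 - w)) = ln (cmod (1 - w))" using that by (intro Re_Ln) auto
    ultimately show ?thesis by (simp only:)
  qed
  have n0: "1 - w \<noteq> 0" if "cmod w < 1" for w :: complex using that by auto
  have w0: "cmod (of_real y) < 1" and w1: "cmod (z * of_real y) < 1" and w2: "cmod (z\<^sup>2 * of_real y) < 1"
    using y z by (simp_all add: norm_mult norm_power)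
  have "(\<lambda>n. 3 * - (Re (of_real y ^ n) / real n) + 4 * - (Re ((z * of_real y) ^ n) / real n) + - (Re ((z\<^sup>2 * of_real y) ^ n) / real n))
     sums (3 * ln (cmod (1 - of_real y)) + 4 * ln (cmod (1 - z * of_real y)) + ln (cmod (1 - z\<^sup>2 * of_real y)))"
    by (intro sums_add sums_mult L w0 w1 w2)
  then have "3 * ln (cmod (1 - of_real y)) + 4 * ln (cmod (1 - z * of_real y)) + ln (cmod (1 - z\<^sup>2 * of_real y)) \<le> 0"
  proof (rule sums_le[OF _ _ sums_zero, rotated])
    fix n
    define v where "v = z ^ n"
    have v: "cmod v = 1" using z by (simp add: v_def norm_power)
    then have v1: "(Re v)\<^sup>2 + (Im v)\<^sup>2 = 1" by (metis cmod_power2 one_power2)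
    have "Re (v\<^sup>2) = (Re v)\<^sup>2 - (Im v)\<^sup>2" by (simp add: power2_eq_square)
    then have "3 + 4 * Re v + Re (v\<^sup>2) = 2 * (Re v + 1)\<^sup>2" using v1 by (simp add: power2_eq_square algebra_simps)
    then have nn: "3 + 4 * Re v + Re (v\<^sup>2) \<ge> 0" by simp
    have e: "Re (of_real y ^ n) = y ^ n" "Re ((z * of_real y) ^ n) = y ^ n * Re v" "Re ((z\<^sup>2 * of_real y) ^ n) = y ^ n * Re (v\<^sup>2)"
      by (simp_all add: v_def power_mult_distrib flip: of_real_power power_mult) (simp_all add: mult.commute power_mult)
    have "3 * - (Re (of_real y ^ n) / real n) + 4 * - (Re ((z * of_real y) ^ n) / real n) + - (Re ((z\<^sup>2 * of_real y) ^ n) / real n)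
       = - (y ^ n / real n * (3 + 4 * Re v + Re (v\<^sup>2)))"
      unfolding e by (simp add: algebra_simps add_divide_distrib)
    also have "\<dots> \<le> 0" using nn y by simp
    finally show "3 * - (Re (of_real y ^ n) / real n) + 4 * - (Re ((z * of_real y) ^ n) / real n) + - (Re ((z\<^sup>2 * of_real y) ^ n) / real n) \<le> 0" .
  qed
  moreover have "ln (cmod (1 - of_real y) ^ 3 * cmod (1 - z * of_real y) ^ 4 * cmod (1 - z\<^sup>2 * of_real y))
     = 3 * ln (cmod (1 - of_real y)) + 4 * ln (cmod (1 - z * of_real y)) + ln (cmod (1 - z\<^sup>2 * of_real y))"
    using n0[OF w0] n0[OF w1] n0[OF w2] by (simp add: ln_mult ln_realpow)
  ultimately show ?thesis
    using n0[OF w0] n0[OF w1] n0[OF w2] by (subst ln_le_zero_iff[symmetric]) auto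
qed

lemma infsum_norm_le:
  fixes f :: "nat \<Rightarrow> complex"
  assumes sm: "summable (\<lambda>n. norm (f n))" and f0: "f 0 = 0"
    and b: "\<And>M. cmod (\<Sum>k<M. f (k + 1)) \<le> b M" and lim: "b \<longlonglongrightarrow> B"
  shows "cmod (infsum f UNIV) \<le> B"
proof -
  have "(\<lambda>n. norm (f n)) summable_on UNIV" using sm summable_on_UNIV_nonneg_real_iff[of "\<lambda>n. norm (f n)"] by simp
  then have "f summable_on UNIV" by (rule Infinite_Sum.abs_summable_summable)
  then have "f sums infsum f UNIV" by (intro has_sum_imp_sums has_sum_infsum)
  then have "(\<lambda>k. f (k + 1)) sums infsum f UNIV" using sums_Suc_iff[of f] f0 by simp
  then have "(\<lambda>M. cmod (\<Sum>k<M. f (k + 1))) \<longlonglongrightarrow> cmod (infsum f UNIV)"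
    unfolding sums_def by (rule tendsto_norm)
  from LIMSEQ_le[OF this lim] show ?thesis using b by auto
qed

text \<open>Both bounds come from ln((n + 2) / (n + 1)) lying between 1 / (n + 2) and 1 / (n + 1).
  The first makes the sum of n^(-1-\<delta>) telescope to O(1 + 1/\<delta>); the second bounds the
  variation of the weights n^(-\<delta>).\<close>

lemma powr_diff_bounds:
  fixes \<delta> :: real
  assumes d: "\<delta> > 0"
  shows "\<delta> * real (n + 2) powr (-1 - \<delta>) \<le> real (n + 1) powr -\<delta> - real (n + 2) powr -\<delta>"
    and "real (n + 1) powr -\<delta> - real (n + 2) powr -\<delta> \<le> \<delta> / real (n + 1)"
proof -
  define t where "t = ln (real (n + 2)) - ln (real (n + 1))"
  have a: "real (n + 1) powr -\<delta> = real (n + 2) powr -\<delta> * exp (\<delta> * t)"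
    by (simp add: powr_def t_def exp_add[symmetric] algebra_simps)
  have t1: "t \<ge> 1 / real (n + 2)"
  proof -
    have "ln (real (n + 1) / real (n + 2)) \<le> real (n + 1) / real (n + 2) - 1" by (intro ln_le_minus_one) auto
    moreover have "ln (real (n + 1) / real (n + 2)) = - t" by (simp add: t_def ln_div)
    ultimately show ?thesis by (simp add: field_simps)
  qed
  have "1 + \<delta> * (1 / real (n + 2)) \<le> 1 + \<delta> * t" using mult_left_mono[OF t1, of \<delta>] d by simp
  also have "\<dots> \<le> exp (\<delta> * t)" using exp_ge_add_one_self[of "\<delta> * t"] by simp
  finally have "real (n + 2) powr -\<delta> * (1 + \<delta> * (1 / real (n + 2))) \<le> real (n + 1) powr -\<delta>"
    unfolding a by (intro mult_left_mono) auto
  moreover have "real (n + 2) powr (-1 - \<delta>) = real (n + 2) powr -\<delta> / real (n + 2)"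
    by (simp add: powr_diff powr_minus divide_inverse) 
  ultimately show "\<delta> * real (n + 2) powr (-1 - \<delta>) \<le> real (n + 1) powr -\<delta> - real (n + 2) powr -\<delta>"
    by (simp add: algebra_simps)
  have t2: "t \<le> 1 / real (n + 1)"
  proof -
    have "ln (real (n + 2) / real (n + 1)) \<le> real (n + 2) / real (n + 1) - 1" by (intro ln_le_minus_one) auto
    moreover have "ln (real (n + 2) / real (n + 1)) = t" by (simp add: t_def ln_div)
    ultimately show ?thesis by (simp add: field_simps)
  qed
  have b: "real (n + 2) powr -\<delta> = real (n + 1) powr -\<delta> * exp (- (\<delta> * t))"
    unfolding a by (simp add: exp_minus)
  have g1: "real (n + 1) powr -\<delta> \<le> 1"
    using d by (simp add: powr_def)
  have "real (n + 1) powr -\<delta> - real (n + 2) powr -\<delta> = real (n + 1) powr -\<delta> * (1 - exp (- (\<delta> * t)))"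
    unfolding b by (simp add: algebra_simps)
  also have "\<dots> \<le> 1 * (\<delta> * t)"
  proof -
    have "0 \<le> 1 / real (n + 2)" by simp
    then have "t \<ge> 0" using t1 by linarith
    then show ?thesis using g1 exp_ge_add_one_self[of "- (\<delta> * t)"] d by (intro mult_mono) auto
  qed
  also have "\<dots> \<le> \<delta> / real (n + 1)" using t2 d mult_left_mono[OF t2, of \<delta>] by simp
  finally show "real (n + 1) powr -\<delta> - real (n + 2) powr -\<delta> \<le> \<delta> / real (n + 1)" .
qed

text \<open>\<open>L0\<close>, \<open>L1\<close>, \<open>L2\<close> are the values at 1 + \<delta>
  of the L-functions of the principal character, \<theta> and \<theta>^2. The first is at most 1 +
  1/\<delta>; the second is O(\<delta>) by the assumed decay; the third is O(1) since \<theta>^2 is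
  nontrivial. The inequality for the Euler factors gives 1 as a lower bound of |L0|^3 |L1|^4 |L2| =
  O(\<delta>), which fails for small \<delta>.\<close>

lemma complex_char_series_not_small:
  assumes dc: "dirichlet_char c \<theta>" and u: "coprime u (int c)" "(\<theta> u)\<^sup>2 \<noteq> 1"
    and S: "\<And>x. cmod (\<Sum>k<x. \<theta> (int k + 1) / of_nat (k + 1)) \<le> 2 * real c / real (x + 1)"
  shows False
proof -
  have c: "c > 0" using dc_pos[OF dc] .
  have bnd: "1 \<le> (1 + 1 / \<delta>) ^ 3 * (2 * real c * \<delta>) ^ 4 * (real c + 1)" if d: "\<delta> > 0" for \<delta>
  proof -
    define w where "w = (\<lambda>n. real n powr (-1 - \<delta>))"
    have wm: "w (m * n) = w m * w n" for m n by (simp add: w_def powr_mult)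
    have w1: "w 1 = 1" by (simp add: w_def)
    have wpos: "w n \<ge> 0" for n by (simp add: w_def)
    have wlt: "w p < 1" if "prime p" for p
    proof -
      have "real p powr (-1 - \<delta>) < real p powr 0" using prime_gt_1_nat[OF that] d by (intro powr_less_mono) auto
      then show ?thesis using prime_gt_0_nat[OF that] by (simp add: w_def)
    qed
    have wsum: "summable w" unfolding w_def using d by (subst summable_real_powr_iff) simp
    define h where "h = (\<lambda>n::nat. if coprime (int n) (int c) then 1 else (0::complex))"
    have hh: "h n = \<theta> (int n) * cnj (\<theta> (int n))" for n using dc_mult_cnj[OF dc] by (simp add: h_def)
    define f0 where "f0 = (\<lambda>n. h n * of_real (w n))"
    define f1 where "f1 = (\<lambda>n. \<theta> (int n) * of_real (w n))"
    define f2 where "f2 = (\<lambda>n. (\<theta> (int n))\<^sup>2 * of_real (w n))"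
    have m0: "f0 (m * n) = f0 m * f0 n" and m1: "f1 (m * n) = f1 m * f1 n" and m2: "f2 (m * n) = f2 m * f2 n" for m n
      by (simp_all add: f0_def f1_def f2_def hh wm dc_mult[OF dc] power_mult_distrib mult_ac)
    have z: "f0 0 = 0" "f1 0 = 0" "f2 0 = 0" by (simp_all add: f0_def f1_def f2_def w_def)
    have o: "f0 1 = 1" "f1 1 = 1" "f2 1 = 1" using dc by (simp_all add: f0_def f1_def f2_def w1[simplified] h_def)
    have n0: "norm (f0 n) \<le> w n" and n1: "norm (f1 n) \<le> w n" and n2: "norm (f2 n) \<le> w n" for n
      using dc_norm_le[OF dc, of "int n"] wpos[of n] power_le_one[of "cmod (\<theta> (int n))" 2]
      by (auto simp: f0_def f1_def f2_def h_def norm_mult norm_power mult_left_le_one_le)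
    have s0: "summable (\<lambda>n. norm (f0 n))" and s1: "summable (\<lambda>n. norm (f1 n))" and s2: "summable (\<lambda>n. norm (f2 n))"
      using n0 n1 n2 by (auto intro!: summable_comparison_test'[OF wsum, of 0])
    define L0 where "L0 = infsum f0 UNIV" 
    define L1 where "L1 = infsum f1 UNIV" 
    define L2 where "L2 = infsum f2 UNIV" 
    have l0: "cmod L0 \<le> 1 + 1 / \<delta>"
      unfolding L0_def
    proof (rule infsum_norm_le[OF s0 z(1) _ tendsto_const])
      fix M
      have "(\<Sum>k<Suc m. w (k + 1)) \<le> 1 + (1 - real (m + 1) powr -\<delta>) / \<delta>" for m
      proof (induction m)
        case (Suc m)
        have "\<delta> * w (m + 2) \<le> real (m + 1) powr -\<delta> - real (m + 2) powr -\<delta>"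
          using powr_diff_bounds(1)[OF d, of m] by (simp add: w_def)
        then have "w (m + 2) \<le> (real (m + 1) powr -\<delta> - real (m + 2) powr -\<delta>) / \<delta>" using d by (simp add: field_simps)
        then show ?case using Suc by (simp add: diff_divide_distrib add_ac numeral_2_eq_2)
      qed (use d in \<open>simp add: w1[simplified]\<close>)
      moreover have "(1 - X powr -\<delta>) / \<delta> \<le> 1 / \<delta>" for X :: real
        using d by (intro divide_right_mono) auto
      ultimately have "(\<Sum>k<Suc m. w (k + 1)) \<le> 1 + 1 / \<delta>" for m
        by (meson add_left_mono order_trans)
      then have "(\<Sum>k<M. w (k + 1)) \<le> 1 + 1 / \<delta>" using d by (cases M) auto
      moreover have "cmod (\<Sum>k<M. f0 (k + 1)) \<le> (\<Sum>k<M. w (k + 1))" by (intro sum_norm_le n0)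
      ultimately show "cmod (\<Sum>k<M. f0 (k + 1)) \<le> 1 + 1 / \<delta>" by linarith
    qed
    \<comment> \<open>Partial summation against n^(-\<delta>). The decay 2 c / (k + 2) of the
      partial sums times the variation \<delta> / (k + 1) of the weights telescopes to at most 2 c
      \<delta>.\<close>
    have l1: "cmod L1 \<le> 2 * real c * \<delta>"
      unfolding L1_def
    proof (rule infsum_norm_le[OF s1 z(2)])
      fix M
      define g where "g = (\<lambda>k. real (k + 1) powr -\<delta>)"
      have gl: "g k \<le> 1" "g k \<ge> 0" for k using d by (auto simp: g_def powr_def)
      have gd: "\<bar>g k - g (Suc k)\<bar> \<le> \<delta> / real (k + 1)" for k
      proof -
        have "\<delta> * real (k + 2) powr (-1 - \<delta>) \<ge> 0" using d by simp
        then have "g k - g (Suc k) \<ge> 0" using powr_diff_bounds(1)[OF d, of k] by (simp add: g_def add_ac)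
        then show ?thesis using powr_diff_bounds(2)[OF d, of k] by (simp add: g_def add_ac)
      qed
      have e: "(\<Sum>k<M. f1 (k + 1)) = (\<Sum>k<M. \<theta> (int k + 1) / of_nat (k + 1) * of_real (g k))"
      proof (rule sum.cong[OF refl])
        fix k
        have "w (k + 1) = g k / real (k + 1)" by (simp add: w_def g_def powr_diff powr_minus divide_inverse mult.commute)
        then show "f1 (k + 1) = \<theta> (int k + 1) / of_nat (k + 1) * of_real (g k)" by (simp add: f1_def add.commute)
      qed
      have "cmod (\<Sum>k<M. f1 (k + 1)) \<le> cmod (\<Sum>k<M. \<theta> (int k + 1) / of_nat (k + 1)) * \<bar>g M\<bar>
         + (\<Sum>k<M. cmod (\<Sum>j<Suc k. \<theta> (int j + 1) / of_nat (j + 1)) * \<bar>g k - g (Suc k)\<bar>)"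
        unfolding e by (subst abel_identity, rule order_trans[OF norm_triangle_ineq add_mono])
          (auto simp: norm_mult intro!: sum_norm_le simp del: of_real_diff sum.lessThan_Suc)
      also have "\<dots> \<le> 2 * real c / real (M + 1) * 1 + (\<Sum>k<M. (2 * real c / real (Suc k + 1)) * (\<delta> / real (k + 1)))"
        by (intro add_mono mult_mono S sum_mono gd) (use gl in auto)
      also have "(\<Sum>k<M. (2 * real c / real (Suc k + 1)) * (\<delta> / real (k + 1))) = 2 * real c * \<delta> * (\<Sum>k<M. 1 / real (k + 1) - 1 / real (Suc k + 1))"
        unfolding sum_distrib_left by (rule sum.cong) (auto simp: field_simps)
      also have "(\<Sum>k<M. 1 / real (k + 1) - 1 / real (Suc k + 1)) = 1 - 1 / real (M + 1)"
        using sum_lessThan_telescope'[of "\<lambda>k. 1 / real (k + 1)" M] by simp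
      also have "2 * real c * \<delta> * (1 - 1 / real (M + 1)) \<le> 2 * real c * \<delta>" using d by (simp add: mult_left_le)
      finally show "cmod (\<Sum>k<M. f1 (k + 1)) \<le> 2 * real c / real (M + 1) + 2 * real c * \<delta>" by simp
    next
      have "(\<lambda>M. 2 * real c / real (M + 1)) \<longlonglongrightarrow> 0" by real_asymp
      from tendsto_add[OF this tendsto_const[of "2 * real c * \<delta>"]]
      show "(\<lambda>M. 2 * real c / real (M + 1) + 2 * real c * \<delta>) \<longlonglongrightarrow> 2 * real c * \<delta>" by simp
    qed
    have l2: "cmod L2 \<le> real c + 1"
      unfolding L2_def
    proof (rule infsum_norm_le[OF s2 z(3) _ tendsto_const])
      fix M
      have dc2: "dirichlet_char c (\<lambda>n. (\<theta> n)\<^sup>2)"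
        using dc_mult_char[OF dc dc, of c] c by (simp add: power2_eq_square)
      have part: "cmod (\<Sum>k<n. (\<theta> (int k + 1))\<^sup>2) \<le> real c + 1" for n
      proof -
        have "(\<Sum>k<Suc n. (\<theta> (int k))\<^sup>2) = (\<theta> 0)\<^sup>2 + (\<Sum>k<n. (\<theta> (int k + 1))\<^sup>2)"
          by (subst sum.lessThan_Suc_shift) (simp add: add.commute)
        moreover have "cmod (\<Sum>k<Suc n. (\<theta> (int k))\<^sup>2) \<le> real c"
          using periodic_partial_sums[OF c dc_periodic[OF dc2] dc_sum_eq_0[OF dc2 u] dc_norm_le[OF dc2]] .
        moreover have "cmod ((\<theta> 0)\<^sup>2) \<le> 1" using dc_norm_le[OF dc2] .
        ultimately show ?thesis 
          using norm_triangle_ineq4[of "(\<theta> 0)\<^sup>2 + (\<Sum>k<n. (\<theta> (int k + 1))\<^sup>2)" "(\<theta> 0)\<^sup>2"] by simp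
      qed
      have "cmod (\<Sum>k<M. (\<theta> (int k + 1))\<^sup>2 * of_real (w (k + 1))) \<le> (real c + 1) * w (0 + 1)"
      proof (rule abel_bound_decreasing[OF part])
        fix k show "w (Suc k + 1) \<le> w (k + 1)"
          unfolding w_def using d by (intro powr_mono2') auto
      qed (rule wpos)
      then show "cmod (\<Sum>k<M. f2 (k + 1)) \<le> real c + 1"
        using w1 by (simp add: f2_def add.commute)
    qed
    define E where "E = (\<lambda>f::nat \<Rightarrow> complex. \<lambda>M::nat. \<Prod>p | prime p \<and> p \<le> M. 1 - f p)"
    have lim: "(\<lambda>M. (E f0 M * L0) ^ 3 * (E f1 M * L1) ^ 4 * (E f2 M * L2)) \<longlonglongrightarrow> 1 ^ 3 * 1 ^ 4 * 1"
      unfolding E_def L0_def L1_def L2_def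
      by (intro tendsto_mult tendsto_power euler_product_limit m0 m1 m2 s0 s1 s2 z o)
    have fac: "cmod (1 - f0 p) ^ 3 * cmod (1 - f1 p) ^ 4 * cmod (1 - f2 p) \<le> 1" if p: "prime p" for p
    proof (cases "coprime (int p) (int c)")
      case True
      then show ?thesis using euler_factor_norm_ge[OF wpos wlt[OF p] dc_norm[OF dc True]] by (simp add: f0_def f1_def f2_def h_def)
    next
      case False
      then have "\<theta> (int p) = 0" using dc_eq_0_iff[OF dc] by simp
      then show ?thesis using False by (simp add: f0_def f1_def f2_def h_def)
    qed
    have Eb: "cmod (E f0 M) ^ 3 * cmod (E f1 M) ^ 4 * cmod (E f2 M) \<le> 1" for M
    proof -
      have "cmod (E f0 M) ^ 3 * cmod (E f1 M) ^ 4 * cmod (E f2 M)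
        = (\<Prod>p | prime p \<and> p \<le> M. cmod (1 - f0 p) ^ 3 * cmod (1 - f1 p) ^ 4 * cmod (1 - f2 p))"
        unfolding E_def prod.distrib prod_norm[symmetric] prod_power_distrib ..
      also have "\<dots> \<le> 1" by (rule prod_le_1) (use fac in auto)
      finally show ?thesis .
    qed
    have "cmod ((E f0 M * L0) ^ 3 * (E f1 M * L1) ^ 4 * (E f2 M * L2)) \<le> cmod L0 ^ 3 * cmod L1 ^ 4 * cmod L2" for M
    proof -
      have "cmod ((E f0 M * L0) ^ 3 * (E f1 M * L1) ^ 4 * (E f2 M * L2)) 
          = (cmod (E f0 M) ^ 3 * cmod (E f1 M) ^ 4 * cmod (E f2 M)) * (cmod L0 ^ 3 * cmod L1 ^ 4 * cmod L2)"
        by (simp add: norm_mult norm_power power_mult_distrib mult_ac)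
      also have "\<dots> \<le> 1 * (cmod L0 ^ 3 * cmod L1 ^ 4 * cmod L2)"
        by (intro mult_right_mono Eb) auto
      finally show ?thesis by simp
    qed
    then have "cmod (1 ^ 3 * 1 ^ 4 * 1) \<le> cmod L0 ^ 3 * cmod L1 ^ 4 * cmod L2"
      by (intro LIMSEQ_le_const2[OF tendsto_norm[OF lim]]) auto
    also have "\<dots> \<le> (1 + 1 / \<delta>) ^ 3 * (2 * real c * \<delta>) ^ 4 * (real c + 1)"
      using l0 l1 l2 d by (intro mult_mono power_mono) auto
    finally show ?thesis by simp
  qed
  define K where "K = 16 * real c ^ 4 * (real c + 1)"
  have "((\<lambda>\<delta>. (\<delta> + 1) ^ 3 * \<delta> * K) \<longlongrightarrow> (0 + 1) ^ 3 * 0 * K) (at_right 0)"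
    by (intro tendsto_intros)
  then have "eventually (\<lambda>\<delta>. (\<delta> + 1) ^ 3 * \<delta> * K < 1) (at_right 0)"
    by (intro order_tendstoD(2)) auto
  moreover have "eventually (\<lambda>\<delta>::real. \<delta> > 0) (at_right 0)" by (simp add: eventually_at_right_less)
  ultimately have "eventually (\<lambda>\<delta>::real. False) (at_right 0)"
  proof eventually_elim
    case (elim \<delta>)
    have "A ^ 3 * (2 * C * d) ^ 4 * B = (d * A) ^ 3 * d * (16 * C ^ 4 * B)" for A B C d :: real
      by (simp add: power_mult_distrib eval_nat_numeral)
    then have "(1 + 1 / \<delta>) ^ 3 * (2 * real c * \<delta>) ^ 4 * (real c + 1) = (\<delta> * (1 + 1 / \<delta>)) ^ 3 * \<delta> * K"
      unfolding K_def by blast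
    also have "\<delta> * (1 + 1 / \<delta>) = \<delta> + 1" using elim by (simp add: field_simps)
    finally show False using bnd[of \<delta>] elim by simp
  qed
  then show False by simp
qed

text \<open>A vanishing sum would make the partial sums of \<theta>(n) / n tend to 0 at the rate
  1/x. For \<theta>^2 nontrivial this contradicts the Euler product argument, whose third factor is
  bounded only then; otherwise \<theta> is real and the Lambert series argument applies.\<close>

theorem odd_char_cot_sum_nonzero:
  assumes dc: "dirichlet_char c \<theta>" and odd: "\<theta> (-1) = -1"
  shows "(\<Sum>m\<in>{0..<int c}. \<theta> m * of_real (ct c m)) \<noteq> 0"
proof
  assume z: "(\<Sum>m\<in>{0..<int c}. \<theta> m * of_real (ct c m)) = 0"
  have c: "c > 0" using dc_pos[OF dc] .
  have S: "cmod (\<Sum>k<x. \<theta> (int k + 1) / of_nat (k + 1)) \<le> 2 * real c / real (x + 1)" for x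
    by (rule cot_sum_zero_imp_series_small[OF c dc_periodic[OF dc] _ dc_norm_le[OF dc] z])
      (use dc_uminus[OF dc] odd in simp)
  show False
  proof (cases "\<forall>u. coprime u (int c) \<longrightarrow> (\<theta> u)\<^sup>2 = 1")
    case False
    then show ?thesis using complex_char_series_not_small[OF dc _ _ S] by blast
  next
    case True
    have val: "\<theta> n \<in> {-1, 0, 1}" for n
      using True dc_eq_0_iff[OF dc, of n] by (auto simp: power2_eq_1_iff)
    define g where "g = (\<lambda>n::nat. Re (\<theta> (int n)))"
    have tg: "\<theta> (int n) = of_real (g n)" for n using val[of "int n"] by (auto simp: g_def)
    show ?thesis
    proof (rule real_char_series_not_zero[of g])
      show "g (m * n) = g m * g n" for m n
      proof -
        have "complex_of_real (g (m * n)) = of_real (g m * g n)"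
          using dc_mult[OF dc, of "int m" "int n"] by (simp add: tg[symmetric])
        then show ?thesis by (simp only: of_real_eq_iff)
      qed
      show "g 1 = 1" using dc by (simp add: g_def)
      show "g n \<in> {-1, 0, 1}" for n using val[of "int n"] by (auto simp: g_def)
      show "\<bar>\<Sum>k<n. g (k + 1)\<bar> \<le> real c + 1" for n
      proof -
        have "(\<Sum>k<Suc n. \<theta> (int k)) = \<theta> 0 + (\<Sum>k<n. \<theta> (int (k + 1)))"
          by (subst sum.lessThan_Suc_shift) simp
        moreover have "cmod (\<Sum>k<Suc n. \<theta> (int k)) \<le> real c"
        proof -
          have z0: "(\<Sum>x\<in>{0..<int c}. \<theta> x) = 0" by (rule dc_sum_eq_0[OF dc, of "-1"]) (use odd in auto)
          show ?thesis by (rule periodic_partial_sums[OF c dc_periodic[OF dc] z0 dc_norm_le[OF dc]])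
        qed
        moreover have "cmod (\<theta> 0) \<le> 1" using dc_norm_le[OF dc] .
        ultimately have "cmod (\<Sum>k<n. \<theta> (int (k + 1))) \<le> real c + 1"
          using norm_triangle_ineq4[of "\<theta> 0 + (\<Sum>k<n. \<theta> (int (k + 1)))" "\<theta> 0"] by simp
        moreover have "(\<Sum>k<n. \<theta> (int (k + 1))) = of_real (\<Sum>k<n. g (k + 1))"
          unfolding tg by simp
        ultimately show ?thesis by (simp only: norm_of_real)
      qed
      have "cmod (\<Sum>k<x. \<theta> (int k + 1) / of_nat (k + 1)) = \<bar>\<Sum>k<x. g (k + 1) / real (k + 1)\<bar>" for x
      proof -
        have "(\<Sum>k<x. \<theta> (int k + 1) / of_nat (k + 1)) = (\<Sum>k<x. of_real (g (k + 1) / real (k + 1)))"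
          by (rule sum.cong[OF refl]) (use tg[of "_ + 1"] in \<open>simp add: add.commute\<close>)
        also have "\<dots> = of_real (\<Sum>k<x. g (k + 1) / real (k + 1))" by simp
        finally show ?thesis by (simp only: norm_of_real)
      qed
      then have "\<bar>\<Sum>k<x. g (k + 1) / real (k + 1)\<bar> \<le> 2 * real c / real (x + 1)" for x using S[of x] by simp
      then have le: "norm (\<Sum>k<x. g (k + 1) / real (k + 1)) \<le> 2 * real c / real (x + 1)" for x
        by (simp only: real_norm_def)
      have "(\<lambda>x. 2 * real c / real (x + 1)) \<longlonglongrightarrow> 0" by real_asymp
      then show "(\<lambda>n. \<Sum>k<n. g (k + 1) / real (k + 1)) \<longlonglongrightarrow> 0"
        by (rule Lim_null_comparison[OF always_eventually[OF allI[OF le]]])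
    qed
  qed
qed

section \<open>Existence of Dirichlet characters\<close>

text \<open>A translation-invariant space of functions on the units, if non-zero, contains a common
  eigenvector of all translations, and such an eigenvector is a character up to a scalar.\<close>

lemma exists_char_nonzero_coefficient:
  fixes F :: "int \<Rightarrow> complex"
  assumes n: "n > 0" and per: "\<And>x. F (x + int n) = F x" and supp: "\<And>x. \<not> coprime x (int n) \<Longrightarrow> F x = 0"
    and nz: "F x0 \<noteq> 0"
  obtains \<psi> where "dirichlet_char n \<psi>" "(\<Sum>x\<in>{0..<int n}. F x * \<psi> x) \<noteq> 0"
proof -
  \<comment> \<open>Stands in for membership in the span of the translates of F: only the
    consequence is carried along that a character orthogonal to F is orthogonal to v.\<close>
  define Q where "Q = (\<lambda>v. (\<forall>x. v (x + int n) = v x) \<and> (\<forall>x. \<not> coprime x (int n) \<longrightarrow> v x = 0) \<and> (\<exists>x. v x \<noteq> 0) \<and>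
     (\<forall>\<psi>. dirichlet_char n \<psi> \<longrightarrow> (\<Sum>x\<in>{0..<int n}. F x * \<psi> x) = 0 \<longrightarrow> (\<Sum>x\<in>{0..<int n}. v x * \<psi> x) = 0))"
  define t where "t = totient n"
  have t: "t > 0" using n by (simp add: t_def)
  have "\<exists>v. Q v \<and> (\<forall>h\<in>H. \<exists>e. \<forall>x. v (h * x) = e * v x)"
    if "finite H" "\<And>h. h \<in> H \<Longrightarrow> coprime h (int n)" for H
    using that
  proof (induction H rule: finite_induct)
    case empty
    show ?case by (rule exI[of _ F]) (use per supp nz in \<open>auto simp: Q_def\<close>)
  next
    case (insert h H)
    then obtain v where v: "Q v" and ev: "\<forall>h\<in>H. \<exists>e. \<forall>x. v (h * x) = e * v x" by auto
    have ch: "coprime h (int n)" using insert by simp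
    have vper: "v (x + int n) = v x" and vs: "\<not> coprime x (int n) \<Longrightarrow> v x = 0" for x using v by (auto simp: Q_def)
    obtain x1 where x1: "v x1 \<noteq> 0" using v by (auto simp: Q_def)
    have vcong: "v x = v y" if "[x = y] (mod int n)" for x y
      using periodic_cong[of v "int n" x y] vper that by blast
    have ht: "[h ^ t = 1] (mod int n)"
    proof -
      define k where "k = nat (h mod int n)"
      have kn: "int k = h mod int n" using n by (simp add: k_def)
      have "coprime (int k) (int n)" using ch n by (simp add: kn coprime_mod_left_iff)
      then have "[k ^ t = 1] (mod n)" unfolding t_def using euler_theorem by auto
      then have "[int k ^ t = 1] (mod int n)" using cong_int_iff[of "k ^ t" 1 n] by simp
      moreover have "[h = int k] (mod int n)" by (simp add: kn unique_euclidean_semiring_class.cong_def)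
      ultimately show ?thesis by (meson cong_pow cong_trans)
    qed
    \<comment> \<open>Projection, up to the factor t, to the eigenspace of translation by h with
      eigenvalue \<open>ee t l\<close>; this uses h^t = 1 modulo n. The projections over all l add
      up to t v, so one of them is non-zero at \<open>x1\<close>. Translations commute, so
      eigenvalues found earlier persist.\<close>
    define w where "w = (\<lambda>l x. \<Sum>i<t. ee t (- (l * int i)) * v (h ^ i * x))"
    have "(\<Sum>l\<in>{0..<int t}. w l x1) = (\<Sum>i<t. v (h ^ i * x1) * (\<Sum>l\<in>{0..<int t}. ee t ((- int i) * l)))"
      unfolding w_def by (subst sum.swap) (simp add: sum_distrib_left mult.commute)
    also have "\<dots> = (\<Sum>i<t. if i = 0 then of_nat t * v x1 else 0)"
    proof (rule sum.cong[OF refl])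
      fix i assume "i \<in> {..<t}"
      then have "int t dvd - int i \<longleftrightarrow> i = 0" by (auto dest: zdvd_imp_le)
      then show "v (h ^ i * x1) * (\<Sum>l\<in>{0..<int t}. ee t ((- int i) * l)) = (if i = 0 then of_nat t * v x1 else 0)"
        by (subst sum_ee[OF t]) auto
    qed
    also have "\<dots> = of_nat t * v x1" using t by simp
    finally have "(\<Sum>l\<in>{0..<int t}. w l x1) \<noteq> 0" using x1 t by simp
    then obtain l where l: "w l x1 \<noteq> 0" by (meson sum.not_neutral_contains_not_neutral)
    have wQ: "Q (w l)"
      unfolding Q_def
    proof (intro conjI allI impI)
      show "w l (x + int n) = w l x" for x
        unfolding w_def using vcong[of "h ^ i * (x + int n)" "h ^ i * x" for i]
        by (simp add: cong_iff_dvd_diff algebra_simps)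
      show "w l x = 0" if "\<not> coprime x (int n)" for x
        unfolding w_def using that by (intro sum.neutral ballI) (simp add: vs)
      show "\<exists>x. w l x \<noteq> 0" using l by blast
      fix \<psi> assume p: "dirichlet_char n \<psi>" "(\<Sum>x\<in>{0..<int n}. F x * \<psi> x) = 0"
      then have v0: "(\<Sum>x\<in>{0..<int n}. v x * \<psi> x) = 0" using v by (auto simp: Q_def)
      have "(\<Sum>x\<in>{0..<int n}. v (h ^ i * x) * \<psi> x) = 0" for i
      proof -
        have "\<psi> (h ^ i) * (\<Sum>x\<in>{0..<int n}. v (h ^ i * x) * \<psi> x) = (\<Sum>x\<in>{0..<int n}. v (h ^ i * x) * \<psi> (h ^ i * x))"
          by (simp add: dc_mult[OF p(1)] sum_distrib_left mult_ac)
        also have "\<dots> = (\<Sum>x\<in>{0..<int n}. v x * \<psi> x)"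
          using sum_periodic_scale[of "int n" "\<lambda>x. v x * \<psi> x" "h ^ i"] n vper dc_periodic[OF p(1)] ch by simp
        finally have "\<psi> (h ^ i) * (\<Sum>x\<in>{0..<int n}. v (h ^ i * x) * \<psi> x) = 0" using v0 by simp
        moreover have "\<psi> (h ^ i) \<noteq> 0" using dc_eq_0_iff[OF p(1)] ch by simp
        ultimately show ?thesis by simp
      qed
      then have "(\<Sum>i<t. ee t (- (l * int i)) * (\<Sum>x\<in>{0..<int n}. v (h ^ i * x) * \<psi> x)) = 0" by simp
      then show "(\<Sum>x\<in>{0..<int n}. w l x * \<psi> x) = 0"
        unfolding w_def sum_distrib_left sum_distrib_right by (subst (asm) sum.swap) (simp add: mult.assoc)
    qed
    have eh: "w l (h * x) = ee t l * w l x" for x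
    proof -
      define f where "f = (\<lambda>i. ee t (- (l * int i)) * v (h ^ i * x))"
      have "w l (h * x) = ee t l * (\<Sum>i<t. f (Suc i))"
        unfolding w_def f_def sum_distrib_left
      proof (rule sum.cong[OF refl])
        fix i
        have "ee t (- (l * int i)) = ee t l * ee t (- (l * int (Suc i)))"
          unfolding ee_add[symmetric] by (simp add: algebra_simps)
        then show "ee t (- (l * int i)) * v (h ^ i * (h * x)) = ee t l * (ee t (- (l * int (Suc i))) * v (h ^ Suc i * x))"
          by (simp add: mult_ac)
      qed
      also have "(\<Sum>i<t. f (Suc i)) = (\<Sum>i<t. f i)"
      proof -
        have "f t = f 0"
        proof -
          have "ee t (- (l * int t)) = 1" using ee_eq_1_iff[OF t] by simp
          moreover have "v (h ^ t * x) = v x" using vcong[of "h ^ t * x" x] cong_scalar_right[OF ht, of x] by simp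
          ultimately show ?thesis by (simp add: f_def)
        qed
        then show ?thesis using sum.lessThan_Suc_shift[of f t] sum.lessThan_Suc[of f t] by (simp add: add.commute)
      qed
      finally show ?thesis by (simp add: w_def f_def)
    qed
    have eH: "\<exists>e. \<forall>x. w l (k * x) = e * w l x" if "k \<in> H" for k
    proof -
      obtain e where e: "\<forall>x. v (k * x) = e * v x" using ev \<open>k \<in> H\<close> by auto
      have "w l (k * x) = e * w l x" for x
        unfolding w_def sum_distrib_left
        by (rule sum.cong[OF refl]) (metis (no_types, opaque_lifting) e mult.left_commute)
      then show ?thesis by blast
    qed
    show ?case using wQ eh eH by (intro exI[of _ "w l"]) auto
  qed
  then have "\<exists>v. Q v \<and> (\<forall>h\<in>{h\<in>{0..<int n}. coprime h (int n)}. \<exists>e. \<forall>x. v (h * x) = e * v x)"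
  proof -
    assume *: "\<And>H. finite H \<Longrightarrow> (\<And>h. h \<in> H \<Longrightarrow> coprime h (int n)) \<Longrightarrow> \<exists>v. Q v \<and> (\<forall>h\<in>H. \<exists>e. \<forall>x. v (h * x) = e * v x)"
    have "finite {h\<in>{0..<int n}. coprime h (int n)}" by (rule finite_subset[of _ "{0..<int n}"]) auto
    then show ?thesis by (rule *) auto
  qed
  then obtain v where v: "Q v" and ev: "\<And>h. h \<in> {0..<int n} \<Longrightarrow> coprime h (int n) \<Longrightarrow> \<exists>e. \<forall>x. v (h * x) = e * v x"
    by blast
  have vper: "v (x + int n) = v x" and vs: "\<not> coprime x (int n) \<Longrightarrow> v x = 0" for x using v by (auto simp: Q_def)
  have vcong: "v x = v y" if "[x = y] (mod int n)" for x y
    using periodic_cong[of v "int n" x y] vper that by blast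
  have ev': "\<exists>e. \<forall>x. v (h * x) = e * v x" if "coprime h (int n)" for h
  proof -
    have "h mod int n \<in> {0..<int n}" "coprime (h mod int n) (int n)"
      using that n by (simp_all add: coprime_mod_left_iff)
    from ev[OF this] obtain e where "\<forall>x. v (h mod int n * x) = e * v x" by blast
    moreover have "v (h mod int n * x) = v (h * x)" for x
      by (rule vcong) (simp add: unique_euclidean_semiring_class.cong_def mod_mult_left_eq)
    ultimately show ?thesis by auto
  qed
  have mult: "v (h * x) * v 1 = v h * v x" if h: "coprime h (int n)" for h x
  proof -
    obtain e where e: "\<forall>x. v (h * x) = e * v x" using ev'[OF h] by auto
    have "v h = e * v 1" using e[rule_format, of 1] by simp
    then show ?thesis using e[rule_format, of x] by simp
  qed
  obtain x1 where x1: "v x1 \<noteq> 0" using v by (auto simp: Q_def)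
  have cx1: "coprime x1 (int n)" using x1 vs by blast
  have v1: "v 1 \<noteq> 0"
  proof
    assume "v 1 = 0"
    obtain e where "\<forall>x. v (x1 * x) = e * v x" using ev'[OF cx1] by auto
    from this[rule_format, of 1] show False using \<open>v 1 = 0\<close> x1 by simp
  qed
  have vn: "v h \<noteq> 0" if h: "coprime h (int n)" for h
  proof -
    obtain k where "[h * k = 1] (mod int n)" using cong_solve_coprime_int[OF h] by auto
    then have "v (h * k) = v 1" by (rule vcong)
    then show ?thesis using mult[OF h, of k] v1 by auto
  qed
  define \<psi> where "\<psi> = (\<lambda>x. v x / v 1)"
  have dc: "dirichlet_char n \<psi>"
    unfolding dirichlet_char_def
  proof (intro conjI allI)
    fix x y
    show "\<psi> (x * y) = \<psi> x * \<psi> y"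
    proof (cases "coprime x (int n)")
      case True
      then show ?thesis using mult[OF True, of y] v1 by (simp add: \<psi>_def field_simps)
    next
      case False
      then show ?thesis using vs[of x] vs[of "x * y"] by (simp add: \<psi>_def)
    qed
    show "\<psi> (x + int n) = \<psi> x" by (simp add: \<psi>_def vper)
    show "(\<psi> x = 0) = (\<not> coprime x (int n))" using vn[of x] vs[of x] v1 by (auto simp: \<psi>_def)
  qed (use n in simp)
  \<comment> \<open>The pairing of v with the conjugate of its own character is \<open>v 1\<close>
    times the number of units. By the last clause of \<open>Q\<close> that conjugate is not
    orthogonal to F either.\<close>
  have "(\<Sum>x\<in>{0..<int n}. v x * cnj (\<psi> x)) = v 1 * (\<Sum>x\<in>{0..<int n}. \<psi> x * cnj (\<psi> x))"
    using v1 by (simp add: \<psi>_def sum_distrib_left)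
  also have "(\<Sum>x\<in>{0..<int n}. \<psi> x * cnj (\<psi> x)) = of_nat (card {x\<in>{0..<int n}. coprime x (int n)})"
    unfolding dc_mult_cnj[OF dc] by (simp add: sum.If_cases Int_def)
  also have "card {x\<in>{0..<int n}. coprime x (int n)} \<noteq> 0"
  proof -
    have "1 mod int n \<in> {x\<in>{0..<int n}. coprime x (int n)}" using n by (simp add: coprime_mod_left_iff)
    moreover have "finite {x\<in>{0..<int n}. coprime x (int n)}" by (rule finite_subset[of _ "{0..<int n}"]) auto
    ultimately show ?thesis by (metis (no_types) card_0_eq empty_iff)
  qed
  then have "v 1 * of_nat (card {x\<in>{0..<int n}. coprime x (int n)}) \<noteq> 0" using v1 by simp
  finally have "(\<Sum>x\<in>{0..<int n}. v x * cnj (\<psi> x)) \<noteq> 0" .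
  then have "(\<Sum>x\<in>{0..<int n}. F x * cnj (\<psi> x)) \<noteq> 0"
    using v dc_cnj[OF dc] by (auto simp: Q_def)
  then show ?thesis using that dc_cnj[OF dc] by blast
qed

text \<open>The product over \<open>J\<close> of \<open>1 - \<kappa> j * \<psi> (g j)\<close> is a linear combination of values of \<open>\<psi>\<close>. If some
  product of the \<open>g j\<close> arises from a single subset of \<open>J\<close>, the combination is not identically zero,
  hence non-zero for some \<open>\<psi>\<close>.\<close>

lemma exists_char_avoiding:
  fixes g :: "'i \<Rightarrow> int" and \<kappa> :: "'i \<Rightarrow> complex"
  assumes n: "n > 0" and J: "finite J" and cop: "\<And>j. j \<in> J \<Longrightarrow> coprime (g j) (int n)"
    and X0: "X0 \<subseteq> J" "\<And>j. j \<in> X0 \<Longrightarrow> \<kappa> j \<noteq> 0"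
    and iso: "\<And>X. X \<subseteq> J \<Longrightarrow> [(\<Prod>j\<in>X. g j) = (\<Prod>j\<in>X0. g j)] (mod int n) \<Longrightarrow> X = X0"
  obtains \<psi> where "dirichlet_char n \<psi>" "\<And>j. j \<in> J \<Longrightarrow> \<kappa> j * \<psi> (g j) \<noteq> 1"
proof -
  define F where "F = (\<lambda>x. \<Sum>X\<in>Pow J. if [(\<Prod>j\<in>X. g j) = x] (mod int n) then (\<Prod>j\<in>X. - \<kappa> j) else 0)"
  have cX: "coprime (\<Prod>j\<in>X. g j) (int n)" if "X \<subseteq> J" for X
    using that cop by (intro prod_coprime_left) auto
  have "F (\<Prod>j\<in>X0. g j) = (\<Sum>X\<in>Pow J. if X = X0 then (\<Prod>j\<in>X. - \<kappa> j) else 0)"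
    unfolding F_def by (rule sum.cong[OF refl]) (use iso in auto)
  also have "\<dots> = (\<Prod>j\<in>X0. - \<kappa> j)" using X0 J by (simp add: sum.delta)
  finally have F0: "F (\<Prod>j\<in>X0. g j) \<noteq> 0" using X0 J finite_subset[OF X0(1) J] by (simp add: prod_zero_iff)
  obtain \<psi> where dc: "dirichlet_char n \<psi>" and nz: "(\<Sum>x\<in>{0..<int n}. F x * \<psi> x) \<noteq> 0"
  proof -
    have "F (x + int n) = F x" for x
      by (simp add: F_def unique_euclidean_semiring_class.cong_def)
    moreover have "F x = 0" if "\<not> coprime x (int n)" for x
      unfolding F_def using that cX by (intro sum.neutral) (auto dest: cong_imp_coprime)
    ultimately show ?thesis using that exists_char_nonzero_coefficient[OF n, where F = F and ?x0.0 = "\<Prod>j\<in>X0. g j"] F0 by blast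
  qed
  have "(\<Sum>x\<in>{0..<int n}. F x * \<psi> x) = (\<Sum>X\<in>Pow J. \<Sum>x\<in>{0..<int n}. if x = (\<Prod>j\<in>X. g j) mod int n then (\<Prod>j\<in>X. - \<kappa> j) * \<psi> x else 0)"
    unfolding F_def sum_distrib_right
    by (subst sum.swap, intro sum.cong refl) (auto simp: unique_euclidean_semiring_class.cong_def)
  also have "\<dots> = (\<Sum>X\<in>Pow J. (\<Prod>j\<in>X. - \<kappa> j) * \<psi> (\<Prod>j\<in>X. g j))"
    using n periodic_mod[of \<psi> "int n"] dc_periodic[OF dc] by (simp add: sum.delta)
  also have "\<dots> = (\<Sum>X\<in>Pow J. (\<Prod>j\<in>X. - \<kappa> j * \<psi> (g j)) * (\<Prod>j\<in>J-X. 1))"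
    by (simp only: dc_prod[OF dc] prod.distrib prod.neutral_const mult_1_right)
  also have "\<dots> = (\<Prod>j\<in>J. - \<kappa> j * \<psi> (g j) + 1)"
    by (rule prod_add[OF J, symmetric])
  finally have "(\<Prod>j\<in>J. - \<kappa> j * \<psi> (g j) + 1) \<noteq> 0" using nz by simp
  then have "- \<kappa> j * \<psi> (g j) + 1 \<noteq> 0" if "j \<in> J" for j using that J prod_zero by metis
  then have "\<kappa> j * \<psi> (g j) \<noteq> 1" if "j \<in> J" for j using that by force
  with dc show ?thesis using that by blast
qed

section \<open>The Dedekind sum as a double cotangent sum\<close>

lemma primitive_cnj: "primitive_char q \<eta> \<Longrightarrow> primitive_char q (\<lambda>n. cnj (\<eta> n))"
  unfolding primitive_char_def using dc_cnj
  by (simp add: induced_modulus_def)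

lemma sum4_swap:
  fixes f :: "'a \<Rightarrow> 'b \<Rightarrow> 'c \<Rightarrow> 'd \<Rightarrow> 'e::comm_monoid_add"
  shows "(\<Sum>j\<in>A. \<Sum>n\<in>B. \<Sum>m\<in>M. \<Sum>k\<in>K. f j n m k) = (\<Sum>m\<in>M. \<Sum>k\<in>K. \<Sum>j\<in>A. \<Sum>n\<in>B. f j n m k)"
proof -
  have C: "(\<Sum>j\<in>X. \<Sum>n\<in>Y. g j n) = (\<Sum>p\<in>X\<times>Y. g (fst p) (snd p))" for X Y and g :: "'x \<Rightarrow> 'y \<Rightarrow> 'e"
    by (simp add: sum.cartesian_product case_prod_beta')
  have "(\<Sum>j\<in>A. \<Sum>n\<in>B. \<Sum>m\<in>M. \<Sum>k\<in>K. f j n m k) = (\<Sum>p\<in>A\<times>B. \<Sum>m\<in>M. \<Sum>k\<in>K. f (fst p) (snd p) m k)"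
    by (rule C)
  also have "\<dots> = (\<Sum>p\<in>A\<times>B. \<Sum>r\<in>M\<times>K. f (fst p) (snd p) (fst r) (snd r))" by (intro sum.cong refl C)
  also have "\<dots> = (\<Sum>r\<in>M\<times>K. \<Sum>p\<in>A\<times>B. f (fst p) (snd p) (fst r) (snd r))" by (rule sum.swap)
  also have "\<dots> = (\<Sum>r\<in>M\<times>K. \<Sum>j\<in>A. \<Sum>n\<in>B. f j n (fst r) (snd r))" by (intro sum.cong refl C[symmetric])
  also have "\<dots> = (\<Sum>m\<in>M. \<Sum>k\<in>K. \<Sum>j\<in>A. \<Sum>n\<in>B. f j n m k)" by (rule C[symmetric])
  finally show ?thesis .
qed

lemma sum_sum_product:
  fixes b d :: "'a \<Rightarrow> 'c::comm_semiring_0"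
  shows "(\<Sum>j\<in>X. \<Sum>n\<in>Y. A * b j * d n) = A * (\<Sum>j\<in>X. b j) * (\<Sum>n\<in>Y. d n)"
  by (simp only: mult.assoc sum_product) (simp only: sum_distrib_left)

text \<open>\<open>ph N \<eta> y\<close> is \<open>\<eta> (y / N)\<close>, understood as 0 unless \<open>N\<close> divides \<open>y\<close>.\<close>

definition ph :: "int \<Rightarrow> (int \<Rightarrow> complex) \<Rightarrow> int \<Rightarrow> complex" where
  "ph N \<eta> y = (if N dvd y then \<eta> (y div N) else 0)"

text \<open>With j = x + q i the sum over i detects whether N divides y, and the sum over x is then
  a Gauss sum at frequency y / N. This is the origin of \<open>ph\<close>.\<close>

lemma gauss_lift:
  assumes prim: "primitive_char q \<eta>" and N: "N > 0"
  shows "(\<Sum>j\<in>{0..<int (q * N)}. cnj (\<eta> j) * ee (q * N) (y * j))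
     = of_nat N * gauss q (\<lambda>n. cnj (\<eta> n)) * ph (int N) \<eta> y"
proof -
  note dc = primitive_dc[OF prim]
  have q: "q > 0" using dc_pos[OF dc] .
  have per: "cnj (\<eta> (x + int q * i)) = cnj (\<eta> x)" for x i
    using periodic_add_mult[of \<eta> "int q" x i] dc_periodic[OF dc] by simp
  have "(\<Sum>j\<in>{0..<int q * int N}. cnj (\<eta> j) * ee (q * N) (y * j))
     = (\<Sum>x\<in>{0..<int q}. cnj (\<eta> x) * ee (q * N) (y * x) * (\<Sum>i\<in>{0..<int N}. ee N (y * i)))"
  proof -
    have "ee (q * N) (y * (x + int q * i)) = ee (q * N) (y * x) * ee N (y * i)" for x i
    proof -
      have "ee (q * N) (y * (x + int q * i)) = ee (q * N) (y * x + int q * (y * i))"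
        by (rule arg_cong[of _ _ "ee (q * N)"]) (simp add: algebra_simps)
      then show ?thesis using ee_scale[OF q, of N "y * i"] by (simp only: ee_add mult.commute[of q N])
    qed
    then show ?thesis using q N by (subst sum_split_residues) (simp_all add: per sum_distrib_left mult.assoc)
  qed
  also have "\<dots> = of_nat N * gauss q (\<lambda>n. cnj (\<eta> n)) * ph (int N) \<eta> y"
  proof (cases "int N dvd y")
    case True
    then obtain z where z: "y = int N * z" by auto
    have "ee (q * N) (y * x) = ee q (z * x)" for x
      using ee_scale[OF N, of q "z * x"] by (simp add: z mult.assoc)
    then have "(\<Sum>x\<in>{0..<int q}. cnj (\<eta> x) * ee (q * N) (y * x)) = \<eta> z * gauss q (\<lambda>n. cnj (\<eta> n))"
      using gauss_primitive[OF primitive_cnj[OF prim], of z] by simp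
    moreover have "(\<Sum>i\<in>{0..<int N}. ee N (y * i)) = of_nat N" using True sum_ee[OF N, of y] by simp
    moreover have "ph (int N) \<eta> y = \<eta> z" using N by (simp add: ph_def z)
    moreover have "(\<Sum>x\<in>{0..<int q}. cnj (\<eta> x) * ee (q * N) (y * x) * (\<Sum>i\<in>{0..<int N}. ee N (y * i)))
        = (\<Sum>x\<in>{0..<int q}. cnj (\<eta> x) * ee (q * N) (y * x)) * (\<Sum>i\<in>{0..<int N}. ee N (y * i))"
      by (rule sum_distrib_right[symmetric])
    ultimately show ?thesis by (simp only: mult_ac)
  next
    case False
    then show ?thesis using sum_ee[OF N, of y] by (simp add: ph_def)
  qed
  finally show ?thesis by simp
qed

definition dcoef :: "nat \<Rightarrow> (int \<Rightarrow> complex) \<Rightarrow> nat \<Rightarrow> (int \<Rightarrow> complex) \<Rightarrow> nat \<Rightarrow> complex" where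
  "dcoef q1 \<eta>1 q2 \<eta>2 c = (\<i> / (2 * of_nat c))\<^sup>2 * of_nat (c div q2) * gauss q1 (\<lambda>n. cnj (\<eta>1 n)) * gauss q2 (\<lambda>n. cnj (\<eta>2 n))"

text \<open>For q2 dividing c the right side is q1 / (16 q2 c^2). The Gauss sum of
  \<open>\<eta>1\<close> is the source of the factor q1 in the final bound.\<close>

lemma dcoef_norm:
  assumes "primitive_char q1 \<eta>1" "primitive_char q2 \<eta>2" "c > 0"
  shows "(cmod (dcoef q1 \<eta>1 q2 \<eta>2 c))\<^sup>2 = (real (c div q2))\<^sup>2 * real q1 * real q2 / (16 * real c ^ 4)"
  using gauss_norm[OF primitive_cnj[OF assms(1)]] gauss_norm[OF primitive_cnj[OF assms(2)]] assms(3)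
  by (simp add: dcoef_def norm_mult norm_power norm_divide power_mult_distrib power_divide)

text \<open>Both values of \<open>B1\<close> are expanded at level c, the second at n c / q1 + a j.
  The sum over n is then a Gauss sum modulo q1 at frequency m and yields \<open>\<eta>1 m\<close>;
  the sum over j has frequency a m + k modulo c and yields \<open>ph\<close>.\<close>

lemma dedekind_sum_cot:
  assumes p1: "primitive_char q1 \<eta>1" and p2: "primitive_char q2 \<eta>2" and c: "c > 0" and dvd: "q1 * q2 dvd c"
  shows "dedekind_sum q1 \<eta>1 \<eta>2 a c = dcoef q1 \<eta>1 q2 \<eta>2 c *
     (\<Sum>m\<in>{0..<int c}. \<Sum>k\<in>{0..<int c}. \<eta>1 m * of_real (ct c m) * of_real (ct c k) * ph (int (c div q2)) \<eta>2 (a * m + k))"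
proof -
  define c1 where "c1 = c div q1"
  define N where "N = c div q2"
  have q1: "q1 > 0" and q2: "q2 > 0" using p1 p2 by (auto dest: primitive_dc dc_pos)
  have c1: "c = q1 * c1" and cN: "c = q2 * N" using dvd by (auto simp: c1_def N_def dest: dvd_mult_left dvd_mult_right)
  have c1p: "c1 > 0" and Np: "N > 0" using c c1 cN by (auto intro: gr0I)
  let ?I = "\<i> / (2 * of_nat c)"
  have B: "complex_of_real (B1 (of_int j / of_nat c)) = ?I * (\<Sum>k\<in>{0..<int c}. of_real (ct c k) * ee c (k * j))" for j
    by (rule B1_fourier[OF c])
  have arg: "of_int n / of_nat q1 + of_int (a * j) / of_nat c = (of_int (n * int c1 + a * j) / of_nat c :: real)" for n j
    using c1p q1 by (simp add: c1 field_simps)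
  have "dedekind_sum q1 \<eta>1 \<eta>2 a c = (\<Sum>j\<in>{0..<int c}. \<Sum>n\<in>{0..<int q1}.
     cnj (\<eta>2 j) * cnj (\<eta>1 n) * (?I * (\<Sum>k\<in>{0..<int c}. of_real (ct c k) * ee c (k * j)))
       * (?I * (\<Sum>m\<in>{0..<int c}. of_real (ct c m) * ee c (m * (n * int c1 + a * j)))))"
    unfolding dedekind_sum_def arg B ..
  also have "\<dots> = ?I\<^sup>2 * (\<Sum>j\<in>{0..<int c}. \<Sum>n\<in>{0..<int q1}. \<Sum>m\<in>{0..<int c}. \<Sum>k\<in>{0..<int c}.
      of_real (ct c m) * of_real (ct c k) * (cnj (\<eta>2 j) * ee c ((a * m + k) * j)) * (cnj (\<eta>1 n) * ee c (m * n * int c1)))"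
  proof -
    have e: "ee c (m * (n * int c1 + a * j)) * ee c (k * j) = ee c ((a * m + k) * j) * ee c (m * n * int c1)" for m n j k
      unfolding ee_add[symmetric] by (simp add: algebra_simps)
    have "cnj (\<eta>2 j) * cnj (\<eta>1 n) * (?I * (\<Sum>k\<in>{0..<int c}. of_real (ct c k) * ee c (k * j)))
       * (?I * (\<Sum>m\<in>{0..<int c}. of_real (ct c m) * ee c (m * (n * int c1 + a * j))))
      = ?I\<^sup>2 * (\<Sum>m\<in>{0..<int c}. \<Sum>k\<in>{0..<int c}.
      of_real (ct c m) * of_real (ct c k) * (cnj (\<eta>2 j) * ee c ((a * m + k) * j)) * (cnj (\<eta>1 n) * ee c (m * n * int c1)))" (is "?L = ?R") for j n
    proof -
      have "?L = ?I\<^sup>2 * (cnj (\<eta>2 j) * cnj (\<eta>1 n)) * ((\<Sum>m\<in>{0..<int c}. of_real (ct c m) * ee c (m * (n * int c1 + a * j))) * (\<Sum>k\<in>{0..<int c}. of_real (ct c k) * ee c (k * j)))"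
        by (simp add: power2_eq_square mult_ac)
      also have "\<dots> = ?I\<^sup>2 * (\<Sum>m\<in>{0..<int c}. \<Sum>k\<in>{0..<int c}. of_real (ct c m) * of_real (ct c k) * cnj (\<eta>2 j) * cnj (\<eta>1 n) * (ee c (m * (n * int c1 + a * j)) * ee c (k * j)))"
        unfolding sum_product by (simp only: sum_distrib_left mult_ac)
      also have "\<dots> = ?R" unfolding e by (simp only: mult_ac)
      finally show ?thesis .
    qed
    then show ?thesis by (simp only: sum_distrib_left)
  qed
  also have "(\<Sum>j\<in>{0..<int c}. \<Sum>n\<in>{0..<int q1}. \<Sum>m\<in>{0..<int c}. \<Sum>k\<in>{0..<int c}.
      of_real (ct c m) * of_real (ct c k) * (cnj (\<eta>2 j) * ee c ((a * m + k) * j)) * (cnj (\<eta>1 n) * ee c (m * n * int c1)))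
     = (\<Sum>m\<in>{0..<int c}. \<Sum>k\<in>{0..<int c}. \<Sum>j\<in>{0..<int c}. \<Sum>n\<in>{0..<int q1}.
      of_real (ct c m) * of_real (ct c k) * (cnj (\<eta>2 j) * ee c ((a * m + k) * j)) * (cnj (\<eta>1 n) * ee c (m * n * int c1)))"
    by (rule sum4_swap)
  also have "\<dots> = (\<Sum>m\<in>{0..<int c}. \<Sum>k\<in>{0..<int c}. of_real (ct c m) * of_real (ct c k) *
      (\<Sum>j\<in>{0..<int c}. cnj (\<eta>2 j) * ee c ((a * m + k) * j)) * (\<Sum>n\<in>{0..<int q1}. cnj (\<eta>1 n) * ee c (m * n * int c1)))"
    by (intro sum.cong refl sum_sum_product)
  also have "\<dots> = (\<Sum>m\<in>{0..<int c}. \<Sum>k\<in>{0..<int c}. of_real (ct c m) * of_real (ct c k) *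
      (of_nat N * gauss q2 (\<lambda>n. cnj (\<eta>2 n)) * ph (int N) \<eta>2 (a * m + k)) * (\<eta>1 m * gauss q1 (\<lambda>n. cnj (\<eta>1 n))))"
  proof -
    have "(\<Sum>n\<in>{0..<int q1}. cnj (\<eta>1 n) * ee c (m * n * int c1)) = \<eta>1 m * gauss q1 (\<lambda>n. cnj (\<eta>1 n))" for m
      using gauss_primitive[OF primitive_cnj[OF p1], of m] ee_scale[OF c1p, of q1 "m * n" for n]
      by (simp add: c1 mult_ac)
    then show ?thesis using gauss_lift[OF p2 Np] unfolding cN by simp
  qed
  finally show ?thesis by (simp add: dcoef_def N_def sum_distrib_left mult_ac)
qed

section \<open>Non-vanishing of a twisted sum of Dedekind sums\<close>

lemma prod_primes_dvd_iff:
  fixes a :: int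
  assumes "finite X" "\<And>p. p \<in> X \<Longrightarrow> prime p"
  shows "int (\<Prod>X) dvd a \<longleftrightarrow> (\<forall>p\<in>X. int p dvd a)"
  using assms
proof (induction X rule: finite_induct)
  case (insert p X)
  have "coprime p (\<Prod>X)"
    using insert by (intro prod_coprime_right) (auto intro!: primes_coprime)
  then have "coprime (int p) (int (\<Prod>X))" by (simp only: coprime_int_iff)
  then have "int (p * \<Prod>X) dvd a \<longleftrightarrow> int p dvd a \<and> int (\<Prod>X) dvd a"
    using divides_mult[of "int p" a "int (\<Prod>X)"] by (auto dest: dvd_mult_left dvd_mult_right)
  then show ?case using insert by simp
qed simp

lemma prod_primes_dvd:
  fixes n :: nat
  assumes "X \<subseteq> prime_factors n" shows "\<Prod>X dvd n"
proof (cases "n = 0")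
  case False
  have "finite X" using assms finite_subset by blast
  then have "int (\<Prod>X) dvd int n \<longleftrightarrow> (\<forall>p\<in>X. int p dvd int n)"
    using assms by (intro prod_primes_dvd_iff) auto
  moreover have "\<forall>p\<in>X. int p dvd int n" using assms by (auto simp: subset_iff)
  ultimately show ?thesis by (simp only: int_dvd_int_iff)
qed simp

lemma not_coprime_prime:
  assumes "\<not> coprime m (int n)" "n > 0" obtains p where "prime p" "p dvd n" "int p dvd m"
proof -
  have "gcd m (int n) \<noteq> 1" using assms by (simp add: coprime_iff_gcd_eq_1)
  then have "nat (gcd m (int n)) \<noteq> 1" by linarith
  then obtain p where p: "prime p" "p dvd nat (gcd m (int n))" using prime_factor_nat by blast
  have "int p dvd gcd m (int n)" using p by (metis gcd_ge_0_int int_dvd_int_iff nat_0_le)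
  then show ?thesis using that p by auto
qed

text \<open>Expansion of the product of 1 - [p divides a] over the primes p of n. Sets of primes
  stand for squarefree divisors throughout, so the Moebius sign is a power of -1.\<close>

lemma mobius_coprime:
  assumes "n > 0"
  shows "(if coprime a (int n) then 1 else 0) = (\<Sum>X\<in>Pow (prime_factors n). (-1) ^ card X * (if int (\<Prod>X) dvd a then 1 else (0::complex)))"
proof -
  have "(if coprime a (int n) then 1 else (0::complex)) = (\<Prod>p\<in>prime_factors n. - (if int p dvd a then 1 else 0) + 1)"
  proof (cases "coprime a (int n)")
    case True
    have "\<not> int p dvd a" if "p \<in> prime_factors n" for p
      using True that not_prime_unit[of "int p"] by (meson coprime_common_divisor in_prime_factors_iff of_nat_dvd_iff prime_nat_int_transfer)
    then show ?thesis using True by simp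
  next
    case False
    then obtain p where p: "prime p" "p dvd n" "int p dvd a" using not_coprime_prime assms by blast
    then have "p \<in> prime_factors n" "int p dvd a" using p assms by (auto simp: in_prime_factors_iff)
    then show ?thesis using False by (subst prod_zero) auto
  qed
  also have "\<dots> = (\<Sum>X\<in>Pow (prime_factors n). (\<Prod>p\<in>X. - (if int p dvd a then 1 else 0)) * (\<Prod>p\<in>prime_factors n - X. 1))"
    by (rule prod_add) simp
  also have "\<dots> = (\<Sum>X\<in>Pow (prime_factors n). (-1) ^ card X * (if int (\<Prod>X) dvd a then 1 else 0))"
  proof (rule sum.cong[OF refl])
    fix X assume X: "X \<in> Pow (prime_factors n)"
    then have fX: "finite X" using finite_subset by blast
    have "(\<Prod>p\<in>X. - (if int p dvd a then 1 else (0::complex))) = (\<Prod>p\<in>X. (-1) * (if int p dvd a then 1 else 0))" by simp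
    also have "\<dots> = (-1) ^ card X * (\<Prod>p\<in>X. if int p dvd a then 1 else 0)" by (simp only: prod.distrib prod_constant)
    also have "(\<Prod>p\<in>X. if int p dvd a then 1 else 0) = (if int (\<Prod>X) dvd a then 1 else (0::complex))"
    proof -
      have "int (\<Prod>X) dvd a \<longleftrightarrow> (\<forall>p\<in>X. int p dvd a)"
        using X fX by (intro prod_primes_dvd_iff) auto
      then show ?thesis using fX by (auto simp: prod_zero_iff)
    qed
    finally show "(\<Prod>p\<in>X. - (if int p dvd a then 1 else 0)) * (\<Prod>p\<in>prime_factors n - X. 1)
       = (-1) ^ card X * (if int (\<Prod>X) dvd a then 1 else (0::complex))" by simp
  qed
  finally show ?thesis .
qed

lemma ph_periodic:
  assumes "N > 0" "\<And>x. \<eta> (x + q) = \<eta> x"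
  shows "ph N \<eta> (y + N * q * z) = ph N \<eta> y"
proof -
  have "N dvd y + N * q * z \<longleftrightarrow> N dvd y" by (metis dvd_add_left_iff dvd_triv_left mult.assoc)
  moreover have "(y + N * q * z) div N = y div N + q * z" using assms(1) by (simp add: mult.assoc)
  ultimately show ?thesis using periodic_add_mult[of \<eta> q, OF assms(2)] by (simp add: ph_def)
qed

lemma ph_scale:
  assumes "dirichlet_char q \<eta>" "N > 0" "coprime u N"
  shows "ph N \<eta> (u * y) = \<eta> u * ph N \<eta> y"
proof -
  have "N dvd u * y \<longleftrightarrow> N dvd y" using assms(3) by (simp add: coprime_commute coprime_dvd_mult_right_iff)
  moreover have "u * y div N = u * (y div N)" if "N dvd y" using that by (simp add: div_mult_swap)
  ultimately show ?thesis using assms(1) by (simp add: ph_def dc_mult)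
qed

text \<open>\<open>qE\<close> collects the primes at which no character \<open>\<psi>\<close> satisfies the last two conditions. These say
  that \<open>\<psi>\<close> and \<open>\<psi> \<eta>2\<close> are ramified to the full level at \<open>p\<close>; they make the inner sums vanish at
  arguments divisible by \<open>p\<close>, so that the twisted sum factors.\<close>

locale twisted =
  fixes q1 q2 c c' qE N q2' :: nat and \<eta>1 \<eta>2 \<psi> :: "int \<Rightarrow> complex"
  assumes p1: "primitive_char q1 \<eta>1" and p2: "primitive_char q2 \<eta>2"
    and cpos: "c > 0" and cN: "c = N * q2" and q1N: "q1 dvd N"
    and cc': "c = c' * qE" and cop: "coprime c' qE" and q2E: "q2 = q2' * qE"
    and dc\<psi>: "dirichlet_char c' \<psi>"
    and prim_cond: "\<And>p. prime p \<Longrightarrow> p dvd c' \<Longrightarrow> \<not> p dvd q1 \<or> p dvd q2 \<Longrightarrow>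
          \<exists>x. coprime x (int c') \<and> [x = 1] (mod int (c' div p)) \<and> \<psi> x \<noteq> 1"
    and ram_cond: "\<And>p. prime p \<Longrightarrow> p dvd c' \<Longrightarrow> p dvd q2 \<Longrightarrow> \<not> p dvd N \<Longrightarrow>
          \<exists>x. coprime x (int c) \<and> [x = 1] (mod int (c div p)) \<and> \<psi> x * \<eta>2 x \<noteq> 1"
begin

lemma dc1: "dirichlet_char q1 \<eta>1" and dc2: "dirichlet_char q2 \<eta>2"
  using p1 p2 by (auto dest: primitive_dc)

lemma pos: "c' > 0" "qE > 0" "N > 0" "q2' > 0" "q2 > 0" "q1 > 0"
  using cpos cN cc' q2E q1N dc_pos[OF dc1] by (auto intro: gr0I)

lemma c'N: "c' = N * q2'"
  using cN cc' q2E pos by simp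

text \<open>A unit x that is 1 modulo n / p fixes the multiples of p modulo n. Hence a function of
  period n that x multiplies by a factor other than 1 vanishes at those multiples.\<close>

lemma cong_mult_prime_quotient:
  assumes "p dvd n" "int p dvd m" "[x = 1] (mod int (n div p))"
  shows "[x * m = m] (mod int n)"
proof -
  obtain k where k: "n = p * k" using assms by auto
  obtain l where l: "m = int p * l" using assms by auto
  show ?thesis
  proof (cases "p = 0")
    case False
    then have "int k dvd x - 1" using assms(3) k by (simp add: cong_iff_dvd_diff)
    then have "int p * int k dvd int p * ((x - 1) * l)" by (intro mult_dvd_mono) auto
    then show ?thesis by (simp add: cong_iff_dvd_diff k l algebra_simps)
  qed (use k l in simp)
qed

abbreviation pp :: "int \<Rightarrow> complex" where "pp \<equiv> ph (int N) \<eta>2"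

lemma pp_cong:
  assumes "[x = y] (mod int c)" shows "pp x = pp y"
proof -
  obtain z where "y = x + int c * z" using assms by (metis cong_iff_lin)
  then show ?thesis using ph_periodic[of "int N" \<eta>2 "int q2" x z] dc_periodic[OF dc2] pos by (simp add: cN)
qed

text \<open>Twist of the kernel over the multiples of qE modulo c, parametrised by residues modulo
  c'. The sums over multiples of any divisor e of qE that occur in the sieve reduce to it, see
  \<open>multiples_pp\<close>.\<close>

definition Th :: "int \<Rightarrow> int \<Rightarrow> complex" where
  "Th m k = (\<Sum>a\<in>{0..<int c'}. \<psi> a * pp (int qE * a * m + k))"

lemma Th_summand_periodic: "\<psi> (a + int c') * pp (int qE * (a + int c') * m + k) = \<psi> a * pp (int qE * a * m + k)"
proof -
  have "[int qE * (a + int c') * m + k = int qE * a * m + k] (mod int c)"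
    by (simp add: cong_iff_dvd_diff cc' algebra_simps)
  then show ?thesis using pp_cong dc_periodic[OF dc\<psi>] by simp
qed

lemma Th_cong: 
  assumes "[m = m'] (mod int c')" "[k = k'] (mod int c)" shows "Th m k = Th m' k'"
proof -
  have "[int qE * a * m + k = int qE * a * m' + k'] (mod int c)" for a
  proof (rule cong_add[OF _ assms(2)])
    have "int c' dvd m - m'" using assms(1) by (simp add: cong_iff_dvd_diff)
    then have "int c' * int qE dvd (m - m') * (int qE * a)" by (intro mult_dvd_mono) auto
    then show "[int qE * a * m = int qE * a * m'] (mod int c)" by (simp add: cong_iff_dvd_diff cc' algebra_simps)
  qed
  then show ?thesis unfolding Th_def using pp_cong by (intro sum.cong refl) auto
qed

lemma Th_scale_left:
  assumes u: "coprime u (int c')" shows "\<psi> u * Th (u * m) k = Th m k"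
proof -
  have "\<psi> u * Th (u * m) k = (\<Sum>a\<in>{0..<int c'}. \<psi> (u * a) * pp (int qE * (u * a) * m + k))"
    by (simp add: Th_def sum_distrib_left dc_mult[OF dc\<psi>] mult_ac)
  also have "\<dots> = Th m k" unfolding Th_def
    using sum_periodic_scale[of "int c'" "\<lambda>a. \<psi> a * pp (int qE * a * m + k)" u] Th_summand_periodic u pos by simp
  finally show ?thesis .
qed

lemma Th_scale_right:
  assumes u: "coprime u (int c)" shows "Th m (u * k) = \<psi> u * \<eta>2 u * Th m k"
proof -
  have uN: "coprime u (int N)" using u by (simp add: cN)
  have uc': "coprime u (int c')" using u by (simp add: cc')
  have s: "pp (int qE * (u * a) * m + u * k) = \<eta>2 u * pp (int qE * a * m + k)" for a
  proof -
    have "int qE * (u * a) * m + u * k = u * (int qE * a * m + k)" by (simp add: algebra_simps)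
    then show ?thesis using ph_scale[OF dc2 _ uN] pos by simp
  qed
  have "Th m (u * k) = (\<Sum>a\<in>{0..<int c'}. \<psi> (u * a) * pp (int qE * (u * a) * m + u * k))"
    unfolding Th_def
    using sum_periodic_scale[of "int c'" "\<lambda>a. \<psi> a * pp (int qE * a * m + u * k)" u] Th_summand_periodic uc' pos by simp
  also have "\<dots> = \<psi> u * \<eta>2 u * Th m k" unfolding s Th_def by (simp add: sum_distrib_left dc_mult[OF dc\<psi>] mult_ac)
  finally show ?thesis .
qed

text \<open>Units are moved out of both arguments by the scaling laws, so the point is that the left
  side vanishes at non-units. If p divides m and c', either \<open>\<eta>1 m = 0\<close> or \<psi>
  is ramified at p. If p divides k, there are three cases. For p dividing c' and N, p does not
  divide qE a m for a unit a, so N cannot divide the argument of \<open>pp\<close>. For p dividing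
  c' but not N, the product \<psi> \<open>\<eta>2\<close> is ramified at p. For p dividing qE, p
  divides the argument N z but not N, so it divides z and \<open>\<eta>2 z = 0\<close>.\<close>

lemma Th_eq: "\<eta>1 m * Th m k = Th 1 1 * (\<eta>1 m * cnj (\<psi> m)) * (\<psi> k * \<eta>2 k)"
proof (cases "coprime m (int c')")
  case False
  then obtain p where p: "prime p" "p dvd c'" "int p dvd m" using not_coprime_prime pos by blast
  have "\<eta>1 m * Th m k = 0"
  proof (cases "p dvd q1")
    case True
    then have "\<not> coprime m (int q1)" using p not_prime_unit[of "int p"]
      by (meson coprime_common_divisor of_nat_dvd_iff prime_nat_int_transfer)
    then show ?thesis using dc_eq_0_iff[OF dc1] by simp
  next
    case f: False
    then obtain x where x: "coprime x (int c')" "[x = 1] (mod int (c' div p))" "\<psi> x \<noteq> 1"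
      using prim_cond p by blast
    have "Th (x * m) k = Th m k" 
      using cong_mult_prime_quotient[OF p(2,3) x(2)] by (intro Th_cong) auto
    then have "(\<psi> x - 1) * Th m k = 0" using Th_scale_left[OF x(1), of m k] by (simp add: algebra_simps)
    then show ?thesis using x by simp
  qed
  moreover have "\<psi> m = 0" using False dc_eq_0_iff[OF dc\<psi>] by simp
  ultimately show ?thesis by simp
next
  case m: True
  show ?thesis
  proof (cases "coprime k (int c)")
    case True
    have "\<psi> m * Th m k = Th 1 k" using Th_scale_left[OF m, of 1 k] by simp
    then have "cnj (\<psi> m) * (\<psi> m * Th m k) = cnj (\<psi> m) * Th 1 k" by simp
    then have "Th m k = cnj (\<psi> m) * Th 1 k" using dc_mult_cnj[OF dc\<psi>, of m] m by (simp add: mult.assoc[symmetric] mult.commute)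
    moreover have "Th 1 k = \<psi> k * \<eta>2 k * Th 1 1" using Th_scale_right[OF True, of 1 1] by simp
    ultimately show ?thesis by simp
  next
    case False
    then obtain p where p: "prime p" "p dvd c" "int p dvd k" using not_coprime_prime cpos by blast
    have pint: "prime (int p)" using p by simp
    have "Th m k = 0"
    proof (cases "p dvd c'")
      case pc: True
      show ?thesis
      proof (cases "p dvd N")
        case True
        have "\<psi> a * pp (int qE * a * m + k) = 0" for a
        proof (cases "coprime a (int c')")
          case a: True
          have "\<not> p dvd qE" using pc cop p by (meson coprime_common_divisor_nat not_prime_1 coprime_common_divisor not_prime_unit)
          moreover have "\<not> int p dvd a" "\<not> int p dvd m" using a m pc pint
            by (meson coprime_common_divisor not_prime_unit of_nat_dvd_iff)+
          ultimately have "\<not> int p dvd int qE * a * m" using pint by (simp add: prime_dvd_mult_iff)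
          then have "\<not> int p dvd int qE * a * m + k" using p(3) by (simp add: dvd_add_left_iff)
          then have "\<not> int N dvd int qE * a * m + k" using True by (meson dvd_trans of_nat_dvd_iff)
          then show ?thesis by (simp add: ph_def)
        qed (use dc_eq_0_iff[OF dc\<psi>] in simp)
        then show ?thesis unfolding Th_def by (intro sum.neutral) blast
      next
        case False
        then have "p dvd q2" using pc p unfolding c'N q2E by (simp add: prime_dvd_mult_iff)
        then obtain x where x: "coprime x (int c)" "[x = 1] (mod int (c div p))" "\<psi> x * \<eta>2 x \<noteq> 1"
          using ram_cond p pc False by blast
        have "Th m (x * k) = Th m k" 
          using cong_mult_prime_quotient[OF p(2,3) x(2)] by (intro Th_cong) auto
        then have "(\<psi> x * \<eta>2 x - 1) * Th m k = 0" using Th_scale_right[OF x(1), of m k] by (simp add: algebra_simps)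
        then show ?thesis using x by simp
      qed
    next
      case pc: False
      then have pE: "p dvd qE" and pN: "\<not> p dvd N" using p by (auto simp: cc' c'N prime_dvd_mult_iff)
      have "pp (int qE * a * m + k) = 0" for a
      proof (cases "int N dvd int qE * a * m + k")
        case True
        then obtain z where z: "int qE * a * m + k = int N * z" by auto
        have "int p dvd int qE * a * m + k" using pE p by (simp add: mult.assoc)
        then have "int p dvd z" using pN pint unfolding z by (simp add: prime_dvd_mult_iff)
        moreover have "p dvd q2" using pE q2E by simp
        ultimately have "\<not> coprime z (int q2)" using pint
          by (meson coprime_common_divisor not_prime_unit of_nat_dvd_iff)
        then show ?thesis using dc_eq_0_iff[OF dc2] pos z by (simp add: ph_def)
      qed (simp add: ph_def)
      then show ?thesis unfolding Th_def by simp
    qed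
    moreover have "\<psi> k * \<eta>2 k = 0"
    proof -
      have "\<not> coprime k (int c') \<or> \<not> coprime k (int q2)" using False by (auto simp: cc' q2E)
      then show ?thesis using dc_eq_0_iff[OF dc\<psi>] dc_eq_0_iff[OF dc2] by auto
    qed
    ultimately show ?thesis by simp
  qed
qed

text \<open>As a function of k, \<open>Th 1 k\<close> is a convolution of \<psi> with
  \<open>pp\<close>, so its transform is a product. It is used to see that \<open>Th\<close> does
  not vanish identically.\<close>

lemma Th_fourier:
  "(\<Sum>k\<in>{0..<int c}. Th 1 k * ee c (l * k)) = cnj (\<eta>2 l) * gauss q2 \<eta>2 * (\<Sum>a\<in>{0..<int c'}. \<psi> a * ee c' (- (l * a)))"
proof -
  have S: "(\<Sum>k\<in>{0..<int c}. pp k * ee c (l * k)) = cnj (\<eta>2 l) * gauss q2 \<eta>2"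
  proof -
    have "(\<Sum>k\<in>{0..<int q2 * int N}. pp k * ee c (l * k)) = (\<Sum>k\<in>{0..<int q2 * int N}. if int N dvd k then \<eta>2 (k div int N) * ee c (l * k) else 0)"
      by (rule sum.cong) (auto simp: ph_def)
    also have "\<dots> = (\<Sum>s\<in>{0..<int q2}. \<eta>2 s * ee q2 (l * s))"
      using pos ee_scale[of N q2 "l * s" for s] by (subst sum_multiples) (simp_all add: cN mult_ac)
    finally show ?thesis using gauss_primitive[OF p2, of l] by (simp add: cN mult.commute)
  qed
  have sh: "(\<Sum>k\<in>{0..<int c}. pp (int qE * a + k) * ee c (l * k)) = ee c' (- (l * a)) * (cnj (\<eta>2 l) * gauss q2 \<eta>2)" for a
  proof -
    let ?g = "\<lambda>k. pp k * ee c (l * k)"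
    have per: "?g (k + int c) = ?g k" for k
      using pp_cong[of "k + int c" k] ee_cong[OF cpos, of "l * (k + int c)" "l * k"] by (simp add: cong_iff_dvd_diff algebra_simps)
    have e: "ee c (l * k) = ee c (l * (k + int qE * a)) * ee c' (- (l * a))" for k
    proof -
      have "ee c (l * k) = ee c (l * (k + int qE * a) + int qE * (- (l * a)))"
        by (rule arg_cong[of _ _ "ee c"]) (simp add: algebra_simps)
      then show ?thesis using ee_scale[OF pos(2), of c' "- (l * a)"] by (simp only: ee_add cc')
    qed
    have "(\<Sum>k\<in>{0..<int c}. pp (int qE * a + k) * ee c (l * k)) = (\<Sum>k\<in>{0..<int c}. ?g (k + int qE * a)) * ee c' (- (l * a))"
      unfolding sum_distrib_right
    proof (intro sum.cong refl)
      fix k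
      show "pp (int qE * a + k) * ee c (l * k) = pp (k + int qE * a) * ee c (l * (k + int qE * a)) * ee c' (- (l * a))"
        unfolding e[of k] by (simp only: add.commute mult.assoc)
    qed
    also have "(\<Sum>k\<in>{0..<int c}. ?g (k + int qE * a)) = (\<Sum>k\<in>{0..<int c}. ?g k)"
      using sum_periodic_shift[of "int c" ?g "int qE * a", OF _ per] cpos by simp
    finally show ?thesis unfolding S by (simp add: mult.commute)
  qed
  have "(\<Sum>k\<in>{0..<int c}. Th 1 k * ee c (l * k)) = (\<Sum>a\<in>{0..<int c'}. \<psi> a * (\<Sum>k\<in>{0..<int c}. pp (int qE * a + k) * ee c (l * k)))"
    unfolding Th_def sum_distrib_left sum_distrib_right by (subst sum.swap) (simp add: mult.assoc)
  then show ?thesis unfolding sh by (simp add: sum_distrib_left sum_distrib_right mult_ac)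
qed

text \<open>If \<open>Th 1 1 = 0\<close>, then \<open>Th 1\<close> vanishes by \<open>Th_eq\<close>,
  and \<open>Th_fourier\<close> makes the transform G of \<psi> vanish at all l prime to q2. For l
  prime to q2' only, l may be changed modulo c' so as to become 1 modulo qE. For the remaining l,
  ramification of \<psi> at a common prime gives G l = 0. Then \<psi> itself would be 0.\<close>

lemma Th_nonzero: "Th 1 1 \<noteq> 0"
proof
  assume z: "Th 1 1 = 0"
  have "Th 1 k = 0" for k using Th_eq[of 1 k] z dc1 by simp
  then have F0: "cnj (\<eta>2 l) * gauss q2 \<eta>2 * (\<Sum>a\<in>{0..<int c'}. \<psi> a * ee c' (- (l * a))) = 0" for l
    using Th_fourier[of l] by simp
  have g0: "gauss q2 \<eta>2 \<noteq> 0" using gauss_norm[OF p2] pos by auto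
  define G where "G = (\<lambda>l. \<Sum>a\<in>{0..<int c'}. \<psi> a * ee c' (- (l * a)))"
  have G1: "G l = 0" if "coprime l (int q2)" for l
    using F0[of l] g0 dc_eq_0_iff[OF dc2, of l] that by (simp add: G_def)
  have Gper: "G l = G l'" if "[l = l'] (mod int c')" for l l'
  proof -
    have "ee c' (- (l * a)) = ee c' (- (l' * a))" for a
      by (rule ee_cong[OF pos(1)]) (use that in \<open>simp add: cong_minus_minus_iff cong_scalar_right\<close>)
    then show ?thesis by (simp add: G_def)
  qed
  have "G l = 0" for l
  proof (cases "coprime l (int q2')")
    case True
    obtain i where i: "[int c' * i = 1 - l] (mod int qE)"
    proof -
      obtain j where "[int c' * j = 1] (mod int qE)" using cop cong_solve_coprime_int[of "int c'" "int qE"] by auto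
      then have "[int c' * (j * (1 - l)) = 1 - l] (mod int qE)"
        using cong_scalar_right[of "int c' * j" 1 "int qE" "1 - l"] by (simp add: mult.assoc)
      then show ?thesis using that by blast
    qed
    define l' where "l' = l + int c' * i"
    have "[l' = 1] (mod int qE)" unfolding l'_def using cong_add[OF cong_refl[of l] i] by simp
    then have "coprime l' (int qE)" by (metis cong_imp_coprime cong_sym coprime_1_left)
    moreover have "coprime l' (int q2')"
    proof -
      have "[l = l'] (mod int q2')" unfolding l'_def c'N by (simp add: cong_iff_dvd_diff)
      then show ?thesis using True cong_imp_coprime by blast
    qed
    ultimately have "G l' = 0" using G1 by (simp add: q2E)
    moreover have "[l = l'] (mod int c')" unfolding l'_def by (simp add: cong_iff_dvd_diff)
    ultimately show ?thesis using Gper by simp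
  next
    case False
    then obtain p where p: "prime p" "p dvd q2'" "int p dvd l" using not_coprime_prime pos by blast
    then have pc: "p dvd c'" "p dvd q2" by (auto simp: c'N q2E)
    then obtain x where x: "coprime x (int c')" "[x = 1] (mod int (c' div p))" "\<psi> x \<noteq> 1"
      using prim_cond p by blast
    have "\<psi> x * G (x * l) = G l"
    proof -
      have "\<psi> x * G (x * l) = (\<Sum>a\<in>{0..<int c'}. \<psi> (x * a) * ee c' (- (l * (x * a))))"
        by (simp add: G_def sum_distrib_left dc_mult[OF dc\<psi>] mult_ac)
      also have "\<dots> = G l" unfolding G_def
      proof (rule sum_periodic_scale[where f = "\<lambda>a. \<psi> a * ee c' (- (l * a))"])
        show "\<psi> (a + int c') * ee c' (- (l * (a + int c'))) = \<psi> a * ee c' (- (l * a))" for a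
          using dc_periodic[OF dc\<psi>] ee_cong[OF pos(1), of "- (l * (a + int c'))" "- (l * a)"]
          by (simp add: cong_iff_dvd_diff algebra_simps)
      qed (use pos x in auto)
      finally show ?thesis .
    qed
    moreover have "G (x * l) = G l" using Gper[OF cong_mult_prime_quotient[OF pc(1) p(3) x(2)]] .
    ultimately have "(\<psi> x - 1) * G l = 0" by (simp add: algebra_simps)
    then show ?thesis using x by simp
  qed
  then have "\<psi> 1 = 0"
    using fourier_inversion[OF pos(1), of \<psi> 1] dc_periodic[OF dc\<psi>] unfolding G_def by simp
  then show False using dc\<psi> by simp
qed

end

section \<open>Sieving to the units, and moduli that are twice an odd number\<close>

lemma sum_odd_residues:
  fixes g :: "int \<Rightarrow> complex"
  assumes c: "c > 0" "odd c" and per: "\<And>x. g (x + int c) = g x"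
  shows "(\<Sum>a\<in>{0..<int (2 * c)}. if odd a then g a else 0) = (\<Sum>a\<in>{0..<int c}. g a)"
proof -
  have tot: "(\<Sum>a\<in>{0..<int c * 2}. g a) = 2 * (\<Sum>a\<in>{0..<int c}. g a)"
    using sum_periodic_blocks[of "int c" 2 g, OF _ _ per] c by simp
  have ev: "(\<Sum>a\<in>{0..<int c * 2}. if 2 dvd a then g a else 0) = (\<Sum>a\<in>{0..<int c}. g a)"
    using sum_multiples[of "int c" 2 g] sum_periodic_scale[of "int c" g 2, OF _ per] c by simp
  have "(\<Sum>a\<in>{0..<int c * 2}. g a) = (\<Sum>a\<in>{0..<int c * 2}. if 2 dvd a then g a else 0) + (\<Sum>a\<in>{0..<int c * 2}. if odd a then g a else 0)"
    unfolding sum.distrib[symmetric] by (rule sum.cong) auto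
  then show ?thesis using tot ev by (simp add: mult.commute)
qed

text \<open>This expression is the factor by which doubling an odd modulus changes the twisted sum.
  If it vanished, z + w = z w + 2; conjugation and multiplication by z w give z + w = 1 + 2 z w.
  Together z w = 1 and z + w = 3, too large for two numbers of modulus 1.\<close>

lemma mult_add_reflected_nonzero:
  assumes "cmod z = 1" "cmod w = 1"
  shows "z * w + (2 - z) * (2 - w) \<noteq> (0::complex)"
proof
  assume "z * w + (2 - z) * (2 - w) = 0"
  then have "2 * (z * w - z - w + 2) = 0" by (simp add: algebra_simps)
  then have "z * w - z - w + 2 = 0" by (simp only: mult_eq_0_iff) simp
  moreover have "z + w = z * w + 2 - (z * w - z - w + 2)" by simp
  ultimately have e: "z + w = z * w + 2" by simp
  have zz: "z * cnj z = 1" "w * cnj w = 1" using assms complex_norm_square[of z] complex_norm_square[of w] by simp_all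
  have "cnj (z + w) = cnj (z * w + 2)" using e by simp
  then have A: "z * w * (cnj z + cnj w) = z * w * (cnj z * cnj w + 2)" by simp
  have "z * w * (cnj z + cnj w) = (z * cnj z) * w + z * (w * cnj w)" by (simp add: algebra_simps)
  then have B: "z * w * (cnj z + cnj w) = z + w" unfolding zz by (simp add: add.commute)
  have "z * w * (cnj z * cnj w + 2) = (z * cnj z) * (w * cnj w) + 2 * (z * w)" by (simp add: algebra_simps)
  then have C: "z * w * (cnj z * cnj w + 2) = 1 + 2 * (z * w)" unfolding zz by simp
  have e2: "z + w = 1 + 2 * (z * w)" using A unfolding B C .
  then have "z * w = 1" using e by (simp add: algebra_simps)
  then have "z + w = 3" using e by simp
  then have "cmod (z + w) = 3" by simp
  then show False using norm_triangle_ineq[of z w] assms by simp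
qed

lemma sum_swap_weighted:
  fixes u :: "'m \<Rightarrow> 'k \<Rightarrow> complex"
  shows "(\<Sum>a\<in>A. if Q a then w a * (\<Sum>m\<in>M. \<Sum>k\<in>K. u m k * p a m k) else 0)
     = (\<Sum>m\<in>M. \<Sum>k\<in>K. u m k * (\<Sum>a\<in>A. if Q a then w a * p a m k else 0))"
proof -
  have "(\<Sum>a\<in>A. if Q a then w a * (\<Sum>m\<in>M. \<Sum>k\<in>K. u m k * p a m k) else 0)
     = (\<Sum>a\<in>A. \<Sum>m\<in>M. \<Sum>k\<in>K. u m k * (if Q a then w a * p a m k else 0))"
    by (intro sum.cong refl) (auto simp: sum_distrib_left mult_ac)
  also have "\<dots> = (\<Sum>m\<in>M. \<Sum>a\<in>A. \<Sum>k\<in>K. u m k * (if Q a then w a * p a m k else 0))" by (rule sum.swap)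
  also have "\<dots> = (\<Sum>m\<in>M. \<Sum>k\<in>K. \<Sum>a\<in>A. u m k * (if Q a then w a * p a m k else 0))"
    by (intro sum.cong refl sum.swap)
  finally show ?thesis by (simp only: sum_distrib_left)
qed

context twisted
begin

definition Phi :: "int \<Rightarrow> int \<Rightarrow> complex" where
  "Phi m k = (\<Sum>a\<in>{0..<int c}. if coprime a (int qE) then \<psi> a * pp (a * m + k) else 0)"

text \<open>A progression of length f is one of q2' e equal pieces of a full period of
  \<open>\<eta>2\<close>, and over the full period \<open>primitive_sum_progression\<close> applies
  with step q2' e m.\<close>

lemma progression_pp:
  assumes qE: "qE = e * f"
  shows "(\<Sum>i\<in>{0..<int f}. pp (Y + int N * (int q2' * int e * m) * i)) = (if int f dvd m then of_nat f * pp Y else 0)"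
proof (cases "int N dvd Y")
  case False
  then have "\<not> int N dvd Y + int N * (int q2' * int e * m) * i" for i
    by (metis dvd_add_left_iff dvd_triv_left mult.assoc)
  then show ?thesis using False by (simp add: ph_def)
next
  case True
  then obtain z where z: "Y = int N * z" by auto
  define B where "B = int q2' * int e * m"
  have ef: "e > 0" "f > 0" using qE pos by auto
  have q2: "int q2 = int f * (int q2' * int e)" by (simp add: q2E qE)
  have "Y + int N * B * i = int N * (z + B * i)" for i by (simp add: z algebra_simps)
  then have pv: "pp (Y + int N * B * i) = \<eta>2 (z + B * i)" for i using pos by (simp add: ph_def)
  have "of_nat (nat (int q2' * int e)) * (\<Sum>i\<in>{0..<int f}. \<eta>2 (z + B * i)) = (\<Sum>i\<in>{0..<int q2}. \<eta>2 (z + B * i))"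
  proof -
    have "\<eta>2 (z + B * (i + int f)) = \<eta>2 (z + B * i)" for i
      by (rule dc_cong[OF dc2]) (simp add: cong_iff_dvd_diff B_def q2 algebra_simps)
    then show ?thesis unfolding q2
      using sum_periodic_blocks[of "int f" "int q2' * int e" "\<lambda>i. \<eta>2 (z + B * i)"] ef pos by simp
  qed
  also have "\<dots> = (if int q2 dvd B then of_nat q2 * \<eta>2 z else 0)" by (rule primitive_sum_progression[OF p2])
  also have "int q2 dvd B \<longleftrightarrow> int f dvd m"
    using ef pos by (simp add: q2 B_def mult.commute[of "int f"])
  also have "complex_of_nat q2 = of_nat (nat (int q2' * int e)) * of_nat f"
    using q2 by (metis int_ops(7) mult.commute nat_int of_nat_mult)
  finally have "complex_of_nat (nat (int q2' * int e)) * (\<Sum>i\<in>{0..<int f}. \<eta>2 (z + B * i)) = of_nat (nat (int q2' * int e)) * (if int f dvd m then of_nat f * \<eta>2 z else 0)"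
    by simp
  moreover have "complex_of_nat (nat (int q2' * int e)) \<noteq> 0" using ef pos by simp
  ultimately have "(\<Sum>i\<in>{0..<int f}. \<eta>2 (z + B * i)) = (if int f dvd m then of_nat f * \<eta>2 z else 0)"
    using mult_left_cancel by blast
  moreover have "pp Y = \<eta>2 z" using pos by (simp add: ph_def z)
  ultimately show ?thesis unfolding B_def[symmetric] pv by simp
qed

text \<open>Write a = e (b + c' i). The character \<psi> sees only b, so the sum over i is the one
  of \<open>progression_pp\<close> and leaves only m divisible by f; there e b m = qE b (m / f),
  which is the argument in \<open>Th\<close>.\<close>

lemma multiples_pp:
  assumes qE: "qE = e * f"
  shows "(\<Sum>a\<in>{0..<int c}. if int e dvd a then \<psi> a * pp (a * m + k) else 0)
     = (if int f dvd m then of_nat f * \<psi> (int e) * Th (m div int f) k else 0)"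
proof -
  have ef: "e > 0" "f > 0" using qE pos by auto
  have ci: "int c = (int c' * int f) * int e" by (simp add: cc' qE)
  have "(\<Sum>a\<in>{0..<int c}. if int e dvd a then \<psi> a * pp (a * m + k) else 0)
     = (\<Sum>b\<in>{0..<int c' * int f}. \<psi> (int e * b) * pp (int e * b * m + k))"
    unfolding ci using ef pos by (subst sum_multiples) simp_all
  also have "\<dots> = (\<Sum>b\<in>{0..<int c'}. \<Sum>i\<in>{0..<int f}. \<psi> (int e * (b + int c' * i)) * pp (int e * (b + int c' * i) * m + k))"
    using ef pos by (subst sum_split_residues) simp_all
  also have "\<dots> = (\<Sum>b\<in>{0..<int c'}. \<psi> (int e * b) * (\<Sum>i\<in>{0..<int f}. pp ((int e * b * m + k) + int N * (int q2' * int e * m) * i)))"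
    unfolding sum_distrib_left
  proof (intro sum.cong refl)
    fix b i
    have "\<psi> (int e * (b + int c' * i)) = \<psi> (int e * b)"
      by (rule dc_cong[OF dc\<psi>]) (simp add: cong_iff_dvd_diff algebra_simps)
    moreover have "int e * (b + int c' * i) * m + k = (int e * b * m + k) + int N * (int q2' * int e * m) * i"
      by (simp add: c'N algebra_simps)
    ultimately show "\<psi> (int e * (b + int c' * i)) * pp (int e * (b + int c' * i) * m + k)
      = \<psi> (int e * b) * pp ((int e * b * m + k) + int N * (int q2' * int e * m) * i)" by (simp only:)
  qed
  also have "\<dots> = (\<Sum>b\<in>{0..<int c'}. \<psi> (int e * b) * (if int f dvd m then of_nat f * pp (int e * b * m + k) else 0))"
    unfolding progression_pp[OF qE] ..
  also have "\<dots> = (if int f dvd m then of_nat f * \<psi> (int e) * Th (m div int f) k else 0)"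
  proof (cases "int f dvd m")
    case True
    then obtain m' where m': "m = int f * m'" by auto
    have eq: "int e * b * m = int qE * b * m'" for b by (simp add: m' qE algebra_simps)
    have "m div int f = m'" using ef by (simp add: m')
    then show ?thesis using True unfolding eq Th_def by (simp add: dc_mult[OF dc\<psi>] sum_distrib_left mult_ac)
  qed simp
  finally show ?thesis .
qed

definition th :: "int \<Rightarrow> complex" where "th m = \<eta>1 m * cnj (\<psi> m)"

lemma dc_th: "dirichlet_char c' th"
proof -
  have "q1 dvd c'" using q1N c'N by simp
  moreover have "q1 dvd c' \<Longrightarrow> coprime x (int q1) \<Longrightarrow> coprime x (int c') \<Longrightarrow> coprime x (int c')" for x by simp
  ultimately show ?thesis using dc_mult_char[OF dc1 dc_cnj[OF dc\<psi>], of c'] pos by (simp add: th_def[abs_def])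
qed

lemma dc_F2: "dirichlet_char c (\<lambda>k. \<psi> k * \<eta>2 k)"
proof (rule dc_mult_char[OF dc\<psi> dc2 _ _ cpos])
  show "c' dvd c" by (simp add: cc')
  show "q2 dvd c" by (simp add: cN)
  show "coprime x (int c)" if "coprime x (int c')" "coprime x (int q2)" for x
    using that by (simp add: cc' q2E)
qed

text \<open>The factor depending on m in the twisted kernel, see \<open>Phi_eq\<close>: the sieve at
  qE replaces the character \<open>th\<close> by a combination of its dilates.\<close>

definition F1 :: "int \<Rightarrow> complex" where
  "F1 m = (\<Sum>X\<in>Pow (prime_factors qE). let e = \<Prod>X; f = qE div e in
      (-1) ^ card X * (if int f dvd m then of_nat f * \<psi> (int e) * \<eta>1 (int f) * th (m div int f) else 0))"

lemma Phi_eq: "\<eta>1 m * Phi m k = Th 1 1 * F1 m * (\<psi> k * \<eta>2 k)"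
proof -
  have "Phi m k = (\<Sum>a\<in>{0..<int c}. (\<Sum>X\<in>Pow (prime_factors qE). (-1) ^ card X * (if int (\<Prod>X) dvd a then 1 else 0)) * (\<psi> a * pp (a * m + k)))"
    unfolding Phi_def mobius_coprime[OF pos(2), symmetric] by (rule sum.cong[OF refl]) simp
  also have "\<dots> = (\<Sum>X\<in>Pow (prime_factors qE). (-1) ^ card X * (\<Sum>a\<in>{0..<int c}. if int (\<Prod>X) dvd a then \<psi> a * pp (a * m + k) else 0))"
    unfolding sum_distrib_left sum_distrib_right by (subst sum.swap) (intro sum.cong refl, simp)
  finally have "\<eta>1 m * Phi m k = (\<Sum>X\<in>Pow (prime_factors qE). (-1) ^ card X * (\<eta>1 m * (\<Sum>a\<in>{0..<int c}. if int (\<Prod>X) dvd a then \<psi> a * pp (a * m + k) else 0)))"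
    by (simp add: sum_distrib_left mult_ac)
  also have "\<dots> = (\<Sum>X\<in>Pow (prime_factors qE). let e = \<Prod>X; f = qE div e in
      (-1) ^ card X * (if int f dvd m then of_nat f * \<psi> (int e) * \<eta>1 (int f) * th (m div int f) else 0) * (Th 1 1 * (\<psi> k * \<eta>2 k)))"
  proof (rule sum.cong[OF refl])
    fix X assume X: "X \<in> Pow (prime_factors qE)"
    define e where "e = \<Prod>X" define f where "f = qE div e"
    have qE: "qE = e * f" using prod_primes_dvd[of X qE] X by (simp add: e_def f_def)
    have "\<eta>1 m * (if int f dvd m then of_nat f * \<psi> (int e) * Th (m div int f) k else 0)
        = (if int f dvd m then of_nat f * \<psi> (int e) * \<eta>1 (int f) * th (m div int f) else 0) * (Th 1 1 * (\<psi> k * \<eta>2 k))"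
    proof (cases "int f dvd m")
      case True
      then obtain m' where m': "m = int f * m'" by auto
      have f0: "f > 0" using qE pos by auto
      have "\<eta>1 m * (of_nat f * \<psi> (int e) * Th m' k) = of_nat f * \<psi> (int e) * \<eta>1 (int f) * (\<eta>1 m' * Th m' k)"
        by (simp add: m' dc_mult[OF dc1] mult_ac)
      then show ?thesis using f0 unfolding Th_eq[of m' k] by (simp add: m' th_def mult_ac)
    qed simp
    then show "(-1) ^ card X * (\<eta>1 m * (\<Sum>a\<in>{0..<int c}. if int (\<Prod>X) dvd a then \<psi> a * pp (a * m + k) else 0)) =
       (let e = \<Prod>X; f = qE div e in
      (-1) ^ card X * (if int f dvd m then of_nat f * \<psi> (int e) * \<eta>1 (int f) * th (m div int f) else 0) * (Th 1 1 * (\<psi> k * \<eta>2 k)))"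
      using multiples_pp[OF qE, of m k] by (simp only: Let_def e_def[symmetric] f_def[symmetric] mult.assoc)
  qed
  also have "\<dots> = F1 m * (Th 1 1 * (\<psi> k * \<eta>2 k))"
    unfolding F1_def sum_distrib_right Let_def ..
  finally show ?thesis by (simp add: mult_ac)
qed

text \<open>Every dilate contributes the same cotangent sum of \<open>th\<close> at level c', since
  the scale f cancels in the cotangent and the remaining level c' e costs only a factor e. The
  signed coefficients then form a product of Euler factors over the primes of qE.\<close>

lemma sum_F1:
  "(\<Sum>m\<in>{0..<int c}. F1 m * of_real (ct c m))
    = of_nat qE * \<eta>1 (int qE) * (\<Sum>m\<in>{0..<int c'}. th m * of_real (ct c' m)) * (\<Prod>p\<in>prime_factors qE. 1 - cnj (th (int p)))"
proof -
  define L where "L = (\<Sum>m\<in>{0..<int c'}. th m * of_real (ct c' m))"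
  have c1E: "coprime (int qE) (int q1)"
  proof -
    have "q1 dvd c'" using q1N c'N by simp
    then have "coprime q1 qE" by (rule coprime_divisors[OF _ dvd_refl cop])
    then show ?thesis by (simp add: coprime_commute)
  qed
  have "(\<Sum>m\<in>{0..<int c}. F1 m * of_real (ct c m)) = (\<Sum>X\<in>Pow (prime_factors qE). let e = \<Prod>X; f = qE div e in
      (-1) ^ card X * (\<Sum>m\<in>{0..<int c}. if int f dvd m then of_nat f * \<psi> (int e) * \<eta>1 (int f) * th (m div int f) * of_real (ct c m) else 0))"
    unfolding F1_def sum_distrib_right Let_def sum_distrib_left
    by (subst sum.swap) (intro sum.cong refl, simp)
  also have "\<dots> = (\<Sum>X\<in>Pow (prime_factors qE). of_nat qE * \<eta>1 (int qE) * L * ((\<Prod>p\<in>X. - cnj (th (int p))) * (\<Prod>p\<in>prime_factors qE - X. 1)))"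
  proof (rule sum.cong[OF refl])
    fix X assume X: "X \<in> Pow (prime_factors qE)"
    define e where "e = \<Prod>X" define f where "f = qE div e"
    have qE: "qE = e * f" using prod_primes_dvd[of X qE] X by (simp add: e_def f_def)
    have ef: "e > 0" "f > 0" using qE pos by auto
    have ci: "int c = int (c' * e) * int f" by (simp add: cc' qE)
    have "(\<Sum>m\<in>{0..<int c}. if int f dvd m then of_nat f * \<psi> (int e) * \<eta>1 (int f) * th (m div int f) * of_real (ct c m) else 0)
      = (\<Sum>y\<in>{0..<int (c' * e)}. of_nat f * \<psi> (int e) * \<eta>1 (int f) * th y * of_real (ct c (int f * y)))"
      unfolding ci using ef pos by (subst sum_multiples) simp_all
    also have "\<dots> = of_nat f * \<psi> (int e) * \<eta>1 (int f) * (\<Sum>y\<in>{0..<int (c' * e)}. th y * of_real (ct (c' * e) y))"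
    proof -
      have "ct c (int f * y) = ct (c' * e) y" for y
        using ct_scale[OF ef(2), of "c' * e" y] by (simp add: cc' qE mult_ac)
      then show ?thesis by (simp add: sum_distrib_left mult_ac)
    qed
    also have "(\<Sum>y\<in>{0..<int (c' * e)}. th y * of_real (ct (c' * e) y)) = of_nat e * L"
      unfolding L_def by (rule sum_ct_level[where f = th, OF pos(1) ef(1) dc_periodic[OF dc_th]])
    also have "of_nat f * \<psi> (int e) * \<eta>1 (int f) * (of_nat e * L) = of_nat qE * \<eta>1 (int qE) * L * (\<psi> (int e) * cnj (\<eta>1 (int e)))"
    proof -
      have "coprime (int e) (int q1)" using c1E qE by simp
      then have "\<eta>1 (int e) * cnj (\<eta>1 (int e)) = 1" using dc_mult_cnj[OF dc1] by simp
      moreover have "\<eta>1 (int qE) = \<eta>1 (int e) * \<eta>1 (int f)" by (simp add: qE dc_mult[OF dc1])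
      ultimately have "\<eta>1 (int f) = \<eta>1 (int qE) * cnj (\<eta>1 (int e))" by simp
      moreover have "complex_of_nat qE = of_nat e * of_nat f" by (simp add: qE)
      ultimately show ?thesis by simp
    qed
    finally have s: "(\<Sum>m\<in>{0..<int c}. if int f dvd m then of_nat f * \<psi> (int e) * \<eta>1 (int f) * th (m div int f) * of_real (ct c m) else 0)
      = of_nat qE * \<eta>1 (int qE) * L * (\<psi> (int e) * cnj (\<eta>1 (int e)))" .
    have "(\<Prod>p\<in>X. - cnj (th (int p))) = (\<Prod>p\<in>X. (-1) * (\<psi> (int p) * cnj (\<eta>1 (int p))))"
      by (simp add: th_def mult.commute)
    also have "\<dots> = (-1) ^ card X * (\<psi> (int e) * cnj (\<eta>1 (int e)))"
      by (simp only: prod.distrib prod_constant e_def of_nat_prod id_apply dc_prod[OF dc\<psi>] dc_prod[OF dc1] cnj_prod)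
    finally have "(-1) ^ card X * (of_nat qE * \<eta>1 (int qE) * L * (\<psi> (int e) * cnj (\<eta>1 (int e)))) 
        = of_nat qE * \<eta>1 (int qE) * L * ((\<Prod>p\<in>X. - cnj (th (int p))) * (\<Prod>p\<in>prime_factors qE - X. 1))"
      by (simp add: mult_ac)
    then show "(let e = \<Prod>X; f = qE div e in
      (-1) ^ card X * (\<Sum>m\<in>{0..<int c}. if int f dvd m then of_nat f * \<psi> (int e) * \<eta>1 (int f) * th (m div int f) * of_real (ct c m) else 0))
       = of_nat qE * \<eta>1 (int qE) * L * ((\<Prod>p\<in>X. - cnj (th (int p))) * (\<Prod>p\<in>prime_factors qE - X. 1))"
      using s by (simp only: Let_def e_def[symmetric] f_def[symmetric])
  qed
  also have "\<dots> = of_nat qE * \<eta>1 (int qE) * L * (\<Prod>p\<in>prime_factors qE. - cnj (th (int p)) + 1)"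
    unfolding sum_distrib_left[symmetric] by (subst prod_add) simp_all
  finally show ?thesis by (simp add: L_def)
qed

lemma F1_scale:
  assumes "coprime u (int c)" shows "F1 (u * m) = th u * F1 m"
  unfolding F1_def sum_distrib_left
proof (rule sum.cong[OF refl])
  fix X assume X: "X \<in> Pow (prime_factors qE)"
  define e where "e = \<Prod>X" define f where "f = qE div e"
  have qE: "qE = e * f" using prod_primes_dvd[of X qE] X by (simp add: e_def f_def)
  have "coprime u (int f)" using assms by (simp add: cc' qE)
  then have "int f dvd u * m \<longleftrightarrow> int f dvd m" by (simp add: coprime_commute coprime_dvd_mult_right_iff)
  moreover have "th (u * m div int f) = th u * th (m div int f)" if "int f dvd m"
    using that by (simp add: div_mult_swap[symmetric] dc_mult[OF dc_th])
  ultimately show "(let e = \<Prod>X; f = qE div e in (-1) ^ card X * (if int f dvd u * m then of_nat f * \<psi> (int e) * \<eta>1 (int f) * th (u * m div int f) else 0))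
     = th u * (let e = \<Prod>X; f = qE div e in (-1) ^ card X * (if int f dvd m then of_nat f * \<psi> (int e) * \<eta>1 (int f) * th (m div int f) else 0))"
    by (simp add: Let_def e_def[symmetric] f_def[symmetric] mult_ac)
qed

lemma F1_periodic: "F1 (m + int c) = F1 m"
  unfolding F1_def
proof (rule sum.cong[OF refl])
  fix X assume X: "X \<in> Pow (prime_factors qE)"
  define e where "e = \<Prod>X" define f where "f = qE div e"
  have qE: "qE = e * f" using prod_primes_dvd[of X qE] X by (simp add: e_def f_def)
  have f0: "f > 0" using qE pos by auto
  have ci: "int c = int f * (int c' * int e)" by (simp add: cc' qE)
  have "int f dvd m + int c \<longleftrightarrow> int f dvd m" unfolding ci by (simp add: dvd_add_left_iff)
  moreover have "th ((m + int c) div int f) = th (m div int f)"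
    unfolding ci using f0 periodic_add_mult[of th "int c'" "m div int f" "int e"] dc_periodic[OF dc_th] by (simp add: add.commute)
  ultimately show "(let e = \<Prod>X; f = qE div e in (-1) ^ card X * (if int f dvd m + int c then of_nat f * \<psi> (int e) * \<eta>1 (int f) * th ((m + int c) div int f) else 0))
     = (let e = \<Prod>X; f = qE div e in (-1) ^ card X * (if int f dvd m then of_nat f * \<psi> (int e) * \<eta>1 (int f) * th (m div int f) else 0))"
    by (simp only: Let_def e_def[symmetric] f_def[symmetric])
qed

lemma cot_sums_nonzero:
  assumes par: "\<eta>1 (-1) * \<eta>2 (-1) = 1" and odd: "\<eta>1 (-1) * \<psi> (-1) = -1"
    and E: "\<And>p. prime p \<Longrightarrow> p dvd qE \<Longrightarrow> th (int p) \<noteq> 1"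
  shows "(\<Sum>m\<in>{0..<int c}. F1 m * of_real (ct c m)) \<noteq> 0" "(\<Sum>k\<in>{0..<int c}. (\<psi> k * \<eta>2 k) * of_real (ct c k)) \<noteq> 0"
proof -
  have c\<psi>: "cnj (\<psi> (-1)) = \<psi> (-1)" using dc_neg_one_cases[OF dc\<psi>] by auto
  have "th (-1) = -1" using odd by (simp add: th_def c\<psi>)
  then have "(\<Sum>m\<in>{0..<int c'}. th m * of_real (ct c' m)) \<noteq> 0" by (rule odd_char_cot_sum_nonzero[OF dc_th])
  moreover have "(\<Prod>p\<in>prime_factors qE. 1 - cnj (th (int p))) \<noteq> 0"
  proof -
    have "1 - cnj (th (int p)) \<noteq> 0" if "p \<in> prime_factors qE" for p
    proof
      assume "1 - cnj (th (int p)) = 0"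
      then have "cnj (th (int p)) = 1" by simp
      then have "th (int p) = 1" by (metis complex_cnj_cnj complex_cnj_one)
      moreover have "prime p" "p dvd qE" using that by (auto simp: in_prime_factors_iff)
      ultimately show False using E by blast
    qed
    then show ?thesis by simp
  qed
  moreover have "\<eta>1 (int qE) \<noteq> 0"
  proof -
    have "q1 dvd c'" using q1N c'N by simp
    then have "coprime q1 qE" by (rule coprime_divisors[OF _ dvd_refl cop])
    then show ?thesis using dc_eq_0_iff[OF dc1] by (simp add: coprime_commute)
  qed
  ultimately show "(\<Sum>m\<in>{0..<int c}. F1 m * of_real (ct c m)) \<noteq> 0" unfolding sum_F1 using pos by simp
  have "\<psi> (-1) * \<eta>2 (-1) = -1"
    using par odd dc_neg_one_cases[OF dc\<psi>] dc_neg_one_cases[OF dc1] dc_neg_one_cases[OF dc2] by auto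
  then show "(\<Sum>k\<in>{0..<int c}. (\<psi> k * \<eta>2 k) * of_real (ct c k)) \<noteq> 0"
    using odd_char_cot_sum_nonzero[OF dc_F2] by simp
qed

lemma coprime_c_iff: "coprime a (int c) \<longleftrightarrow> coprime a (int c') \<and> coprime a (int qE)"
  by (simp add: cc')

theorem dedekind_sum_nonzero:
  assumes par: "\<eta>1 (-1) * \<eta>2 (-1) = 1" and odd: "\<eta>1 (-1) * \<psi> (-1) = -1"
    and E: "\<And>p. prime p \<Longrightarrow> p dvd qE \<Longrightarrow> th (int p) \<noteq> 1"
  shows "\<exists>a. coprime a (int c) \<and> dedekind_sum q1 \<eta>1 \<eta>2 a c \<noteq> 0"
proof (rule ccontr)
  assume "\<not> ?thesis"
  then have z: "\<And>a. coprime a (int c) \<Longrightarrow> dedekind_sum q1 \<eta>1 \<eta>2 a c = 0" by blast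
  have dvd: "q1 * q2 dvd c" using q1N by (simp add: cN)
  have cdiv: "c div q2 = N" using pos by (simp add: cN)
  define D where "D = dcoef q1 \<eta>1 q2 \<eta>2 c"
  have D0: "D \<noteq> 0" using dcoef_norm[OF p1 p2 cpos] pos cpos cdiv by (auto simp: D_def)
  have "(\<Sum>a\<in>{0..<int c}. if coprime a (int qE) then \<psi> a * (\<Sum>m\<in>{0..<int c}. \<Sum>k\<in>{0..<int c}. \<eta>1 m * of_real (ct c m) * of_real (ct c k) * pp (a * m + k)) else 0) = 0"
  proof (intro sum.neutral ballI)
    fix a
    show "(if coprime a (int qE) then \<psi> a * (\<Sum>m\<in>{0..<int c}. \<Sum>k\<in>{0..<int c}. \<eta>1 m * of_real (ct c m) * of_real (ct c k) * pp (a * m + k)) else 0) = 0"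
      using z[of a] dedekind_sum_cot[OF p1 p2 cpos dvd, of a] D0 dc_eq_0_iff[OF dc\<psi>, of a]
      unfolding cdiv D_def[symmetric] coprime_c_iff by auto
  qed
  also have "(\<Sum>a\<in>{0..<int c}. if coprime a (int qE) then \<psi> a * (\<Sum>m\<in>{0..<int c}. \<Sum>k\<in>{0..<int c}. \<eta>1 m * of_real (ct c m) * of_real (ct c k) * pp (a * m + k)) else 0)
     = (\<Sum>m\<in>{0..<int c}. \<Sum>k\<in>{0..<int c}. of_real (ct c m) * of_real (ct c k) * (\<eta>1 m * Phi m k))"
  proof -
    show ?thesis unfolding sum_swap_weighted Phi_def[symmetric] by (simp only: mult_ac)
  qed
  also have "\<dots> = Th 1 1 * ((\<Sum>m\<in>{0..<int c}. F1 m * of_real (ct c m)) * (\<Sum>k\<in>{0..<int c}. (\<psi> k * \<eta>2 k) * of_real (ct c k)))"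
    by (simp only: Phi_eq sum_product) (simp only: sum_distrib_left mult_ac)
  finally show False using Th_nonzero cot_sums_nonzero[OF par odd E] by simp
qed

text \<open>Each residue modulo the odd c has one odd representative modulo 2 c. For odd a the extra
  factor 2 in the divisor 2 N demands that m + k be even, and halving the argument contributes the
  conjugate of \<open>\<eta>2 2\<close>.\<close>

lemma Phi_double:
  assumes "odd c"
  shows "(\<Sum>a\<in>{0..<int (2 * c)}. if odd a \<and> coprime a (int qE) then \<psi> a * ph (int (2 * N)) \<eta>2 (a * m + k) else 0)
     = (if even (m + k) then cnj (\<eta>2 2) * Phi m k else 0)"
proof -
  have N2: "odd N" "odd q2" using assms cN by auto
  have "ph (int (2 * N)) \<eta>2 y = (if even y then cnj (\<eta>2 2) * pp y else 0)" for y
  proof (cases "even y")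
    case True
    then obtain w where w: "y = 2 * w" by auto
    have "coprime 2 (int N)" "coprime 2 (int q2)" using N2 by simp_all
    then have "pp y = \<eta>2 2 * pp w" "\<eta>2 2 * cnj (\<eta>2 2) = 1"
      using ph_scale[OF dc2, of "int N" 2 w] pos dc_mult_cnj[OF dc2, of 2] by (simp_all add: w)
    then have "cnj (\<eta>2 2) * pp y = pp w" by (metis mult.assoc mult.commute mult.left_neutral)
    then show ?thesis using True by (simp add: ph_def w)
  next
    case False
    then have "\<not> int (2 * N) dvd y" by (metis dvd_mult_left of_nat_mult of_nat_numeral)
    then show ?thesis using False by (simp add: ph_def)
  qed
  then have "(\<Sum>a\<in>{0..<int (2 * c)}. if odd a \<and> coprime a (int qE) then \<psi> a * ph (int (2 * N)) \<eta>2 (a * m + k) else 0)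
     = (\<Sum>a\<in>{0..<int (2 * c)}. if odd a then (if even (m + k) then cnj (\<eta>2 2) * (if coprime a (int qE) then \<psi> a * pp (a * m + k) else 0) else 0) else 0)"
    by (intro sum.cong refl) auto
  also have "\<dots> = (\<Sum>a\<in>{0..<int c}. (if even (m + k) then cnj (\<eta>2 2) * (if coprime a (int qE) then \<psi> a * pp (a * m + k) else 0) else 0))"
  proof (rule sum_odd_residues[OF cpos assms])
    fix a
    have "coprime (a + int c) (int qE) \<longleftrightarrow> coprime a (int qE)"
      by (metis cc' coprime_iff_gcd_eq_1 gcd.commute gcd_add_mult mult.commute of_nat_mult add.commute)
    moreover have "\<psi> (a + int c) = \<psi> a" by (rule dc_cong[OF dc\<psi>]) (simp add: cong_iff_dvd_diff cc')
    moreover have "pp ((a + int c) * m + k) = pp (a * m + k)" by (rule pp_cong) (simp add: cong_iff_dvd_diff algebra_simps)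
    ultimately show "(if even (m + k) then cnj (\<eta>2 2) * (if coprime (a + int c) (int qE) then \<psi> (a + int c) * pp ((a + int c) * m + k) else 0) else 0)
       = (if even (m + k) then cnj (\<eta>2 2) * (if coprime a (int qE) then \<psi> a * pp (a * m + k) else 0) else 0)" by simp
  qed
  also have "\<dots> = (if even (m + k) then cnj (\<eta>2 2) * Phi m k else 0)"
    by (simp add: Phi_def sum_distrib_left)
  finally show ?thesis .
qed

text \<open>The even part is the sum at level c with f dilated by 2. The odd part is the total,
  which is twice the sum at level c, minus the even part.\<close>

lemma even_odd_cot_sums:
  fixes f :: "int \<Rightarrow> complex"
  assumes per: "\<And>x. f (x + int c) = f x" and sc: "\<And>x. f (2 * x) = z * f x"
  shows "(\<Sum>m\<in>{0..<int (2 * c)}. if even m then f m * of_real (ct (2 * c) m) else 0) = z * (\<Sum>m\<in>{0..<int c}. f m * of_real (ct c m))"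
    and "(\<Sum>m\<in>{0..<int (2 * c)}. if odd m then f m * of_real (ct (2 * c) m) else 0) = (2 - z) * (\<Sum>m\<in>{0..<int c}. f m * of_real (ct c m))"
proof -
  let ?g = "\<lambda>m. f m * complex_of_real (ct (2 * c) m)"
  have "(\<Sum>m\<in>{0..<int c * 2}. if 2 dvd m then ?g m else 0) = (\<Sum>m\<in>{0..<int c}. ?g (2 * m))"
    using cpos by (intro sum_multiples) auto
  also have "\<dots> = z * (\<Sum>m\<in>{0..<int c}. f m * of_real (ct c m))"
  proof -
    have "ct (2 * c) (2 * m) = ct c m" for m using ct_scale[of 2 c m] by (simp add: mult.commute)
    then show ?thesis by (simp add: sc sum_distrib_left mult.assoc)
  qed
  finally show ev: "(\<Sum>m\<in>{0..<int (2 * c)}. if even m then ?g m else 0) = z * (\<Sum>m\<in>{0..<int c}. f m * of_real (ct c m))"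
    by (simp add: mult.commute)
  have tot: "(\<Sum>m\<in>{0..<int (2 * c)}. ?g m) = 2 * (\<Sum>m\<in>{0..<int c}. f m * of_real (ct c m))"
    using sum_ct_level[OF cpos, of 2 f, OF _ per] by (simp add: mult.commute)
  have "(\<Sum>m\<in>{0..<int (2 * c)}. ?g m) = (\<Sum>m\<in>{0..<int (2 * c)}. if even m then ?g m else 0) + (\<Sum>m\<in>{0..<int (2 * c)}. if odd m then ?g m else 0)"
    unfolding sum.distrib[symmetric] by (rule sum.cong) auto
  then show "(\<Sum>m\<in>{0..<int (2 * c)}. if odd m then ?g m else 0) = (2 - z) * (\<Sum>m\<in>{0..<int c}. f m * of_real (ct c m))"
    using ev tot by (simp add: algebra_simps)
qed

text \<open>No character is ramified at a prime 2 dividing the modulus exactly once, so at modulus 2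
  c the twist has to come from modulus c. Only pairs m, k of equal parity survive; their even and
  odd parts differ from the full sums at level c by the factors z, 2 - z and w, 2 - w, with z =
  \<open>th 2\<close> and w = \<open>\<psi> 2 * \<eta>2 2\<close>.\<close>

theorem dedekind_sum_nonzero_double:
  assumes par: "\<eta>1 (-1) * \<eta>2 (-1) = 1" and odd: "\<eta>1 (-1) * \<psi> (-1) = -1"
    and E: "\<And>p. prime p \<Longrightarrow> p dvd qE \<Longrightarrow> th (int p) \<noteq> 1" and oc: "odd c"
  shows "\<exists>a. coprime a (int (2 * c)) \<and> dedekind_sum q1 \<eta>1 \<eta>2 a (2 * c) \<noteq> 0"
proof (rule ccontr)
  assume "\<not> ?thesis"
  then have z: "\<And>a. coprime a (int (2 * c)) \<Longrightarrow> dedekind_sum q1 \<eta>1 \<eta>2 a (2 * c) = 0" by blast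
  let ?C = "2 * c"
  have C: "?C > 0" using cpos by simp
  have dvd: "q1 * q2 dvd ?C" using q1N by (auto simp: cN)
  have cdiv: "?C div q2 = 2 * N" using pos by (simp add: cN)
  define D where "D = dcoef q1 \<eta>1 q2 \<eta>2 ?C"
  have D0: "D \<noteq> 0" using dcoef_norm[OF p1 p2 C] pos cpos cdiv by (auto simp: D_def)
  define P where "P = ph (int (2 * N)) \<eta>2"
  have cC: "coprime a (int ?C) \<longleftrightarrow> odd a \<and> coprime a (int c') \<and> coprime a (int qE)" for a
    using coprime_c_iff[of a] by auto
  have "(\<Sum>a\<in>{0..<int ?C}. if odd a \<and> coprime a (int qE) then \<psi> a * (\<Sum>m\<in>{0..<int ?C}. \<Sum>k\<in>{0..<int ?C}. \<eta>1 m * of_real (ct ?C m) * of_real (ct ?C k) * P (a * m + k)) else 0) = 0"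
  proof (intro sum.neutral ballI)
    fix a
    show "(if odd a \<and> coprime a (int qE) then \<psi> a * (\<Sum>m\<in>{0..<int ?C}. \<Sum>k\<in>{0..<int ?C}. \<eta>1 m * of_real (ct ?C m) * of_real (ct ?C k) * P (a * m + k)) else 0) = 0"
      using z[of a] dedekind_sum_cot[OF p1 p2 C dvd, of a] D0 dc_eq_0_iff[OF dc\<psi>, of a]
      unfolding cdiv D_def[symmetric] cC P_def by auto
  qed
  also have "(\<Sum>a\<in>{0..<int ?C}. if odd a \<and> coprime a (int qE) then \<psi> a * (\<Sum>m\<in>{0..<int ?C}. \<Sum>k\<in>{0..<int ?C}. \<eta>1 m * of_real (ct ?C m) * of_real (ct ?C k) * P (a * m + k)) else 0)
     = (\<Sum>m\<in>{0..<int ?C}. \<Sum>k\<in>{0..<int ?C}. of_real (ct ?C m) * of_real (ct ?C k) * (\<eta>1 m * (if even (m + k) then cnj (\<eta>2 2) * Phi m k else 0)))"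
  proof -
    show ?thesis unfolding sum_swap_weighted P_def Phi_double[OF oc] by (simp only: mult_ac)
  qed
  also have "\<dots> = cnj (\<eta>2 2) * Th 1 1 * (\<Sum>m\<in>{0..<int ?C}. \<Sum>k\<in>{0..<int ?C}. 
       (if even m then F1 m * of_real (ct ?C m) else 0) * (if even k then (\<psi> k * \<eta>2 k) * of_real (ct ?C k) else 0)
     + (if odd m then F1 m * of_real (ct ?C m) else 0) * (if odd k then (\<psi> k * \<eta>2 k) * of_real (ct ?C k) else 0))"
    unfolding sum_distrib_left
  proof (intro sum.cong refl)
    fix m k
    have "of_real (ct ?C m) * of_real (ct ?C k) * (\<eta>1 m * (if even (m + k) then cnj (\<eta>2 2) * Phi m k else 0))
        = (if even (m + k) then cnj (\<eta>2 2) * of_real (ct ?C m) * of_real (ct ?C k) * (\<eta>1 m * Phi m k) else 0)" by simp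
    then show "of_real (ct ?C m) * of_real (ct ?C k) * (\<eta>1 m * (if even (m + k) then cnj (\<eta>2 2) * Phi m k else 0))
     = cnj (\<eta>2 2) * Th 1 1 * ((if even m then F1 m * of_real (ct ?C m) else 0) * (if even k then (\<psi> k * \<eta>2 k) * of_real (ct ?C k) else 0)
     + (if odd m then F1 m * of_real (ct ?C m) else 0) * (if odd k then (\<psi> k * \<eta>2 k) * of_real (ct ?C k) else 0))"
      unfolding Phi_eq by (cases "even m"; cases "even k") (simp_all add: mult_ac)
  qed
  also have "\<dots> = cnj (\<eta>2 2) * Th 1 1 * (
     (\<Sum>m\<in>{0..<int ?C}. if even m then F1 m * of_real (ct ?C m) else 0) * (\<Sum>k\<in>{0..<int ?C}. if even k then (\<psi> k * \<eta>2 k) * of_real (ct ?C k) else 0)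
     + (\<Sum>m\<in>{0..<int ?C}. if odd m then F1 m * of_real (ct ?C m) else 0) * (\<Sum>k\<in>{0..<int ?C}. if odd k then (\<psi> k * \<eta>2 k) * of_real (ct ?C k) else 0))"
    by (simp only: sum.distrib sum_product)
  also have "\<dots> = cnj (\<eta>2 2) * Th 1 1 * ((th 2 * (\<psi> 2 * \<eta>2 2) + (2 - th 2) * (2 - \<psi> 2 * \<eta>2 2)) *
      ((\<Sum>m\<in>{0..<int c}. F1 m * of_real (ct c m)) * (\<Sum>k\<in>{0..<int c}. (\<psi> k * \<eta>2 k) * of_real (ct c k))))"
  proof -
    have c2: "coprime 2 (int c)" using oc by simp
    have s2: "\<psi> (2 * x) * \<eta>2 (2 * x) = \<psi> 2 * \<eta>2 2 * (\<psi> x * \<eta>2 x)" for x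
      by (simp add: dc_mult[OF dc\<psi>] dc_mult[OF dc2] mult_ac)
    show ?thesis
      unfolding even_odd_cot_sums[of F1, OF F1_periodic F1_scale[OF c2]]
        even_odd_cot_sums[of "\<lambda>k. \<psi> k * \<eta>2 k", OF dc_periodic[OF dc_F2] s2]
      by (simp only: ring_distribs mult_ac)
  qed
  finally have "cnj (\<eta>2 2) * Th 1 1 * ((th 2 * (\<psi> 2 * \<eta>2 2) + (2 - th 2) * (2 - \<psi> 2 * \<eta>2 2)) *
      ((\<Sum>m\<in>{0..<int c}. F1 m * of_real (ct c m)) * (\<Sum>k\<in>{0..<int c}. (\<psi> k * \<eta>2 k) * of_real (ct c k)))) = 0" .
  moreover have "\<eta>2 2 \<noteq> 0" using oc dc_eq_0_iff[OF dc2] by (simp add: cN)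
  moreover have "th 2 * (\<psi> 2 * \<eta>2 2) + (2 - th 2) * (2 - \<psi> 2 * \<eta>2 2) \<noteq> 0"
  proof (rule mult_add_reflected_nonzero)
    show "cmod (th 2) = 1" using oc by (intro dc_norm[OF dc_th]) (simp add: cc')
    show "cmod (\<psi> 2 * \<eta>2 2) = 1" using oc by (intro dc_norm[OF dc_F2]) simp
  qed
  ultimately show False using Th_nonzero cot_sums_nonzero[OF par odd E] by simp
qed

end

section \<open>Choice of the twisting character\<close>

text \<open>For odd k a unit modulo 2 k that is 1 modulo k is odd, hence 1 modulo 2 k, so the
  modulus would be induced from k.\<close>

lemma primitive_even_imp_4_dvd:
  assumes "primitive_char q \<eta>" "even q" shows "4 dvd q"
proof (rule ccontr)
  assume n4: "\<not> 4 dvd q"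
  obtain k where k: "q = 2 * k" using assms(2) by auto
  have ok: "odd k" using n4 k by auto
  have q: "q > 0" using dc_pos[OF primitive_dc[OF assms(1)]] .
  then obtain a where a: "coprime a (int q)" "[a = 1] (mod int k)" "\<eta> a \<noteq> 1"
    using primitive_witness[OF assms(1), of k] k by auto
  have "odd a" using a(1) k by auto
  then have "2 dvd a - 1" by simp
  moreover have "int k dvd a - 1" using a(2) by (simp add: cong_iff_dvd_diff)
  moreover have "coprime 2 (int k)" using ok by simp
  ultimately have "2 * int k dvd a - 1" by (simp add: divides_mult)
  then have "[a = 1] (mod int q)" by (simp add: k cong_iff_dvd_diff)
  then have "\<eta> a = 1" using dc_cong[OF primitive_dc[OF assms(1)]] dc_one[OF primitive_dc[OF assms(1)]] by metis
  then show False using a by simp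
qed

lemma primitive_nontrivial_ge_3:
  assumes p: "primitive_char q \<eta>" and nt: "\<eta> \<noteq> trivial_char q" shows "q \<ge> 3"
proof -
  have dc: "dirichlet_char q \<eta>" using primitive_dc[OF p] .
  have "q \<noteq> 1"
  proof
    assume q: "q = 1"
    have "\<eta> n = trivial_char q n" for n
      using dc_cong[OF dc, of n 1] dc by (simp add: q trivial_char_def)
    then show False using nt by auto
  qed
  moreover have "q \<noteq> 2" using primitive_even_imp_4_dvd[OF p] by auto
  ultimately show ?thesis using dc_pos[OF dc] by linarith
qed

lemma strip_primes:
  fixes n :: nat
  assumes "n > 0" "\<And>p. p \<in> P \<Longrightarrow> prime p"
  obtains a b where "n = a * b" "\<And>p. prime p \<Longrightarrow> p dvd b \<Longrightarrow> p \<in> P" "\<And>p. p \<in> P \<Longrightarrow> \<not> p dvd a"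
proof -
  have "\<exists>a b. n = a * b \<and> (\<forall>p. prime p \<longrightarrow> p dvd b \<longrightarrow> p \<in> P) \<and> (\<forall>p\<in>P. \<not> p dvd a)"
    using assms(1)
  proof (induction n rule: less_induct)
    case (less n)
    show ?case
    proof (cases "\<exists>p\<in>P. p dvd n")
      case True
      then obtain p m where p: "p \<in> P" "n = p * m" by (metis dvd_def)
      have "m > 0" "m < n" using p less.prems prime_gt_1_nat[OF assms(2)[OF p(1)]] by auto
      then obtain a b where ab: "m = a * b" "\<forall>p. prime p \<longrightarrow> p dvd b \<longrightarrow> p \<in> P" "\<forall>p\<in>P. \<not> p dvd a"
        using less.IH by blast
      have "r \<in> P" if "prime r" "r dvd p * b" for r
        using that ab(2) p(1) assms(2)[OF p(1)] by (metis prime_dvd_mult_iff primes_dvd_imp_eq)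
      then show ?thesis using ab p by (intro exI[of _ a] exI[of _ "p * b"]) auto
    next
      case False
      then show ?thesis by (intro exI[of _ n] exI[of _ 1]) auto
    qed
  qed
  then show ?thesis using that by blast
qed

lemma prime_powers_dvd_imp_dvd:
  fixes n :: nat and m :: int
  assumes n: "n > 0" and h: "\<And>p. prime p \<Longrightarrow> p dvd n \<Longrightarrow> int (p ^ multiplicity p n) dvd m"
  shows "int n dvd m"
proof (cases "m = 0")
  case False
  define k where "k = nat \<bar>m\<bar>"
  have k0: "k > 0" using False by (simp add: k_def)
  have "multiplicity p n \<le> multiplicity p k" if "prime p" for p
  proof (cases "p dvd n")
    case True
    then have "int (p ^ multiplicity p n) dvd int k" using h[OF that] by (simp add: k_def)
    then have "p ^ multiplicity p n dvd k" by (simp only: int_dvd_int_iff)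
    then show ?thesis using that k0 by (intro multiplicity_geI) auto
  next
    case False
    then show ?thesis by (simp add: not_dvd_imp_multiplicity_0)
  qed
  then have "n dvd k" using n k0 by (intro multiplicity_le_imp_dvd) auto
  then have "int n dvd int k" by simp
  then show ?thesis by (simp add: k_def)
qed simp

text \<open>Provides the units at which ramification at p is tested. With v inverse to w modulo p,
  the witness 1 + p^(g-1) w v s is 1 modulo c / p and has the prescribed p-part. For g = 1 it is not
  automatically prime to p, whence the condition on s.\<close>

lemma exists_local_unit:
  fixes c p s g w :: nat
  assumes p: "prime p" and c: "c = p ^ g * w" and w: "\<not> p dvd w" and g: "g > 0"
    and s: "g = 1 \<Longrightarrow> \<not> p dvd 1 + s"
  obtains x where "coprime x (int c)" "[x = 1] (mod int (c div p))" "[x = 1 + int s * int p ^ (g - 1)] (mod int p ^ g)"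
proof -
  have "coprime w p" using p w by (metis coprime_commute prime_imp_coprime)
  then have "coprime (int w) (int p)" by simp
  then obtain v where "[int w * v = 1] (mod int p)" using cong_solve_coprime_int by blast
  then have "[int w * v * int s = 1 * int s] (mod int p)" by (rule cong_scalar_right)
  then have v: "int p dvd int w * (v * int s) - int s" by (simp add: cong_iff_dvd_diff mult.assoc)
  define x where "x = 1 + int p ^ (g - 1) * int w * (v * int s)"
  have pg: "int p ^ g = int p ^ (g - 1) * int p" using g by (metis Suc_pred' mult.commute power_Suc)
  have cp: "c div p = p ^ (g - 1) * w"
  proof -
    have "c = p * (p ^ (g - 1) * w)" using g by (simp add: c power_eq_if)
    then show ?thesis using p by (simp add: prime_gt_0_nat)
  qed
  have x1: "[x = 1] (mod int (c div p))" unfolding cp x_def by (simp add: cong_iff_dvd_diff mult.assoc)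
  have x2: "[x = 1 + int s * int p ^ (g - 1)] (mod int p ^ g)"
  proof -
    have "x - (1 + int s * int p ^ (g - 1)) = int p ^ (g - 1) * (int w * (v * int s) - int s)" by (simp add: x_def algebra_simps)
    moreover have "int p ^ (g - 1) * int p dvd int p ^ (g - 1) * (int w * (v * int s) - int s)" using v by (intro mult_dvd_mono) auto
    ultimately show ?thesis by (simp add: cong_iff_dvd_diff pg)
  qed
  have "coprime x (int c)"
  proof (rule ccontr)
    assume "\<not> coprime x (int c)"
    moreover have "c > 0" using c w p by (auto intro: gr0I simp: prime_gt_0_nat)
    ultimately obtain r where r: "prime r" "r dvd c" "int r dvd x" using not_coprime_prime by blast
    show False
    proof (cases "r dvd c div p")
      case True
      then have "int r dvd x - 1" using x1 by (meson cong_iff_dvd_diff dvd_trans of_nat_dvd_iff)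
      then have "int r dvd 1" using r(3) by (metis dvd_diff_commute dvd_diff_right_iff)
      then show False using r(1) by simp
    next
      case False
      then have rp: "\<not> r dvd w" "\<not> r dvd p ^ (g - 1)" unfolding cp by (auto dest: dvd_mult)
      then have "r dvd p ^ g" using r by (auto simp: c prime_dvd_mult_iff)
      then have "r dvd p" using r(1) prime_dvd_power by blast
      then have req: "r = p" using r(1) p by (simp add: primes_dvd_imp_eq)
      then have g1: "g = 1" using rp(2) g by (cases "g - 1") auto
      have "[x = 1 + int s] (mod int p)" using x2 g1 by simp
      then have "int p dvd 1 + int s" using r(3) req by (metis cong_dvd_iff)
      then have "int p dvd int (1 + s)" by simp
      then show False using s[OF g1] by (simp only: int_dvd_int_iff)
    qed
  qed
  then show ?thesis using that x1 x2 by blast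
qed

lemma cong_prod_single:
  fixes x :: "nat \<Rightarrow> int" and Y :: "(nat \<times> nat) set" and m :: int
  assumes "finite Y" "\<And>i r. (i, r) \<in> Y \<Longrightarrow> r \<noteq> p \<Longrightarrow> [x r = 1] (mod m)"
  shows "[(\<Prod>j\<in>Y. x (snd j)) = x p ^ card {j\<in>Y. snd j = p}] (mod m)"
proof -
  have "[(\<Prod>j\<in>Y. x (snd j)) = (\<Prod>j\<in>Y. if snd j = p then x p else 1)] (mod m)"
    by (rule cong_prod) (use assms(2) in \<open>auto\<close>)
  also have "(\<Prod>j\<in>Y. if snd j = p then x p else 1) = x p ^ card {j\<in>Y. snd j = p}"
    using assms(1) by (simp add: prod.If_cases Int_def)
  finally show ?thesis .
qed

text \<open>Each demand on \<psi> can be written as \<kappa> \<psi>(g) \<noteq> 1 for one unit g. By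
  \<open>exists_char_avoiding\<close> it remains to find a set \<open>X0\<close> of demands whose
  product of units modulo c' is attained by no other set. This is checked prime by prime on
  c'.\<close>

lemma choose_twist:
  fixes q1 q2 c c' qE N q2' :: nat and \<eta>1 \<eta>2 :: "int \<Rightarrow> complex" and E :: "nat set"
  assumes p1: "primitive_char q1 \<eta>1" and p2: "primitive_char q2 \<eta>2" and q13: "q1 \<ge> 3"
    and cpos: "c > 0" and cN: "c = N * q2" and q1N: "q1 dvd N"
    and cc': "c = c' * qE" and cop: "coprime c' qE" and q2E: "q2 = q2' * qE"
    and ev: "2 dvd c \<Longrightarrow> 4 dvd c"
    and E: "E = {p. prime p \<and> p dvd qE}" and E23: "E \<subseteq> {2, 3}"
    and E2: "2 dvd q2 \<Longrightarrow> \<not> 2 dvd N \<Longrightarrow> 2 \<in> E"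
    and E3: "3 dvd q2 \<Longrightarrow> \<not> 3 dvd N \<Longrightarrow> \<not> 9 dvd q2 \<Longrightarrow> 3 \<in> E"
  obtains \<psi> where "twisted q1 q2 c c' qE N q2' \<eta>1 \<eta>2 \<psi>" "\<eta>1 (-1) * \<psi> (-1) = -1"
    "\<And>p. p \<in> E \<Longrightarrow> \<eta>1 (int p) * cnj (\<psi> (int p)) \<noteq> 1"
proof -
  note result = that
  note dc1 = primitive_dc[OF p1] and dc2 = primitive_dc[OF p2]
  have pos: "c' > 0" "qE > 0" "N > 0" "q2' > 0" "q2 > 0" "q1 > 0"
    using cpos cN cc' q2E q13 by (auto intro: gr0I)
  have c'N: "c' = N * q2'" using cN cc' q2E pos by simp
  have q1c': "q1 dvd c'" using q1N c'N by simp
  have fE: "finite E" using E23 finite_subset by blast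
  have Ec': "\<not> p dvd c'" if "p \<in> E" for p
    using that E cop by (metis coprime_common_divisor_nat mem_Collect_eq not_prime_1 not_prime_unit coprime_common_divisor)
  have c'E: "\<not> p dvd qE" if "prime p" "p dvd c'" for p using Ec'[of p] that E by auto
  \<comment> \<open>\<open>Fl\<close> holds the primes at which \<psi> has to be ramified to full
    level, \<open>Dt\<close> those at which \<psi> \<open>\<eta>2\<close> has to be as well.\<close>
  define Fl where "Fl = {p. prime p \<and> p dvd c' \<and> (\<not> p dvd q1 \<or> p dvd q2)}"
  define Dt where "Dt = {p. prime p \<and> p dvd c' \<and> p dvd q2 \<and> \<not> p dvd N}"
  have DF: "Dt \<subseteq> Fl" using q1N by (auto simp: Dt_def Fl_def)
  have finF: "finite Fl" using pos(1) by (intro finite_subset[OF _ finite_divisors_nat[of c']]) (auto simp: Fl_def)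
  have finD: "finite Dt" using DF finF finite_subset by blast
  define \<gamma> where "\<gamma> = (\<lambda>p. multiplicity p c')"
  have g0: "\<gamma> p > 0" if "prime p" "p dvd c'" for p
    using that pos(1) by (simp add: \<gamma>_def prime_multiplicity_gt_zero_iff)
  have pg: "p ^ \<gamma> p dvd c'" for p by (simp add: \<gamma>_def multiplicity_dvd)
  have two: "4 dvd c'" if "2 dvd c'"
  proof -
    have "odd qE" using c'E[of 2] that by auto
    moreover have "4 dvd c' * qE" using ev that cc' by auto
    moreover have "coprime (4::nat) qE" using \<open>odd qE\<close> by (metis coprime_commute coprime_left_2_iff_odd coprime_power_right_iff power2_eq_square mult_2_right numeral_Bit0 zero_less_numeral coprime_power_left_iff num_double numeral_times_numeral)
    ultimately show ?thesis by (simp add: coprime_dvd_mult_left_iff)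
  qed
  have ge2: "\<gamma> p \<ge> k" if "prime p" "p ^ k dvd c'" for p k
    using that pos(1) unfolding \<gamma>_def by (intro multiplicity_geI) auto
  have g2: "\<gamma> 2 \<ge> 2" if "2 dvd c'" using ge2[of 2 2] two[OF that] by simp
  \<comment> \<open>If p divides c' once, then \<open>x p\<close> is 1 + s modulo p. The choice
    between 2 and 3 for 1 + s keeps \<open>x p\<close> a unit with square not 1 where that is
    required. For 3 in E and p \<noteq> 2 the value 3 makes the differences of products compared
    later have prime factors 2, 3 and 5 only; with the value 2 there could be a difference -3 - 2.
    At p = 2 the value s = 2 would make \<open>x p\<close> trivial.\<close>
  define s where "s = (\<lambda>p::nat. if 3 \<in> E \<and> p \<noteq> 2 then 2 else (1::nat))"
  have exx: "\<exists>x. coprime x (int c) \<and> [x = 1] (mod int (c div p)) \<and> [x = 1 + int (s p) * int p ^ (\<gamma> p - 1)] (mod int p ^ \<gamma> p)"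
    if p: "p \<in> Fl" for p
  proof -
    have pp: "prime p" "p dvd c'" using p by (auto simp: Fl_def)
    obtain w where w: "c' = p ^ \<gamma> p * w" using pg by blast
    have "\<not> p dvd w"
    proof
      assume "p dvd w"
      then have "p ^ Suc (\<gamma> p) dvd c'" using w by (auto elim!: dvdE)
      then show False using ge2[OF pp(1), of "Suc (\<gamma> p)"] by simp
    qed
    then have nw: "\<not> p dvd w * qE" using c'E[OF pp] pp by (simp add: prime_dvd_mult_iff)
    have sg: "\<not> p dvd 1 + s p" if "\<gamma> p = 1"
    proof
      assume d: "p dvd 1 + s p"
      have p2: "p \<noteq> 2" using that g2 pp by auto
      show False
      proof (cases "3 \<in> E")
        case True
        then have "p dvd 3" using d p2 by (simp add: s_def eval_nat_numeral)
        then have "p = 3" using pp by (simp add: primes_dvd_imp_eq)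
        then show False using True Ec' pp by auto
      next
        case False
        then have "p dvd 2" using d by (simp add: s_def numeral_2_eq_2)
        then show False using p2 pp by (simp add: primes_dvd_imp_eq)
      qed
    qed
    have "c = p ^ \<gamma> p * (w * qE)" using w cc' by (simp add: mult.assoc)
    from exists_local_unit[OF pp(1) this nw g0[OF pp] sg] show ?thesis by blast
  qed
  obtain x where x: "\<And>p. p \<in> Fl \<Longrightarrow> coprime (x p) (int c) \<and> [x p = 1] (mod int (c div p)) \<and> [x p = 1 + int (s p) * int p ^ (\<gamma> p - 1)] (mod int p ^ \<gamma> p)"
    using exx by metis
  have xother: "[x r = 1] (mod int p ^ \<gamma> p)" if "r \<in> Fl" "r \<noteq> p" "prime p" for r p
  proof -
    have r: "prime r" "r dvd c" using that cc' by (auto simp: Fl_def)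
    have "p ^ \<gamma> p dvd c" using pg cc' by simp
    then have "p ^ \<gamma> p dvd r * (c div r)" using r by simp
    moreover have "coprime (p ^ \<gamma> p) r" using that r by (simp add: primes_coprime)
    ultimately have "p ^ \<gamma> p dvd c div r" by (simp add: coprime_dvd_mult_right_iff)
    then have "int (p ^ \<gamma> p) dvd int (c div r)" by (simp only: int_dvd_int_iff)
    then show ?thesis using x[OF that(1)] cong_dvd_modulus by (metis of_nat_power)
  qed
  have xnot1: "\<not> [x p = 1] (mod int p ^ \<gamma> p)" if p: "p \<in> Fl" for p
  proof
    have pp: "prime p" "p dvd c'" using p by (auto simp: Fl_def)
    assume "[x p = 1] (mod int p ^ \<gamma> p)"
    then have "[1 + int (s p) * int p ^ (\<gamma> p - 1) = 1] (mod int p ^ \<gamma> p)" using x[OF p] by (meson cong_sym cong_trans)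
    then have "int p ^ \<gamma> p dvd int (s p) * int p ^ (\<gamma> p - 1)" by (simp add: cong_iff_dvd_diff)
    moreover have "int p ^ \<gamma> p = int p * int p ^ (\<gamma> p - 1)" using g0[OF pp] by (simp add: power_eq_if)
    ultimately have "int p dvd int (s p)" using pp by (simp add: prime_gt_0_nat)
    then have "p dvd s p" by simp
    then have "s p = 2 \<and> p = 2" using pp primes_dvd_imp_eq[of p 2] by (auto simp: s_def split: if_splits)
    then show False by (auto simp: s_def split: if_splits)
  qed
  \<comment> \<open>For p in \<open>Dt\<close> two demands carry \<open>x p\<close>, so the
    exponents 0, 1 and 2 must be told apart. Here the exceptional primes have to be in E: at p = 2
    the square of \<open>x p\<close> can be 1, and so it is at p = 3 if 3 divides c' only once and s
    = 1.\<close>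
  have x2not1: "\<not> [x p ^ 2 = 1] (mod int p ^ \<gamma> p)" if p: "p \<in> Dt" for p
  proof
    have pF: "p \<in> Fl" using p DF by auto
    have pp: "prime p" "p dvd c'" "p dvd q2" "\<not> p dvd N" using p by (auto simp: Dt_def)
    have pn2: "p \<noteq> 2" using E2 Ec'[of 2] pp by auto
    assume "[x p ^ 2 = 1] (mod int p ^ \<gamma> p)"
    then have "[(1 + int (s p) * int p ^ (\<gamma> p - 1))\<^sup>2 = 1] (mod int p ^ \<gamma> p)"
      using x[OF pF] by (meson cong_pow cong_sym cong_trans)
    then have d: "int p ^ \<gamma> p dvd (1 + int (s p) * int p ^ (\<gamma> p - 1))\<^sup>2 - 1" by (simp add: cong_iff_dvd_diff)
    have pw: "int p ^ \<gamma> p = int p * int p ^ (\<gamma> p - 1)" using g0[OF pp(1,2)] by (simp add: power_eq_if)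
    have "(1 + int (s p) * int p ^ (\<gamma> p - 1))\<^sup>2 - 1 = int p ^ (\<gamma> p - 1) * (int (s p) * (2 + int (s p) * int p ^ (\<gamma> p - 1)))"
      by (simp add: power2_eq_square algebra_simps)
    then have "int p dvd int (s p) * (2 + int (s p) * int p ^ (\<gamma> p - 1))" using d pw pp by (simp add: prime_gt_0_nat mult.commute)
    moreover have pint: "prime (int p)" using pp by simp
    moreover have "\<not> int p dvd int (s p)"
    proof
      assume "int p dvd int (s p)"
      then have "p dvd s p" by simp
      then show False using pp pn2 primes_dvd_imp_eq[of p 2] by (auto simp: s_def split: if_splits)
    qed
    ultimately have d2: "int p dvd 2 + int (s p) * int p ^ (\<gamma> p - 1)" by (simp add: prime_dvd_mult_iff)
    show False
    proof (cases "\<gamma> p = 1")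
      case True
      then have "int p dvd int (2 + s p)" using d2 by simp
      then have d3: "p dvd 2 + s p" by (simp only: int_dvd_int_iff)
      show False
      proof (cases "3 \<in> E")
        case True
        then have "p dvd 2 ^ 2" using d3 pn2 by (simp add: s_def)
        then have "p dvd 2" using pp prime_dvd_power by blast
        then show False using pn2 pp by (simp add: primes_dvd_imp_eq)
      next
        case False
        then have "p dvd 3" using d3 by (simp add: s_def numeral_3_eq_3)
        then have p3: "p = 3" using pp by (simp add: primes_dvd_imp_eq)
        have "\<not> 9 dvd q2"
        proof
          assume "9 dvd q2"
          moreover have "coprime (3 ^ 2) qE"
          proof -
            have "coprime 3 qE" using c'E[of 3] pp p3 by (intro prime_imp_coprime) auto
            then show ?thesis by (metis coprime_power_left_iff)
          qed
          ultimately have "3 ^ 2 dvd q2'" unfolding q2E by (simp add: coprime_dvd_mult_left_iff)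
          then have "3 ^ 2 dvd c'" by (simp add: c'N)
          then show False using ge2[of 3 2] True p3 by simp
        qed
        then show False using E3 False pp p3 by simp
      qed
    next
      case False
      then have "\<gamma> p - 1 > 0" using g0[OF pp(1,2)] by simp
      then have "int p dvd int (s p) * int p ^ (\<gamma> p - 1)" by simp
      then have "int p dvd 2" using d2 by (simp add: dvd_add_left_iff)
      then have "p dvd 2" by presburger
      then show False using pn2 pp by (simp add: primes_dvd_imp_eq)
    qed
  qed
  \<comment> \<open>Demands are coded as pairs: (0, 0) for oddness, (1, e) for the Euler factor at e
    in E, (2, p) for ramification of \<psi> at p, and (3, p) for ramification of \<psi>
    \<open>\<eta>2\<close> at p.\<close>
  define J where "J = {(0::nat,0::nat)} \<union> Pair 1 ` E \<union> Pair 2 ` Fl \<union> Pair 3 ` Dt"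
  define g where "g = (\<lambda>j::nat\<times>nat. if fst j = 0 then -1 else if fst j = 1 then int (snd j) else x (snd j))"
  define \<kappa> where "\<kappa> = (\<lambda>j::nat\<times>nat. if fst j = 0 then \<eta>1 (-1) else if fst j = 1 then cnj (\<eta>1 (int (snd j))) else if fst j = 2 then 1 else \<eta>2 (x (snd j)))"
  have finJ: "finite J" using fE finF finD by (simp add: J_def)
  have xc': "coprime (x p) (int c')" if "p \<in> Fl" for p using x[OF that] by (simp add: cc')
  have Eq1: "coprime (int e) (int c')" if "e \<in> E" for e
  proof -
    have "prime e" using that E by auto
    then show ?thesis using Ec'[OF that] prime_imp_coprime[of e c'] by simp
  qed
  have copg: "coprime (g j) (int c')" if "j \<in> J" for j
    using that xc' Eq1 DF by (auto simp: J_def g_def)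
  have k0: "\<kappa> j \<noteq> 0" if "j \<in> J" for j
  proof -
    have "\<eta>1 (-1) \<noteq> 0" using dc_eq_0_iff[OF dc1, of "-1"] by simp
    moreover have "\<eta>1 (int e) \<noteq> 0" if "e \<in> E" for e
    proof -
      have "coprime (int e) (int q1)" using Eq1[OF that] q1c' by (meson coprime_divisors dvd_refl of_nat_dvd_iff)
      then show ?thesis using dc_eq_0_iff[OF dc1] by simp
    qed
    moreover have "\<eta>2 (x p) \<noteq> 0" if "p \<in> Dt" for p
    proof -
      have "coprime (x p) (int q2)" using x[of p] that DF by (auto simp: cN)
      then show ?thesis using dc_eq_0_iff[OF dc2] by simp
    qed
    ultimately show ?thesis using that by (auto simp: J_def \<kappa>_def)
  qed
  have finish: thesis if dc\<psi>: "dirichlet_char c' \<psi>" and av: "\<And>j. j \<in> J \<Longrightarrow> \<kappa> j * \<psi> (g j) \<noteq> 1" for \<psi>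
  proof -
    have "twisted q1 q2 c c' qE N q2' \<eta>1 \<eta>2 \<psi>"
    proof
      fix p assume p: "prime p" "p dvd c'" "\<not> p dvd q1 \<or> p dvd q2"
      then have pF: "p \<in> Fl" by (simp add: Fl_def)
      have "c' div p dvd c div p" using p(2) by (auto simp: cc' elim!: dvdE)
      then have "[x p = 1] (mod int (c' div p))" using x[OF pF] cong_dvd_modulus by (meson of_nat_dvd_iff)
      moreover have "\<psi> (x p) \<noteq> 1" using av[of "(2, p)"] pF by (auto simp: J_def \<kappa>_def g_def)
      ultimately show "\<exists>x. coprime x (int c') \<and> [x = 1] (mod int (c' div p)) \<and> \<psi> x \<noteq> 1" using xc'[OF pF] by blast
    next
      fix p assume p: "prime p" "p dvd c'" "p dvd q2" "\<not> p dvd N"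
      then have pD: "p \<in> Dt" by (simp add: Dt_def)
      have "\<psi> (x p) * \<eta>2 (x p) \<noteq> 1" using av[of "(3, p)"] pD by (auto simp: J_def \<kappa>_def g_def mult.commute)
      then show "\<exists>x. coprime x (int c) \<and> [x = 1] (mod int (c div p)) \<and> \<psi> x * \<eta>2 x \<noteq> 1" using x[of p] pD DF by blast
    qed (use p1 p2 cpos cN q1N cc' cop q2E dc\<psi> in auto)
    moreover have "\<eta>1 (-1) * \<psi> (-1) = -1"
      using av[of "(0,0)"] dc_neg_one_cases[OF dc1] dc_neg_one_cases[OF dc\<psi>] by (auto simp: J_def \<kappa>_def g_def)
    moreover have "\<eta>1 (int p) * cnj (\<psi> (int p)) \<noteq> 1" if "p \<in> E" for p
    proof
      assume "\<eta>1 (int p) * cnj (\<psi> (int p)) = 1"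
      then have "cnj (\<eta>1 (int p) * cnj (\<psi> (int p))) = 1" by simp
      then show False using av[of "(1, p)"] that by (auto simp: J_def \<kappa>_def g_def)
    qed
    ultimately show thesis using result by blast
  qed
  show thesis
  \<comment> \<open>In these cases \<open>X0\<close> is not isolated, but \<open>e\<close> or \<open>e\<^sup>2\<close> is \<open>-1\<close> modulo \<open>q1\<close> for \<open>e \<in> E\<close>, so oddness suffices.\<close>
  proof (cases "c' = q1 \<and> q1 \<in> {3, 4, 5} \<and> Fl = {}")
    case True
    then have c'q: "c' = q1" and Fl0: "Fl = {}" by auto
    have D0: "Dt = {}" using DF Fl0 by auto
    obtain \<psi> where dc\<psi>: "dirichlet_char c' \<psi>" and av: "\<And>j. j \<in> {()} \<Longrightarrow> \<eta>1 (-1) * \<psi> (-1) \<noteq> 1"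
    proof (rule exists_char_avoiding[of c' "{()}" "\<lambda>_. -1" "{}" "\<lambda>_. \<eta>1 (-1)"])
      fix X :: "unit set" assume X: "X \<subseteq> {()}" "[(\<Prod>j\<in>X. - 1) = (\<Prod>j\<in>{}. - 1)] (mod int c')"
      show "X = {}"
      proof (rule ccontr)
        assume "X \<noteq> {}"
        then have "X = {()}" using X by auto
        then have "int c' dvd 2" using X(2) by (simp add: cong_iff_dvd_diff)
        then show False using q13 c'q zdvd_imp_le[of "int c'" 2] by simp
      qed
    qed (use pos in auto)
    have odd: "\<eta>1 (-1) * \<psi> (-1) = -1"
      using av dc_neg_one_cases[OF dc1] dc_neg_one_cases[OF dc\<psi>] by auto
    have nE: "\<eta>1 (int e) * cnj (\<psi> (int e)) \<noteq> 1" if e: "e \<in> E" for e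
    proof
      assume one: "\<eta>1 (int e) * cnj (\<psi> (int e)) = 1"
      have dt: "dirichlet_char c' (\<lambda>n. \<eta>1 n * cnj (\<psi> n))"
        by (rule dc_mult_char[OF dc1 dc_cnj[OF dc\<psi>]]) (use pos q1c' in auto)
      have e23: "e = 2 \<or> e = 3" using e E23 by auto
      have en: "\<not> e dvd q1" using Ec'[OF e] c'q by simp
      have "[int e ^ 2 = -1] (mod int c') \<or> [int e = -1] (mod int c')"
        using True e23 en unfolding c'q by (auto simp: cong_iff_dvd_diff)
      moreover have "\<eta>1 (-1) * cnj (\<psi> (-1)) = -1"
        using odd dc_neg_one_cases[OF dc\<psi>] by auto
      moreover have "\<eta>1 (int e ^ 2) * cnj (\<psi> (int e ^ 2)) = 1"
        using one dc_power[OF dt, of "int e" 2] by simp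
      ultimately show False using one dc_cong[OF dt] by fastforce
    qed
    show thesis
    proof (rule finish[OF dc\<psi>])
      fix j assume j: "j \<in> J"
      then consider "j = (0,0)" | e where "e \<in> E" "j = (1, e)" by (auto simp: J_def Fl0 D0)
      then show "\<kappa> j * \<psi> (g j) \<noteq> 1"
      proof cases
        case 2
        have "cnj (\<eta>1 (int e)) * \<psi> (int e) \<noteq> 1"
        proof
          assume "cnj (\<eta>1 (int e)) * \<psi> (int e) = 1"
          then have "cnj (cnj (\<eta>1 (int e)) * \<psi> (int e)) = 1" by simp
          then show False using nE[OF 2(1)] by simp
        qed
        then show ?thesis using 2 by (simp add: \<kappa>_def g_def)
      qed (use av in \<open>auto simp: \<kappa>_def g_def\<close>)
    qed
  next
    case special: False
    \<comment> \<open>For E = {2, 3} the products of the first two kinds of demands are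
      \<plusminus>1, \<plusminus>2, \<plusminus>3, \<plusminus>6. The product 1 would collide with
      -6 modulo 7. The product 3 collides with another one modulo a number prime to 6 only at 5,
      with -2. For q1 = 5 the product 1 is kept, and only 6 collides.\<close>
    define B0 where "B0 = (if E = {2,3} \<and> q1 \<noteq> 5 then {(1::nat, 3::nat)} else {})"
    define X0 where "X0 = B0 \<union> Pair 2 ` Fl \<union> Pair 3 ` Dt"
    have X0J: "X0 \<subseteq> J" by (auto simp: X0_def B0_def J_def)
    \<comment> \<open>Modulo the p-part of c' the product over X is \<open>T X\<close> times a power
      of \<open>x p\<close>: \<open>T\<close> collects the demands without a unit x,
      \<open>I X p\<close> is the exponent, and all other units x are 1 there.\<close>
    define T where "T = (\<lambda>X::(nat\<times>nat) set. (if (0,0) \<in> X then -1 else 1) * (if (1,2) \<in> X then 2 else 1) * (if (1,3) \<in> X then 3 else (1::int)))"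
    define I where "I = (\<lambda>X::(nat\<times>nat) set. \<lambda>p. card (X \<inter> {(2,p),(3,p)}))"
    have prodT: "[(\<Prod>j\<in>X. g j) = T X * x p ^ I X p] (mod int p ^ \<gamma> p)" if XJ: "X \<subseteq> J" and p: "prime p" for X p
    proof -
      define Y where "Y = {j\<in>X. fst j \<ge> 2}"
      have fX: "finite X" using XJ finJ finite_subset by blast
      have "(\<Prod>j\<in>X. g j) = (\<Prod>j\<in>X - Y. g j) * (\<Prod>j\<in>Y. g j)"
        by (rule prod.subset_diff) (use fX in \<open>auto simp: Y_def\<close>)
      also have "(\<Prod>j\<in>X - Y. g j) = T X"
      proof -
        have XY: "X - Y = (if (0,0) \<in> X then {(0,0)} else {}) \<union> (if (1,2) \<in> X then {(1,2)} else {}) \<union> (if (1,3) \<in> X then {(1,3)} else {})"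
          using XJ E23 by (auto simp: Y_def J_def split: if_splits)
        show ?thesis unfolding XY T_def by (auto simp: g_def)
      qed
      also have "(\<Prod>j\<in>Y. g j) = (\<Prod>j\<in>Y. x (snd j))" by (rule prod.cong) (auto simp: Y_def g_def)
      finally have e: "(\<Prod>j\<in>X. g j) = T X * (\<Prod>j\<in>Y. x (snd j))" .
      have "[(\<Prod>j\<in>Y. x (snd j)) = x p ^ card {j\<in>Y. snd j = p}] (mod int p ^ \<gamma> p)"
      proof (rule cong_prod_single)
        fix i r assume ir: "(i, r) \<in> Y" "r \<noteq> p"
        then have "r \<in> Fl" using XJ DF by (auto simp: Y_def J_def)
        then show "[x r = 1] (mod int p ^ \<gamma> p)" using xother ir p by blast
      qed (use fX in \<open>simp add: Y_def\<close>)
      moreover have "{j\<in>Y. snd j = p} = X \<inter> {(2,p),(3,p)}"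
        using XJ by (auto simp: Y_def J_def)
      ultimately show ?thesis unfolding e I_def by (simp add: cong_scalar_left)
    qed
    have IX: "I X p \<le> I X0 p" if XJ: "X \<subseteq> J" for X p
    proof -
      have "X \<inter> {(2,p),(3,p)} \<subseteq> X0 \<inter> {(2,p),(3,p)}" using XJ by (auto simp: J_def X0_def)
      then show ?thesis unfolding I_def by (intro card_mono) auto
    qed
    have I0F: "I X0 p = 0" if "p \<notin> Fl" for p
    proof -
      have "X0 \<inter> {(2,p),(3,p)} = {}" using that DF by (auto simp: X0_def B0_def)
      then show ?thesis by (simp add: I_def)
    qed
    have I0D: "I X0 p = 2" if "p \<in> Dt" for p
    proof -
      have "X0 \<inter> {(2,p),(3,p)} = {(2,p),(3,p)}" using that DF by (auto simp: X0_def B0_def)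
      then show ?thesis by (simp add: I_def)
    qed
    have I0N: "I X0 p = 1" if "p \<in> Fl" "p \<notin> Dt" for p
    proof -
      have "X0 \<inter> {(2,p),(3,p)} = {(2,p)}" using that by (auto simp: X0_def B0_def)
      then show ?thesis by (simp add: I_def)
    qed
    have TX0: "T X0 = (if E = {2,3} \<and> q1 \<noteq> 5 then 3 else 1)"
      by (simp add: T_def X0_def B0_def image_iff)
    have iso: "X = X0" if XJ: "X \<subseteq> J" and eq: "[(\<Prod>j\<in>X. g j) = (\<Prod>j\<in>X0. g j)] (mod int c')" for X
    proof -
      have loc: "[T X * x p ^ I X p = T X0 * x p ^ I X0 p] (mod int p ^ \<gamma> p)" if p: "prime p" for p
      proof -
        have "int p ^ \<gamma> p dvd int c'" using pg[of p] by (metis of_nat_dvd_iff of_nat_power)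
        then have "[(\<Prod>j\<in>X. g j) = (\<Prod>j\<in>X0. g j)] (mod int p ^ \<gamma> p)" using eq cong_dvd_modulus by blast
        then show ?thesis using prodT[OF XJ p] prodT[OF X0J p] by (meson cong_sym cong_trans)
      qed
      \<comment> \<open>At primes outside \<open>Fl\<close> no x intervenes and the values of
        \<open>T\<close> agree modulo the full p-part of c'. At primes of \<open>Fl\<close> the unit
        \<open>x p\<close> is 1 only modulo one power of p less, so one power is lost.\<close>
      have locN: "int p ^ \<gamma> p dvd T X - T X0" if p: "prime p" "p \<notin> Fl" for p
      proof -
        have "I X p = 0" using IX[OF XJ, of p] I0F[OF p(2)] by simp
        then show ?thesis using loc[OF p(1)] I0F[OF p(2)] by (simp add: cong_iff_dvd_diff)
      qed
      have locF: "int p ^ (\<gamma> p - 1) dvd T X - T X0" if p: "prime p" "p \<in> Fl" for p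
      proof -
        have d: "int p ^ (\<gamma> p - 1) dvd int p ^ \<gamma> p" by (rule le_imp_power_dvd) simp
        have "[x p = 1 + int (s p) * int p ^ (\<gamma> p - 1)] (mod int p ^ (\<gamma> p - 1))"
          using x[OF p(2)] d cong_dvd_modulus by blast
        then have x1: "[x p = 1] (mod int p ^ (\<gamma> p - 1))" by (simp add: unique_euclidean_semiring_class.cong_def mod_add_right_eq[symmetric])
        have "[T X * x p ^ i = T X] (mod int p ^ (\<gamma> p - 1))" "[T X0 * x p ^ i = T X0] (mod int p ^ (\<gamma> p - 1))" for i
          using cong_scalar_left[OF cong_pow[OF x1, of i], of "T X"] cong_scalar_left[OF cong_pow[OF x1, of i], of "T X0"] by simp_all
        moreover have "[T X * x p ^ I X p = T X0 * x p ^ I X0 p] (mod int p ^ (\<gamma> p - 1))" using loc[OF p(1)] d cong_dvd_modulus by blast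
        ultimately show ?thesis by (metis cong_iff_dvd_diff cong_sym cong_trans)
      qed
      \<comment> \<open>A prime of q1 lies in \<open>Fl\<close> only if it divides q2; then it
        divides q2', so c' = N q2' contains it more often than q1 does, which makes up for the lost
        power.\<close>
      have key: "int q1 dvd T X - T X0"
      proof (rule prime_powers_dvd_imp_dvd[OF pos(6)])
        fix p assume p: "prime p" "p dvd q1"
        have pc: "p dvd c'" using p q1c' by auto
        show "int (p ^ multiplicity p q1) dvd T X - T X0"
        proof (cases "p dvd q2")
          case False
          then have "p \<notin> Fl" using p by (simp add: Fl_def)
          moreover have "multiplicity p q1 \<le> \<gamma> p" using q1c' pos unfolding \<gamma>_def by (intro dvd_imp_multiplicity_le) auto
          ultimately show ?thesis using locN[OF p(1)] le_imp_power_dvd[of "multiplicity p q1" "\<gamma> p" "int p"] by (metis dvd_trans of_nat_power)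
        next
          case True
          have "p dvd q2'" using True c'E[OF p(1) pc] p(1) by (auto simp: q2E prime_dvd_mult_iff)
          then have "p ^ multiplicity p q1 * p dvd N * q2'" using q1N by (intro mult_dvd_mono) (auto intro: dvd_trans[OF multiplicity_dvd])
          then have "\<gamma> p \<ge> Suc (multiplicity p q1)" using ge2[OF p(1)] by (simp add: c'N mult.commute)
          then have "int p ^ multiplicity p q1 dvd int p ^ (\<gamma> p - 1)" by (intro le_imp_power_dvd) simp
          moreover have "p \<in> Fl" using p pc True by (simp add: Fl_def)
          ultimately show ?thesis using locF[OF p(1)] by (metis dvd_trans of_nat_power)
        qed
      qed
      have TE: "((1,2) \<in> X \<longrightarrow> 2 \<in> E) \<and> ((1,3) \<in> X \<longrightarrow> 3 \<in> E)" using XJ by (auto simp: J_def)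
      have Tle: "T X \<noteq> T X0 \<Longrightarrow> int q1 \<le> \<bar>T X - T X0\<bar>" using dvd_imp_le_int[OF _ key] by simp
      have E2q: "2 \<in> E \<Longrightarrow> odd q1" and E3q: "3 \<in> E \<Longrightarrow> \<not> 3 dvd q1" using Ec' q1c' by (blast intro: dvd_trans)+
      \<comment> \<open>The difference of the two values is at most 9 in absolute value and
        divisible by q1, which is at least 3 and prime to the elements of E. Three coincidences
        survive, each with difference exactly q1 up to sign; they are refuted below.\<close>
      have TT: "T X = T X0"
      proof (rule ccontr)
        assume ne: "T X \<noteq> T X0"
        have left0: "(E = {2} \<and> q1 = 3 \<and> T X = -2) \<or> (E = {3} \<and> q1 = 4 \<and> T X = -3) \<or> (E = {2,3} \<and> q1 = 5 \<and> T X = 6)"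
        proof -
          have TX: "T X \<in> {1, -1, 2, -2, 3, -3, 6, -6}" by (auto simp: T_def)
          have "\<bar>T X - T X0\<bar> \<le> 9" using TX TX0 by (auto split: if_splits)
          then have "q1 \<le> 9" using Tle[OF ne] by linarith
          then have q1: "q1 \<in> {3, 4, 5, 6, 7, 8, 9}" using q13 by auto
          consider "E = {}" | "E = {2}" | "E = {3}" | "E = {2, 3}" using E23 by blast
          then show ?thesis
          proof cases
            case 1
            then have "T X0 = 1" "T X \<in> {1, -1}" using TX0 TE by (auto simp: T_def)
            then show ?thesis using Tle[OF ne] q13 by auto
          next
            case 2
            then have "T X0 = 1" "T X \<in> {1, -1, 2, -2}" using TX0 TE by (auto simp: T_def)
            then show ?thesis using key ne q1 2 by auto
          next
            case 3
            then have "T X0 = 1" "T X \<in> {1, -1, 3, -3}" using TX0 TE by (auto simp: T_def)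
            then show ?thesis using key ne q1 3 E3q by auto
          next
            case 4
            then have "q1 \<in> {5, 7}" using q1 E3q E2q by auto
            then show ?thesis using key ne TX TX0 4 by (auto split: if_splits)
          qed
        qed
        have sets: "{2::nat} \<noteq> {2,3}" "{3::nat} \<noteq> {2,3}" by auto
        have T01: "T X0 = 1" using left0 TX0 sets by metis
        have left: "(2 \<in> E \<and> 3 \<notin> E \<and> q1 = 3 \<and> T X = -2) \<or> (2 \<notin> E \<and> 3 \<in> E \<and> q1 = 4 \<and> T X = -3) \<or> (2 \<in> E \<and> 3 \<in> E \<and> q1 = 5 \<and> T X = 6)"
          using left0 by (elim disjE conjE) simp_all
        \<comment> \<open>\<open>p0\<close> is the only prime of q1 in the surviving cases. If it
          divides q2, a higher power of it in c' separates the products. If not, the p0-part of c'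
          divides q1, and the claim \<open>only\<close> excludes every other prime of c'; so c' = q1
          and \<open>Fl\<close> is empty, the case treated before.\<close>
        define p0 where "p0 = (if q1 = 3 then 3 else if q1 = 4 then 2 else 5 :: nat)"
        have p0: "prime p0" "p0 dvd q1" using left by (auto simp: p0_def)
        have p0c: "p0 dvd c'" using p0(2) q1c' by auto
        have p0N: "p0 dvd N" using p0(2) q1N by auto
        have dq: "\<bar>T X - T X0\<bar> = int q1" using left T01 by auto
        show False
        proof (cases "p0 dvd q2")
          case True
          then have F: "p0 \<in> Fl" using p0(1) p0c by (simp add: Fl_def)
          have nD: "p0 \<notin> Dt" using p0N by (simp add: Dt_def)
          have lF: "int p0 ^ k dvd int q1" if "k \<le> \<gamma> p0 - 1" for k
            using locF[OF p0(1) F] le_imp_power_dvd[OF that, of "int p0"] dq by (metis dvd_abs_iff dvd_trans)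
          have cq: "coprime p0 qE" using c'E[OF p0(1) p0c] p0(1) by (simp add: prime_imp_coprime)
          show False
          proof (cases "q1 = 4")
            case q4: True
            then have p02: "p0 = 2" by (simp add: p0_def)
            then have "2 ^ 2 dvd q2' * qE" using primitive_even_imp_4_dvd[OF p2] True q2E by simp
            moreover have "coprime (2 ^ 2) qE" using cq p02 by (metis coprime_power_left_iff)
            ultimately have "2 ^ 2 dvd q2'" by (simp add: coprime_dvd_mult_left_iff)
            then have "4 * 2 ^ 2 dvd N * q2'" using q1N q4 by (intro mult_dvd_mono) auto
            then have "2 ^ 4 dvd c'" by (simp add: c'N)
            then have "\<gamma> 2 \<ge> 4" using ge2[of 2 4] by simp
            then have "int 2 ^ 3 dvd int q1" using lF[of 3] p02 by simp
            then show False using q4 by simp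
          next
            case q4: False
            then have p0q: "p0 = q1" using left by (auto simp: p0_def)
            have "p0 dvd q2'" using True cq by (simp add: q2E coprime_dvd_mult_left_iff)
            then have "p0 ^ 2 dvd c'" using p0N by (simp add: c'N power2_eq_square mult_dvd_mono)
            then have g2': "\<gamma> p0 \<ge> 2" using ge2[OF p0(1), of 2] by simp
            have "\<not> \<gamma> p0 \<ge> 3"
            proof
              assume "\<gamma> p0 \<ge> 3"
              then have "int p0 ^ 2 dvd int q1" using lF[of 2] by simp
              then show False using left p0q by auto
            qed
            then have g: "\<gamma> p0 = 2" using g2' by simp
            have xq: "[x p0 = 1 + int (s p0) * int p0] (mod int p0 ^ 2)" using x[OF F] g by simp
            have i: "I X p0 = 0 \<or> I X p0 = 1" using IX[OF XJ, of p0] I0N[OF F nD] by auto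
            have "[T X * x p0 ^ I X p0 = x p0] (mod int p0 ^ 2)" using loc[OF p0(1)] g T01 I0N[OF F nD] by simp
            moreover have "[T X * x p0 ^ I X p0 = T X * (1 + int (s p0) * int p0) ^ I X p0] (mod int p0 ^ 2)"
              using cong_scalar_left[OF cong_pow[OF xq]] .
            ultimately have "[T X * (1 + int (s p0) * int p0) ^ I X p0 = 1 + int (s p0) * int p0] (mod int p0 ^ 2)"
              using xq by (meson cong_sym cong_trans)
            then show False using left i p0q q4 by (auto simp: s_def cong_iff_dvd_diff)
          qed
        next
          case False
          then have nF: "p0 \<notin> Fl" using p0 by (simp add: Fl_def)
          have pN: "int p0 ^ \<gamma> p0 dvd int q1" using locN[OF p0(1) nF] dq by (metis dvd_abs_iff)
          have only: "l = p0" if l: "prime l" "l dvd c'" for l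
          proof (rule ccontr)
            assume ne: "l \<noteq> p0"
            have l1: "\<not> l dvd q1"
            proof
              assume "l dvd q1"
              moreover have "q1 \<in> {p0, p0 ^ 2}" using left by (auto simp: p0_def)
              ultimately have "l dvd p0" using l(1) prime_dvd_power by auto
              then show False using ne l p0 by (simp add: primes_dvd_imp_eq)
            qed
            then have lF: "l \<in> Fl" using l by (simp add: Fl_def)
            have lg: "\<gamma> l = 1"
            proof (rule ccontr)
              assume "\<gamma> l \<noteq> 1"
              then have "\<gamma> l - 1 > 0" using g0[OF l] by simp
              then have "int l dvd int l ^ (\<gamma> l - 1)" by simp
              then have "int l dvd int q1" using locF[OF l(1) lF] dq by (metis dvd_abs_iff dvd_trans)
              then show False using l1 by simp
            qed
            have i0: "I X0 l = 1 \<or> I X0 l = 2" using I0D I0N lF by blast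
            have i: "I X l \<le> I X0 l" using IX[OF XJ] .
            have xl: "[x l = 1 + int (s l)] (mod int l)" using x[OF lF] lg by simp
            have "[T X * x l ^ I X l = x l ^ I X0 l] (mod int l)" using loc[OF l(1)] lg T01 by simp
            moreover have "[T X * x l ^ I X l = T X * (1 + int (s l)) ^ I X l] (mod int l)"
              using cong_scalar_left[OF cong_pow[OF xl]] .
            moreover have "[x l ^ I X0 l = (1 + int (s l)) ^ I X0 l] (mod int l)" using cong_pow[OF xl] .
            ultimately have "[T X * (1 + int (s l)) ^ I X l = (1 + int (s l)) ^ I X0 l] (mod int l)" by (meson cong_sym cong_trans)
            then have D: "int l dvd T X * (1 + int (s l)) ^ I X l - (1 + int (s l)) ^ I X0 l" by (simp add: cong_iff_dvd_diff)
            have ii: "(I X l, I X0 l) \<in> {(0,1), (1,1), (0,2), (1,2), (2,2)}" using i0 i by auto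
            have l23: "l \<noteq> 2" "l \<noteq> 3" "q1 = 5 \<Longrightarrow> l \<noteq> 5"
              using left l ne Ec'[of 2] Ec'[of 3] by (auto simp: p0_def)
            \<comment> \<open>Here \<open>T X\<close> is -2, -3 or 6 and 1 + s is 2, 3 or 3
              respectively, so the list is finite. All entries divide 72, or 360 if q1 = 5, whose
              primes 2, 3, 5 are excluded for l.\<close>
            have "T X * (1 + int (s l)) ^ I X l - (1 + int (s l)) ^ I X0 l \<in> {-4, -6, -8, -12, -18, -36} \<union> (if q1 = 5 then {3, 15, -3, 9, 45} else {})"
              using left ii l23 by (auto simp: s_def)
            moreover have "\<not> int l dvd n" if "n \<in> {-4, -6, -8, -12, -18, -36} \<union> (if q1 = 5 then {3, 15, -3, 9, 45} else {})" for n
            proof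
              assume dn: "int l dvd n"
              have "n dvd (if q1 = 5 then 360 else 72)" using that by (auto split: if_splits)
              also have "\<dots> = int (2 ^ 3 * 3 ^ 2 * (if q1 = 5 then 5 else 1))" by simp
              finally have "int l dvd int (2 ^ 3 * 3 ^ 2 * (if q1 = 5 then 5 else 1))" using dn dvd_trans by blast
              then have "l dvd 2 ^ 3 * 3 ^ 2 * (if q1 = 5 then 5 else 1)" by (simp only: int_dvd_int_iff)
              then have "l dvd 2 ^ 3 \<or> l dvd 3 ^ 2 \<or> (q1 = 5 \<and> l dvd 5)"
                using l(1) by (auto simp only: prime_dvd_mult_iff split: if_splits)
              then have "l dvd 2 \<or> l dvd 3 \<or> (q1 = 5 \<and> l dvd 5)" using l(1) prime_dvd_power by blast
              then show False using l23 l(1) primes_dvd_imp_eq[of l] by auto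
            qed
            ultimately show False using D by blast
          qed
          have "int c' dvd int q1"
          proof (rule prime_powers_dvd_imp_dvd[OF pos(1)])
            fix p assume "prime p" "p dvd c'"
            then show "int (p ^ multiplicity p c') dvd int q1" using only pN by (simp add: \<gamma>_def)
          qed
          then have "c' = q1" using q1c' by (simp add: dvd_antisym)
          moreover have "Fl = {}"
          proof (rule equals0I)
            fix p assume p: "p \<in> Fl"
            then have "p = p0" unfolding Fl_def by (intro only) blast+
            then show False using nF p by blast
          qed
          moreover have "q1 \<in> {3, 4, 5}" using left by auto
          ultimately show False using special by blast
        qed
      qed
      \<comment> \<open>With \<open>T X = T X0\<close> cancelled, powers of \<open>x p\<close> are
        compared. The exponents agree because \<open>x p\<close>, and for p in \<open>Dt\<close>
        also its square, is not 1.\<close>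
      have III: "I X p = I X0 p" if p: "p \<in> Fl" for p
      proof (rule ccontr)
        assume ne: "I X p \<noteq> I X0 p"
        have pp: "prime p" "p dvd c'" using p by (auto simp: Fl_def)
        have "coprime (T X0) (int p)"
        proof (cases "T X0 = 3")
          case True
          then have "3 \<in> E" using TX0 by (auto split: if_splits)
          then have "p \<noteq> 3" using Ec' pp by auto
          then have "coprime 3 p" using pp by (intro primes_coprime) auto
          then have "coprime (int 3) (int p)" by (simp only: coprime_int_iff)
          then show ?thesis using True by simp
        qed (use TX0 in auto)
        then have cT: "coprime (T X0) (int p ^ \<gamma> p)" by simp
        have "[T X0 * x p ^ I X p = T X0 * x p ^ I X0 p] (mod int p ^ \<gamma> p)" using loc[OF pp(1)] TT by simp
        then have e: "[x p ^ I X p = x p ^ I X0 p] (mod int p ^ \<gamma> p)" using cong_mult_lcancel[OF cT] by simp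
        have cx: "coprime (x p) (int p ^ \<gamma> p)"
        proof -
          have "coprime (x p) (int p)" using xc'[OF p] pp(2) by (meson coprime_divisors dvd_refl of_nat_dvd_iff)
          then show ?thesis by simp
        qed
        have lt: "I X p < I X0 p" using IX[OF XJ, of p] ne by simp
        show False
        proof (cases "p \<in> Dt")
          case True
          then have "I X0 p = 2" "I X p = 0 \<or> I X p = 1" using I0D lt by auto
          moreover have "[x p = 1] (mod int p ^ \<gamma> p)" if "[x p = x p ^ 2] (mod int p ^ \<gamma> p)"
          proof -
            have "[x p * 1 = x p * x p] (mod int p ^ \<gamma> p)" using that by (simp add: power2_eq_square)
            then show ?thesis using cong_mult_lcancel[OF cx, of 1 "x p"] cong_sym by blast
          qed
          ultimately show False using e xnot1[OF p] x2not1[OF True] cong_sym by fastforce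
        next
          case False
          then have "I X0 p = 1" "I X p = 0" using I0N[OF p] lt by auto
          then show False using e xnot1[OF p] cong_sym by fastforce
        qed
      qed
      have tag: "X \<inter> {(2,p),(3,p)} = X0 \<inter> {(2,p),(3,p)}" if p: "p \<in> Fl" for p
        by (rule card_subset_eq) (use XJ III[OF p] in \<open>auto simp: J_def X0_def I_def\<close>)
      have base: "(0,0) \<notin> X" "(1,2) \<notin> X" "(1,3) \<in> X \<longleftrightarrow> (1,3) \<in> B0"
        using TT TX0 by (auto simp: T_def B0_def split: if_splits)
      show "X = X0"
      proof (rule Set.set_eqI)
        fix j :: "nat \<times> nat"
        obtain i p where j: "j = (i, p)" by (cases j)
        show "j \<in> X \<longleftrightarrow> j \<in> X0"
        proof (cases "i \<le> 1")
          case True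
          then show ?thesis using base XJ E23 j by (auto simp: J_def X0_def B0_def split: if_splits)
        next
          case False
          show ?thesis
          proof (cases "p \<in> Fl")
            case True
            then show ?thesis using tag[OF True] False XJ X0J j DF by (auto simp: J_def)
          next
            case False
            then show ?thesis using \<open>\<not> i \<le> 1\<close> XJ X0J j DF by (auto simp: J_def)
          qed
        qed
      qed
    qed
    obtain \<psi> where "dirichlet_char c' \<psi>" "\<And>j. j \<in> J \<Longrightarrow> \<kappa> j * \<psi> (g j) \<noteq> 1"
    proof (rule exists_char_avoiding[OF pos(1) finJ copg X0J, where \<kappa> = \<kappa>])
      fix \<psi> assume "dirichlet_char c' \<psi>" "\<And>j. j \<in> J \<Longrightarrow> \<kappa> j * \<psi> (g j) \<noteq> 1"
      then show thesis by (rule that)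
    qed (use iso k0 X0J in blast)+
    then show thesis by (rule finish)
  qed
qed

lemma B1_add_int: "B1 (x + of_int k) = B1 x"
  by (simp add: B1_def)

lemma dedekind_sum_mod:
  assumes "c > 0"
  shows "dedekind_sum q1 \<eta>1 \<eta>2 (a mod int c) c = dedekind_sum q1 \<eta>1 \<eta>2 a c"
proof -
  have "B1 (of_int n / of_nat q1 + of_int (a * j) / of_nat c) = B1 (of_int n / of_nat q1 + of_int (a mod int c * j) / of_nat c)" for n j
  proof -
    have "a * j = a mod int c * j + int c * (a div int c * j)"
      by (metis distrib_right mod_mult_div_eq mult.assoc)
    then have "(of_int (a * j) :: real) = of_int (a mod int c * j + int c * (a div int c * j))" by (rule arg_cong)
    also have "\<dots> = of_int (a mod int c * j) + of_nat c * of_int (a div int c * j)" by simp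
    finally have "of_int (a * j) / of_nat c = (of_int (a mod int c * j) / of_nat c + of_int (a div int c * j) :: real)"
      using assms by (simp only: add_divide_distrib) simp
    then show ?thesis using B1_add_int[of "of_int n / of_nat q1 + of_int (a mod int c * j) / of_nat c" "a div int c * j"]
      by (simp only: add.assoc)
  qed
  then show ?thesis by (simp add: dedekind_sum_def)
qed

theorem dedekind_sum_not_all_zero:
  assumes p1: "primitive_char q1 \<eta>1" and nt1: "\<eta>1 \<noteq> trivial_char q1"
    and p2: "primitive_char q2 \<eta>2" and par: "\<eta>1 (-1) * \<eta>2 (-1) = 1"
    and C: "C > 0" and dv: "q1 * q2 dvd C"
  shows "\<exists>a\<in>{0..<int C}. coprime a (int C) \<and> dedekind_sum q1 \<eta>1 \<eta>2 a C \<noteq> 0"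
proof -
  have q13: "q1 \<ge> 3" by (rule primitive_nontrivial_ge_3[OF p1 nt1])
  have q2: "q2 > 0" using dc_pos[OF primitive_dc[OF p2]] .
  \<comment> \<open>If C is twice an odd number, the twist is built modulo C / 2. A primitive
    character of even modulus has modulus divisible by 4, so then q1 and q2 are odd and q1 q2 still
    divides C / 2.\<close>
  define h :: nat where "h = (if 2 dvd C \<and> \<not> 4 dvd C then 2 else 1)"
  define c where "c = C div h"
  have Ch: "C = h * c" by (auto simp: h_def c_def)
  have h2: "odd c \<and> odd q1 \<and> odd q2" if "h = 2"
  proof -
    have n4: "\<not> 4 dvd C" using that by (auto simp: h_def split: if_splits)
    have "q1 dvd C" "q2 dvd C" using dv by (auto dest: dvd_mult_left dvd_mult_right)
    then have "\<not> 4 dvd q1" "\<not> 4 dvd q2" using n4 dvd_trans by blast+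
    then have "odd q1" "odd q2" using primitive_even_imp_4_dvd p1 p2 by blast+
    moreover have "odd c" using n4 Ch that by auto
    ultimately show ?thesis by simp
  qed
  have dc: "q1 * q2 dvd c"
  proof (cases "h = 2")
    case True
    then have "coprime (q1 * q2) 2" using h2 by simp
    then show ?thesis using dv Ch True by (simp add: coprime_dvd_mult_right_iff)
  next
    case False
    then have "h = 1" by (auto simp: h_def split: if_splits)
    then show ?thesis using dv Ch by simp
  qed
  define N where "N = c div q2"
  have cN: "c = N * q2" using dc by (auto simp: N_def elim!: dvdE)
  have q1N: "q1 dvd N" using dc q2 by (auto simp: N_def elim!: dvdE)
  have cpos: "c > 0" using C Ch by (auto intro: gr0I)
  \<comment> \<open>At 2 the product of two characters of full level is never of full level, and modulo 3 there is
    only one nontrivial character.\<close>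
  define P where "P = {p. (p = 2 \<or> p = (3::nat)) \<and> p dvd q2 \<and> \<not> p dvd N \<and> (p = 3 \<longrightarrow> \<not> 9 dvd q2)}"
  have prP: "prime p" if "p \<in> P" for p using that by (auto simp: P_def)
  obtain q2' qE where q2E: "q2 = q2' * qE" and E1: "\<And>p. prime p \<Longrightarrow> p dvd qE \<Longrightarrow> p \<in> P"
    and E2: "\<And>p. p \<in> P \<Longrightarrow> \<not> p dvd q2'"
    using strip_primes[OF q2 prP] by blast
  define c' where "c' = N * q2'"
  define E where "E = {p. prime p \<and> p dvd qE}"
  have EP: "E = P"
  proof
    show "E \<subseteq> P" using E1 by (auto simp: E_def)
    show "P \<subseteq> E"
    proof
      fix p assume p: "p \<in> P"
      then have "p dvd q2' * qE" by (simp add: P_def q2E)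
      then show "p \<in> E" using E2[OF p] prP[OF p] by (simp add: E_def prime_dvd_mult_iff)
    qed
  qed
  have cop: "coprime c' qE"
  proof (rule ccontr)
    assume "\<not> coprime c' qE"
    moreover have "qE > 0" using q2 q2E by (auto intro: gr0I)
    ultimately obtain p where p: "prime p" "p dvd qE" "int p dvd int c'"
      using not_coprime_prime[of "int c'" qE] by auto
    then have "p dvd c'" by simp
    moreover have "p \<in> P" using E1 p by blast
    ultimately show False using E2 p(1) by (auto simp: c'_def P_def prime_dvd_mult_iff)
  qed
  have cc': "c = c' * qE" by (simp add: c'_def cN q2E)
  obtain \<psi> where tw: "twisted q1 q2 c c' qE N q2' \<eta>1 \<eta>2 \<psi>" and odd: "\<eta>1 (-1) * \<psi> (-1) = -1"
    and ne: "\<And>p. p \<in> E \<Longrightarrow> \<eta>1 (int p) * cnj (\<psi> (int p)) \<noteq> 1"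
  proof (rule choose_twist[OF p1 p2 q13 cpos cN q1N cc' cop q2E _ E_def])
    show "4 dvd c" if "2 dvd c"
    proof -
      have "h \<noteq> 2" using h2 that by blast
      moreover have "2 dvd C" using that Ch by simp
      ultimately have "4 dvd C" "h = 1" by (simp_all add: h_def split: if_splits)
      then show ?thesis using Ch by simp
    qed
  qed (use EP in \<open>auto simp: P_def\<close>)
  have "\<exists>a. coprime a (int C) \<and> dedekind_sum q1 \<eta>1 \<eta>2 a C \<noteq> 0"
  proof (cases "h = 2")
    case True
    then show ?thesis using twisted.dedekind_sum_nonzero_double[OF tw par odd] ne h2 Ch
      by (auto simp: E_def twisted.th_def[OF tw])
  next
    case False
    have "h = 1" using False by (simp add: h_def split: if_splits)
    then have cC: "c = C" using Ch by simp
    have "\<exists>a. coprime a (int c) \<and> dedekind_sum q1 \<eta>1 \<eta>2 a c \<noteq> 0"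
      by (rule twisted.dedekind_sum_nonzero[OF tw par odd]) (use ne in \<open>simp add: E_def twisted.th_def[OF tw]\<close>)
    then show ?thesis unfolding cC .
  qed
  then obtain a where a: "coprime a (int C)" "dedekind_sum q1 \<eta>1 \<eta>2 a C \<noteq> 0" by blast
  show ?thesis
  proof (rule bexI[of _ "a mod int C"])
    show "coprime (a mod int C) (int C) \<and> dedekind_sum q1 \<eta>1 \<eta>2 (a mod int C) C \<noteq> 0"
      using a dedekind_sum_mod[OF C] C by simp
  qed (use C in simp)
qed

section \<open>The correlation with a test function\<close>

lemma sum_units_inverse:
  fixes F G :: "int \<Rightarrow> 'a::comm_monoid_add"
  assumes n: "n > 0" and FG: "\<And>x y. x \<in> {0..<n} \<Longrightarrow> y \<in> {0..<n} \<Longrightarrow> [x * y = 1] (mod n) \<Longrightarrow> F x = G y"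
  shows "(\<Sum>x\<in>{0..<n}. if coprime x n then F x else 0) = (\<Sum>x\<in>{0..<n}. if coprime x n then G x else 0)"
proof -
  let ?U = "{x\<in>{0..<n}. coprime x n}"
  define r where "r = (\<lambda>x. SOME y. y \<in> {0..<n} \<and> [x * y = 1] (mod n))"
  have r: "r x \<in> {0..<n} \<and> [x * r x = 1] (mod n)" if x: "x \<in> ?U" for x
  proof -
    obtain y where "[x * y = 1] (mod n)" using cong_solve_coprime_int[of x n] x by auto
    then have "[x * (y mod n) = 1] (mod n)" by (simp add: unique_euclidean_semiring_class.cong_def mod_mult_right_eq)
    then have "\<exists>y. y \<in> {0..<n} \<and> [x * y = 1] (mod n)" using n by (intro exI[of _ "y mod n"]) simp
    then show ?thesis unfolding r_def by (rule someI_ex)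
  qed
  have rU: "r x \<in> ?U" if x: "x \<in> ?U" for x
  proof -
    have "coprime (x * r x) n" using r[OF x] by (metis cong_imp_coprime cong_sym coprime_1_left)
    then show ?thesis using r[OF x] by simp
  qed
  have rr: "r (r x) = x" if x: "x \<in> ?U" for x
  proof -
    have "[r x * r (r x) = r x * x] (mod n)" using r[OF rU[OF x]] r[OF x] by (metis cong_sym cong_trans mult.commute)
    then have "[r (r x) = x] (mod n)" using cong_mult_lcancel[of "r x" n] rU[OF x] by simp
    then show ?thesis using r[OF rU[OF x]] x n by (intro cong_less_imp_eq_int) auto
  qed
  have "(\<Sum>x\<in>?U. F x) = (\<Sum>x\<in>?U. G x)"
  proof (rule sum.reindex_bij_witness[where i = r and j = r])
    show "G (r x) = F x" if x: "x \<in> ?U" for x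
      using FG[of x "r x"] r[OF x] x by auto
  qed (use rU rr in blast)+
  then show ?thesis by (simp only: sum.inter_filter finite_atLeastLessThan_int)
qed

text \<open>In the correlation a = b + N r. With s inverse to r modulo q, s a = b s + N, so the
  second condition says that a is prime to q.\<close>

definition good :: "nat \<Rightarrow> nat \<Rightarrow> nat \<Rightarrow> int \<Rightarrow> bool" where
  "good q N b s \<longleftrightarrow> coprime s (int q) \<and> coprime (int b * s + int N) (int q)"

text \<open>The first factor restricts a to b + N r, which is prime to N because b is. The second
  factor is then \<eta>(t + r m), and for s inverse to r the product of the conjugate of \<eta>(r)
  with it is \<eta>(m + t s). For t = 0 this does not depend on s, which produces the main
  term.\<close>

lemma ph_correlation:
  fixes N b q c :: nat
  assumes dc: "dirichlet_char q \<eta>" and N: "N > 0" and c: "c = N * q" and b: "coprime b N"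
  shows "(\<Sum>a\<in>{0..<int c}. if coprime a (int c) then cnj (ph (int N) \<eta> (a - int b)) * ph (int N) \<eta> (a * m + (int N * t - int b * m)) else 0)
     = (\<Sum>s\<in>{0..<int q}. if good q N b s then \<eta> (m + t * s) else 0)"
proof -
  have q: "q > 0" using dc_pos[OF dc] .
  have cpos: "int c > 0" using c N q by simp
  define f where "f = (\<lambda>a. if coprime a (int c) then cnj (ph (int N) \<eta> (a - int b)) * ph (int N) \<eta> (a * m + (int N * t - int b * m)) else 0)"
  have php: "ph (int N) \<eta> (y + int c * z) = ph (int N) \<eta> y" for y z
    using ph_periodic[of "int N" \<eta> "int q" y z] dc_periodic[OF dc] N by (simp add: c)
  have fper: "f (a + int c) = f a" for a
  proof -
    have "a + int c - int b = (a - int b) + int c * 1"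
      "(a + int c) * m + (int N * t - int b * m) = (a * m + (int N * t - int b * m)) + int c * m" by (simp_all add: algebra_simps)
    moreover have "coprime (a + int c) (int c) \<longleftrightarrow> coprime a (int c)" by (simp add: coprime_iff_gcd_eq_1)
    ultimately show ?thesis unfolding f_def by (simp only: php)
  qed
  have fb: "f (a + int b) = (if int N dvd a then f (a + int b) else 0)" for a
    by (simp add: f_def ph_def)
  have fN: "f (int N * r + int b) = (if coprime r (int q) then if coprime (int N * r + int b) (int q) then cnj (\<eta> r) * \<eta> (t + r * m) else 0 else 0)" for r
  proof -
    have "coprime (int N * r + int b) (int N)" using b
      by (metis add.commute coprime_commute coprime_int_iff gcd_add_mult coprime_iff_gcd_eq_1 mult.commute)
    then have e: "coprime (int N * r + int b) (int c) \<longleftrightarrow> coprime (int N * r + int b) (int q)" by (simp add: c)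
    have "(int N * r + int b) * m + (int N * t - int b * m) = int N * (t + r * m)" by (simp add: algebra_simps)
    moreover have "\<eta> r = 0" if "\<not> coprime r (int q)" using that dc_eq_0_iff[OF dc] by simp
    ultimately show ?thesis using e N by (simp add: f_def ph_def)
  qed
  have "(\<Sum>a\<in>{0..<int c}. f a) = (\<Sum>a\<in>{0..<int c}. f (a + int b))"
    using sum_periodic_shift[of "int c" f "int b"] cpos fper by simp
  also have "\<dots> = (\<Sum>a\<in>{0..<int q * int N}. if int N dvd a then f (a + int b) else 0)"
    by (rule sum.cong) (use fb in \<open>auto simp: c mult.commute\<close>)
  also have "\<dots> = (\<Sum>r\<in>{0..<int q}. f (int N * r + int b))"
    using q N by (intro sum_multiples) auto
  also have "\<dots> = (\<Sum>s\<in>{0..<int q}. if coprime s (int q) then if coprime (int b * s + int N) (int q) then \<eta> (m + t * s) else 0 else 0)"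
    unfolding fN
  proof (rule sum_units_inverse)
    fix x y assume xy: "[x * y = 1] (mod int q)"
    have "coprime (x * y) (int q)" using xy by (metis cong_imp_coprime cong_sym coprime_1_left)
    then have cx: "coprime x (int q)" and cy: "coprime y (int q)" by simp_all
    have "[x * y * int N = 1 * int N] (mod int q)" using xy by (rule cong_scalar_right)
    then have "[y * (int N * x + int b) = int b * y + int N] (mod int q)"
      by (simp add: cong_iff_dvd_diff algebra_simps)
    then have e: "coprime (int N * x + int b) (int q) \<longleftrightarrow> coprime (int b * y + int N) (int q)"
      using cy by (metis cong_imp_coprime cong_sym coprime_mult_left_iff)
    have "\<eta> x * \<eta> y = 1" using dc_cong[OF dc xy] dc_one[OF dc] dc_mult[OF dc] by simp
    moreover have "cnj (\<eta> x) * \<eta> x = 1" using dc_mult_cnj[OF dc, of x] cx by (simp add: mult.commute)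
    ultimately have c1: "cnj (\<eta> x) = \<eta> y" by (metis mult.assoc mult.right_neutral mult_1)
    have "[x * y * m = 1 * m] (mod int q)" using xy by (rule cong_scalar_right)
    then have "[y * (t + x * m) = m + t * y] (mod int q)" by (simp add: cong_iff_dvd_diff algebra_simps)
    then have "\<eta> y * \<eta> (t + x * m) = \<eta> (m + t * y)" using dc_cong[OF dc] dc_mult[OF dc] by metis
    then show "(if coprime (int N * x + int b) (int q) then cnj (\<eta> x) * \<eta> (t + x * m) else 0)
       = (if coprime (int b * y + int N) (int q) then \<eta> (m + t * y) else 0)" using e c1 by simp
  qed (use q in simp)
  also have "\<dots> = (\<Sum>s\<in>{0..<int q}. if good q N b s then \<eta> (m + t * s) else 0)"
    by (rule sum.cong) (auto simp: good_def)
  finally show ?thesis by (simp add: f_def)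
qed

lemma ph_correlation_zero:
  fixes N b c :: nat
  assumes "\<not> int N dvd u"
  shows "cnj (ph (int N) \<eta> (a - int b)) * ph (int N) \<eta> (a * m + (u - int b * m)) = 0"
proof (cases "int N dvd a - int b")
  case True
  have "a * m + (u - int b * m) = u + (a - int b) * m" by (simp add: algebra_simps)
  then have "\<not> int N dvd a * m + (u - int b * m)" using assms True by (metis dvd_add_left_iff dvd_mult2)
  then show ?thesis by (simp add: ph_def)
qed (simp add: ph_def)

text \<open>A residue class modulo L is a progression of length q / L, and L copies of it form a
  full period, where \<open>primitive_sum_progression\<close> applies with step t L.\<close>

lemma primitive_class_sum_bound:
  assumes prim: "primitive_char q \<eta>" and L: "L dvd q"
  shows "cmod (\<Sum>s\<in>{0..<int q}. if int L dvd s - s0 then \<eta> (m + t * s) else 0) \<le> (if int (q div L) dvd t then real (q div L) else 0)"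
proof -
  note dc = primitive_dc[OF prim]
  have q: "q > 0" using dc_pos[OF dc] .
  define g where "g = q div L"
  have qg: "q = g * L" using L by (simp add: g_def)
  have pos: "g > 0" "L > 0" using q qg by (auto intro: gr0I)
  define A where "A = m + t * s0"
  define f where "f = (\<lambda>s. if int L dvd s - s0 then \<eta> (m + t * s) else 0)"
  have etp: "\<eta> (x + int q * z) = \<eta> x" for x z
    using periodic_add_mult[of \<eta> "int q"] dc_periodic[OF dc] by blast
  have fper: "f (s + int q) = f s" for s
  proof -
    have "int L dvd s + int q - s0 \<longleftrightarrow> int L dvd s - s0" using L
      by (metis add_diff_eq add.commute dvd_add_right_iff of_nat_dvd_iff)
    moreover have "m + t * (s + int q) = (m + t * s) + int q * t" by (simp add: algebra_simps)
    ultimately show ?thesis unfolding f_def by (simp only: etp)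
  qed
  have "(\<Sum>s\<in>{0..<int q}. f s) = (\<Sum>s\<in>{0..<int q}. f (s + s0))"
    using sum_periodic_shift[of "int q" f s0] q fper by simp
  also have "\<dots> = (\<Sum>s\<in>{0..<int g * int L}. if int L dvd s then \<eta> (A + t * s) else 0)"
    by (rule sum.cong) (auto simp: f_def A_def qg algebra_simps)
  also have "\<dots> = (\<Sum>y\<in>{0..<int g}. \<eta> (A + t * int L * y))"
    using sum_multiples[of "int g" "int L" "\<lambda>s. \<eta> (A + t * s)"] pos by (simp add: mult.assoc)
  finally have 1: "(\<Sum>s\<in>{0..<int q}. f s) = (\<Sum>y\<in>{0..<int g}. \<eta> (A + t * int L * y))" .
  have "(\<Sum>x\<in>{0..<int g * int L}. \<eta> (A + t * int L * x)) = of_nat (nat (int L)) * (\<Sum>y\<in>{0..<int g}. \<eta> (A + t * int L * y))"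
  proof (rule sum_periodic_blocks)
    fix x
    have "A + t * int L * (x + int g) = (A + t * int L * x) + int q * t" by (simp add: qg algebra_simps)
    then show "\<eta> (A + t * int L * (x + int g)) = \<eta> (A + t * int L * x)" by (simp only: etp)
  qed (use pos in auto)
  moreover have "(\<Sum>x\<in>{0..<int g * int L}. \<eta> (A + t * int L * x)) = (if int q dvd t * int L then of_nat q * \<eta> A else 0)"
    using primitive_sum_progression[OF prim, of A "t * int L"] by (simp add: qg)
  moreover have "int q dvd t * int L \<longleftrightarrow> int g dvd t" using pos by (simp add: qg)
  ultimately have "of_nat L * (\<Sum>s\<in>{0..<int q}. f s) = (if int g dvd t then of_nat q * \<eta> A else 0)"
    unfolding 1 by simp
  also have "\<dots> = of_nat L * (if int g dvd t then of_nat g * \<eta> A else 0)" by (simp add: qg)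
  finally have "of_nat L * (\<Sum>s\<in>{0..<int q}. f s) = of_nat L * (if int g dvd t then of_nat g * \<eta> A else 0)" .
  then have "(\<Sum>s\<in>{0..<int q}. f s) = (if int g dvd t then of_nat g * \<eta> A else 0)" using pos by simp
  then show ?thesis using dc_norm_le[OF dc, of A] by (simp add: f_def g_def norm_mult mult_left_le)
qed

text \<open>X and Y are the sets of primes in Moebius inversion for the two coprimality conditions
  of \<open>good\<close>. Their divisibility conditions, if solvable, define one residue class
  modulo the product of X \<union> Y.\<close>

definition corr_bound :: "nat \<Rightarrow> int \<Rightarrow> real" where
  "corr_bound q t = (\<Sum>X\<in>Pow (prime_factors q). \<Sum>Y\<in>Pow (prime_factors q).
     if int (q div \<Prod>(X \<union> Y)) dvd t then real (q div \<Prod>(X \<union> Y)) else 0)"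

lemma good_sum_bound:
  assumes prim: "primitive_char q \<eta>" and b: "coprime b N"
  shows "cmod (\<Sum>s\<in>{0..<int q}. if good q N b s then \<eta> (m + t * s) else 0) \<le> corr_bound q t"
proof -
  have q: "q > 0" using dc_pos[OF primitive_dc[OF prim]] .
  let ?P = "Pow (prime_factors q)"
  let ?G = "\<lambda>X Y s. int (\<Prod>X) dvd s \<and> int (\<Prod>Y) dvd int b * s + int N"
  have e: "(if good q N b s then \<eta> (m + t * s) else 0)
      = (\<Sum>X\<in>?P. \<Sum>Y\<in>?P. (-1) ^ card X * (-1) ^ card Y * (if ?G X Y s then \<eta> (m + t * s) else 0))" for s
  proof -
    have "(if good q N b s then \<eta> (m + t * s) else 0) = (if coprime s (int q) then 1 else 0) * (if coprime (int b * s + int N) (int q) then 1 else 0) * \<eta> (m + t * s)"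
      by (simp add: good_def)
    also have "\<dots> = (\<Sum>X\<in>?P. \<Sum>Y\<in>?P. ((-1) ^ card X * (if int (\<Prod>X) dvd s then 1 else 0)) * ((-1) ^ card Y * (if int (\<Prod>Y) dvd int b * s + int N then 1 else 0)) * \<eta> (m + t * s))"
      unfolding mobius_coprime[OF q] by (subst sum_product) (simp only: sum_distrib_right)
    also have "\<dots> = (\<Sum>X\<in>?P. \<Sum>Y\<in>?P. (-1) ^ card X * (-1) ^ card Y * (if ?G X Y s then \<eta> (m + t * s) else 0))"
      by (intro sum.cong refl) simp
    finally show ?thesis .
  qed
  have inner: "cmod (\<Sum>s\<in>{0..<int q}. if ?G X Y s then \<eta> (m + t * s) else 0)
      \<le> (if int (q div \<Prod>(X \<union> Y)) dvd t then real (q div \<Prod>(X \<union> Y)) else 0)"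
    if X: "X \<subseteq> prime_factors q" and Y: "Y \<subseteq> prime_factors q" for X Y
  proof (cases "\<exists>s. ?G X Y s")
    case False
    then have "(\<Sum>s\<in>{0..<int q}. if ?G X Y s then \<eta> (m + t * s) else 0) = 0" by (intro sum.neutral) meson
    then show ?thesis by (simp only: norm_zero) simp
  next
    case True
    then obtain s0 where s0: "?G X Y s0" by blast
    have fin: "finite X" "finite Y" using X Y finite_subset by blast+
    have pX: "\<And>p. p \<in> X \<Longrightarrow> prime p" and pY: "\<And>p. p \<in> Y \<Longrightarrow> prime p" using X Y by auto
    have dX: "int (\<Prod>X) dvd a \<longleftrightarrow> (\<forall>p\<in>X. int p dvd a)" for a using prod_primes_dvd_iff[OF fin(1) pX] .
    have dY: "int (\<Prod>Y) dvd a \<longleftrightarrow> (\<forall>p\<in>Y. int p dvd a)" for a using prod_primes_dvd_iff[OF fin(2) pY] .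
    have dU: "int (\<Prod>(X \<union> Y)) dvd a \<longleftrightarrow> (\<forall>p\<in>X\<union>Y. int p dvd a)" for a
      using fin pX pY by (intro prod_primes_dvd_iff) auto
    \<comment> \<open>A prime of Y does not divide b: it divides b s0 + N, so it would divide N too,
      while b and N are coprime. Hence the second condition also fixes s modulo each such
      prime.\<close>
    have eq: "?G X Y s \<longleftrightarrow> int (\<Prod>(X \<union> Y)) dvd s - s0" for s
    proof -
      have 1: "int p dvd s \<longleftrightarrow> int p dvd s - s0" if "p \<in> X" for p
        using s0 that unfolding dX by (metis dvd_diff_left_iff)
      have 2: "int p dvd int b * s + int N \<longleftrightarrow> int p dvd s - s0" if "p \<in> Y" for p
      proof -
        have pr: "prime (int p)" using pY that by simp
        have d: "int p dvd int b * s0 + int N" using s0 that unfolding dY by blast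
        have nb: "\<not> int p dvd int b"
        proof
          assume pb: "int p dvd int b"
          then have "int p dvd int N" using d by (metis dvd_add_right_iff dvd_mult2)
          then have "p dvd b" "p dvd N" using pb by simp_all
          then have "is_unit p" using coprime_common_divisor[OF b] by blast
          then show False using pY[OF that] by simp
        qed
        have "int b * s + int N = (int b * s0 + int N) + int b * (s - s0)" by (simp add: algebra_simps)
        then have "int p dvd int b * s + int N \<longleftrightarrow> int p dvd int b * (s - s0)" using d by (metis dvd_add_right_iff)
        then show ?thesis using pr nb by (simp add: prime_dvd_mult_iff)
      qed
      show ?thesis unfolding dX dY dU using 1 2 by blast
    qed
    show ?thesis unfolding eq
      by (rule primitive_class_sum_bound[OF prim prod_primes_dvd]) (use X Y in auto)
  qed
  have "(\<Sum>s\<in>{0..<int q}. if good q N b s then \<eta> (m + t * s) else 0)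
      = (\<Sum>X\<in>?P. \<Sum>Y\<in>?P. (-1) ^ card X * (-1) ^ card Y * (\<Sum>s\<in>{0..<int q}. if ?G X Y s then \<eta> (m + t * s) else 0))"
    unfolding e sum_distrib_left
    by (subst sum.swap, rule sum.cong[OF refl], subst sum.swap, rule refl)
  also have "cmod \<dots> \<le> corr_bound q t" unfolding corr_bound_def
  proof (intro sum_norm_le)
    fix X Y assume "X \<in> ?P" "Y \<in> ?P"
    then show "cmod ((-1) ^ card X * (-1) ^ card Y * (\<Sum>s\<in>{0..<int q}. if ?G X Y s then \<eta> (m + t * s) else 0))
       \<le> (if int (q div \<Prod>(X \<union> Y)) dvd t then real (q div \<Prod>(X \<union> Y)) else 0)"
      using inner[of X Y] by (simp add: norm_mult norm_power)
  qed
  finally show ?thesis .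
qed

definition first_moment_main :: "nat \<Rightarrow> nat \<Rightarrow> (int \<Rightarrow> complex) \<Rightarrow> complex" where
  "first_moment_main c b \<eta> = (\<Sum>m\<in>{0..<int c}. \<eta> m * of_real (ct c m * ct c (- int b * m)))"

text \<open>With k = u - b m the kernel vanishes unless u = N t. The term t = 0 is the main term,
  where every good s contributes \<open>\<eta>2 m\<close>; for the others
  \<open>good_sum_bound\<close> replaces the character sum by a bound that depends on t
  alone.\<close>

lemma first_moment:
  fixes N b q1 q2 c :: nat
  assumes p1: "primitive_char q1 \<eta>1" and p2: "primitive_char q2 \<eta>2" and c: "c > 0" and dvd: "q1 * q2 dvd c"
    and cN: "c = N * q2" and b: "coprime b N"
  shows "cmod ((\<Sum>a\<in>{0..<int c}. if coprime a (int c) then cnj (ph (int N) \<eta>2 (a - int b)) * dedekind_sum q1 \<eta>1 \<eta>2 a c else 0)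
       - dcoef q1 \<eta>1 q2 \<eta>2 c * (of_nat (card {s\<in>{0..<int q2}. good q2 N b s}) * first_moment_main c b (\<lambda>m. \<eta>1 m * \<eta>2 m)))
     \<le> cmod (dcoef q1 \<eta>1 q2 \<eta>2 c) * (\<Sum>t\<in>{0..<int q2}. if t = 0 then 0 else corr_bound q2 t * (\<Sum>m\<in>{0..<int c}. \<bar>ct c m\<bar> * \<bar>ct c (int N * t - int b * m)\<bar>))"
proof -
  note dc1 = primitive_dc[OF p1] and dc2 = primitive_dc[OF p2]
  have q2: "q2 > 0" using dc_pos[OF dc2] .
  have N: "N > 0" using c cN by (auto intro: gr0I)
  have cdiv: "c div q2 = N" using q2 by (simp add: cN)
  let ?I = "{0..<int c}"
  let ?d = "dcoef q1 \<eta>1 q2 \<eta>2 c"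
  define K where "K = (\<lambda>m k. \<Sum>a\<in>?I. if coprime a (int c) then cnj (ph (int N) \<eta>2 (a - int b)) * ph (int N) \<eta>2 (a * m + k) else 0)"
  define R where "R = (\<lambda>m t. \<Sum>s\<in>{0..<int q2}. if good q2 N b s then \<eta>2 (m + t * s) else 0)"
  define U where "U = (\<lambda>m t. \<eta>1 m * of_real (ct c m) * of_real (ct c (int N * t - int b * m)) * R m t)"
  have KR: "K m (int N * t - int b * m) = R m t" for m t
    unfolding K_def R_def by (rule ph_correlation[OF dc2 N cN b])
  have K0: "K m (u - int b * m) = 0" if "\<not> int N dvd u" for m u
    unfolding K_def using ph_correlation_zero[OF that] by (intro sum.neutral) simp
  have php: "ph (int N) \<eta>2 (y + int c) = ph (int N) \<eta>2 y" for y
    using ph_periodic[of "int N" \<eta>2 "int q2" y 1] dc_periodic[OF dc2] N by (simp add: cN)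
  have Kper: "K m (k + int c) = K m k" for m k
    unfolding K_def by (intro sum.cong refl) (use php in \<open>simp add: add.assoc[symmetric]\<close>)
  have row: "(\<Sum>k\<in>?I. \<eta>1 m * of_real (ct c m) * of_real (ct c k) * K m k) = (\<Sum>t\<in>{0..<int q2}. U m t)" for m
  proof -
    let ?h = "\<lambda>k. \<eta>1 m * of_real (ct c m) * of_real (ct c k) * K m k"
    have "(\<Sum>k\<in>?I. ?h k) = (\<Sum>k\<in>?I. ?h (k + - (int b * m)))"
      by (rule sum_periodic_shift[symmetric]) (use c Kper ct_periodic in auto)
    also have "\<dots> = (\<Sum>u\<in>{0..<int q2 * int N}. if int N dvd u then ?h (u - int b * m) else 0)"
      using K0 by (intro sum.cong) (auto simp: cN mult.commute)
    also have "\<dots> = (\<Sum>t\<in>{0..<int q2}. ?h (int N * t - int b * m))"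
      using q2 N by (intro sum_multiples) auto
    finally show ?thesis by (simp add: KR U_def)
  qed
  have "(\<Sum>a\<in>?I. if coprime a (int c) then cnj (ph (int N) \<eta>2 (a - int b)) * dedekind_sum q1 \<eta>1 \<eta>2 a c else 0)
      = ?d * (\<Sum>a\<in>?I. if coprime a (int c) then cnj (ph (int N) \<eta>2 (a - int b)) *
          (\<Sum>m\<in>?I. \<Sum>k\<in>?I. \<eta>1 m * of_real (ct c m) * of_real (ct c k) * ph (int N) \<eta>2 (a * m + k)) else 0)"
    unfolding sum_distrib_left dedekind_sum_cot[OF p1 p2 c dvd] cdiv by (intro sum.cong refl) (simp add: sum_distrib_left mult_ac)
  also have "\<dots> = ?d * (\<Sum>m\<in>?I. \<Sum>k\<in>?I. \<eta>1 m * of_real (ct c m) * of_real (ct c k) * K m k)"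
    unfolding K_def by (subst sum_swap_weighted) (rule refl)
  also have "\<dots> = ?d * (\<Sum>t\<in>{0..<int q2}. \<Sum>m\<in>?I. U m t)"
    unfolding row by (subst sum.swap) (rule refl)
  also have "(\<Sum>t\<in>{0..<int q2}. \<Sum>m\<in>?I. U m t) = (\<Sum>m\<in>?I. U m 0) + (\<Sum>t\<in>{0..<int q2} - {0}. \<Sum>m\<in>?I. U m t)"
    using q2 by (intro sum.remove) auto
  also have "(\<Sum>m\<in>?I. U m 0) = of_nat (card {s\<in>{0..<int q2}. good q2 N b s}) * first_moment_main c b (\<lambda>m. \<eta>1 m * \<eta>2 m)"
  proof -
    have "R m 0 = of_nat (card {s\<in>{0..<int q2}. good q2 N b s}) * \<eta>2 m" for m
      by (simp add: R_def sum.inter_filter[symmetric])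
    then show ?thesis by (simp add: U_def first_moment_main_def sum_distrib_left mult_ac)
  qed
  finally have eq: "(\<Sum>a\<in>?I. if coprime a (int c) then cnj (ph (int N) \<eta>2 (a - int b)) * dedekind_sum q1 \<eta>1 \<eta>2 a c else 0)
      - ?d * (of_nat (card {s\<in>{0..<int q2}. good q2 N b s}) * first_moment_main c b (\<lambda>m. \<eta>1 m * \<eta>2 m))
      = ?d * (\<Sum>t\<in>{0..<int q2} - {0}. \<Sum>m\<in>?I. U m t)" by (simp add: distrib_left)
  have Ub: "cmod (U m t) \<le> corr_bound q2 t * (\<bar>ct c m\<bar> * \<bar>ct c (int N * t - int b * m)\<bar>)" for m t
  proof -
    have "cmod (U m t) = cmod (\<eta>1 m) * (\<bar>ct c m\<bar> * \<bar>ct c (int N * t - int b * m)\<bar>) * cmod (R m t)"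
      by (simp add: U_def norm_mult)
    also have "\<dots> \<le> 1 * (\<bar>ct c m\<bar> * \<bar>ct c (int N * t - int b * m)\<bar>) * corr_bound q2 t"
      using good_sum_bound[OF p2 b] dc_norm_le[OF dc1] unfolding R_def by (intro mult_mono) auto
    finally show ?thesis by (simp add: mult_ac)
  qed
  have "cmod (\<Sum>t\<in>{0..<int q2} - {0}. \<Sum>m\<in>?I. U m t)
     \<le> (\<Sum>t\<in>{0..<int q2} - {0}. corr_bound q2 t * (\<Sum>m\<in>?I. \<bar>ct c m\<bar> * \<bar>ct c (int N * t - int b * m)\<bar>))"
    unfolding sum_distrib_left by (intro sum_norm_le Ub)
  also have "\<dots> = (\<Sum>t\<in>{0..<int q2}. if t = 0 then 0 else corr_bound q2 t * (\<Sum>m\<in>?I. \<bar>ct c m\<bar> * \<bar>ct c (int N * t - int b * m)\<bar>))"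
    by (rule sum.mono_neutral_cong_left) auto
  finally show ?thesis unfolding eq norm_mult by (intro mult_left_mono) auto
qed

section \<open>Estimates for cotangent sums\<close>

text \<open>The addition formula cot x cot y = 1 + cot (x + y) (cot x + cot y). For fixed x + y it
  reduces products of cotangents to single ones, so that a sum over x loses only a logarithm. If sin
  x or sin y is 0, the default value of the cotangent makes the left side 0.\<close>

lemma abs_cot_mult_le:
  assumes "sin (x + y) \<noteq> (0::real)"
  shows "\<bar>cot x * cot y\<bar> \<le> 1 + \<bar>cot (x + y)\<bar> * (\<bar>cot x\<bar> + \<bar>cot y\<bar>)"
proof (cases "sin x = 0 \<or> sin y = 0")
  case True
  then have z: "cot x * cot y = 0" by (auto simp: cot_def)
  have "0 \<le> \<bar>cot (x + y)\<bar> * (\<bar>cot x\<bar> + \<bar>cot y\<bar>)" by (intro mult_nonneg_nonneg) auto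
  then show ?thesis unfolding z by simp
next
  case False
  have "cot x * cot y = 1 + cot (x + y) * (cot x + cot y)"
  proof -
    have "cot x + cot y = sin (x + y) / (sin x * sin y)" using False by (simp add: cot_def sin_add field_simps)
    then have "cot (x + y) * (cot x + cot y) = cos (x + y) / (sin x * sin y)" using assms by (simp add: cot_def)
    then show ?thesis using False by (simp add: cos_add cot_def field_simps)
  qed
  also have "\<bar>\<dots>\<bar> \<le> 1 + \<bar>cot (x + y) * (cot x + cot y)\<bar>" using abs_triangle_ineq[of 1] by simp
  also have "\<bar>cot (x + y) * (cot x + cot y)\<bar> \<le> \<bar>cot (x + y)\<bar> * (\<bar>cot x\<bar> + \<bar>cot y\<bar>)"
    unfolding abs_mult by (intro mult_left_mono abs_triangle_ineq) simp
  finally show ?thesis by simp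
qed

lemma abs_ct_mult_le:
  assumes C: "C > 0" and n: "\<not> int C dvd x + y"
  shows "\<bar>ct C x\<bar> * \<bar>ct C y\<bar> \<le> 1 + \<bar>ct C (x + y)\<bar> * (\<bar>ct C x\<bar> + \<bar>ct C y\<bar>)"
proof -
  have e: "pi * of_int (x + y) / of_nat C = pi * of_int x / of_nat C + pi * of_int y / of_nat C"
    by (simp add: add_divide_distrib distrib_left)
  have "sin (pi * of_int (x + y) / of_nat C) \<noteq> 0"
  proof
    assume "sin (pi * of_int (x + y) / of_nat C) = 0"
    then obtain i :: int where "pi * of_int (x + y) / of_nat C = of_int i * pi" using sin_zero_iff_int2 by blast
    then have "pi * real_of_int (x + y) = pi * real_of_int (i * int C)" using C by (simp add: field_simps)
    then have "real_of_int (x + y) = real_of_int (i * int C)" by (simp only: mult_cancel_left pi_neq_zero simp_thms)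
    then have "x + y = i * int C" by (simp only: of_int_eq_iff)
    then show False using n by simp
  qed
  then show ?thesis using abs_cot_mult_le[of "pi * of_int x / of_nat C" "pi * of_int y / of_nat C"]
    unfolding ct_def e by (simp add: abs_mult)
qed

lemma abs_cot_le:
  assumes "0 < t" "t < pi"
  shows "\<bar>cot t\<bar> \<le> 1 / t \<or> \<bar>cot t\<bar> \<le> 1 / (pi - t)"
proof -
  have a: "\<bar>cot u\<bar> \<le> 1 / u" if "0 < u" "u < pi / 2" for u
  proof -
    have "cos u > 0" "sin u > 0" using that cos_gt_zero[of u] sin_gt_zero[of u] by auto
    then have "cot u \<ge> 0" by (simp add: cot_def)
    then show ?thesis using cot_le_inverse[OF that] by simp
  qed
  consider "t < pi / 2" | "t = pi / 2" | "t > pi / 2" by linarith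
  then show ?thesis
  proof cases
    case 3
    have "cot (pi - t) = - cot t" by (simp add: cot_def sin_diff cos_diff)
    then show ?thesis using a[of "pi - t"] 3 assms by simp
  next
    case 2
    have "cot t = cot (pi / 2)" using 2 by (rule arg_cong)
    then have "cot t = 0" by (simp add: cot_def)
    then show ?thesis using assms by simp
  qed (use a assms in blast)
qed

lemma abs_ct_le:
  assumes "0 < x" "x < n"
  shows "\<bar>ct n (int x)\<bar> \<le> real n / pi * (1 / real x) \<or> \<bar>ct n (int x)\<bar> \<le> real n / pi * (1 / real (n - x))"
proof -
  have t: "0 < pi * real x / real n" "pi * real x / real n < pi" using assms by (auto simp: field_simps)
  have "1 / (pi * real x / real n) = real n / pi * (1 / real x)" by simp
  moreover have "pi - pi * real x / real n = pi * real (n - x) / real n" using assms by (simp add: field_simps of_nat_diff)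
  ultimately show ?thesis using abs_cot_le[OF t] unfolding ct_def by simp
qed

lemma sum_abs_ct_le: "(\<Sum>x\<in>{0..<int n}. \<bar>ct n x\<bar>) \<le> real n * harm n"
proof (cases "n = 0")
  case False
  have 1: "(\<Sum>x\<in>{1..<n}. 1 / real x) \<le> harm n"
    unfolding harm_def by (simp add: inverse_eq_divide[symmetric]) (rule sum_mono2, auto)
  have 2: "(\<Sum>x\<in>{1..<n}. 1 / real (n - x)) = (\<Sum>x\<in>{1..<n}. 1 / real x)"
    by (rule sum.reindex_bij_witness[where i = "\<lambda>x. n - x" and j = "\<lambda>x. n - x"]) auto
  have "(\<Sum>x\<in>{0..<int n}. \<bar>ct n x\<bar>) = (\<Sum>x\<in>{0..<n}. \<bar>ct n (int x)\<bar>)"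
    by (simp add: sum_int_eq_sum_nat atLeast0LessThan)
  also have "\<dots> = (\<Sum>x\<in>{1..<n}. \<bar>ct n (int x)\<bar>)"
    by (rule sum.mono_neutral_right) (auto simp: not_less_eq_eq)
  also have "\<dots> \<le> (\<Sum>x\<in>{1..<n}. real n / pi * (1 / real x + 1 / real (n - x)))"
  proof (rule sum_mono)
    fix x assume "x \<in> {1..<n}"
    then have x: "0 < x" "x < n" by auto
    have "0 \<le> real n / pi * (1 / real x)" "0 \<le> real n / pi * (1 / real (n - x))" by auto
    then show "\<bar>ct n (int x)\<bar> \<le> real n / pi * (1 / real x + 1 / real (n - x))"
      using abs_ct_le[OF x] unfolding distrib_left by (metis add_increasing add_increasing2)
  qed
  also have "\<dots> = real n / pi * (2 * (\<Sum>x\<in>{1..<n}. 1 / real x))"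
    by (simp only: sum_distrib_left[symmetric] sum.distrib 2 mult_2)
  also have "\<dots> \<le> real n / pi * (2 * harm n)" using 1 by (intro mult_left_mono) auto
  also have "\<dots> = real n * harm n * (2 / pi)" by simp
  also have "\<dots> \<le> real n * harm n * 1" using pi_ge_two harm_nonneg[of n] by (intro mult_left_mono mult_nonneg_nonneg) auto
  finally show ?thesis by simp
qed simp

text \<open>At level C = c b the cotangent at M v - b m is, by the distribution relation, an average
  of b cotangents whose arguments add up with b m to M v + c i. This sum is free of m and not
  divisible by C, as n does not divide v. After \<open>abs_ct_mult_le\<close> the sums over m and
  over the pairs (v, i) separate, and each costs its length times a harmonic number.\<close>

lemma cot_correlation_bound:
  fixes M n b c :: nat
  assumes M: "M > 0" and n: "n > 0" and b: "b > 0" and c: "c = n * M"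
  shows "(\<Sum>v\<in>{0..<int n}. if v = 0 then 0 else (\<Sum>m\<in>{0..<int c}. \<bar>ct c m\<bar> * \<bar>ct c (int M * v - int b * m)\<bar>))
      \<le> real (b + 2) * real c * real n * (harm (c * b))\<^sup>2"
proof -
  define C where "C = c * b"
  define h :: real where "h = harm C"
  have cpos: "c > 0" and Cpos: "C > 0" using M n b by (simp_all add: c C_def)
  have cC: "c \<le> C" using b by (simp add: C_def)
  have nbC: "n * b \<le> C" using M by (simp add: C_def c)
  have hm: "harm k \<le> h" if "k \<le> C" for k unfolding h_def by (rule harm_mono[OF that])
  have "harm 1 = (1::real)" by (simp add: harm_def)
  then have h1: "h \<ge> 1" using hm[of 1] Cpos by linarith
  have s1: "(\<Sum>m\<in>{0..<int c}. \<bar>ct C (int b * m)\<bar>) \<le> real c * h"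
  proof -
    have "ct C (int b * m) = ct c m" for m using ct_scale[OF b, of c m] by (simp add: C_def)
    then show ?thesis using sum_abs_ct_le[of c] hm[OF cC] mult_left_mono[of "harm c" h "real c"] by simp
  qed
  have s2: "(\<Sum>m\<in>{0..<int c}. \<bar>ct C (w - int b * m)\<bar>) \<le> real C * h" for w
  proof -
    have "(\<Sum>m\<in>{0..<int c}. \<bar>ct C (w - int b * m)\<bar>) = (\<Sum>x\<in>{0..<int c * int b}. if int b dvd x then \<bar>ct C (w - x)\<bar> else 0)"
      by (rule sum_multiples[symmetric]) (use cpos b in auto)
    also have "\<dots> \<le> (\<Sum>x\<in>{0..<int c * int b}. \<bar>ct C (w - x)\<bar>)" by (rule sum_mono) simp
    also have "\<dots> = (\<Sum>x\<in>{0..<int C}. \<bar>ct C ((-1) * x + w)\<bar>)" by (simp add: C_def)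
    also have "\<dots> = (\<Sum>x\<in>{0..<int C}. \<bar>ct C x\<bar>)"
      by (rule sum_periodic_affine[where f = "\<lambda>x. \<bar>ct C x\<bar>"]) (use Cpos ct_periodic in auto)
    also have "\<dots> \<le> real C * h" using sum_abs_ct_le[of C] by (simp add: h_def)
    finally show ?thesis .
  qed
  have s3: "(\<Sum>v\<in>{0..<int n}. \<Sum>i\<in>{0..<int b}. \<bar>ct C (int M * v + int c * i)\<bar>) \<le> real (n * b) * h"
  proof -
    have "ct C (int M * v + int c * i) = ct (n * b) (v + int n * i)" for v i
      using ct_scale[OF M, of "n * b" "v + int n * i"] by (simp add: C_def c algebra_simps)
    then have "(\<Sum>v\<in>{0..<int n}. \<Sum>i\<in>{0..<int b}. \<bar>ct C (int M * v + int c * i)\<bar>) = (\<Sum>x\<in>{0..<int n * int b}. \<bar>ct (n * b) x\<bar>)"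
      using n b by (simp add: sum_split_residues)
    also have "\<dots> \<le> real (n * b) * harm (n * b)" using sum_abs_ct_le[of "n * b"] by simp
    also have "\<dots> \<le> real (n * b) * h" using hm[OF nbC] by (intro mult_left_mono) auto
    finally show ?thesis .
  qed
  define z where "z = (\<lambda>v. \<Sum>i\<in>{0..<int b}. \<bar>ct C (int M * v + int c * i)\<bar>)"
  have z0: "z v \<ge> 0" for v by (simp add: z_def sum_nonneg)
  have row: "real b * (\<Sum>m\<in>{0..<int c}. \<bar>ct c m\<bar> * \<bar>ct c (int M * v - int b * m)\<bar>) \<le> real b * real c + z v * (real c * h + real C * h)"
    if v: "v \<in> {0..<int n}" "v \<noteq> 0" for v
  proof -
    have nd: "\<not> int C dvd int b * m + (int M * v + int c * i - int b * m)" for m i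
    proof
      assume "int C dvd int b * m + (int M * v + int c * i - int b * m)"
      then have "int c dvd int M * v + int c * i" by (simp add: C_def) (metis dvd_mult_left)
      then have "int n * int M dvd v * int M" by (simp add: c mult.commute dvd_add_left_iff)
      then have "int n dvd v" using M by simp
      then show False using v zdvd_not_zless[of v "int n"] by auto
    qed
    have summand: "real b * (\<bar>ct c m\<bar> * \<bar>ct c (int M * v - int b * m)\<bar>)
        \<le> (\<Sum>i\<in>{0..<int b}. 1 + \<bar>ct C (int M * v + int c * i)\<bar> * (\<bar>ct C (int b * m)\<bar> + \<bar>ct C (int M * v + int c * i - int b * m)\<bar>))" for m
    proof -
      have "real b * (\<bar>ct c m\<bar> * \<bar>ct c (int M * v - int b * m)\<bar>) = \<bar>ct C (int b * m)\<bar> * \<bar>real b * ct c (int M * v - int b * m)\<bar>"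
        using ct_scale[OF b, of c m] by (simp add: C_def abs_mult)
      also have "real b * ct c (int M * v - int b * m) = (\<Sum>i\<in>{0..<int b}. ct C (int M * v - int b * m + int c * i))"
        unfolding C_def by (rule ct_distribution[OF cpos b, symmetric])
      also have "\<bar>ct C (int b * m)\<bar> * \<bar>\<dots>\<bar> \<le> \<bar>ct C (int b * m)\<bar> * (\<Sum>i\<in>{0..<int b}. \<bar>ct C (int M * v - int b * m + int c * i)\<bar>)"
        by (intro mult_left_mono sum_abs) simp
      also have "\<dots> = (\<Sum>i\<in>{0..<int b}. \<bar>ct C (int b * m)\<bar> * \<bar>ct C (int M * v + int c * i - int b * m)\<bar>)"
        by (simp add: sum_distrib_left algebra_simps)
      also have "\<dots> \<le> (\<Sum>i\<in>{0..<int b}. 1 + \<bar>ct C (int M * v + int c * i)\<bar> * (\<bar>ct C (int b * m)\<bar> + \<bar>ct C (int M * v + int c * i - int b * m)\<bar>))"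
      proof (rule sum_mono)
        fix i
        show "\<bar>ct C (int b * m)\<bar> * \<bar>ct C (int M * v + int c * i - int b * m)\<bar>
          \<le> 1 + \<bar>ct C (int M * v + int c * i)\<bar> * (\<bar>ct C (int b * m)\<bar> + \<bar>ct C (int M * v + int c * i - int b * m)\<bar>)"
          using abs_ct_mult_le[OF Cpos nd[of m i]] by simp
      qed
      finally show ?thesis .
    qed
    have "real b * (\<Sum>m\<in>{0..<int c}. \<bar>ct c m\<bar> * \<bar>ct c (int M * v - int b * m)\<bar>)
        \<le> (\<Sum>m\<in>{0..<int c}. \<Sum>i\<in>{0..<int b}. 1 + \<bar>ct C (int M * v + int c * i)\<bar> * (\<bar>ct C (int b * m)\<bar> + \<bar>ct C (int M * v + int c * i - int b * m)\<bar>))"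
      unfolding sum_distrib_left by (rule sum_mono) (use summand in blast)
    also have "\<dots> = (\<Sum>i\<in>{0..<int b}. real c + \<bar>ct C (int M * v + int c * i)\<bar> * ((\<Sum>m\<in>{0..<int c}. \<bar>ct C (int b * m)\<bar>) + (\<Sum>m\<in>{0..<int c}. \<bar>ct C (int M * v + int c * i - int b * m)\<bar>)))"
      by (subst sum.swap, rule sum.cong[OF refl]) (simp add: sum.distrib sum_distrib_left[symmetric])
    also have "\<dots> \<le> (\<Sum>i\<in>{0..<int b}. real c + \<bar>ct C (int M * v + int c * i)\<bar> * (real c * h + real C * h))"
      by (intro sum_mono add_left_mono mult_left_mono add_mono s1 s2) simp
    also have "\<dots> = real b * real c + z v * (real c * h + real C * h)"
      by (simp add: sum.distrib z_def sum_distrib_right)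
    finally show ?thesis .
  qed
  have "real b * (\<Sum>v\<in>{0..<int n}. if v = 0 then 0 else (\<Sum>m\<in>{0..<int c}. \<bar>ct c m\<bar> * \<bar>ct c (int M * v - int b * m)\<bar>))
      \<le> (\<Sum>v\<in>{0..<int n}. real b * real c + z v * (real c * h + real C * h))"
    unfolding sum_distrib_left
  proof (rule sum_mono)
    fix v assume v: "v \<in> {0..<int n}"
    have "0 \<le> real b * real c + z v * (real c * h + real C * h)" using z0 h1 by (intro add_nonneg_nonneg mult_nonneg_nonneg) auto
    then show "real b * (if v = 0 then 0 else (\<Sum>m\<in>{0..<int c}. \<bar>ct c m\<bar> * \<bar>ct c (int M * v - int b * m)\<bar>))
        \<le> real b * real c + z v * (real c * h + real C * h)" using row[OF v] by auto
  qed
  also have "\<dots> = real n * real b * real c + (\<Sum>v\<in>{0..<int n}. z v) * (real c * h + real C * h)"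
    by (simp add: sum.distrib sum_distrib_right)
  also have "\<dots> \<le> real n * real b * real c + (real (n * b) * h) * (real c * h + real C * h)"
    using s3 h1 unfolding z_def by (intro add_left_mono mult_right_mono) auto
  also have "\<dots> = real b * (real n * real c * (1 + real (1 + b) * h\<^sup>2))"
    by (simp add: C_def power2_eq_square algebra_simps)
  also have "\<dots> \<le> real b * (real n * real c * (real (b + 2) * h\<^sup>2))"
  proof -
    have "1 \<le> h\<^sup>2" using h1 by (simp add: one_le_power)
    then have "1 + real (1 + b) * h\<^sup>2 \<le> real (b + 2) * h\<^sup>2" by (simp add: algebra_simps)
    then show ?thesis by (intro mult_left_mono) auto
  qed
  finally have "(\<Sum>v\<in>{0..<int n}. if v = 0 then 0 else (\<Sum>m\<in>{0..<int c}. \<bar>ct c m\<bar> * \<bar>ct c (int M * v - int b * m)\<bar>))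
      \<le> real n * real c * (real (b + 2) * h\<^sup>2)" using b by (simp only: mult_le_cancel_left_pos of_nat_0_less_iff)
  then show ?thesis by (simp add: h_def C_def mult_ac)
qed

text \<open>Telescoping from the value 1/4 at n = 2. What matters is that 3/4 is below 1, so that
  the terms at \<plusminus>1 dominate in the next lemma.\<close>

lemma sum_inverse_squares_from_2:
  assumes "n \<ge> 2" shows "(\<Sum>m\<in>{2..n}. 1 / (real m)\<^sup>2) \<le> 3 / 4 - 1 / real n"
  using assms
proof (induction n rule: dec_induct)
  case (step n)
  have "1 / (real (Suc n))\<^sup>2 \<le> 1 / (real n * real (Suc n))"
    using step by (intro divide_left_mono) (auto simp: power2_eq_square)
  also have "\<dots> = 1 / real n - 1 / real (Suc n)" using step by (simp add: field_simps)
  finally show ?case using step by simp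
qed simp

text \<open>The terms m = 1 and m = c - 1 give at least 2 (c/\<pi>)^2 - 2, all others together at
  most 3/2 (c/\<pi>)^2. The difference is at least c^2/32 - 2 because \<pi> < 4.\<close>

lemma weighted_ct_squares_ge:
  fixes f :: "int \<Rightarrow> complex"
  assumes c: "c \<ge> 4" and f: "\<And>m. cmod (f m) \<le> 1" and f1: "f 1 = 1" and f2: "f (int c - 1) = 1"
  shows "cmod (\<Sum>m\<in>{0..<int c}. f m * of_real ((ct c m)\<^sup>2)) \<ge> (real c)\<^sup>2 / 32 - 2"
proof -
  define w where "w = (\<lambda>m::nat. f (int m) * of_real ((ct c (int m))\<^sup>2))"
  have c1: "(ct c 1)\<^sup>2 \<ge> (real c / pi)\<^sup>2 - 1"
  proof -
    let ?x = "pi / real c"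
    have x: "0 < ?x" "?x < pi" using c by (auto simp: field_simps)
    have s: "0 < sin ?x" "sin ?x \<le> ?x" using sin_gt_zero[OF x] sin_x_le_x[of ?x] x by auto
    have "(cot ?x)\<^sup>2 = 1 / (sin ?x)\<^sup>2 - 1"
      using s(1) by (simp add: cot_def power_divide cos_squared_eq field_simps)
    moreover have "1 / ?x\<^sup>2 \<le> 1 / (sin ?x)\<^sup>2" using s x by (intro divide_left_mono power_mono mult_pos_pos zero_less_power) auto
    ultimately show ?thesis by (simp add: ct_def power_divide)
  qed
  have cc: "(ct c (int c - 1))\<^sup>2 = (ct c 1)\<^sup>2"
    using ct_periodic[of c "-1"] ct_uminus[of c 1] c by simp
  have "(\<Sum>m\<in>{0..<int c}. f m * of_real ((ct c m)\<^sup>2)) = (\<Sum>m\<in>{0..<c}. w m)"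
    by (simp add: sum_int_eq_sum_nat atLeast0LessThan w_def)
  also have "\<dots> = w 0 + w 1 + w (c - 1) + (\<Sum>m\<in>{2..c-2}. w m)"
  proof -
    have "{0..<c} = insert 0 (insert 1 (insert (c - 1) {2..c-2}))" using c by auto
    moreover have "1 \<noteq> c - 1" "0 \<noteq> c - 1" "c - 1 \<notin> {2..c-2}" using c by auto
    ultimately show ?thesis by (simp add: add.assoc)
  qed
  also have "w 0 + w 1 + w (c - 1) = of_real (2 * (ct c 1)\<^sup>2)"
    using c f1 f2 cc by (simp add: w_def of_nat_diff flip: of_real_power)
  finally have e: "(\<Sum>m\<in>{0..<int c}. f m * of_real ((ct c m)\<^sup>2)) = of_real (2 * (ct c 1)\<^sup>2) + (\<Sum>m\<in>{2..c-2}. w m)" .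
  have "cmod (\<Sum>m\<in>{2..c-2}. w m) \<le> (\<Sum>m\<in>{2..c-2}. (real c / pi)\<^sup>2 * (1 / (real m)\<^sup>2 + 1 / (real (c - m))\<^sup>2))"
  proof (rule sum_norm_le)
    fix m assume "m \<in> {2..c-2}"
    then have m: "0 < m" "m < c" using c by auto
    have "cmod (w m) \<le> (ct c (int m))\<^sup>2"
      using mult_right_mono[OF f[of "int m"], of "(ct c (int m))\<^sup>2"] by (simp add: w_def norm_mult norm_power)
    also have "\<dots> \<le> (real c / pi)\<^sup>2 * (1 / (real m)\<^sup>2 + 1 / (real (c - m))\<^sup>2)"
    proof -
      have p: "0 \<le> (real c / pi * (1 / real m))\<^sup>2" "0 \<le> (real c / pi * (1 / real (c - m)))\<^sup>2" by auto
      have "(ct c (int m))\<^sup>2 \<le> (real c / pi * (1 / real m))\<^sup>2 \<or> (ct c (int m))\<^sup>2 \<le> (real c / pi * (1 / real (c - m)))\<^sup>2"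
        using abs_ct_le[OF m] power_mono[of "\<bar>ct c (int m)\<bar>" _ 2] by fastforce
      then have "(ct c (int m))\<^sup>2 \<le> (real c / pi * (1 / real m))\<^sup>2 + (real c / pi * (1 / real (c - m)))\<^sup>2" using p by linarith
      then show ?thesis by (simp add: power_mult_distrib power_divide distrib_left)
    qed
    finally show "cmod (w m) \<le> (real c / pi)\<^sup>2 * (1 / (real m)\<^sup>2 + 1 / (real (c - m))\<^sup>2)" .
  qed
  also have "\<dots> = (real c / pi)\<^sup>2 * (2 * (\<Sum>m\<in>{2..c-2}. 1 / (real m)\<^sup>2))"
  proof -
    have "(\<Sum>m\<in>{2..c-2}. 1 / (real (c - m))\<^sup>2) = (\<Sum>m\<in>{2..c-2}. 1 / (real m)\<^sup>2)"
      by (rule sum.reindex_bij_witness[where i = "\<lambda>x. c - x" and j = "\<lambda>x. c - x"]) (use c in auto)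
    then show ?thesis by (simp only: sum_distrib_left[symmetric] sum.distrib mult_2)
  qed
  also have "\<dots> \<le> (real c / pi)\<^sup>2 * (2 * (3 / 4))"
  proof -
    have "(\<Sum>m\<in>{2..c-2}. 1 / (real m)\<^sup>2) \<le> 3 / 4 - 1 / real (c - 2)" using c by (intro sum_inverse_squares_from_2) simp
    also have "\<dots> \<le> 3 / 4" by simp
    finally show ?thesis by (intro mult_left_mono) auto
  qed
  finally have tail: "cmod (\<Sum>m\<in>{2..c-2}. w m) \<le> 3 / 2 * (real c / pi)\<^sup>2" by simp
  have "cmod (of_real (2 * (ct c 1)\<^sup>2)) - cmod (\<Sum>m\<in>{2..c-2}. w m) \<le> cmod (of_real (2 * (ct c 1)\<^sup>2) + (\<Sum>m\<in>{2..c-2}. w m))"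
    using norm_diff_ineq .
  moreover have "cmod (of_real (2 * (ct c 1)\<^sup>2)) = 2 * (ct c 1)\<^sup>2" by (simp add: norm_power norm_mult)
  moreover have "(real c)\<^sup>2 / 16 \<le> (real c / pi)\<^sup>2"
  proof -
    have "pi\<^sup>2 \<le> 4\<^sup>2" using pi_less_4 by (intro power_mono) auto
    then have "(real c)\<^sup>2 / 4\<^sup>2 \<le> (real c)\<^sup>2 / pi\<^sup>2" by (intro divide_left_mono) auto
    then show ?thesis by (simp add: power_divide)
  qed
  ultimately show ?thesis unfolding e using tail c1 by linarith
qed

text \<open>Generically the difference is exactly -1/2. Where sin x or cos x vanishes the products
  are 0 by the default values, so only an inequality holds throughout.\<close>

lemma cot_double_approx: "\<bar>cot x * cot (2 * x) - (cot x)\<^sup>2 / 2\<bar> \<le> (1/2::real)"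
proof (cases "sin x = 0 \<or> cos x = 0")
  case True
  then have "cot x = 0" by (auto simp: cot_def)
  then show ?thesis by simp
next
  case False
  have "cot x * cot (2 * x) = ((cos x)\<^sup>2 - (sin x)\<^sup>2) / (2 * (sin x)\<^sup>2)"
    using False by (simp add: cot_def sin_double cos_double power2_eq_square)
  also have "\<dots> = (cot x)\<^sup>2 / 2 - 1 / 2" using False by (simp add: cot_def power_divide field_simps)
  finally show ?thesis by simp
qed

lemma weighted_ct_product_ge:
  fixes f :: "int \<Rightarrow> complex"
  assumes c: "c \<ge> 4" and f: "\<And>m. cmod (f m) \<le> 1" and f1: "f 1 = 1" and f2: "f (int c - 1) = 1" and b: "b = 1 \<or> b = (2::nat)"
  shows "cmod (\<Sum>m\<in>{0..<int c}. f m * of_real (ct c m * ct c (- int b * m))) \<ge> (real c)\<^sup>2 / 64 - 1 - real c / 2"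
proof -
  have W: "(real c)\<^sup>2 / 32 - 2 \<le> cmod (\<Sum>m\<in>{0..<int c}. f m * of_real ((ct c m)\<^sup>2))"
    by (rule weighted_ct_squares_ge[OF c f f1 f2])
  have neg: "ct c (- int b * m) = - ct c (int b * m)" for m using ct_uminus[of c "int b * m"] by simp
  show ?thesis using b
  proof
    assume "b = 1"
    then have "(\<Sum>m\<in>{0..<int c}. f m * of_real (ct c m * ct c (- int b * m))) = - (\<Sum>m\<in>{0..<int c}. f m * of_real ((ct c m)\<^sup>2))"
      by (simp add: ct_uminus sum_negf power2_eq_square)
    then have "cmod (\<Sum>m\<in>{0..<int c}. f m * of_real (ct c m * ct c (- int b * m))) = cmod (\<Sum>m\<in>{0..<int c}. f m * of_real ((ct c m)\<^sup>2))"
      by simp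
    moreover have "(real c)\<^sup>2 / 64 - 1 - real c / 2 \<le> (real c)\<^sup>2 / 32 - 2"
    proof -
      have "4 * 4 \<le> real c * real c" using c by (intro mult_mono) auto
      moreover have "real c \<ge> 4" using c by simp
      ultimately show ?thesis by (simp add: power2_eq_square)
    qed
    ultimately show ?thesis using W by linarith
  next
    assume b2: "b = 2"
    let ?S = "\<Sum>m\<in>{0..<int c}. f m * of_real ((ct c m)\<^sup>2)"
    let ?T = "\<Sum>m\<in>{0..<int c}. f m * of_real (ct c m * ct c (2 * m))"
    have "?T - ?S / 2 = (\<Sum>m\<in>{0..<int c}. f m * of_real (ct c m * ct c (2 * m) - (ct c m)\<^sup>2 / 2))"
      by (simp add: sum_divide_distrib sum_subtractf[symmetric] algebra_simps)
    also have "cmod \<dots> \<le> (\<Sum>m\<in>{0..<int c}. 1 / 2)"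
    proof (rule sum_norm_le)
      fix m
      have "\<bar>ct c m * ct c (2 * m) - (ct c m)\<^sup>2 / 2\<bar> \<le> 1 / 2"
        using cot_double_approx[of "pi * of_int m / of_nat c"] by (simp add: ct_def mult_ac)
      then have "cmod (f m) * \<bar>ct c m * ct c (2 * m) - (ct c m)\<^sup>2 / 2\<bar> \<le> 1 * (1 / 2)"
        using f by (intro mult_mono) auto
      then show "cmod (f m * of_real (ct c m * ct c (2 * m) - (ct c m)\<^sup>2 / 2)) \<le> 1 / 2"
        by (simp only: norm_mult norm_of_real mult_1)
    qed
    finally have d: "cmod (?T - ?S / 2) \<le> real c / 2" by simp
    have "cmod (?S / 2) \<le> cmod ?T + cmod (?T - ?S / 2)" using norm_triangle_sub[of "?S / 2" ?T] by (simp add: norm_minus_commute)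
    moreover have "cmod (?S / 2) = cmod ?S / 2" by (simp add: norm_divide)
    moreover have "cmod (\<Sum>m\<in>{0..<int c}. f m * of_real (ct c m * ct c (- int b * m))) = cmod ?T"
    proof -
      have "(\<Sum>m\<in>{0..<int c}. f m * of_real (ct c m * ct c (- int b * m))) = - ?T" unfolding neg by (simp add: b2 sum_negf)
      then show ?thesis by simp
    qed
    ultimately show ?thesis using d W by linarith
  qed
qed

section \<open>Counting and the second moment for large modulus\<close>

text \<open>For odd p at most two residues are excluded and p - 2 is at least p / 3, with equality
  at 3. For p = 2 the residue 1 is good exactly because b + N is odd.\<close>

lemma local_good_count:
  fixes p N b :: nat
  assumes p: "prime p" and b: "b = 1 \<or> b = 2" and odd: "p = 2 \<Longrightarrow> odd (b + N)"
  shows "real p / 3 \<le> (\<Sum>x\<in>{0..<int p}. if \<not> int p dvd x \<and> \<not> int p dvd int b * x + int N then 1 else 0)"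
proof (cases "p = 2")
  case True
  have "{0..<2::int} = {0, 1}" by auto
  moreover have "odd (int b + int N)" using odd[OF True] by simp
  ultimately show ?thesis using True by simp
next
  case False
  then have p3: "p \<ge> 3" using prime_ge_2_nat[OF p] by simp
  let ?B = "{x\<in>{0..<int p}. int p dvd int b * x + int N}"
  have uniq: "x = y" if xy: "x \<in> ?B" "y \<in> ?B" for x y
  proof -
    have "int p dvd (int b * x + int N) - (int b * y + int N)" using xy by (intro dvd_diff) auto
    then have "int p dvd int b * (x - y)" by (simp add: algebra_simps)
    moreover have "\<not> int p dvd int b"
    proof
      assume "int p dvd int b"
      then show False using b p3 zdvd_imp_le[of "int p" "int b"] by auto
    qed
    ultimately have "int p dvd x - y" using p by (simp add: prime_dvd_mult_iff)
    then have "[x = y] (mod int p)" by (simp add: cong_iff_dvd_diff)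
    then show ?thesis using xy by (intro cong_less_imp_eq_int) auto
  qed
  have fin: "finite {x\<in>{0..<int p}. P x}" for P by (rule finite_subset[of _ "{0..<int p}"]) auto
  then have "card ?B \<le> Suc 0 \<longleftrightarrow> (\<forall>x\<in>?B. \<forall>y\<in>?B. x = y)" by (rule card_le_Suc0_iff_eq)
  then have B: "card ?B \<le> 1" using uniq unfolding One_nat_def by blast
  have "real p = real (card {0..<int p})" by simp
  also have "\<dots> \<le> real (card ({x\<in>{0..<int p}. \<not> int p dvd x \<and> \<not> int p dvd int b * x + int N} \<union> {0} \<union> ?B))"
  proof -
    have "{0..<int p} \<subseteq> {x\<in>{0..<int p}. \<not> int p dvd x \<and> \<not> int p dvd int b * x + int N} \<union> {0} \<union> ?B"
      using zdvd_not_zless by auto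
    then show ?thesis by (intro of_nat_mono card_mono finite_UnI fin) auto
  qed
  also have "\<dots> \<le> real (card {x\<in>{0..<int p}. \<not> int p dvd x \<and> \<not> int p dvd int b * x + int N} + 1 + 1)"
    by (intro of_nat_mono order_trans[OF card_Un_le] add_mono B) auto
  also have "\<dots> = (\<Sum>x\<in>{0..<int p}. if \<not> int p dvd x \<and> \<not> int p dvd int b * x + int N then 1 else 0) + 2"
    by (simp add: sum.inter_filter[symmetric])
  finally show ?thesis using p3 by linarith
qed

lemma good_count_prime_product:
  fixes N b :: nat
  assumes P: "finite P" "\<And>p. p \<in> P \<Longrightarrow> prime p" and b: "b = 1 \<or> b = 2" and odd: "2 \<in> P \<Longrightarrow> odd (b + N)"
  shows "real (\<Prod>P) / 3 ^ card P \<le> (\<Sum>x\<in>{0..<int (\<Prod>P)}. if \<forall>p\<in>P. \<not> int p dvd x \<and> \<not> int p dvd int b * x + int N then 1 else 0)"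
  using P odd
proof (induction P rule: finite_induct)
  case (insert p P)
  define R where "R = \<Prod>P"
  let ?g = "\<lambda>p x. \<not> int p dvd x \<and> \<not> int p dvd int b * x + int N"
  have pp: "prime p" using insert by simp
  have R: "R > 0" using insert by (auto simp: R_def intro!: prod_pos prime_gt_0_nat)
  have "coprime R p" unfolding R_def using insert by (intro prod_coprime_left) (auto intro!: primes_coprime)
  then have cR: "coprime (int R) (int p)" by simp
  have shift: "?g r (x + int m * y) \<longleftrightarrow> ?g r x" if "r dvd m" for r m x y
  proof -
    have d: "int r dvd int m * y" using that by simp
    have "int b * (x + int m * y) + int N = (int b * x + int N) + int b * (int m * y)" by (simp add: algebra_simps)
    then show ?thesis using d by (metis dvd_add_left_iff dvd_mult)
  qed
  have gP: "(\<forall>r\<in>P. ?g r (x + int R * i)) \<longleftrightarrow> (\<forall>r\<in>P. ?g r x)" for x i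
    using shift[of _ R x i] insert(1) by (intro ball_cong refl) (auto simp: R_def dvd_prodI)
  have "(\<Sum>x\<in>{0..<int (\<Prod>(insert p P))}. if \<forall>r\<in>insert p P. ?g r x then 1 else (0::real))
     = (\<Sum>x\<in>{0..<int R * int p}. if \<forall>r\<in>insert p P. ?g r x then 1 else 0)"
    using insert by (simp add: R_def mult.commute)
  also have "\<dots> = (\<Sum>x\<in>{0..<int R}. \<Sum>i\<in>{0..<int p}. if \<forall>r\<in>insert p P. ?g r (x + int R * i) then 1 else 0)"
    by (rule sum_split_residues) (use R pp prime_gt_0_nat in auto)
  also have "\<dots> = (\<Sum>x\<in>{0..<int R}. (if \<forall>r\<in>P. ?g r x then 1 else 0) * (\<Sum>i\<in>{0..<int p}. if ?g p (int R * i + x) then 1 else 0))"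
    unfolding ball_simps gP sum_distrib_left by (intro sum.cong refl) (simp add: add.commute)
  also have "\<dots> = (\<Sum>x\<in>{0..<int R}. (if \<forall>r\<in>P. ?g r x then 1 else 0) * (\<Sum>i\<in>{0..<int p}. if ?g p i then 1 else 0))"
  proof -
    have "(\<Sum>i\<in>{0..<int p}. if ?g p (int R * i + x) then 1 else (0::real)) = (\<Sum>i\<in>{0..<int p}. if ?g p i then 1 else 0)" for x
      by (rule sum_periodic_affine[where f = "\<lambda>i. if ?g p i then 1 else (0::real)"])
        (use pp prime_gt_0_nat cR shift[of p p _ 1] in auto)
    then show ?thesis by simp
  qed
  also have "\<dots> = (\<Sum>x\<in>{0..<int R}. if \<forall>r\<in>P. ?g r x then 1 else 0) * (\<Sum>i\<in>{0..<int p}. if ?g p i then 1 else 0)"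
    by (simp only: sum_distrib_right)
  also have "\<dots> \<ge> (real R / 3 ^ card P) * (real p / 3)"
  proof (rule mult_mono)
    show "real R / 3 ^ card P \<le> (\<Sum>x\<in>{0..<int R}. if \<forall>r\<in>P. ?g r x then 1 else 0)"
      using insert by (simp add: R_def)
    show "real p / 3 \<le> (\<Sum>i\<in>{0..<int p}. if ?g p i then 1 else 0)"
      by (rule local_good_count[OF pp b]) (use insert in auto)
  qed (auto intro: sum_nonneg)
  finally show ?case using insert by (simp add: R_def mult.commute)
qed simp

lemma good_count_ge:
  fixes q N b :: nat
  assumes q: "q > 0" and b: "b = 1 \<or> b = 2" and odd: "even q \<Longrightarrow> odd (b + N)"
  shows "real q / 3 ^ card (prime_factors q) \<le> real (card {s\<in>{0..<int q}. good q N b s})"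
proof -
  define P where "P = prime_factors q"
  define R where "R = \<Prod>P"
  define n where "n = q div R"
  let ?g = "\<lambda>x. \<forall>p\<in>P. \<not> int p dvd x \<and> \<not> int p dvd int b * x + int N"
  have qR: "q = R * n" using prod_primes_dvd[of P q] by (simp add: P_def R_def n_def)
  have pos: "R > 0" "n > 0" using q qR by (auto intro: gr0I)
  have cop: "coprime a (int q) \<longleftrightarrow> (\<forall>p\<in>P. \<not> int p dvd a)" for a
  proof
    assume a: "coprime a (int q)"
    show "\<forall>p\<in>P. \<not> int p dvd a"
    proof (intro ballI notI)
      fix p assume p: "p \<in> P" "int p dvd a"
      then have "p dvd q" "prime p" by (auto simp: P_def)
      then have "is_unit (int p)" using coprime_common_divisor[OF a p(2)] by simp
      then show False using \<open>prime p\<close> by simp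
    qed
  next
    assume a: "\<forall>p\<in>P. \<not> int p dvd a"
    show "coprime a (int q)"
    proof (rule ccontr)
      assume "\<not> coprime a (int q)"
      then obtain p where "prime p" "p dvd q" "int p dvd a" using not_coprime_prime[of a q] q by blast
      then show False using a q by (auto simp: P_def prime_factors_dvd)
    qed
  qed
  have gg: "good q N b s \<longleftrightarrow> ?g s" for s unfolding good_def cop by blast
  have "2 \<in> P \<Longrightarrow> odd (b + N)" using odd by (auto simp: P_def)
  then have 1: "real R / 3 ^ card P \<le> (\<Sum>x\<in>{0..<int R}. if ?g x then 1 else 0)"
    unfolding R_def by (intro good_count_prime_product b) (auto simp: P_def)
  have per: "?g (x + int R) \<longleftrightarrow> ?g x" for x
  proof (intro ball_cong refl)
    fix p assume "p \<in> P"
    then have d: "int p dvd int R" by (auto simp: R_def P_def dvd_prodI simp del: of_nat_prod)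
    have "int b * (x + int R) + int N = (int b * x + int N) + int b * int R" by (simp add: algebra_simps)
    then show "(\<not> int p dvd x + int R \<and> \<not> int p dvd int b * (x + int R) + int N) = (\<not> int p dvd x \<and> \<not> int p dvd int b * x + int N)"
      using d by (metis dvd_add_left_iff dvd_mult)
  qed
  have "real (card {s\<in>{0..<int q}. good q N b s}) = (\<Sum>x\<in>{0..<int R * int n}. if ?g x then 1 else 0)"
    unfolding gg by (simp add: qR sum.inter_filter[symmetric])
  also have "\<dots> = of_nat (nat (int n)) * (\<Sum>x\<in>{0..<int R}. if ?g x then 1 else 0)"
    by (rule sum_periodic_blocks[where f = "\<lambda>x. if ?g x then 1 else (0::real)"]) (use pos per in auto)
  finally show ?thesis using mult_left_mono[OF 1, of "real n"] by (simp add: qR P_def mult.commute)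
qed

text \<open>Primes up to B contribute at most K^B. Every larger prime p satisfies K \<le>
  p^\<delta>, and the product of those dividing n is at most n.\<close>

lemma power_card_prime_factors_bound:
  fixes K \<delta> :: real
  assumes K: "K \<ge> 1" and d: "\<delta> > 0"
  obtains C where "C > 0" "\<And>n. n > 0 \<Longrightarrow> K ^ card (prime_factors n) \<le> C * real n powr \<delta>"
proof -
  define B where "B = nat \<lceil>K powr (1 / \<delta>)\<rceil>"
  have "K ^ card (prime_factors n) \<le> K ^ B * real n powr \<delta>" if n: "n > 0" for n
  proof -
    define S1 where "S1 = {p\<in>prime_factors n. p \<le> B}"
    define S2 where "S2 = {p\<in>prime_factors n. p > B}"
    have fin: "finite S1" "finite S2" by (auto simp: S1_def S2_def)
    have "prime_factors n = S1 \<union> S2" "S1 \<inter> S2 = {}" by (auto simp: S1_def S2_def)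
    then have "K ^ card (prime_factors n) = K ^ card S1 * K ^ card S2" using fin by (simp add: card_Un_disjoint power_add)
    also have "\<dots> \<le> K ^ B * real n powr \<delta>"
    proof (rule mult_mono)
      have "S1 \<subseteq> {1..B}" by (auto simp: S1_def Suc_le_eq intro!: prime_gt_0_nat in_prime_factors_imp_prime)
      then have "card S1 \<le> B" using card_mono[of "{1..B}" S1] by simp
      then show "K ^ card S1 \<le> K ^ B" using K by (rule power_increasing)
      have "K ^ card S2 = (\<Prod>p\<in>S2. K)" by simp
      also have "\<dots> \<le> (\<Prod>p\<in>S2. real p powr \<delta>)"
      proof (rule prod_mono)
        fix p assume "p \<in> S2"
        then have "real B \<le> real p" by (simp add: S2_def)
        moreover have "K powr (1 / \<delta>) \<le> real B" unfolding B_def by (rule of_nat_ceiling)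
        ultimately have "K powr (1 / \<delta>) \<le> real p" by linarith
        then have "(K powr (1 / \<delta>)) powr \<delta> \<le> real p powr \<delta>" using d by (intro powr_mono2) auto
        then show "0 \<le> K \<and> K \<le> real p powr \<delta>" using K d by (simp add: powr_powr)
      qed
      also have "\<dots> = (\<Prod>p\<in>S2. real p) powr \<delta>" by (rule prod_powr_distrib[symmetric])
      also have "\<dots> = real (\<Prod>S2) powr \<delta>" by simp
      also have "\<dots> \<le> real n powr \<delta>"
      proof -
        have "\<Prod>S2 dvd n" by (rule prod_primes_dvd) (auto simp: S2_def)
        then have "\<Prod>S2 \<le> n" using n by (rule dvd_imp_le)
        then have "real (\<Prod>S2) \<le> real n" by (simp only: of_nat_le_iff)
        then show ?thesis using d by (intro powr_mono2 of_nat_0_le_iff) auto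
      qed
      finally show "K ^ card S2 \<le> real n powr \<delta>" .
    qed (use K in auto)
    finally show ?thesis .
  qed
  then show ?thesis using that[of "K ^ B"] K by simp
qed

text \<open>For each pair (X, Y) only multiples t = g v of g = q / \<Prod>(X \<union> Y) count, with
  weight g, while the sum over v of length n = q / g is bounded by a multiple of n. So every pair
  costs a multiple of g n = q, and there are 4^w pairs, w the number of primes of q.\<close>

lemma corr_error_bound:
  fixes N b q c :: nat
  assumes q: "q > 0" and N: "N > 0" and c: "c = N * q" and b: "b > 0"
  shows "(\<Sum>t\<in>{0..<int q}. if t = 0 then 0 else corr_bound q t * (\<Sum>m\<in>{0..<int c}. \<bar>ct c m\<bar> * \<bar>ct c (int N * t - int b * m)\<bar>))
     \<le> 4 ^ card (prime_factors q) * (real (b + 2) * real c * real q * (harm (c * b))\<^sup>2)"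
proof -
  let ?P = "Pow (prime_factors q)"
  define V where "V = (\<lambda>t. \<Sum>m\<in>{0..<int c}. \<bar>ct c m\<bar> * \<bar>ct c (int N * t - int b * m)\<bar>)"
  define E where "E = real (b + 2) * real c * real q * (harm (c * b))\<^sup>2"
  have one: "(\<Sum>t\<in>{0..<int q}. if t = 0 then 0 else (if int g dvd t then real g else 0) * V t) \<le> E"
    if gn: "q = n * g" for g n :: nat
  proof -
    have pos: "g > 0" "n > 0" using q gn by (auto intro: gr0I)
    have "(\<Sum>t\<in>{0..<int q}. if t = 0 then 0 else (if int g dvd t then real g else 0) * V t)
        = (\<Sum>t\<in>{0..<int n * int g}. if int g dvd t then (if t = 0 then 0 else real g * V t) else 0)"
      by (intro sum.cong) (auto simp: gn)
    also have "\<dots> = (\<Sum>v\<in>{0..<int n}. if int g * v = 0 then 0 else real g * V (int g * v))"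
      using pos by (intro sum_multiples) auto
    also have "\<dots> = real g * (\<Sum>v\<in>{0..<int n}. if v = 0 then 0 else V (int g * v))"
      using pos unfolding sum_distrib_left by (intro sum.cong refl) auto
    also have "(\<Sum>v\<in>{0..<int n}. if v = 0 then 0 else V (int g * v)) \<le> real (b + 2) * real c * real n * (harm (c * b))\<^sup>2"
    proof -
      have VV: "V (int g * v) = (\<Sum>m\<in>{0..<int c}. \<bar>ct c m\<bar> * \<bar>ct c (int (N * g) * v - int b * m)\<bar>)" for v
        by (simp add: V_def mult.assoc)
      have cc: "c = n * (N * g)" and Ng: "N * g > 0" using pos N by (simp_all add: c gn)
      show ?thesis unfolding VV by (rule cot_correlation_bound[OF Ng pos(2) b cc])
    qed
    finally show ?thesis using pos by (simp add: E_def gn mult_ac)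
  qed
  have "(\<Sum>t\<in>{0..<int q}. if t = 0 then 0 else corr_bound q t * V t)
     = (\<Sum>t\<in>{0..<int q}. \<Sum>X\<in>?P. \<Sum>Y\<in>?P. if t = 0 then 0 else (if int (q div \<Prod>(X \<union> Y)) dvd t then real (q div \<Prod>(X \<union> Y)) else 0) * V t)"
    unfolding corr_bound_def sum_distrib_right by (intro sum.cong refl) simp
  also have "\<dots> = (\<Sum>X\<in>?P. \<Sum>Y\<in>?P. \<Sum>t\<in>{0..<int q}. if t = 0 then 0 else (if int (q div \<Prod>(X \<union> Y)) dvd t then real (q div \<Prod>(X \<union> Y)) else 0) * V t)"
    by (subst sum.swap, rule sum.cong[OF refl], subst sum.swap, rule refl)
  also have "\<dots> \<le> (\<Sum>X\<in>?P. \<Sum>Y\<in>?P. E)"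
  proof (intro sum_mono)
    fix X Y assume "X \<in> ?P" "Y \<in> ?P"
    then have "\<Prod>(X \<union> Y) dvd q" by (intro prod_primes_dvd) auto
    then have "q = \<Prod>(X \<union> Y) * (q div \<Prod>(X \<union> Y))" by simp
    then show "(\<Sum>t\<in>{0..<int q}. if t = 0 then 0 else (if int (q div \<Prod>(X \<union> Y)) dvd t then real (q div \<Prod>(X \<union> Y)) else 0) * V t) \<le> E"
      by (rule one)
  qed
  also have "\<dots> = 4 ^ card (prime_factors q) * E" by (simp add: card_Pow power_mult_distrib[symmetric])
  finally show ?thesis by (simp only: V_def E_def)
qed

lemma harm_le_ln: "n > 0 \<Longrightarrow> harm n \<le> 1 + ln (real n)"
  using euler_mascheroni_sequence_decreasing[of 1 n] by (simp add: harm_def)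

text \<open>By \<open>big2\<close> the main cotangent sum is at least c^2 / 100, and
  \<open>big1\<close> makes the error at most half of the main term: 12 = 3 * 4 joins the loss 3 in
  the count of good residues with the loss 4 in the error, and 800 = 4 * 200 contains the bound 4
  for b + 2. Hence 640000 = 16 * 200^2, the 16 coming from \<open>dcoef_norm\<close>.\<close>

lemma second_moment_lower_bound:
  assumes p1: "primitive_char q1 \<eta>1" and p2: "primitive_char q2 \<eta>2"
    and par: "\<eta>1 (-1) * \<eta>2 (-1) = 1" and c4: "c \<ge> 4" and dvd: "q1 * q2 dvd c"
    and big1: "12 ^ card (prime_factors q2) * (800 * (1 + ln (2 * real c))\<^sup>2) \<le> real c"
    and big2: "(real c)\<^sup>2 / 100 \<le> (real c)\<^sup>2 / 64 - 1 - real c / 2"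
  shows "real q1 * (real c)\<^sup>2 / (640000 * 3 ^ card (prime_factors q2))
     \<le> (\<Sum>a\<in>{a\<in>{0..<int c}. coprime a (int c)}. (cmod (dedekind_sum q1 \<eta>1 \<eta>2 a c))\<^sup>2)"
proof -
  note dc1 = primitive_dc[OF p1] and dc2 = primitive_dc[OF p2]
  have c: "c > 0" using c4 by simp
  have q: "q1 > 0" "q2 > 0" using dc_pos dc1 dc2 by auto
  define N where "N = c div q2"
  have cN: "c = N * q2" using dvd by (auto simp: N_def elim!: dvdE)
  have N: "N > 0" using c cN by (auto intro: gr0I)
  \<comment> \<open>For even \<open>q2\<close> and odd \<open>N\<close> the test function with \<open>b = 1\<close> vanishes at all units.\<close>
  define b :: nat where "b = (if even q2 \<and> odd N then 2 else 1)"
  have b12: "b = 1 \<or> b = 2" by (simp add: b_def)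
  have b0: "b > 0" by (simp add: b_def)
  have cop: "coprime b N" by (simp add: b_def)
  have odd: "odd (b + N)" if "even q2" using that by (simp add: b_def)
  define \<omega> where "\<omega> = card (prime_factors q2)"
  define f where "f = (\<lambda>m. \<eta>1 m * \<eta>2 m)"
  define M0 where "M0 = real (card {s\<in>{0..<int q2}. good q2 N b s})"
  define W where "W = first_moment_main c b f"
  define D where "D = cmod (dcoef q1 \<eta>1 q2 \<eta>2 c)"
  let ?A = "{a\<in>{0..<int c}. coprime a (int c)}"
  define T where "T = (\<lambda>a. ph (int N) \<eta>2 (a - int b))"
  define S where "S = (\<lambda>a. dedekind_sum q1 \<eta>1 \<eta>2 a c)"
  define Z where "Z = (\<Sum>a\<in>?A. cnj (T a) * S a)"
  have M0: "real q2 / 3 ^ \<omega> \<le> M0" unfolding M0_def \<omega>_def by (rule good_count_ge[OF q(2) b12 odd])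
  then have M0p: "M0 > 0" using q(2) by (smt (verit) divide_pos_pos of_nat_0_less_iff zero_less_power)
  have W: "(real c)\<^sup>2 / 100 \<le> cmod W"
  proof -
    have "f 1 = 1" using dc1 dc2 by (simp add: f_def)
    moreover have "f (int c - 1) = 1"
    proof -
      have "q1 dvd c" "q2 dvd c" using dvd by (auto dest: dvd_mult_left dvd_mult_right)
      then have "[int c - 1 = -1] (mod int q1)" "[int c - 1 = -1] (mod int q2)" by (simp_all add: cong_iff_dvd_diff)
      then show ?thesis using dc_cong dc1 dc2 par unfolding f_def by metis
    qed
    moreover have "cmod (f m) \<le> 1" for m
      using mult_mono[OF dc_norm_le[OF dc1, of m] dc_norm_le[OF dc2, of m]] by (simp add: f_def norm_mult)
    ultimately have "(real c)\<^sup>2 / 64 - 1 - real c / 2 \<le> cmod W"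
      unfolding W_def first_moment_main_def by (intro weighted_ct_product_ge c4 b12) auto
    then show ?thesis using big2 by simp
  qed
  \<comment> \<open>The squared norm of the test function is its correlation with itself, which is
    \<open>ph_correlation\<close> at m = 1 and t = 0. One factor of its value cancels in the
    Cauchy-Schwarz inequality.\<close>
  have TT: "(\<Sum>a\<in>?A. (cmod (T a))\<^sup>2) = M0"
  proof -
    have "complex_of_real (\<Sum>a\<in>?A. (cmod (T a))\<^sup>2) = (\<Sum>a\<in>?A. cnj (T a) * T a)"
      unfolding of_real_sum by (intro sum.cong refl) (metis complex_norm_square mult.commute)
    also have "\<dots> = (\<Sum>a\<in>{0..<int c}. if coprime a (int c) then cnj (T a) * T a else 0)"
      by (rule sum.inter_filter) simp
    also have "\<dots> = (\<Sum>s\<in>{0..<int q2}. if good q2 N b s then \<eta>2 (1 + 0 * s) else 0)"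
    proof -
      have e: "ph (int N) \<eta>2 (a * 1 + (int N * 0 - int b * 1)) = ph (int N) \<eta>2 (a - int b)" for a by simp
      show ?thesis using ph_correlation[OF dc2 N cN cop, of 1 0] by (simp only: e T_def)
    qed
    also have "\<dots> = of_real M0" using dc2 by (simp add: M0_def sum.inter_filter[symmetric])
    finally show ?thesis by (simp only: of_real_eq_iff)
  qed
  have D0: "D \<ge> 0" by (simp add: D_def)
  have Z: "D * M0 * (real c)\<^sup>2 / 200 \<le> cmod Z"
  proof -
    define h :: real where "h = harm (c * b)"
    have h: "0 \<le> h" "h \<le> 1 + ln (2 * real c)"
    proof -
      show "0 \<le> h" by (simp add: h_def harm_nonneg)
      have "h \<le> harm (2 * c)" unfolding h_def using b12 by (intro harm_mono) auto
      also have "\<dots> \<le> 1 + ln (2 * real c)" using harm_le_ln[of "2 * c"] c by simp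
      finally show "h \<le> 1 + ln (2 * real c)" .
    qed
    have Zs: "Z = (\<Sum>a\<in>{0..<int c}. if coprime a (int c) then cnj (ph (int N) \<eta>2 (a - int b)) * dedekind_sum q1 \<eta>1 \<eta>2 a c else 0)"
      unfolding Z_def T_def S_def by (rule sum.inter_filter) simp
    have "cmod (Z - dcoef q1 \<eta>1 q2 \<eta>2 c * (of_real M0 * W))
      \<le> D * (\<Sum>t\<in>{0..<int q2}. if t = 0 then 0 else corr_bound q2 t * (\<Sum>m\<in>{0..<int c}. \<bar>ct c m\<bar> * \<bar>ct c (int N * t - int b * m)\<bar>))"
      using first_moment[OF p1 p2 c dvd cN cop] by (simp only: Zs M0_def D_def W_def f_def of_real_of_nat_eq)
    also have "\<dots> \<le> D * (4 ^ \<omega> * (real (b + 2) * real c * real q2 * h\<^sup>2))"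
      unfolding \<omega>_def h_def by (intro mult_left_mono corr_error_bound q(2) N cN b0 D0)
    also have "\<dots> \<le> D * (M0 * (real c)\<^sup>2 / 200)"
    proof (rule mult_left_mono[OF _ D0])
      have "4 ^ \<omega> * (real (b + 2) * real c * real q2 * h\<^sup>2) \<le> 4 ^ \<omega> * (4 * real c * real q2 * (1 + ln (2 * real c))\<^sup>2)"
        using b12 h by (intro mult_left_mono mult_mono power_mono) auto
      also have "\<dots> = (real q2 / 3 ^ \<omega>) * real c / 200 * (12 ^ \<omega> * (800 * (1 + ln (2 * real c))\<^sup>2))"
      proof -
        have "(12::real) ^ \<omega> = 3 ^ \<omega> * 4 ^ \<omega>" by (simp add: power_mult_distrib[symmetric])
        then show ?thesis by simp
      qed
      also have "\<dots> \<le> (real q2 / 3 ^ \<omega>) * real c / 200 * real c"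
        using big1 by (intro mult_left_mono) (auto simp: \<omega>_def)
      also have "\<dots> = (real q2 / 3 ^ \<omega>) * ((real c)\<^sup>2 / 200)" by (simp add: power2_eq_square)
      also have "\<dots> \<le> M0 * ((real c)\<^sup>2 / 200)" by (rule mult_right_mono[OF M0]) simp
      finally show "4 ^ \<omega> * (real (b + 2) * real c * real q2 * h\<^sup>2) \<le> M0 * (real c)\<^sup>2 / 200" by simp
    qed
    finally have err: "cmod (Z - dcoef q1 \<eta>1 q2 \<eta>2 c * (of_real M0 * W)) \<le> D * (M0 * (real c)\<^sup>2 / 200)" .
    have "D * (M0 * ((real c)\<^sup>2 / 100)) \<le> D * (M0 * cmod W)"
      using W M0p D0 by (intro mult_left_mono) auto
    also have "\<dots> = cmod (dcoef q1 \<eta>1 q2 \<eta>2 c * (of_real M0 * W))" using M0p by (simp add: D_def norm_mult)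
    also have "\<dots> \<le> cmod Z + cmod (Z - dcoef q1 \<eta>1 q2 \<eta>2 c * (of_real M0 * W))"
      using norm_triangle_sub[of "dcoef q1 \<eta>1 q2 \<eta>2 c * (of_real M0 * W)" Z] by (simp add: norm_minus_commute)
    finally show ?thesis using err by simp
  qed
  define Q where "Q = (\<Sum>a\<in>?A. (cmod (S a))\<^sup>2)"
  have "(D * M0 * (real c)\<^sup>2 / 200)\<^sup>2 \<le> (cmod Z)\<^sup>2"
    using Z D0 M0p by (intro power_mono) auto
  also have "\<dots> \<le> (\<Sum>a\<in>?A. cmod (T a) * cmod (S a))\<^sup>2"
    unfolding Z_def by (intro power_mono sum_norm_le) (auto simp: norm_mult)
  also have "\<dots> \<le> (\<Sum>a\<in>?A. (cmod (T a))\<^sup>2) * (\<Sum>a\<in>?A. (cmod (S a))\<^sup>2)" by (rule Cauchy_Schwarz_ineq_sum)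
  also have "\<dots> = M0 * Q" by (simp only: TT Q_def)
  finally have "M0 * (D\<^sup>2 * M0 * (real c) ^ 4 / 40000) \<le> M0 * Q"
    by (simp add: power2_eq_square power4_eq_xxxx mult_ac)
  then have Q: "D\<^sup>2 * M0 * (real c) ^ 4 / 40000 \<le> Q" using M0p by simp
  have "real q1 * (real c)\<^sup>2 / (640000 * 3 ^ \<omega>) = (real N)\<^sup>2 * real q1 * real q2 / (16 * real c ^ 4) * (real q2 / 3 ^ \<omega>) * (real c) ^ 4 / 40000"
  proof -
    have "real c ^ 4 \<noteq> 0" using c by simp
    then have "(real N)\<^sup>2 * real q1 * real q2 / (16 * real c ^ 4) * (real q2 / 3 ^ \<omega>) * (real c) ^ 4 / 40000
        = (real N)\<^sup>2 * real q1 * real q2 * (real q2 / 3 ^ \<omega>) / 640000" by (simp add: field_simps)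
    then show ?thesis by (simp add: cN power2_eq_square mult_ac)
  qed
  also have "\<dots> = D\<^sup>2 * (real q2 / 3 ^ \<omega>) * (real c) ^ 4 / 40000"
    unfolding D_def dcoef_norm[OF p1 p2 c] N_def ..
  also have "\<dots> \<le> D\<^sup>2 * M0 * (real c) ^ 4 / 40000"
    using M0 by (intro divide_right_mono mult_right_mono mult_left_mono) auto
  also have "\<dots> \<le> Q" by (rule Q)
  finally show ?thesis by (simp only: \<omega>_def Q_def S_def)
qed

section \<open>The finitely many remaining cases and the final constant\<close>

lemma finite_dirichlet_chars:
  assumes q: "q > 0"
  shows "finite {\<eta>. dirichlet_char q \<eta>}"
proof -
  let ?V = "insert 0 {z::complex. z ^ totient q = 1}"
  have "card {z::complex. z ^ totient q = 1} > 0" using q by (subst card_roots_unity_eq) auto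
  then have V: "finite ?V" using card_ge_0_finite by blast
  have "inj_on (\<lambda>\<eta>. restrict \<eta> {0..<int q}) {\<eta>. dirichlet_char q \<eta>}"
  proof (rule inj_onI)
    fix \<eta> \<theta> assume a: "\<eta> \<in> {\<eta>. dirichlet_char q \<eta>}" "\<theta> \<in> {\<eta>. dirichlet_char q \<eta>}"
      and e: "restrict \<eta> {0..<int q} = restrict \<theta> {0..<int q}"
    show "\<eta> = \<theta>"
    proof
      fix n
      have "n mod int q \<in> {0..<int q}" using q by simp
      then have "\<eta> (n mod int q) = \<theta> (n mod int q)" using e by (metis restrict_apply')
      moreover have "[n = n mod int q] (mod int q)" by (simp add: unique_euclidean_semiring_class.cong_def)
      ultimately show "\<eta> n = \<theta> n" using a dc_cong by (metis mem_Collect_eq)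
    qed
  qed
  moreover have "(\<lambda>\<eta>. restrict \<eta> {0..<int q}) ` {\<eta>. dirichlet_char q \<eta>} \<subseteq> PiE {0..<int q} (\<lambda>_. ?V)"
  proof
    fix r assume "r \<in> (\<lambda>\<eta>. restrict \<eta> {0..<int q}) ` {\<eta>. dirichlet_char q \<eta>}"
    then obtain \<eta> where d: "dirichlet_char q \<eta>" and r: "r = restrict \<eta> {0..<int q}" by blast
    have "\<eta> n \<in> ?V" for n using dc_root_of_unity[OF d, of n] dc_eq_0_iff[OF d, of n] by blast
    then show "r \<in> PiE {0..<int q} (\<lambda>_. ?V)" unfolding r by (simp add: PiE_def)
  qed
  then have "finite ((\<lambda>\<eta>. restrict \<eta> {0..<int q}) ` {\<eta>. dirichlet_char q \<eta>})"
    using finite_PiE[of "{0..<int q}" "\<lambda>_. ?V"] V finite_subset by blast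
  ultimately show ?thesis using finite_imageD by blast
qed

lemma finite_positive_bound:
  fixes f :: "'a \<Rightarrow> real"
  assumes "finite A" "\<And>x. x \<in> A \<Longrightarrow> f x > 0"
  obtains C where "C > 0" "\<And>x. x \<in> A \<Longrightarrow> C \<le> f x"
  using that[of "Min (insert 1 (f ` A))"] assms by auto

theorem theorem4p5:
  shows "\<forall>\<epsilon>::real. \<epsilon> > 0 \<longrightarrow>
    (\<exists>C::real. C > 0 \<and>
      (\<forall>(q\<^sub>1::nat) (q\<^sub>2::nat) (\<chi>\<^sub>1::int \<Rightarrow> complex) (\<chi>\<^sub>2::int \<Rightarrow> complex) (c::nat).
         primitive_char q\<^sub>1 \<chi>\<^sub>1 \<and> \<chi>\<^sub>1 \<noteq> trivial_char q\<^sub>1 \<and>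
         primitive_char q\<^sub>2 \<chi>\<^sub>2 \<and> \<chi>\<^sub>2 \<noteq> trivial_char q\<^sub>2 \<and>
         \<chi>\<^sub>1 (-1) * \<chi>\<^sub>2 (-1) = 1 \<and>
         c > 0 \<and> q\<^sub>1 * q\<^sub>2 dvd c \<longrightarrow>
         (\<Sum>a\<in>{a\<in>{0..<int c}. coprime a (int c)}. (cmod (dedekind_sum q\<^sub>1 \<chi>\<^sub>1 \<chi>\<^sub>2 a c))\<^sup>2)
           \<ge> C * real q\<^sub>1 * real c powr (2 - \<epsilon>)))"
proof (intro allI impI)
  fix \<epsilon> :: real assume \<epsilon>: "\<epsilon> > 0"
  define S where "S = (\<lambda>(q1::nat, q2::nat, \<eta>1, \<eta>2, c). \<Sum>a\<in>{a\<in>{0..<int c}. coprime a (int c)}. (cmod (dedekind_sum q1 \<eta>1 \<eta>2 a c))\<^sup>2)"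
  define H where "H = (\<lambda>(q1, q2, \<eta>1, \<eta>2, c). primitive_char q1 \<eta>1 \<and> \<eta>1 \<noteq> trivial_char q1 \<and>
         primitive_char q2 \<eta>2 \<and> \<eta>2 \<noteq> trivial_char q2 \<and> \<eta>1 (-1) * \<eta>2 (-1) = 1 \<and> c > 0 \<and> q1 * q2 dvd c)"
  define B where "B = (\<lambda>(q1::nat, q2::nat, \<eta>1::int\<Rightarrow>complex, \<eta>2::int\<Rightarrow>complex, c::nat). real q1 * real c powr (2 - \<epsilon>))"
  \<comment> \<open>\<open>C1\<close> turns the loss 3^w of the lower bound, w the number of primes
    of q2, into c^\<epsilon>. \<open>C2\<close> serves only for the condition on large c, where any
    exponent below 1 leaves room for the logarithms.\<close>
  obtain C1 where C1: "C1 > 0" "\<And>n. n > 0 \<Longrightarrow> 3 ^ card (prime_factors n) \<le> C1 * real n powr \<epsilon>"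
    using power_card_prime_factors_bound[of 3 \<epsilon>] \<epsilon> by auto
  obtain C2 where C2: "C2 > 0" "\<And>n. n > 0 \<Longrightarrow> 12 ^ card (prime_factors n) \<le> C2 * real n powr (1/2)"
    using power_card_prime_factors_bound[of 12 "1/2"] by auto
  have "eventually (\<lambda>c. C2 * real c powr (1/2) * (800 * (1 + ln (2 * real c))\<^sup>2) \<le> real c) at_top" by real_asymp
  moreover have "eventually (\<lambda>c. (real c)\<^sup>2 / 100 \<le> (real c)\<^sup>2 / 64 - 1 - real c / 2) at_top" by real_asymp
  ultimately have "eventually (\<lambda>c. C2 * real c powr (1/2) * (800 * (1 + ln (2 * real c))\<^sup>2) \<le> real c
      \<and> (real c)\<^sup>2 / 100 \<le> (real c)\<^sup>2 / 64 - 1 - real c / 2) at_top" by (rule eventually_conj)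
  then obtain c0 where c0: "\<And>c. c \<ge> c0 \<Longrightarrow> C2 * real c powr (1/2) * (800 * (1 + ln (2 * real c))\<^sup>2) \<le> real c
      \<and> (real c)\<^sup>2 / 100 \<le> (real c)\<^sup>2 / 64 - 1 - real c / 2"
    unfolding eventually_at_top_linorder by blast
  have large: "1 / (640000 * C1) * B (q1, q2, \<eta>1, \<eta>2, c) \<le> S (q1, q2, \<eta>1, \<eta>2, c)"
    if h: "H (q1, q2, \<eta>1, \<eta>2, c)" and c: "c \<ge> max 4 c0" for q1 q2 \<eta>1 \<eta>2 c
  proof -
    have p: "primitive_char q1 \<eta>1" "primitive_char q2 \<eta>2" and par: "\<eta>1 (-1) * \<eta>2 (-1) = 1"
      and cp: "c > 0" and dvd: "q1 * q2 dvd c" using h by (auto simp: H_def)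
    have q2: "q2 > 0" using dc_pos primitive_dc p by blast
    have "q2 dvd c" using dvd by (rule dvd_mult_right)
    then have q2c: "q2 \<le> c" using cp by (rule dvd_imp_le)
    have "12 ^ card (prime_factors q2) \<le> C2 * real q2 powr (1/2)" by (rule C2(2)[OF q2])
    also have "\<dots> \<le> C2 * real c powr (1/2)" using q2c C2(1) by (intro mult_left_mono powr_mono2) auto
    finally have "12 ^ card (prime_factors q2) * (800 * (1 + ln (2 * real c))\<^sup>2) \<le> C2 * real c powr (1/2) * (800 * (1 + ln (2 * real c))\<^sup>2)"
      by (intro mult_right_mono) auto
    also have "\<dots> \<le> real c" using c0 c by simp
    finally have "real q1 * (real c)\<^sup>2 / (640000 * 3 ^ card (prime_factors q2)) \<le> S (q1, q2, \<eta>1, \<eta>2, c)"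
      using second_moment_lower_bound[OF p par _ dvd] c0 c by (simp add: S_def)
    moreover have "1 / (640000 * C1) * B (q1, q2, \<eta>1, \<eta>2, c) \<le> real q1 * (real c)\<^sup>2 / (640000 * 3 ^ card (prime_factors q2))"
    proof -
      have "3 ^ card (prime_factors q2) \<le> C1 * real q2 powr \<epsilon>" by (rule C1(2)[OF q2])
      also have "\<dots> \<le> C1 * real c powr \<epsilon>" using q2c C1(1) \<epsilon> by (intro mult_left_mono powr_mono2) auto
      finally have "real q1 * (real c)\<^sup>2 / (640000 * (C1 * real c powr \<epsilon>)) \<le> real q1 * (real c)\<^sup>2 / (640000 * 3 ^ card (prime_factors q2))"
        using C1(1) cp by (intro divide_left_mono mult_left_mono mult_pos_pos) auto
      moreover have "real c powr (2 - \<epsilon>) = (real c)\<^sup>2 / real c powr \<epsilon>" using cp by (simp add: powr_diff powr_numeral)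
      ultimately show ?thesis by (simp add: B_def)
    qed
    ultimately show ?thesis by linarith
  qed
  \<comment> \<open>Since q1 and q2 divide c, bounded c leaves finitely many tuples. On each of them
    the quotient \<open>S x / B x\<close> is positive by \<open>dedekind_sum_not_all_zero\<close>,
    so it has a positive lower bound, which depends on \<epsilon> alone.\<close>
  define F where "F = {x. H x \<and> (case x of (q1, q2, \<eta>1, \<eta>2, c) \<Rightarrow> c < max 4 c0)}"
  have "finite F"
  proof (rule finite_subset)
    let ?n = "max 4 c0"
    show "F \<subseteq> (SIGMA q1:{0<..<?n}. SIGMA q2:{0<..<?n}. {\<eta>. dirichlet_char q1 \<eta>} \<times> {\<eta>. dirichlet_char q2 \<eta>} \<times> {..<?n})"
    proof (rule subsetI)
      fix x assume xF: "x \<in> F"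
      obtain q1 q2 \<eta>1 \<eta>2 c where x: "x = (q1, q2, \<eta>1, \<eta>2, c)" by (cases x)
      from xF have h: "H (q1, q2, \<eta>1, \<eta>2, c)" and c: "c < ?n" by (simp_all add: F_def x)
      have d: "dirichlet_char q1 \<eta>1" "dirichlet_char q2 \<eta>2" using h primitive_dc by (auto simp: H_def)
      have "q1 dvd c" "q2 dvd c" "c > 0" using h by (auto simp: H_def dest: dvd_mult_left dvd_mult_right)
      then have "q1 < ?n" "q2 < ?n" using c by (meson dvd_imp_le le_less_trans)+
      then show "x \<in> (SIGMA q1:{0<..<?n}. SIGMA q2:{0<..<?n}. {\<eta>. dirichlet_char q1 \<eta>} \<times> {\<eta>. dirichlet_char q2 \<eta>} \<times> {..<?n})"
        using d[THEN dc_pos] d c by (simp add: x)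
    qed
  qed (intro finite_SigmaI finite_cartesian_product finite_dirichlet_chars finite_greaterThanLessThan finite_lessThan, auto)
  moreover have "S x / B x > 0" if "x \<in> F" for x
  proof -
    obtain q1 q2 \<eta>1 \<eta>2 c where x: "x = (q1, q2, \<eta>1, \<eta>2, c)" by (cases x)
    have h: "H (q1, q2, \<eta>1, \<eta>2, c)" using that by (simp add: F_def x)
    obtain a where a: "a \<in> {a\<in>{0..<int c}. coprime a (int c)}" "dedekind_sum q1 \<eta>1 \<eta>2 a c \<noteq> 0"
      using dedekind_sum_not_all_zero[of q1 \<eta>1 q2 \<eta>2 c] h by (auto simp: H_def)
    have "finite {a\<in>{0..<int c}. coprime a (int c)}" by (rule finite_subset[of _ "{0..<int c}"]) auto
    then have "S x > 0" unfolding x S_def prod.case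
      by (rule sum_pos2[OF _ a(1)]) (use a(2) in auto)
    moreover have "B x > 0" using h dc_pos primitive_dc by (auto simp: x B_def H_def)
    ultimately show ?thesis by simp
  qed
  ultimately obtain C3 where C3: "C3 > 0" "\<And>x. x \<in> F \<Longrightarrow> C3 \<le> S x / B x"
    using finite_positive_bound[of F "\<lambda>x. S x / B x"] by blast
  define C where "C = min (1 / (640000 * C1)) C3"
  have Cpos: "C > 0" using C1 C3 by (simp add: C_def)
  have CB: "C * B x \<le> S x" if "H x" for x
  proof -
    obtain q1 q2 \<eta>1 \<eta>2 c where x: "x = (q1, q2, \<eta>1, \<eta>2, c)" by (cases x)
    have Bp: "B x > 0" using that dc_pos primitive_dc by (auto simp: x B_def H_def)
    show ?thesis
    proof (cases "c < max 4 c0")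
      case True
      then have "x \<in> F" using that by (simp add: F_def x)
      from C3(2)[OF this] have "C3 * B x \<le> S x" using Bp by (simp add: pos_le_divide_eq)
      moreover have "C * B x \<le> C3 * B x" using Bp by (intro mult_right_mono) (auto simp: C_def)
      ultimately show ?thesis by linarith
    next
      case False
      then have "c \<ge> max 4 c0" by (simp add: not_less)
      then have "1 / (640000 * C1) * B x \<le> S x" using large that unfolding x by blast
      moreover have "C * B x \<le> 1 / (640000 * C1) * B x" using Bp by (intro mult_right_mono) (auto simp: C_def)
      ultimately show ?thesis by linarith
    qed
  qed
  show "\<exists>C::real. C > 0 \<and>
      (\<forall>(q\<^sub>1::nat) (q\<^sub>2::nat) (\<chi>\<^sub>1::int \<Rightarrow> complex) (\<chi>\<^sub>2::int \<Rightarrow> complex) (c::nat).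
         primitive_char q\<^sub>1 \<chi>\<^sub>1 \<and> \<chi>\<^sub>1 \<noteq> trivial_char q\<^sub>1 \<and>
         primitive_char q\<^sub>2 \<chi>\<^sub>2 \<and> \<chi>\<^sub>2 \<noteq> trivial_char q\<^sub>2 \<and>
         \<chi>\<^sub>1 (-1) * \<chi>\<^sub>2 (-1) = 1 \<and>
         c > 0 \<and> q\<^sub>1 * q\<^sub>2 dvd c \<longrightarrow>
         (\<Sum>a\<in>{a\<in>{0..<int c}. coprime a (int c)}. (cmod (dedekind_sum q\<^sub>1 \<chi>\<^sub>1 \<chi>\<^sub>2 a c))\<^sup>2)
           \<ge> C * real q\<^sub>1 * real c powr (2 - \<epsilon>))"
  proof (rule exI[of _ C], rule conjI, rule Cpos, intro allI impI)
    fix q\<^sub>1 q\<^sub>2 :: nat and \<chi>\<^sub>1 \<chi>\<^sub>2 :: "int \<Rightarrow> complex" and c :: nat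
    assume "primitive_char q\<^sub>1 \<chi>\<^sub>1 \<and> \<chi>\<^sub>1 \<noteq> trivial_char q\<^sub>1 \<and>
         primitive_char q\<^sub>2 \<chi>\<^sub>2 \<and> \<chi>\<^sub>2 \<noteq> trivial_char q\<^sub>2 \<and> \<chi>\<^sub>1 (-1) * \<chi>\<^sub>2 (-1) = 1 \<and> c > 0 \<and> q\<^sub>1 * q\<^sub>2 dvd c"
    then have "H (q\<^sub>1, q\<^sub>2, \<chi>\<^sub>1, \<chi>\<^sub>2, c)" by (simp add: H_def)
    from CB[OF this] show "(\<Sum>a\<in>{a\<in>{0..<int c}. coprime a (int c)}. (cmod (dedekind_sum q\<^sub>1 \<chi>\<^sub>1 \<chi>\<^sub>2 a c))\<^sup>2)
           \<ge> C * real q\<^sub>1 * real c powr (2 - \<epsilon>)" by (simp add: B_def S_def mult.assoc)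
  qed
qed

end
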